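(* Let $f:[0,T]\times\mathbb R^d\times E\to\mathbb R$ be Borel measurable, with $f_0(t,x):=f(t,x,0,0,0)\in\mathcal H_0$, and let $g\in H^1(\mu_T)$. Suppose there are constants $K,L_0,L_1,L_2\ge0$ with $\|f_0\|_{\mathcal H_0}\le K$, $\|g\|_{H^1(\mu_T)}\le K$, $$|f(t,x,y,z,\gamma)-f(t,x,y',z',\gamma')|\le L_0|y-y'|+L_1|z-z'|+L_2|\gamma-\gamma'|_F$$ for all $(t,x)$ and all $(y,z,\gamma),(y',z',\gamma')\in E$, and $2\sqrt2\,L_2<1$. Fix $\beta>0$. For $F\in\mathcal H_\beta$ put $$(\Phi(F))(t,x):=f\bigl(t,x,u^F(t,x),D_xu^F(t,x),D_x^2u^F(t,x)\bigr),\qquad u^F:=\mathcal U(F,g).$$ Then $\Phi$ is a well-defined map $\mathcal H_\beta\to\mathcal H_\beta$, and for all $F,\widetilde F\in\mathcal H_\beta$, $$\|\Phi(F)-\Phi(\widetilde F)\|_{\mathcal H_\beta}\le\lambda(\beta)\|F-\widetilde F\|_{\mathcal H_\beta},\qquad \lambda(\beta):=\frac{L_0}{\beta}+\frac{L_1}{\sqrt\beta}+2\sqrt2\,L_2 .$$ Suppose moreover that $\lambda(\beta)<1$ (which, since $2\sqrt2L_2<1$, holds for all sufficiently large $\beta$). Then there is a unique fixed point $F^\star\in\mathcal H_\beta$ of $\Phi$, and $$\|F^\star\|_{\mathcal H_\beta}\le\frac{1+L_0\beta^{-1/2}+L_1+L_2}{1-\lambda(\beta)}\,K .$$ The function $u^\star:=u^{F^\star}$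 satisfies $F^{u^\star}=F^\star$ and is the unique nonlinear occupation mild solution of $$\partial_tu+\tfrac12\Delta u+f(t,x,u,\nabla_xu,D_x^2u)=0,\qquad u(T,\cdot)=g .$$
   Context: Fix $T>0$, $d\in\mathbb N^+$, $x_0\in\mathbb R^d$. $W$ is a $d$-dimensional Brownian motion, $X_t=x_0+W_t$, $\mu_t$ is the law of $X_t$ (for $t>0$, $\mu_t=N(x_0,tI_d)$ with density $p_t$), and $P_r\varphi(x)=\mathbb E[\varphi(x+W_r)]$ is the heat semigroup. For $\beta\ge0$ put $r_\beta(t)=e^{-2\beta(T-t)}$, $\nu_\beta(dt,dx)=r_\beta(t)p_t(x)\,dt\,dx$ on $(0,T)\times\mathbb R^d$, and $\mathcal H_\beta=L^2(\nu_\beta)$ (same notation for scalar-, vector-, matrix-valued functions; matrices carry the Frobenius norm $|\cdot|_F$). $\mathbb S^d$ is the space of real symmetric $d\times d$ matrices and $E=\mathbb R\times\mathbb R^d\times\mathbb S^d$. $H^1(\mu_T)$ is the Gaussian Sobolev space of functions with weak derivatives of order $\le1$ in $L^2(\mu_T)$. Weak spatial derivatives: for $\phi,\xi_k\in L^1_{\mathrm{loc}}((0,T)\times\mathbb R^d)$, $\partial_{x_k}\phi=\xi_k$ weakly if $\int\phi\,\partial_{x_k}\varphi\,dt\,dx=-\int\xi_k\varphi\,dt\,dx$ for all $\varphi\in C_c^\infty((0,T)\times\mathbb R^d)$; $D_x\phi=(\partial_{x_1}\phi,\dots,\partial_{x_d}\phi)$. (Elements of $\mathcal H_\beta$ are in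 $L^1_{\mathrm{loc}}$.) Duhamel map: for $F\in\mathcal H_\beta$, $\eta\in H^1(\mu_T)$, $$(\mathcal U(F,\eta))(t,x)=P_{T-t}\eta(x)+\int_t^TP_{r-t}F(r,\cdot)(x)\,dr$$ (for a.e. $(t,x)$). A measurable $v:(0,T)\times\mathbb R^d\to\mathbb R$ has an occupation mild jet if there are measurable $z$ ($\mathbb R^d$-valued) and $\gamma$ ($\mathbb S^d$-valued) with $v,z,\gamma\in\mathcal H_\beta$, $D_xv=z$, $D_xz=\gamma$ weakly; then $D_x^2v:=\gamma$. A function $v$ with an occupation mild jet is a nonlinear occupation mild solution of the PDE if $F^v(t,x):=f(t,x,v(t,x),D_xv(t,x),D_x^2v(t,x))$ belongs to $\mathcal H_\beta$ and $v=\mathcal U(F^v,g)$. Well-definedness of $\Phi$ includes that $u^F$ has an occupation mild jet for every $F\in\mathcal H_\beta$. *)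

theory Defs
  imports "HOL-Probability.Probability"
begin

text \<open>
  The dimension is \<open>CARD('n)\<close>.  Elements of L2 spaces are represented by measurable functions;
  equality in such a space is equality almost everywhere with respect to the measure.
  The norm of \<^typ>\<open>real ^ 'n ^ 'n\<close> is the Frobenius norm.
\<close>

definition L2_space :: "'a measure \<Rightarrow> ('a \<Rightarrow> 'b::euclidean_space) set" where
  "L2_space M = {F \<in> borel_measurable M. integrable M (\<lambda>x. (norm (F x))\<^sup>2)}"

definition L2_norm :: "'a measure \<Rightarrow> ('a \<Rightarrow> 'b::euclidean_space) \<Rightarrow> real" where
  "L2_norm M F = sqrt (LINT x|M. (norm (F x))\<^sup>2)"

definition sym_mats :: "(real ^ 'n ^ 'n) set" where
  "sym_mats = {A. transpose A = A}"


subsection \<open>Test functions and weak derivatives\<close>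

primrec Ck :: "nat \<Rightarrow> ('a::euclidean_space \<Rightarrow> real) \<Rightarrow> bool" where
  "Ck 0 \<phi> \<longleftrightarrow> continuous_on UNIV \<phi>"
| "Ck (Suc k) \<phi> \<longleftrightarrow>
     (\<forall>x. \<phi> differentiable (at x)) \<and> (\<forall>b\<in>Basis. Ck k (\<lambda>x. frechet_derivative \<phi> (at x) b))"

text \<open>Functions in \<open>C_c^\<infinity>(\<Omega>)\<close> are extended by zero to the whole space.\<close>

definition test_functions :: "'a::euclidean_space set \<Rightarrow> ('a \<Rightarrow> real) set" where
  "test_functions \<Omega> = {\<phi>. (\<forall>k. Ck k \<phi>) \<and>
     compact (closure {x. \<phi> x \<noteq> 0}) \<and> closure {x. \<phi> x \<noteq> 0} \<subseteq> \<Omega>}"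

definition locally_integrable :: "'a::euclidean_space set \<Rightarrow> ('a \<Rightarrow> real) \<Rightarrow> bool" where
  "locally_integrable \<Omega> \<phi> \<longleftrightarrow> (\<forall>C. compact C \<and> C \<subseteq> \<Omega> \<longrightarrow> set_integrable lborel C \<phi>)"

definition weak_deriv ::
  "'a::euclidean_space set \<Rightarrow> 'a \<Rightarrow> ('a \<Rightarrow> real) \<Rightarrow> ('a \<Rightarrow> real) \<Rightarrow> bool" where
  "weak_deriv \<Omega> b \<phi> \<xi> \<longleftrightarrow> locally_integrable \<Omega> \<phi> \<and> locally_integrable \<Omega> \<xi> \<and>
     (\<forall>\<psi>\<in>test_functions \<Omega>.
        (LINT y:\<Omega>|lborel. \<phi> y * frechet_derivative \<psi> (at y) b) = - (LINT y:\<Omega>|lborel. \<xi> y * \<psi> y))"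


subsection \<open>Gaussian measures, Brownian motion and the heat semigroup\<close>

definition gauss_density :: "real ^ 'n \<Rightarrow> real \<Rightarrow> real ^ 'n \<Rightarrow> real" where
  "gauss_density m r x = (\<Prod>i\<in>UNIV. normal_density (m $ i) (sqrt r) (x $ i))"

definition gaussian :: "real ^ 'n \<Rightarrow> real \<Rightarrow> (real ^ 'n) measure" where
  "gaussian m r = density lborel (\<lambda>x. ennreal (gauss_density m r x))"

definition brownian_motion :: "'w measure \<Rightarrow> (real \<Rightarrow> 'w \<Rightarrow> real ^ 'n) \<Rightarrow> bool" where
  "brownian_motion M W \<longleftrightarrow> prob_space M \<and>
     (\<forall>t\<ge>0. W t \<in> borel_measurable M) \<and>
     (AE \<omega> in M. W 0 \<omega> = 0) \<and>
     (\<forall>s t. 0 \<le> s \<and> s < t \<longrightarrow> distr M borel (\<lambda>\<omega>. W t \<omega> - W s \<omega>) = gaussian 0 (t - s)) \<and>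
     (\<forall>(\<tau> :: nat \<Rightarrow> real) k. 0 \<le> \<tau> 0 \<and> mono \<tau> \<longrightarrow>
        prob_space.indep_vars M (\<lambda>_. borel) (\<lambda>i \<omega>. W (\<tau> (Suc i)) \<omega> - W (\<tau> i) \<omega>) {..<k}) \<and>
     (AE \<omega> in M. continuous_on {0..} (\<lambda>t. W t \<omega>))"

text \<open>Law of \<open>X_t = x0 + W_t\<close>.\<close>

definition law :: "'w measure \<Rightarrow> (real \<Rightarrow> 'w \<Rightarrow> real ^ 'n) \<Rightarrow> real ^ 'n \<Rightarrow> real \<Rightarrow> (real ^ 'n) measure" where
  "law M W x0 t = distr M borel (\<lambda>\<omega>. x0 + W t \<omega>)"

definition heat ::
  "'w measure \<Rightarrow> (real \<Rightarrow> 'w \<Rightarrow> real ^ 'n) \<Rightarrow> real \<Rightarrow> (real ^ 'n \<Rightarrow> real) \<Rightarrow> real ^ 'n \<Rightarrow> real" where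
  "heat M W r \<phi> x = (LINT \<omega>|M. \<phi> (x + W r \<omega>))"


subsection \<open>The Sobolev space \<open>H\<^sup>1(\<mu>)\<close>\<close>

definition weak_gradient :: "(real ^ 'n \<Rightarrow> real) \<Rightarrow> (real ^ 'n \<Rightarrow> real ^ 'n) \<Rightarrow> bool" where
  "weak_gradient \<eta> \<zeta> \<longleftrightarrow> (\<forall>k. weak_deriv UNIV (axis k 1) \<eta> (\<lambda>x. \<zeta> x $ k))"

definition H1_space :: "(real ^ 'n) measure \<Rightarrow> (real ^ 'n \<Rightarrow> real) set" where
  "H1_space \<mu> = {\<eta> \<in> L2_space \<mu>. \<exists>\<zeta>\<in>L2_space \<mu>. weak_gradient \<eta> \<zeta>}"

definition H1_norm :: "(real ^ 'n) measure \<Rightarrow> (real ^ 'n \<Rightarrow> real) \<Rightarrow> real" where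
  "H1_norm \<mu> \<eta> = sqrt ((L2_norm \<mu> \<eta>)\<^sup>2 +
     (L2_norm \<mu> (SOME \<zeta>. \<zeta> \<in> L2_space \<mu> \<and> weak_gradient \<eta> \<zeta>))\<^sup>2)"


subsection \<open>Occupation spaces and jets\<close>

definition spacetime :: "real \<Rightarrow> (real \<times> (real ^ 'n)) set" where
  "spacetime T = {0<..<T} \<times> UNIV"

text \<open>The space of this measure is \<^term>\<open>spacetime T\<close>, so values outside it play no role.\<close>

definition nu :: "real \<Rightarrow> real ^ 'n \<Rightarrow> real \<Rightarrow> (real \<times> (real ^ 'n)) measure" where
  "nu T x0 \<beta> = density (restrict_space lborel (spacetime T))
     (\<lambda>(t, x). ennreal (exp (- 2 * \<beta> * (T - t)) * gauss_density x0 t x))"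

definition weak_Dx ::
  "real \<Rightarrow> (real \<times> (real ^ 'n) \<Rightarrow> real) \<Rightarrow> (real \<times> (real ^ 'n) \<Rightarrow> real ^ 'n) \<Rightarrow> bool" where
  "weak_Dx T v z \<longleftrightarrow> (\<forall>k. weak_deriv (spacetime T) (0, axis k 1) v (\<lambda>p. z p $ k))"

definition occupation_mild_jet ::
  "real \<Rightarrow> real ^ 'n \<Rightarrow> real \<Rightarrow> (real \<times> (real ^ 'n) \<Rightarrow> real) \<Rightarrow>
   (real \<times> (real ^ 'n) \<Rightarrow> real ^ 'n) \<Rightarrow> (real \<times> (real ^ 'n) \<Rightarrow> real ^ 'n ^ 'n) \<Rightarrow> bool" where
  "occupation_mild_jet T x0 \<beta> v z \<gamma> \<longleftrightarrow>
     v \<in> L2_space (nu T x0 \<beta>) \<and> z \<in> L2_space (nu T x0 \<beta>) \<and> \<gamma> \<in> L2_space (nu T x0 \<beta>) \<and>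
     (\<forall>p\<in>spacetime T. \<gamma> p \<in> sym_mats) \<and>
     weak_Dx T v z \<and> (\<forall>k. weak_Dx T (\<lambda>p. z p $ k) (\<lambda>p. \<gamma> p $ k))"

definition has_occupation_mild_jet ::
  "real \<Rightarrow> real ^ 'n \<Rightarrow> real \<Rightarrow> (real \<times> (real ^ 'n) \<Rightarrow> real) \<Rightarrow> bool" where
  "has_occupation_mild_jet T x0 \<beta> v \<longleftrightarrow> (\<exists>z \<gamma>. occupation_mild_jet T x0 \<beta> v z \<gamma>)"

text \<open>Chosen representatives of \<open>D_x v\<close> and \<open>D_x\<^sup>2 v\<close>; a jet is unique only almost everywhere.\<close>

definition jet_of ::
  "real \<Rightarrow> real ^ 'n \<Rightarrow> real \<Rightarrow> (real \<times> (real ^ 'n) \<Rightarrow> real) \<Rightarrow>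
   (real \<times> (real ^ 'n) \<Rightarrow> real ^ 'n) \<times> (real \<times> (real ^ 'n) \<Rightarrow> real ^ 'n ^ 'n)" where
  "jet_of T x0 \<beta> v = (SOME (z, \<gamma>). occupation_mild_jet T x0 \<beta> v z \<gamma>)"

definition Dx ::
  "real \<Rightarrow> real ^ 'n \<Rightarrow> real \<Rightarrow> (real \<times> (real ^ 'n) \<Rightarrow> real) \<Rightarrow> real \<times> (real ^ 'n) \<Rightarrow> real ^ 'n" where
  "Dx T x0 \<beta> v = fst (jet_of T x0 \<beta> v)"

definition D2x ::
  "real \<Rightarrow> real ^ 'n \<Rightarrow> real \<Rightarrow> (real \<times> (real ^ 'n) \<Rightarrow> real) \<Rightarrow> real \<times> (real ^ 'n) \<Rightarrow> real ^ 'n ^ 'n" where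
  "D2x T x0 \<beta> v = snd (jet_of T x0 \<beta> v)"


subsection \<open>The Duhamel map, mild solutions and the fixed-point map\<close>

definition duhamel ::
  "'w measure \<Rightarrow> (real \<Rightarrow> 'w \<Rightarrow> real ^ 'n) \<Rightarrow> real \<Rightarrow>
   (real \<times> (real ^ 'n) \<Rightarrow> real) \<Rightarrow> (real ^ 'n \<Rightarrow> real) \<Rightarrow> real \<times> (real ^ 'n) \<Rightarrow> real" where
  "duhamel M W T F \<eta> = (\<lambda>(t, x). heat M W (T - t) \<eta> x +
     (LINT r:{t<..<T}|lborel. heat M W (r - t) (\<lambda>y. F (r, y)) x))"

text \<open>All integrals in the Duhamel formula at a point exist (Bochner integrals are total in HOL,
  with value 0 for non-integrable functions).\<close>

definition duhamel_converges ::
  "'w measure \<Rightarrow> (real \<Rightarrow> 'w \<Rightarrow> real ^ 'n) \<Rightarrow> real \<Rightarrow>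
   (real \<times> (real ^ 'n) \<Rightarrow> real) \<Rightarrow> (real ^ 'n \<Rightarrow> real) \<Rightarrow> real \<times> (real ^ 'n) \<Rightarrow> bool" where
  "duhamel_converges M W T F \<eta> = (\<lambda>(t, x).
     integrable M (\<lambda>\<omega>. \<eta> (x + W (T - t) \<omega>)) \<and>
     (AE r in lborel. r \<in> {t<..<T} \<longrightarrow> integrable M (\<lambda>\<omega>. F (r, x + W (r - t) \<omega>))) \<and>
     set_integrable lborel {t<..<T} (\<lambda>r. heat M W (r - t) (\<lambda>y. F (r, y)) x))"

text \<open>\<open>F^v\<close>\<close>

definition nonlin ::
  "real \<Rightarrow> real ^ 'n \<Rightarrow> real \<Rightarrow>
   (real \<Rightarrow> real ^ 'n \<Rightarrow> real \<Rightarrow> real ^ 'n \<Rightarrow> real ^ 'n ^ 'n \<Rightarrow> real) \<Rightarrow>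
   (real \<times> (real ^ 'n) \<Rightarrow> real) \<Rightarrow> real \<times> (real ^ 'n) \<Rightarrow> real" where
  "nonlin T x0 \<beta> f v =
     (\<lambda>(t, x). f t x (v (t, x)) (Dx T x0 \<beta> v (t, x)) (D2x T x0 \<beta> v (t, x)))"

definition nonlinear_mild_solution ::
  "'w measure \<Rightarrow> (real \<Rightarrow> 'w \<Rightarrow> real ^ 'n) \<Rightarrow> real \<Rightarrow> real ^ 'n \<Rightarrow> real \<Rightarrow>
   (real \<Rightarrow> real ^ 'n \<Rightarrow> real \<Rightarrow> real ^ 'n \<Rightarrow> real ^ 'n ^ 'n \<Rightarrow> real) \<Rightarrow> (real ^ 'n \<Rightarrow> real) \<Rightarrow>
   (real \<times> (real ^ 'n) \<Rightarrow> real) \<Rightarrow> bool" where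
  "nonlinear_mild_solution M W T x0 \<beta> f g v \<longleftrightarrow>
     has_occupation_mild_jet T x0 \<beta> v \<and>
     nonlin T x0 \<beta> f v \<in> L2_space (nu T x0 \<beta>) \<and>
     (AE p in nu T x0 \<beta>. v p = duhamel M W T (nonlin T x0 \<beta> f v) g p)"

definition Phi ::
  "'w measure \<Rightarrow> (real \<Rightarrow> 'w \<Rightarrow> real ^ 'n) \<Rightarrow> real \<Rightarrow> real ^ 'n \<Rightarrow> real \<Rightarrow>
   (real \<Rightarrow> real ^ 'n \<Rightarrow> real \<Rightarrow> real ^ 'n \<Rightarrow> real ^ 'n ^ 'n \<Rightarrow> real) \<Rightarrow> (real ^ 'n \<Rightarrow> real) \<Rightarrow>
   (real \<times> (real ^ 'n) \<Rightarrow> real) \<Rightarrow> real \<times> (real ^ 'n) \<Rightarrow> real" where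
  "Phi M W T x0 \<beta> f g F = nonlin T x0 \<beta> f (duhamel M W T F g)"

definition contraction_const :: "real \<Rightarrow> real \<Rightarrow> real \<Rightarrow> real \<Rightarrow> real" where
  "contraction_const L0 L1 L2 \<beta> = L0 / \<beta> + L1 / sqrt \<beta> + 2 * sqrt 2 * L2"

end

(*
  By density it suffices to treat F(t,x) = sum_j a_j(t) E_j(t,x) with the waves
  E_j(t,x) = exp(t |l_j|^2 / 2) cos(l_j . (x - x0) + th_j).  The heat semigroup P_(r-t) maps E_j(r,.)
  to E_j(t,.), so the Duhamel integral of F is sum_j A_j E_j with A_j(t) = int_t^T a_j, and a spatial
  derivative multiplies the coefficients by components of l_j and shifts the phases.  Expanding the
  Gram matrices of the waves in L^2(mu_t) in powers of t (the Wiener chaos decomposition) gives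
  |sum_j A_j E_j|^2 = sum_n t^n / n! Q_n(A(t)) with positive semidefinite forms Q_n, and summing the
  squared norms of the first derivatives replaces Q_n by Q_(n+1).  In every degree the three jet
  estimates thus become weighted one-dimensional inequalities between G(t) = int_t^T phi and phi;
  the one for the second derivative is Hardy's inequality with constant 4n / (n - 1) <= 8, n >= 2.

  For the terminal datum the chaos expansion bounds the gradient of P_(T-t) g by the norm of g.  The
  semigroup commutes with the weak gradient, so the same bound applied to grad g controls the second
  derivative.  The map Phi is then a contraction of a complete space.
*)

theory Submission
  imports Defs "HOL-Real_Asymp.Real_Asymp"
begin

section \<open>L2 of a measure: completeness and a dense class for finite Borel measures\<close>

subsection \<open>Completeness of \<open>L2\<close>\<close>

text \<open>The second derivative is the borderline case. Estimating under the Duhamel integral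
  costs a factor of order \<open>1/(r-t)\<close> for \<open>D^2 P_(r-t)\<close>, which is not
  integrable in \<open>r\<close>; on the waves the integral over \<open>r\<close> is carried out
  before any norm is taken.

  Waves with different frequencies are not orthogonal in \<open>L2(mu_t)\<close>. Sorting by degree
  leaves forms \<open>Q_n\<close> that do not depend on time and puts all of the time dependence
  into \<open>t^n/n!\<close>. In degree n the Hessian has \<open>t^(n-2)/(n-2)!\<close> where F has
  \<open>t^n/n!\<close>; the missing \<open>t^2\<close> is what Hardy's inequality supplies, with
  constant \<open>4/(n-1)^2\<close>, and the factorials contribute \<open>n(n-1)\<close>.

  For the terminal datum, \<open>t^(n-2)/(n-2)!\<close> integrates over (0,T) to
  \<open>T^(n-1)/(n-1)!\<close>, which is n/T times the weight \<open>T^n/n!\<close> of g itself.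
  This loss is unbounded in n, but it is exactly the weight of degree n in the norm of grad g: hence
  the hypothesis that g lies in \<open>H^1\<close>.

  Elements of L2 are represented by functions and jets are picked by choice, so every identity
  between jets passes through almost everywhere uniqueness of weak derivatives.\<close>

lemma L2_space_iff:
  "F \<in> L2_space M \<longleftrightarrow> F \<in> borel_measurable M \<and> (\<integral>\<^sup>+x. ennreal ((norm (F x))\<^sup>2) \<partial>M) < \<infinity>"
  by (auto simp: L2_space_def integrable_iff_bounded)

lemma L2_space_measurable [measurable_dest]: "F \<in> L2_space M \<Longrightarrow> F \<in> borel_measurable M"
  by (simp add: L2_space_def)

lemma L2_space_integrable: "F \<in> L2_space M \<Longrightarrow> integrable M (\<lambda>x. (norm (F x))\<^sup>2)"
  by (simp add: L2_space_def)

lemma L2_norm_nonneg [simp]: "0 \<le> L2_norm M F"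
  by (simp add: L2_norm_def)

lemma L2_norm_sq: "(L2_norm M F)\<^sup>2 = (LINT x|M. (norm (F x))\<^sup>2)"
  by (simp add: L2_norm_def)

lemma L2_norm_sq_nn:
  assumes "F \<in> L2_space M"
  shows "ennreal ((L2_norm M F)\<^sup>2) = (\<integral>\<^sup>+x. ennreal ((norm (F x))\<^sup>2) \<partial>M)"
  using L2_space_integrable[OF assms] by (simp add: L2_norm_sq nn_integral_eq_integral)

lemma L2_norm_le_iff:
  assumes "F \<in> L2_space M" "0 \<le> c"
  shows "L2_norm M F \<le> c \<longleftrightarrow> (\<integral>\<^sup>+x. ennreal ((norm (F x))\<^sup>2) \<partial>M) \<le> ennreal (c\<^sup>2)"
  using assms by (simp add: L2_norm_sq_nn[symmetric] ennreal_le_iff abs_le_square_iff[symmetric])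

lemma L2_spaceI:
  assumes "F \<in> borel_measurable M" "(\<integral>\<^sup>+x. ennreal ((norm (F x))\<^sup>2) \<partial>M) \<le> ennreal c"
  shows "F \<in> L2_space M"
  using assms by (auto simp: L2_space_iff intro: le_less_trans)

lemma L2_norm_leI:
  assumes "F \<in> borel_measurable M" "(\<integral>\<^sup>+x. ennreal ((norm (F x))\<^sup>2) \<partial>M) \<le> ennreal (c\<^sup>2)" "0 \<le> c"
  shows "F \<in> L2_space M" "L2_norm M F \<le> c"
proof -
  show F: "F \<in> L2_space M" using assms(1,2) by (rule L2_spaceI)
  show "L2_norm M F \<le> c" using L2_norm_le_iff[OF F assms(3)] assms(2) by blast
qed

lemma L2_space_zero [simp]: "(\<lambda>x. 0) \<in> L2_space M"
  by (simp add: L2_space_def)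

lemma L2_space_scaleR:
  assumes "F \<in> L2_space M" shows "(\<lambda>x. c *\<^sub>R F x) \<in> L2_space M"
  using assms by (auto simp: L2_space_def power_mult_distrib)

lemma L2_norm_scaleR: "L2_norm M (\<lambda>x. c *\<^sub>R F x) = \<bar>c\<bar> * L2_norm M F"
  by (simp add: L2_norm_def power_mult_distrib real_sqrt_mult)

text \<open>Optimising over \<open>a\<close> and \<open>b\<close> after integration yields the triangle inequality.\<close>

lemma norm_add_sq_le:
  fixes x y :: "'a::real_normed_vector"
  assumes "0 < a" "0 < b"
  shows "(norm (x + y))\<^sup>2 \<le> (a + b) * ((norm x)\<^sup>2 / a + (norm y)\<^sup>2 / b)"
proof -
  have "(norm (x + y))\<^sup>2 \<le> (norm x + norm y)\<^sup>2"
    by (simp add: norm_triangle_ineq power_mono)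
  also have "\<dots> \<le> (a + b) * ((norm x)\<^sup>2 / a + (norm y)\<^sup>2 / b)"
  proof -
    have "(a + b) * ((norm x)\<^sup>2 / a + (norm y)\<^sup>2 / b) - (norm x + norm y)\<^sup>2
        = (b * norm x - a * norm y)\<^sup>2 / (a * b)"
      using assms by (simp add: field_simps power2_eq_square)
    also have "\<dots> \<ge> 0" using assms by simp
    finally show ?thesis by simp
  qed
  finally show ?thesis .
qed

lemma L2_space_add:
  assumes F: "F \<in> L2_space M" and G: "G \<in> L2_space M"
  shows "(\<lambda>x. F x + G x) \<in> L2_space M"
proof -
  have "integrable M (\<lambda>x. (norm (F x + G x))\<^sup>2)"
  proof (rule Bochner_Integration.integrable_bound)
    show "integrable M (\<lambda>x. (1 + 1) * ((norm (F x))\<^sup>2 / 1 + (norm (G x))\<^sup>2 / 1))"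
      using F G by (auto simp: L2_space_def)
    show "(\<lambda>x. (norm (F x + G x))\<^sup>2) \<in> borel_measurable M"
      using F G by (auto simp: L2_space_def)
    show "AE x in M. norm ((norm (F x + G x))\<^sup>2)
        \<le> norm ((1 + 1) * ((norm (F x))\<^sup>2 / 1 + (norm (G x))\<^sup>2 / 1))"
      using norm_add_sq_le[of 1 1] by (intro AE_I2) simp
  qed
  with F G show ?thesis by (auto simp: L2_space_def)
qed

lemma L2_space_minus: "F \<in> L2_space M \<Longrightarrow> (\<lambda>x. - F x) \<in> L2_space M"
  using L2_space_scaleR[of F M "-1"] by simp

lemma L2_space_diff:
  assumes "F \<in> L2_space M" "G \<in> L2_space M"
  shows "(\<lambda>x. F x - G x) \<in> L2_space M"
  using L2_space_add[OF assms(1) L2_space_minus[OF assms(2)]] by simp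

lemma L2_norm_add_le:
  assumes F: "F \<in> L2_space M" and G: "G \<in> L2_space M"
  shows "L2_norm M (\<lambda>x. F x + G x) \<le> L2_norm M F + L2_norm M G"
proof (rule field_le_epsilon)
  fix e :: real assume e: "0 < e"
  \<comment> \<open>The optimal weights are the two norms themselves. They are enlarged by
    \<open>e/2\<close> because they stand in denominators and may vanish.\<close>
  define a where "a = L2_norm M F + e/2"
  define b where "b = L2_norm M G + e/2"
  have ab: "0 < a" "0 < b" using e by (auto simp: a_def b_def add_nonneg_pos)
  have "(L2_norm M (\<lambda>x. F x + G x))\<^sup>2
      \<le> (LINT x|M. (a + b) * ((norm (F x))\<^sup>2 / a + (norm (G x))\<^sup>2 / b))"
    unfolding L2_norm_sq
    using L2_space_integrable[OF F] L2_space_integrable[OF G]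
      L2_space_integrable[OF L2_space_add[OF F G]] norm_add_sq_le[OF ab]
    by (intro integral_mono) auto
  also have "\<dots> = (a + b) * ((L2_norm M F)\<^sup>2 / a + (L2_norm M G)\<^sup>2 / b)"
    using L2_space_integrable[OF F] L2_space_integrable[OF G] by (simp add: L2_norm_sq)
  also have "\<dots> \<le> (a + b) * (a + b)"
  proof (intro mult_left_mono add_mono)
    have "(L2_norm M F)\<^sup>2 \<le> a\<^sup>2" "(L2_norm M G)\<^sup>2 \<le> b\<^sup>2"
      using e by (auto simp: a_def b_def intro!: power_mono)
    then show "(L2_norm M F)\<^sup>2 / a \<le> a" "(L2_norm M G)\<^sup>2 / b \<le> b"
      using ab by (auto simp: field_simps power2_eq_square)
  qed (use ab in auto)
  finally have "(L2_norm M (\<lambda>x. F x + G x))\<^sup>2 \<le> (a + b)\<^sup>2" by (simp add: power2_eq_square)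
  then have "L2_norm M (\<lambda>x. F x + G x) \<le> a + b"
    by (rule power2_le_imp_le) (use ab in linarith)
  then show "L2_norm M (\<lambda>x. F x + G x) \<le> L2_norm M F + L2_norm M G + e"
    by (simp add: a_def b_def)
qed

lemma L2_norm_diff_commute: "L2_norm M (\<lambda>x. F x - G x) = L2_norm M (\<lambda>x. G x - F x)"
  by (simp add: L2_norm_def norm_minus_commute)

lemma L2_norm_triangle:
  assumes "F \<in> L2_space M" "G \<in> L2_space M" "H \<in> L2_space M"
  shows "L2_norm M (\<lambda>x. F x - H x) \<le> L2_norm M (\<lambda>x. F x - G x) + L2_norm M (\<lambda>x. G x - H x)"
  using L2_norm_add_le[OF L2_space_diff[OF assms(1,2)] L2_space_diff[OF assms(2,3)]] by simp

lemma L2_norm_le_add_diff: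
  assumes "F \<in> L2_space M" "G \<in> L2_space M"
  shows "L2_norm M F \<le> L2_norm M G + L2_norm M (\<lambda>x. F x - G x)"
  using L2_norm_add_le[OF assms(2) L2_space_diff[OF assms]] by simp

lemma L2_norm_cong_AE:
  assumes "F \<in> borel_measurable M" "G \<in> borel_measurable M" "AE x in M. norm (F x) = norm (G x)"
  shows "L2_norm M F = L2_norm M G"
proof -
  have "(LINT x|M. (norm (F x))\<^sup>2) = (LINT x|M. (norm (G x))\<^sup>2)"
    using assms by (intro integral_cong_AE) auto
  then show ?thesis by (simp add: L2_norm_def)
qed

lemma L2_space_cong_AE:
  assumes "F \<in> L2_space M" "G \<in> borel_measurable M" "AE x in M. F x = G x"
  shows "G \<in> L2_space M"
proof -
  have "(\<integral>\<^sup>+x. ennreal ((norm (F x))\<^sup>2) \<partial>M) = (\<integral>\<^sup>+x. ennreal ((norm (G x))\<^sup>2) \<partial>M)"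
    using assms(3) by (intro nn_integral_cong_AE) auto
  with assms show ?thesis by (auto simp: L2_space_iff)
qed

lemma L2_norm_eq_0_iff:
  assumes "F \<in> L2_space M"
  shows "L2_norm M F = 0 \<longleftrightarrow> (AE x in M. F x = 0)"
  using L2_space_integrable[OF assms]
  by (simp add: L2_norm_def integral_nonneg_eq_0_iff_AE)

lemma L2_norm_mono:
  fixes F :: "'a \<Rightarrow> 'b::euclidean_space" and G :: "'a \<Rightarrow> 'c::euclidean_space"
  assumes "F \<in> borel_measurable M" "G \<in> L2_space M" "AE x in M. norm (F x) \<le> norm (G x)"
  shows "F \<in> L2_space M" "L2_norm M F \<le> L2_norm M G"
proof -
  have "(\<integral>\<^sup>+x. ennreal ((norm (F x))\<^sup>2) \<partial>M) \<le> (\<integral>\<^sup>+x. ennreal ((norm (G x))\<^sup>2) \<partial>M)"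
    using assms(3) by (intro nn_integral_mono_AE) (auto intro!: ennreal_leI power_mono)
  then have "(\<integral>\<^sup>+x. ennreal ((norm (F x))\<^sup>2) \<partial>M) \<le> ennreal ((L2_norm M G)\<^sup>2)"
    using assms by (simp add: L2_norm_sq_nn)
  from L2_norm_leI[OF assms(1) this] show "F \<in> L2_space M" "L2_norm M F \<le> L2_norm M G" by auto
qed

text \<open>Riesz--Fischer: along a subsequence with geometrically decreasing increments the functions
  converge almost everywhere, and Fatou's lemma identifies the limit.\<close>

lemma L2_subseq_AE_convergent:
  fixes F :: "nat \<Rightarrow> 'a \<Rightarrow> 'b::euclidean_space"
  assumes F: "\<And>n. F n \<in> L2_space M"
    and d: "\<And>n. (L2_norm M (\<lambda>x. F (Suc n) x - F n x))\<^sup>2 \<le> (1/8) ^ n"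
  shows "AE x in M. convergent (\<lambda>n. F n x)"
proof -
  have [measurable]: "\<And>n. F n \<in> borel_measurable M" using F by (auto simp: L2_space_def)
  define D where "D n x = norm (F (Suc n) x - F n x)" for n x
  have [measurable]: "\<And>n. D n \<in> borel_measurable M" unfolding D_def by measurable
  \<comment> \<open>The weight \<open>4 ^ n\<close> is small enough against \<open>(1/8) ^ n\<close>
    to keep the series of integrals geometric, and large enough that convergence of the series at a
    point forces \<open>D n x\<close> below \<open>(1/2) ^ n\<close> eventually.\<close>
  have "(\<integral>\<^sup>+x. (\<Sum>n. ennreal (4 ^ n * (D n x)\<^sup>2)) \<partial>M) = (\<Sum>n. \<integral>\<^sup>+x. ennreal (4 ^ n * (D n x)\<^sup>2) \<partial>M)"
    by (rule nn_integral_suminf) simp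
  also have "\<dots> \<le> (\<Sum>n. ennreal ((1/2)^n))"
  proof (intro suminf_le)
    fix n
    have "(\<integral>\<^sup>+x. ennreal (4 ^ n * (D n x)\<^sup>2) \<partial>M) = ennreal (4 ^ n) * ennreal ((L2_norm M (\<lambda>x. F (Suc n) x - F n x))\<^sup>2)"
      by (subst L2_norm_sq_nn) (auto intro!: L2_space_diff F simp: D_def ennreal_mult nn_integral_cmult)
    also have "\<dots> \<le> ennreal (4 ^ n) * ennreal ((1/8) ^ n)"
      by (intro mult_left_mono ennreal_leI d) auto
    also have "\<dots> = ennreal ((1/2)^n)"
      by (subst ennreal_mult[symmetric]) (auto simp: power_mult_distrib[symmetric])
    finally show "(\<integral>\<^sup>+x. ennreal (4 ^ n * (D n x)\<^sup>2) \<partial>M) \<le> ennreal ((1/2)^n)" .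
  qed auto
  also have "\<dots> < \<infinity>"
    by (subst suminf_ennreal2) (auto simp: summable_geometric ennreal_less_top)
  finally have "AE x in M. (\<Sum>n. ennreal (4 ^ n * (D n x)\<^sup>2)) \<noteq> \<infinity>"
    by (intro nn_integral_PInf_AE) auto
  then show ?thesis
  proof eventually_elim
    case (elim x)
    have s: "summable (\<lambda>n. 4 ^ n * (D n x)\<^sup>2)"
      using elim by (intro summable_suminf_not_top) auto
    then have "(\<lambda>n. 4 ^ n * (D n x)\<^sup>2) \<longlonglongrightarrow> 0" by (rule summable_LIMSEQ_zero)
    then have "eventually (\<lambda>n. 4 ^ n * (D n x)\<^sup>2 < 1) sequentially"
      by (rule order_tendstoD) simp
    then have ev: "eventually (\<lambda>n. norm (F (Suc n) x - F n x) \<le> (1/2) ^ n) sequentially"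
    proof eventually_elim
      case (elim n)
      have "(2 ^ n * D n x)\<^sup>2 < 1\<^sup>2"
      proof -
        have "(2 ^ n)\<^sup>2 = (4::real) ^ n" by (simp add: power2_eq_square flip: power_mult_distrib)
        then show ?thesis using elim by (simp add: power_mult_distrib)
      qed
      then have "2 ^ n * D n x < 1" by (rule power2_less_imp_less) simp
      then have "D n x < 1 / 2 ^ n" by (simp add: pos_less_divide_eq mult.commute)
      then show ?case by (simp add: D_def power_one_over)
    qed
    have "summable (\<lambda>n. F (Suc n) x - F n x)"
      by (rule summable_comparison_test_ev[OF ev]) (simp add: summable_geometric)
    then have "convergent (\<lambda>n. \<Sum>i<n. F (Suc i) x - F i x)" by (simp add: summable_iff_convergent)
    then have "convergent (\<lambda>n. F n x - F 0 x)"
      by (simp add: sum_lessThan_telescope[of "\<lambda>n. F n x"])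
    then have "convergent (\<lambda>n. (F n x - F 0 x) + F 0 x)"
      by (intro convergent_add convergent_const)
    then show ?case by simp
  qed
qed

lemma L2_complete:
  fixes F :: "nat \<Rightarrow> 'a \<Rightarrow> 'b::euclidean_space"
  assumes F: "\<And>n. F n \<in> L2_space M"
    and C: "\<And>e. 0 < e \<Longrightarrow> \<exists>N. \<forall>m\<ge>N. \<forall>n\<ge>N. L2_norm M (\<lambda>x. F m x - F n x) \<le> e"
  obtains G where "G \<in> L2_space M" "(\<lambda>n. L2_norm M (\<lambda>x. F n x - G x)) \<longlonglongrightarrow> 0"
proof -
  have [measurable]: "\<And>n. F n \<in> borel_measurable M" using F by (auto simp: L2_space_def)
  have "\<exists>N. \<forall>m\<ge>N. \<forall>n\<ge>N. L2_norm M (\<lambda>x. F m x - F n x) \<le> (1/4) ^ k" for k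
    by (rule C) simp
  then obtain N where N: "\<And>k m n. N k \<le> m \<Longrightarrow> N k \<le> n \<Longrightarrow> L2_norm M (\<lambda>x. F m x - F n x) \<le> (1/4) ^ k"
    by metis
  \<comment> \<open>Summing all thresholds up to \<open>k\<close> puts both \<open>r k\<close> and
    \<open>r (Suc k)\<close> above \<open>N k\<close> although \<open>N\<close> need not be
    monotone. The summand \<open>k\<close> makes \<open>r\<close> tend to infinity, which Fatou's
    lemma needs below.\<close>
  define r where "r k = (\<Sum>i\<le>k. N i) + k" for k
  have rN: "N k \<le> r k" for k
    unfolding r_def by (simp add: member_le_sum trans_le_add1)
  have rN': "N k \<le> r (Suc k)" for k
    using rN[of k] by (simp add: r_def)
  have r_ge: "k \<le> r k" for k by (simp add: r_def)
  have "AE x in M. convergent (\<lambda>k. F (r k) x)"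
  proof (rule L2_subseq_AE_convergent)
    fix k
    have "(L2_norm M (\<lambda>x. F (r (Suc k)) x - F (r k) x))\<^sup>2 \<le> ((1/4) ^ k)\<^sup>2"
      by (intro power_mono N rN rN') simp
    also have "\<dots> = (1/16) ^ k" by (simp add: power2_eq_square power_mult_distrib[symmetric])
    also have "\<dots> \<le> (1/8)^k" by (intro power_mono) auto
    finally show "(L2_norm M (\<lambda>x. F (r (Suc k)) x - F (r k) x))\<^sup>2 \<le> (1/8) ^ k" .
  qed (rule F)
  moreover define G where "G x = lim (\<lambda>k. F (r k) x)" for x
  ultimately have lim: "AE x in M. (\<lambda>k. F (r k) x) \<longlonglongrightarrow> G x"
    by (auto simp: convergent_LIMSEQ_iff)
  have [measurable]: "G \<in> borel_measurable M" unfolding G_def by measurable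
  \<comment> \<open>With \<open>n\<close> fixed, Fatou's lemma along the subsequence carries the
    Cauchy bound over to the limit. This gives convergence of the whole sequence and also, since the
    bound is finite, that \<open>G\<close> is square integrable.\<close>
  have key: "(\<integral>\<^sup>+x. ennreal ((norm (F n x - G x))\<^sup>2) \<partial>M) \<le> ennreal (e\<^sup>2)"
    if "0 < e" "\<forall>m\<ge>N'. \<forall>n\<ge>N'. L2_norm M (\<lambda>x. F m x - F n x) \<le> e" "N' \<le> n" for e N' n
  proof -
    have "(\<integral>\<^sup>+x. ennreal ((norm (F n x - G x))\<^sup>2) \<partial>M)
       = (\<integral>\<^sup>+x. liminf (\<lambda>k. ennreal ((norm (F n x - F (r k) x))\<^sup>2)) \<partial>M)"
    proof (rule nn_integral_cong_AE)
      show "AE x in M. ennreal ((norm (F n x - G x))\<^sup>2)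
          = liminf (\<lambda>k. ennreal ((norm (F n x - F (r k) x))\<^sup>2))"
        using lim
      proof eventually_elim
        case (elim x)
        have "(\<lambda>k. ennreal ((norm (F n x - F (r k) x))\<^sup>2)) \<longlonglongrightarrow> ennreal ((norm (F n x - G x))\<^sup>2)"
          using elim by (intro tendsto_intros)
        from lim_imp_Liminf[OF _ this] show ?case by simp
      qed
    qed
    also have "\<dots> \<le> liminf (\<lambda>k. \<integral>\<^sup>+x. ennreal ((norm (F n x - F (r k) x))\<^sup>2) \<partial>M)"
      by (rule nn_integral_liminf) simp
    also have "\<dots> \<le> liminf (\<lambda>k. ennreal (e\<^sup>2))"
    proof (rule Liminf_mono, rule eventually_sequentiallyI[of N'])
      fix k assume "N' \<le> k"
      then have "N' \<le> r k" using r_ge[of k] by simp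
      with that have "L2_norm M (\<lambda>x. F n x - F (r k) x) \<le> e" by blast
      then show "(\<integral>\<^sup>+x. ennreal ((norm (F n x - F (r k) x))\<^sup>2) \<partial>M) \<le> ennreal (e\<^sup>2)"
        using that by (subst (asm) L2_norm_le_iff) (auto intro: L2_space_diff F)
    qed
    also have "\<dots> = ennreal (e\<^sup>2)" by (simp add: Liminf_const)
    finally show ?thesis .
  qed
  have conv: "(\<lambda>n. L2_norm M (\<lambda>x. F n x - G x)) \<longlonglongrightarrow> 0"
  proof (rule LIMSEQ_I)
    fix e :: real assume e: "0 < e"
    with C[of "e/2"] obtain N' where N': "\<forall>m\<ge>N'. \<forall>n\<ge>N'. L2_norm M (\<lambda>x. F m x - F n x) \<le> e/2" by auto
    have "L2_norm M (\<lambda>x. F n x - G x) \<le> e/2" if "N' \<le> n" for n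
      using e key[OF _ N' that] by (intro L2_norm_leI) auto
    then show "\<exists>no. \<forall>n\<ge>no. norm (L2_norm M (\<lambda>x. F n x - G x) - 0) < e"
      using e by (intro exI[of _ N']) (auto intro: le_less_trans[of _ "e/2"])
  qed
  obtain N' where N': "\<forall>m\<ge>N'. \<forall>n\<ge>N'. L2_norm M (\<lambda>x. F m x - F n x) \<le> 1" using C[of 1] by auto
  have "(\<lambda>x. F N' x - G x) \<in> L2_space M"
    using key[OF _ N', of N'] by (intro L2_spaceI[of _ _ 1]) auto
  from L2_space_diff[OF F[of N'] this] have "G \<in> L2_space M" by simp
  with conv that show ?thesis by blast
qed

subsection \<open>Density of trigonometric polynomials\<close>

text \<open>The free phase covers sines as well as cosines, so these functions form an algebra
  without complex exponentials. Constants are atoms of frequency zero, and scalar multiples are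
  products with constants.\<close>

inductive_set trig_polys :: "('a::euclidean_space \<Rightarrow> real) set" where
  atom: "(\<lambda>x. c * cos (v \<bullet> x + \<theta>)) \<in> trig_polys"
| add: "f \<in> trig_polys \<Longrightarrow> g \<in> trig_polys \<Longrightarrow> (\<lambda>x. f x + g x) \<in> trig_polys"

lemma trig_polys_const: "(\<lambda>x. c) \<in> trig_polys"
  using trig_polys.atom[of c 0 0] by simp

lemma trig_polys_sum:
  "(\<And>i. i \<in> I \<Longrightarrow> f i \<in> trig_polys) \<Longrightarrow> (\<lambda>x. \<Sum>i\<in>I. f i x) \<in> trig_polys"
  by (induction I rule: infinite_finite_induct) (auto intro: trig_polys_const trig_polys.add)

text \<open>The product-to-sum formula settles two atoms; bilinearity then gives the rest by an
  induction in each factor.\<close>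

lemma trig_polys_mult:
  assumes "f \<in> trig_polys" "g \<in> trig_polys"
  shows "(\<lambda>x. f x * g x) \<in> trig_polys"
  using assms
proof (induction f)
  case (atom c v \<theta>)
  from atom(1) show ?case
  proof (induction g)
    case (atom d w \<eta>)
    have eq: "(\<lambda>x. c * cos (v \<bullet> x + \<theta>) * (d * cos (w \<bullet> x + \<eta>)))
        = (\<lambda>x. (c * d / 2) * cos ((v - w) \<bullet> x + (\<theta> - \<eta>)) + (c * d / 2) * cos ((v + w) \<bullet> x + (\<theta> + \<eta>)))"
    proof
      fix x
      have "c * cos (v \<bullet> x + \<theta>) * (d * cos (w \<bullet> x + \<eta>)) = c * d * (cos (v \<bullet> x + \<theta>) * cos (w \<bullet> x + \<eta>))"
        by simp
      also have "\<dots> = (c * d / 2) * (cos ((v \<bullet> x + \<theta>) - (w \<bullet> x + \<eta>)) + cos ((v \<bullet> x + \<theta>) + (w \<bullet> x + \<eta>)))"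
        by (simp only: cos_times_cos) simp
      also have "\<dots> = (c * d / 2) * cos ((v - w) \<bullet> x + (\<theta> - \<eta>)) + (c * d / 2) * cos ((v + w) \<bullet> x + (\<theta> + \<eta>))"
        by (simp add: algebra_simps inner_diff_left inner_add_left)
      finally show "c * cos (v \<bullet> x + \<theta>) * (d * cos (w \<bullet> x + \<eta>)) = \<dots>" .
    qed
    show ?case unfolding eq by (intro trig_polys.intros)
  next
    case (add f g)
    then show ?case by (auto simp: distrib_left intro: trig_polys.add)
  qed
next
  case (add f1 f2)
  then show ?case by (auto simp: distrib_right intro: trig_polys.add)
qed

lemma trig_polys_continuous: "f \<in> trig_polys \<Longrightarrow> continuous_on UNIV f"
  by (induction rule: trig_polys.induct) (auto intro!: continuous_intros)

lemma trig_polys_measurable [measurable_dest]: "f \<in> trig_polys \<Longrightarrow> f \<in> borel_measurable borel"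
  by (intro borel_measurable_continuous_onI trig_polys_continuous)

lemma trig_polys_bounded:
  assumes "f \<in> trig_polys" shows "\<exists>B. \<forall>x. \<bar>f x\<bar> \<le> B"
  using assms
proof induction
  case (atom c v \<theta>)
  have "\<bar>c * cos (v \<bullet> x + \<theta>)\<bar> \<le> \<bar>c\<bar>" for x
    using mult_left_mono[OF abs_cos_le_one[of "v \<bullet> x + \<theta>"], of "\<bar>c\<bar>"] by (simp add: abs_mult)
  then show ?case by blast
next
  case (add f g)
  then obtain B C where B: "\<And>x. \<bar>f x\<bar> \<le> B" and C: "\<And>x. \<bar>g x\<bar> \<le> C" by blast
  have "\<bar>f x + g x\<bar> \<le> B + C" for x using B[of x] C[of x] by linarith
  then show ?case by blast
qed

text \<open>A periodic substitute for the coordinates: its values stay in a fixed cube, where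
  polynomial approximation is uniform, while \<open>L *\<^sub>R sin_map L x\<close> recovers
  \<open>x\<close> for large \<open>L\<close>.\<close>

definition sin_map :: "real \<Rightarrow> 'a::euclidean_space \<Rightarrow> 'a" where
  "sin_map L x = (\<Sum>b\<in>Basis. sin ((x \<bullet> b) / L) *\<^sub>R b)"

text \<open>Because trigonometric polynomials form an algebra, only linear functions need a
  computation, and there a sine is a cosine with phase \<open>- pi/2\<close>.\<close>

lemma trig_polys_poly_sin_map:
  fixes p :: "'a::euclidean_space \<Rightarrow> real"
  assumes "real_polynomial_function p"
  shows "(\<lambda>x. p (sin_map L x)) \<in> trig_polys"
  using assms
proof induction
  case (linear p)
  have "p (sin_map L x) = (\<Sum>b\<in>Basis. p b * cos ((b /\<^sub>R L) \<bullet> x + (- pi/2)))" for x :: 'a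
  proof -
    have s: "sin ((x \<bullet> b) / L) = cos ((b /\<^sub>R L) \<bullet> x + (- pi/2))" for b :: 'a
    proof -
      have "cos ((b /\<^sub>R L) \<bullet> x + (- pi/2)) = cos (pi/2 - (b /\<^sub>R L) \<bullet> x)"
        by (subst cos_minus[symmetric]) simp
      also have "\<dots> = sin ((b /\<^sub>R L) \<bullet> x)" by (simp add: cos_diff)
      finally show ?thesis by (simp add: inner_commute field_simps)
    qed
    show ?thesis
      unfolding sin_map_def using linear
      by (simp only: s linear_sum[OF bounded_linear.linear] linear_cmul[OF bounded_linear.linear])
         (simp add: mult.commute)
  qed
  then have "(\<lambda>x. p (sin_map L x)) = (\<lambda>x. \<Sum>b\<in>Basis. p b * cos ((b /\<^sub>R L) \<bullet> x + (- pi/2)))"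
    by (rule ext)
  then show ?case by (simp only: trig_polys_sum trig_polys.atom)
qed (auto intro: trig_polys_const trig_polys.add trig_polys_mult)

lemma sin_map_tendsto: "(\<lambda>n. real (Suc n) *\<^sub>R sin_map (real (Suc n)) x) \<longlonglongrightarrow> x"
proof -
  have *: "(\<lambda>n. real (Suc n) * sin (a / real (Suc n))) \<longlonglongrightarrow> a" for a :: real
    by real_asymp
  have "(\<lambda>n. \<Sum>b\<in>Basis. (real (Suc n) * sin ((x \<bullet> b) / real (Suc n))) *\<^sub>R b) \<longlonglongrightarrow> (\<Sum>b\<in>Basis. (x \<bullet> b) *\<^sub>R b)"
    by (intro tendsto_intros *)
  then show ?thesis by (simp add: sin_map_def scaleR_sum_right euclidean_representation)
qed

lemma sin_map_in_cbox: "sin_map L x \<in> cbox (- One) One"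
  by (auto simp: mem_box sin_map_def inner_sum_left_Basis abs_le_iff)

text \<open>Membership of the approximant in \<open>L2_space M\<close> is demanded explicitly: the
  Bochner integral of a function that is not integrable is 0, so without it \<open>L2_norm\<close>
  could report a false approximation.\<close>

definition trig_closure :: "'a::euclidean_space measure \<Rightarrow> ('a \<Rightarrow> real) set" where
  "trig_closure M = {f \<in> L2_space M. \<forall>e>0. \<exists>g\<in>trig_polys. g \<in> L2_space M \<and> L2_norm M (\<lambda>x. f x - g x) < e}"

lemma trig_closureD:
  assumes "f \<in> trig_closure M" "0 < e"
  obtains g where "g \<in> trig_polys" "g \<in> L2_space M" "L2_norm M (\<lambda>x. f x - g x) < e"
  using assms by (auto simp: trig_closure_def)

lemma trig_closure_L2: "f \<in> trig_closure M \<Longrightarrow> f \<in> L2_space M"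
  by (simp add: trig_closure_def)

lemma trig_closure_add:
  assumes f: "f \<in> trig_closure M" and g: "g \<in> trig_closure M"
  shows "(\<lambda>x. f x + g x) \<in> trig_closure M"
proof -
  have "\<exists>h\<in>trig_polys. h \<in> L2_space M \<and> L2_norm M (\<lambda>x. (f x + g x) - h x) < e" if e: "e > 0" for e
  proof -
    obtain f' where f': "f' \<in> trig_polys" "f' \<in> L2_space M" "L2_norm M (\<lambda>x. f x - f' x) < e/2"
      using trig_closureD[OF f, of "e/2"] e by auto
    obtain g' where g': "g' \<in> trig_polys" "g' \<in> L2_space M" "L2_norm M (\<lambda>x. g x - g' x) < e/2"
      using trig_closureD[OF g, of "e/2"] e by auto
    have "L2_norm M (\<lambda>x. (f x - f' x) + (g x - g' x)) \<le> L2_norm M (\<lambda>x. f x - f' x) + L2_norm M (\<lambda>x. g x - g' x)"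
      by (intro L2_norm_add_le L2_space_diff trig_closure_L2 f g f' g')
    also have "\<dots> < e" using f' g' by simp
    finally have "L2_norm M (\<lambda>x. (f x + g x) - (f' x + g' x)) < e"
      by (simp add: algebra_simps)
    then show ?thesis
      using f' g' by (intro bexI[of _ "\<lambda>x. f' x + g' x"]) (auto intro: trig_polys.add L2_space_add)
  qed
  then show ?thesis using assms by (auto simp: trig_closure_def intro: L2_space_add)
qed

lemma trig_closure_cmult:
  assumes f: "f \<in> trig_closure M"
  shows "(\<lambda>x. c * f x) \<in> trig_closure M"
proof -
  have "\<exists>h\<in>trig_polys. h \<in> L2_space M \<and> L2_norm M (\<lambda>x. c * f x - h x) < e" if e: "e > 0" for e
  proof -
    have "0 < e / (\<bar>c\<bar> + 1)" using e by simp
    from trig_closureD[OF f this]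
    obtain f' where f': "f' \<in> trig_polys" "f' \<in> L2_space M" "L2_norm M (\<lambda>x. f x - f' x) < e / (\<bar>c\<bar> + 1)"
      by blast
    have "L2_norm M (\<lambda>x. c * f x - c * f' x) = \<bar>c\<bar> * L2_norm M (\<lambda>x. f x - f' x)"
      using L2_norm_scaleR[of M c "\<lambda>x. f x - f' x"] by (simp add: right_diff_distrib)
    also have "\<dots> \<le> (\<bar>c\<bar> + 1) * L2_norm M (\<lambda>x. f x - f' x)" by (intro mult_right_mono) auto
    also have "\<dots> < e" using f'(3) by (simp add: field_simps)
    finally show ?thesis
      using f' L2_space_scaleR[of f' M c]
      by (intro bexI[of _ "\<lambda>x. c * f' x"]) (auto intro: trig_polys_mult trig_polys_const)
  qed
  then show ?thesis using assms L2_space_scaleR[of f M c] by (auto simp: trig_closure_def)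
qed

lemma L2_norm_dominated_convergence:
  fixes f :: "nat \<Rightarrow> 'a \<Rightarrow> real"
  assumes h: "h \<in> L2_space M" and f: "\<And>n. f n \<in> borel_measurable M" "\<And>n x. x \<in> space M \<Longrightarrow> \<bar>f n x\<bar> \<le> h x"
    and g: "g \<in> borel_measurable M" and lim: "\<And>x. x \<in> space M \<Longrightarrow> (\<lambda>n. f n x) \<longlonglongrightarrow> g x"
  shows "(\<lambda>n. L2_norm M (\<lambda>x. f n x - g x)) \<longlonglongrightarrow> 0" "g \<in> L2_space M"
proof -
  have gh: "\<bar>g x\<bar> \<le> h x" if "x \<in> space M" for x
    using f(2)[OF that] by (intro LIMSEQ_le_const2[OF tendsto_rabs[OF lim[OF that]]]) auto
  have "norm (g x) \<le> norm (h x)" if "x \<in> space M" for x using gh[OF that] by simp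
  then show "g \<in> L2_space M" using g h by (intro L2_norm_mono(1)[OF g h]) auto
  have "(\<lambda>n. LINT x|M. (norm (f n x - g x))\<^sup>2) \<longlonglongrightarrow> (LINT x|M. 0)"
  proof (rule integral_dominated_convergence)
    show "integrable M (\<lambda>x. 4 * (norm (h x))\<^sup>2)" using L2_space_integrable[OF h] by simp
    show "AE x in M. (\<lambda>n. (norm (f n x - g x))\<^sup>2) \<longlonglongrightarrow> 0"
    proof (rule AE_I2)
      fix x assume "x \<in> space M"
      from lim[OF this] have "(\<lambda>n. f n x - g x) \<longlonglongrightarrow> 0" by (simp add: LIM_zero)
      then have "(\<lambda>n. (norm (f n x - g x))\<^sup>2) \<longlonglongrightarrow> (norm (0::real))\<^sup>2" by (intro tendsto_intros)
      then show "(\<lambda>n. (norm (f n x - g x))\<^sup>2) \<longlonglongrightarrow> 0" by simp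
    qed
    show "AE x in M. norm ((norm (f n x - g x))\<^sup>2) \<le> 4 * (norm (h x))\<^sup>2" for n
    proof (rule AE_I2)
      fix x assume x: "x \<in> space M"
      have "\<bar>f n x - g x\<bar> \<le> 2 * h x" using f(2)[OF x, of n] gh[OF x] by linarith
      then have "\<bar>f n x - g x\<bar>\<^sup>2 \<le> (2 * h x)\<^sup>2" by (intro power_mono) auto
      then show "norm ((norm (f n x - g x))\<^sup>2) \<le> 4 * (norm (h x))\<^sup>2"
        by (simp add: power_mult_distrib)
    qed
  qed (use f g in auto)
  then have "(\<lambda>n. sqrt (LINT x|M. (norm (f n x - g x))\<^sup>2)) \<longlonglongrightarrow> sqrt 0"
    by (intro tendsto_real_sqrt) simp
  then show "(\<lambda>n. L2_norm M (\<lambda>x. f n x - g x)) \<longlonglongrightarrow> 0" by (simp add: L2_norm_def)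
qed

lemma trig_closure_limit:
  assumes f: "\<And>n. f n \<in> trig_closure M" and g: "g \<in> L2_space M"
    and lim: "(\<lambda>n. L2_norm M (\<lambda>x. f n x - g x)) \<longlonglongrightarrow> 0"
  shows "g \<in> trig_closure M"
proof -
  have "\<exists>h\<in>trig_polys. h \<in> L2_space M \<and> L2_norm M (\<lambda>x. g x - h x) < e" if e: "e > 0" for e
  proof -
    have "eventually (\<lambda>n. L2_norm M (\<lambda>x. f n x - g x) < e/2) sequentially"
      using e by (intro order_tendstoD[OF lim]) auto
    then obtain n where n: "L2_norm M (\<lambda>x. f n x - g x) < e/2" by (auto simp: eventually_sequentially)
    obtain h where h: "h \<in> trig_polys" "h \<in> L2_space M" "L2_norm M (\<lambda>x. f n x - h x) < e/2"
      using trig_closureD[OF f[of n], of "e/2"] e by auto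
    have "L2_norm M (\<lambda>x. g x - h x) \<le> L2_norm M (\<lambda>x. g x - f n x) + L2_norm M (\<lambda>x. f n x - h x)"
      by (intro L2_norm_triangle g trig_closure_L2 f h)
    also have "\<dots> < e" using n h(3) by (simp add: L2_norm_diff_commute[of M g])
    finally show ?thesis using h by blast
  qed
  then show ?thesis using g by (auto simp: trig_closure_def)
qed

context
  fixes M :: "'a::euclidean_space measure"
  assumes fin: "finite_measure M" and sets_M: "sets M = sets borel"
begin

lemma borel_measurable_eq_finite: "f \<in> borel_measurable borel \<longleftrightarrow> f \<in> borel_measurable M"
  by (simp add: measurable_cong_sets[OF sets_M refl])

lemma space_eq_UNIV: "space M = UNIV"
  using sets_eq_imp_space_eq[OF sets_M] by simp

lemma bounded_L2:
  fixes f :: "'a \<Rightarrow> real"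
  assumes "f \<in> borel_measurable borel" "\<And>x. \<bar>f x\<bar> \<le> B"
  shows "f \<in> L2_space M"
proof -
  interpret finite_measure M by (rule fin)
  have "(\<integral>\<^sup>+x. ennreal ((norm (f x))\<^sup>2) \<partial>M) \<le> (\<integral>\<^sup>+x. ennreal (B\<^sup>2) \<partial>M)"
    using assms by (intro nn_integral_mono ennreal_leI power_mono) auto
  also have "\<dots> = ennreal (B\<^sup>2 * measure M UNIV)"
    by (simp add: emeasure_eq_measure space_eq_UNIV ennreal_mult)
  finally show ?thesis
    using assms(1) by (intro L2_spaceI) (auto simp: borel_measurable_eq_finite)
qed

lemma trig_polys_L2: "f \<in> trig_polys \<Longrightarrow> f \<in> L2_space M"
  using trig_polys_bounded[of f] bounded_L2[of f] by (auto dest: trig_polys_measurable)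

lemma trig_polys_closure: "f \<in> trig_polys \<Longrightarrow> f \<in> trig_closure M"
  by (auto simp: trig_closure_def trig_polys_L2 L2_norm_def intro!: bexI[of _ f])

text \<open>On a finite measure a constant is a square integrable majorant, so bounded pointwise
  convergence is convergence in L2. Continuous functions, indicators of open sets and countable
  disjoint unions are all reached in this way.\<close>

lemma trig_closure_bounded_limit:
  assumes f: "\<And>n. f n \<in> trig_closure M" "\<And>n x. \<bar>f n x\<bar> \<le> B"
    and g: "g \<in> borel_measurable borel" and lim: "\<And>x. (\<lambda>n. f n x) \<longlonglongrightarrow> g x"
  shows "g \<in> trig_closure M"
proof (rule trig_closure_limit[OF f(1)])
  have h: "(\<lambda>x. B) \<in> L2_space M" by (rule bounded_L2[of _ "\<bar>B\<bar>"]) auto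
  note * = L2_norm_dominated_convergence[OF h, of f g]
  have "f n \<in> borel_measurable M" for n using f(1)[of n] by (auto simp: trig_closure_def L2_space_def)
  with f(2) g lim show "g \<in> L2_space M" "(\<lambda>n. L2_norm M (\<lambda>x. f n x - g x)) \<longlonglongrightarrow> 0"
    by (auto intro!: * simp: borel_measurable_eq_finite)
qed

text \<open>\<open>\<phi>(L sin (x/L))\<close> is bounded, tends to \<open>\<phi>(x)\<close> as \<open>L\<close> grows, and only sees \<open>\<phi>\<close> on a compact cube.\<close>

lemma trig_closure_continuous:
  assumes \<phi>: "continuous_on UNIV \<phi>" and B: "\<And>x. \<bar>\<phi> x\<bar> \<le> B"
  shows "\<phi> \<in> trig_closure M"
proof -
  have "\<exists>p. real_polynomial_function p \<and>
      (\<forall>s\<in>cbox (- One) (One::'a). \<bar>\<phi> (real (Suc n) *\<^sub>R s) - p s\<bar> < inverse (real (Suc n)))" for n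
  proof -
    have "continuous_on (cbox (- One) (One::'a)) (\<lambda>s. \<phi> (real (Suc n) *\<^sub>R s))"
      by (intro continuous_on_compose2[OF \<phi>] continuous_intros) auto
    from Stone_Weierstrass_real_polynomial_function[OF compact_cbox this, of "inverse (real (Suc n))"]
    obtain p where "real_polynomial_function p"
      "\<And>s. s \<in> cbox (- One) (One::'a) \<Longrightarrow> \<bar>\<phi> (real (Suc n) *\<^sub>R s) - p s\<bar> < inverse (real (Suc n))"
      by auto
    then show ?thesis by blast
  qed
  then obtain p where p: "\<And>n. real_polynomial_function (p n)"
    "\<And>n s. s \<in> cbox (- One) (One::'a) \<Longrightarrow> \<bar>\<phi> (real (Suc n) *\<^sub>R s) - p n s\<bar> < inverse (real (Suc n))"
    by metis
  define f where "f n x = p n (sin_map (real (Suc n)) x)" for n x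
  have fb: "\<bar>f n x - \<phi> (real (Suc n) *\<^sub>R sin_map (real (Suc n)) x)\<bar> < inverse (real (Suc n))" for n x
    unfolding f_def using p(2)[OF sin_map_in_cbox, of n "real (Suc n)" x] by (simp add: abs_minus_commute)
  show ?thesis
  proof (rule trig_closure_bounded_limit)
    show "f n \<in> trig_closure M" for n
      unfolding f_def by (intro trig_polys_closure trig_polys_poly_sin_map p)
    show "\<bar>f n x\<bar> \<le> B + 1" for n x
    proof -
      have "inverse (real (Suc n)) \<le> 1" by (simp add: field_simps)
      with fb[of n x] B[of "real (Suc n) *\<^sub>R sin_map (real (Suc n)) x"] show ?thesis by linarith
    qed
    show "\<phi> \<in> borel_measurable borel" by (rule borel_measurable_continuous_onI[OF \<phi>])
    show "(\<lambda>n. f n x) \<longlonglongrightarrow> \<phi> x" for x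
    proof -
      have "(\<lambda>n. \<phi> (real (Suc n) *\<^sub>R sin_map (real (Suc n)) x)) \<longlonglongrightarrow> \<phi> x"
        using \<phi> by (intro isCont_tendsto_compose[OF _ sin_map_tendsto]) (simp add: continuous_on_eq_continuous_at)
      moreover have "(\<lambda>n. f n x - \<phi> (real (Suc n) *\<^sub>R sin_map (real (Suc n)) x)) \<longlonglongrightarrow> 0"
        by (rule Lim_null_comparison[OF _ LIMSEQ_inverse_real_of_nat])
           (rule always_eventually, use fb[of _ x] in \<open>simp only: real_norm_def less_imp_le simp_thms\<close>)
      ultimately have "(\<lambda>n. (f n x - \<phi> (real (Suc n) *\<^sub>R sin_map (real (Suc n)) x))
          + \<phi> (real (Suc n) *\<^sub>R sin_map (real (Suc n)) x)) \<longlonglongrightarrow> 0 + \<phi> x"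
        by (intro tendsto_add)
      then show ?thesis by simp
    qed
  qed
qed

text \<open>The truncated multiples of the distance to the complement are continuous and tend to the
  indicator. The whole space is treated apart, since \<open>infdist\<close> to the empty set is 0
  and would give the wrong limit.\<close>

lemma trig_closure_open:
  assumes "open U" shows "(indicator U :: 'a \<Rightarrow> real) \<in> trig_closure M"
proof (cases "U = UNIV")
  case True
  then show ?thesis using trig_polys_closure[OF trig_polys_const[of 1]] by (simp add: indicator_def)
next
  case False
  define f where "f n x = min 1 (real n * infdist x (- U))" for n x
  show ?thesis
  proof (rule trig_closure_bounded_limit)
    show "f n \<in> trig_closure M" for n
      unfolding f_def
      by (rule trig_closure_continuous[of _ 1]) (auto intro!: continuous_intros simp: infdist_nonneg)
    show "\<bar>f n x\<bar> \<le> 1" for n x by (auto simp: f_def infdist_nonneg)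
    show "indicator U \<in> borel_measurable borel" using assms by simp
    show "(\<lambda>n. f n x) \<longlonglongrightarrow> indicator U x" for x
    proof (cases "x \<in> U")
      case True
      with False assms have d: "0 < infdist x (- U)"
        using in_closed_iff_infdist_zero[of "- U" x] infdist_nonneg[of x "- U"] by (auto simp: less_le)
      then obtain N where N: "1 < real N * infdist x (- U)"
        using reals_Archimedean3[of "infdist x (- U)"] by blast
      have "f n x = 1" if "N \<le> n" for n
      proof -
        have "real N * infdist x (- U) \<le> real n * infdist x (- U)"
          using that d by (intro mult_right_mono) auto
        then show ?thesis using N by (simp add: f_def)
      qed
      then show ?thesis using True
        by (intro tendsto_eventually eventually_sequentiallyI[of N]) auto
    qed (auto simp: f_def)
  qed
qed

text \<open>A Dynkin argument: open sets are a generator stable under intersection, and the closure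
  is stable under complements (subtract from 1) and disjoint unions (bounded limits of partial
  sums).\<close>

lemma trig_closure_indicator:
  assumes "A \<in> sets borel"
  shows "(indicator A :: 'a \<Rightarrow> real) \<in> trig_closure M"
proof -
  have "Int_stable {S::'a set. open S}" by (auto simp: Int_stable_def)
  moreover have "{S::'a set. open S} \<subseteq> Pow UNIV" by auto
  moreover have "A \<in> sigma_sets UNIV {S. open S}" using assms by (simp add: borel_def)
  ultimately show ?thesis
  proof (induction rule: sigma_sets_induct_disjoint)
    case (basic A)
    then show ?case by (auto intro: trig_closure_open)
  next
    case empty
    show ?case by (rule trig_closure_open) simp
  next
    case (compl A)
    have "(\<lambda>x. 1 + (-1) * indicator A x) \<in> trig_closure M"
      by (intro trig_closure_add trig_closure_cmult[OF compl.IH] trig_polys_closure trig_polys_const)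
    moreover have "(\<lambda>x. 1 + (-1) * indicator A x) = (indicator (UNIV - A) :: 'a \<Rightarrow> real)"
      by (auto simp: fun_eq_iff split: split_indicator)
    ultimately show ?case by simp
  next
    case (union A)
    have sb: "A i \<in> sets borel" for i using union(2) by (auto simp: borel_def)
    have eq: "(\<Sum>i<n. indicator (A i) x) = (indicator (\<Union>i<n. A i) x :: real)" for n x
      by (rule indicator_UN_disjoint[symmetric]) (use union(1) in \<open>auto simp: disjoint_family_on_def\<close>)
    show ?case
    proof (rule trig_closure_bounded_limit)
      show "(\<lambda>x. \<Sum>i<n. indicator (A i) x) \<in> trig_closure M" for n
      proof (induction n)
        case 0
        then show ?case using trig_polys_closure[OF trig_polys_const[of 0]] by simp
      next
        case (Suc n)
        then show ?case using union by (auto intro: trig_closure_add)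
      qed
      show "\<bar>\<Sum>i<n. indicator (A i) x\<bar> \<le> (1::real)" for n x
        by (subst eq) (auto split: split_indicator)
      show "indicator (\<Union>i. A i) \<in> borel_measurable borel" using sb by auto
      show "(\<lambda>n. \<Sum>i<n. indicator (A i) x) \<longlonglongrightarrow> (indicator (\<Union>i. A i) x :: real)" for x
        unfolding eq by (rule LIMSEQ_indicator_UN)
    qed
  qed
qed

text \<open>The induction over nonnegative Borel functions carries square integrability as a
  premise, so every constituent has to inherit it: by domination for summands and monotone
  approximants, by dividing by \<open>c\<close> for multiples, whence the separate case
  \<open>c = 0\<close>.\<close>

lemma trig_closure_nonneg:
  assumes "u \<in> borel_measurable borel" "\<And>x. 0 \<le> u x" "u \<in> L2_space M"
  shows "u \<in> trig_closure M"
proof -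
  have dom: "f \<in> L2_space M" if "u \<in> L2_space M" "f \<in> borel_measurable borel" "\<And>x. 0 \<le> f x" "\<And>x. f x \<le> u x" for f u :: "'a \<Rightarrow> real"
  proof (rule L2_norm_mono(1)[OF _ that(1)])
    show "f \<in> borel_measurable M" using that(2) borel_measurable_eq_finite by blast
    show "AE x in M. norm (f x) \<le> norm (u x)"
    proof (rule AE_I2)
      fix x show "norm (f x) \<le> norm (u x)" using that(3,4)[of x] by simp
    qed
  qed
  show ?thesis using assms
  proof (induction rule: borel_measurable_induct_real)
    case (set A)
    then show ?case by (intro trig_closure_indicator) auto
  next
    case (mult u c)
    show ?case
    proof (cases "c = 0")
      case True
      then show ?thesis using trig_polys_closure[OF trig_polys_const[of 0]] by simp
    next
      case False
      have "(\<lambda>x. (1/c) *\<^sub>R (c * u x)) \<in> L2_space M" by (intro L2_space_scaleR mult)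
      then have "u \<in> L2_space M" using False by simp
      then show ?thesis by (intro trig_closure_cmult mult.IH)
    qed
  next
    case (add u v)
    have "u \<in> L2_space M" "v \<in> L2_space M" by (rule dom[OF add.prems]; use add.hyps in simp)+
    then show ?case by (intro trig_closure_add add.IH)
  next
    case (seq U)
    have lim: "(\<lambda>i. U i x) \<longlonglongrightarrow> u x" for x using seq.hyps(4)[of x] by simp
    have "incseq (\<lambda>i. U i x)" for x using \<open>incseq U\<close> by (simp add: incseq_def le_fun_def)
    then have le: "U i x \<le> u x" for i x using lim by (rule incseq_le)
    have U: "U i \<in> L2_space M" for i
      by (rule dom[OF seq.prems]) (use seq.hyps le in blast)+
    show ?case
    proof (rule trig_closure_limit)
      show "U i \<in> trig_closure M" for i using seq.IH U by blast
      have ab: "\<bar>U i x\<bar> \<le> u x" for i x using seq.hyps(2)[of i x] le[of i x] by simp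
      show "(\<lambda>n. L2_norm M (\<lambda>x. U n x - u x)) \<longlonglongrightarrow> 0"
        by (rule L2_norm_dominated_convergence(1)[OF seq.prems L2_space_measurable[OF U] ab
              L2_space_measurable[OF seq.prems] lim])
    qed (rule seq)
  qed
qed

theorem trig_polys_dense:
  assumes u: "u \<in> L2_space M" and e: "0 < e"
  obtains g where "g \<in> trig_polys" "g \<in> L2_space M" "L2_norm M (\<lambda>x. u x - g x) < e"
proof -
  have um: "u \<in> borel_measurable borel" using u by (auto simp: L2_space_def borel_measurable_eq_finite)
  have "(\<lambda>x. max 0 (u x)) \<in> trig_closure M" "(\<lambda>x. max 0 (- u x)) \<in> trig_closure M"
    using um u by (auto intro!: trig_closure_nonneg L2_norm_mono(1)[OF _ u] simp flip: borel_measurable_eq_finite)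
  then have "(\<lambda>x. max 0 (u x) + (-1) * max 0 (- u x)) \<in> trig_closure M"
    by (intro trig_closure_add trig_closure_cmult)
  moreover have "(\<lambda>x. max 0 (u x) + (-1) * max 0 (- u x)) = u" by (auto simp: fun_eq_iff max_def)
  ultimately have "u \<in> trig_closure M" by simp
  from trig_closureD[OF this e] that show ?thesis by blast
qed

end

section \<open>Test functions, weak derivatives and their uniqueness\<close>

subsection \<open>Functions of class \<open>Ck\<close> and test functions\<close>

lemma Ck_SucI:
  assumes "\<And>x. (f has_derivative f' x) (at x)" "\<And>b. b \<in> Basis \<Longrightarrow> Ck k (\<lambda>x. f' x b)"
  shows "Ck (Suc k) f"
proof -
  have "frechet_derivative f (at x) = f' x" for x
    using frechet_derivative_at[OF assms(1)[of x]] by simp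
  with assms show ?thesis by (auto simp: differentiable_def)
qed

lemma Ck_has_derivative:
  "Ck (Suc k) f \<Longrightarrow> (f has_derivative frechet_derivative f (at x)) (at x)"
  by (simp add: frechet_derivative_works[symmetric])

lemma Ck_continuous: "Ck k f \<Longrightarrow> continuous_on UNIV f"
  by (cases k) (auto simp: continuous_on_eq_continuous_within differentiable_imp_continuous_within)

lemma Ck_Suc_imp: "Ck (Suc k) f \<Longrightarrow> Ck k f"
proof (induction k arbitrary: f)
  case 0
  then show ?case using Ck_continuous[of "Suc 0"] by simp
next
  case (Suc k)
  then show ?case by (metis Ck.simps(2))
qed

lemma Ck_const: "Ck k (\<lambda>x. c)"
proof (induction k arbitrary: c)
  case (Suc k)
  show ?case by (rule Ck_SucI[of _ "\<lambda>x h. 0"]) (auto intro: Suc)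
qed simp

lemma Ck_add: "Ck k f \<Longrightarrow> Ck k g \<Longrightarrow> Ck k (\<lambda>x. f x + g x)"
proof (induction k arbitrary: f g)
  case 0
  then show ?case by (auto intro: continuous_intros)
next
  case (Suc k)
  show ?case
    by (rule Ck_SucI, rule has_derivative_add[OF Ck_has_derivative[OF Suc.prems(1)] Ck_has_derivative[OF Suc.prems(2)]])
       (use Suc in auto)
qed

lemma Ck_mult: "Ck k f \<Longrightarrow> Ck k g \<Longrightarrow> Ck k (\<lambda>x. f x * g x)"
proof (induction k arbitrary: f g)
  case 0
  then show ?case by (auto intro: continuous_intros)
next
  case (Suc k)
  show ?case
    by (rule Ck_SucI, rule has_derivative_mult[OF Ck_has_derivative[OF Suc.prems(1)] Ck_has_derivative[OF Suc.prems(2)]])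
       (use Suc Ck_Suc_imp[OF Suc.prems(1)] Ck_Suc_imp[OF Suc.prems(2)] in \<open>auto intro!: Ck_add Suc.IH\<close>)
qed

lemma Ck_prod: "(\<And>i. i \<in> I \<Longrightarrow> Ck k (f i)) \<Longrightarrow> Ck k (\<lambda>x. \<Prod>i\<in>I. f i x)"
  by (induction I rule: infinite_finite_induct) (auto intro: Ck_mult Ck_const)

text \<open>A whole chain of derivatives \<open>D n\<close> is carried along, because
  differentiating trades one order of smoothness for one index; the chain rule otherwise changes
  only the constant \<open>c\<close>, over which the induction generalises.\<close>

lemma Ck_comp_inner:
  assumes "\<And>n x. (D n has_real_derivative D (Suc n) x) (at x)"
  shows "Ck k (\<lambda>x. c * D n (v \<bullet> x + a))"
proof (induction k arbitrary: n c)
  case 0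
  have c: "continuous_on UNIV (D n)"
    using DERIV_isCont[OF assms] by (simp add: continuous_on_eq_continuous_at)
  have "continuous_on UNIV (\<lambda>x. D n (v \<bullet> x + a))"
    by (rule continuous_on_compose2[OF c]) (auto intro!: continuous_intros)
  then show ?case by (simp add: continuous_on_mult_left)
next
  case (Suc k)
  show ?case
  proof (rule Ck_SucI)
    show "((\<lambda>x. c * D n (v \<bullet> x + a)) has_derivative (\<lambda>h. (c * (v \<bullet> h)) * D (Suc n) (v \<bullet> x + a))) (at x)" for x
    proof -
      have *: "(D n has_derivative (\<lambda>h. D (Suc n) (v \<bullet> x + a) * h)) (at (v \<bullet> x + a))"
        using assms by (simp add: has_field_derivative_def)
      have "((\<lambda>x. v \<bullet> x + a) has_derivative (\<lambda>h. v \<bullet> h)) (at x)"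
        by (auto intro!: derivative_eq_intros)
      from has_derivative_compose[OF this *]
      have "((\<lambda>x. D n (v \<bullet> x + a)) has_derivative (\<lambda>h. D (Suc n) (v \<bullet> x + a) * (v \<bullet> h))) (at x)" .
      from has_derivative_mult_right[OF this, of c] show ?thesis by (simp add: algebra_simps)
    qed
  qed (rule Suc)
qed

text \<open>Spatial derivatives of a translated slice are translated slices of spatial derivatives,
  so the induction never leaves this form. Slices are the test functions on space that a test
  function on space-time provides.\<close>

lemma Ck_slice:
  fixes \<psi> :: "real \<times> 'a::euclidean_space \<Rightarrow> real"
  shows "Ck k \<psi> \<Longrightarrow> Ck k (\<lambda>x. \<psi> (t, x - y))"
    and slice_has_derivative: "Ck (Suc k) \<psi> \<Longrightarrow>
      ((\<lambda>x. \<psi> (t, x - y)) has_derivative (\<lambda>h. frechet_derivative \<psi> (at (t, x - y)) (0, h))) (at x)"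
proof -
  show der: "((\<lambda>x. \<psi> (t, x - y)) has_derivative (\<lambda>h. frechet_derivative \<psi> (at (t, x - y)) (0, h))) (at x)"
    if "Ck (Suc k) \<psi>" for k \<psi> and x
  proof -
    have "((\<lambda>x. (t, x - y)) has_derivative (\<lambda>h. (0, h))) (at x)"
      by (auto intro!: derivative_eq_intros)
    from has_derivative_compose[OF this Ck_has_derivative[OF that]] show ?thesis .
  qed
  show "Ck k \<psi> \<Longrightarrow> Ck k (\<lambda>x. \<psi> (t, x - y))"
  proof (induction k arbitrary: \<psi>)
    case 0
    then show ?case by (auto intro!: continuous_on_compose2[of UNIV \<psi>] continuous_intros)
  next
    case (Suc k)
    show ?case
    proof (rule Ck_SucI[OF der[OF Suc.prems]])
      fix b :: 'a assume "b \<in> Basis"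
      then have "(0, b) \<in> (Basis :: (real \<times> 'a) set)" by (auto simp: Basis_prod_def)
      then have "Ck k (\<lambda>p. frechet_derivative \<psi> (at p) (0, b))" using Suc.prems by simp
      from Suc.IH[OF this] show "Ck k (\<lambda>x. frechet_derivative \<psi> (at (t, x - y)) (0, b))" .
    qed
  qed
qed

lemma Ck_directional:
  assumes "Ck (Suc k) f"
  shows "((\<lambda>s. f (y + s *\<^sub>R b)) has_real_derivative frechet_derivative f (at (y + s *\<^sub>R b)) b) (at s)"
proof -
  have "((\<lambda>s. y + s *\<^sub>R b) has_derivative (\<lambda>h. h *\<^sub>R b)) (at s)"
    by (auto intro!: derivative_eq_intros)
  from has_derivative_compose[OF this Ck_has_derivative[OF assms]]
  have "((\<lambda>s. f (y + s *\<^sub>R b)) has_derivative (\<lambda>h. frechet_derivative f (at (y + s *\<^sub>R b)) (h *\<^sub>R b))) (at s)" .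
  moreover have "frechet_derivative f (at (y + s *\<^sub>R b)) (h *\<^sub>R b) = frechet_derivative f (at (y + s *\<^sub>R b)) b * h" for h
  proof -
    have "linear (frechet_derivative f (at (y + s *\<^sub>R b)))"
      using assms by (intro linear_frechet_derivative) simp
    then show ?thesis by (simp add: linear_cmul mult.commute)
  qed
  ultimately show ?thesis by (simp add: has_field_derivative_def)
qed

text \<open>Schwarz's theorem: both mixed derivatives are limits of the same second difference quotient.\<close>

lemma Ck_second_difference:
  assumes f: "Ck (Suc (Suc k)) f" and b: "b \<in> Basis" and s: "0 < s"
  shows "\<exists>\<xi> \<eta>. 0 < \<xi> \<and> \<xi> < s \<and> 0 < \<eta> \<and> \<eta> < s \<and>
    f (x + s *\<^sub>R b + s *\<^sub>R c) - f (x + s *\<^sub>R b) - f (x + s *\<^sub>R c) + f x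
    = s * s * frechet_derivative (\<lambda>y. frechet_derivative f (at y) b) (at (x + \<xi> *\<^sub>R b + \<eta> *\<^sub>R c)) c"
proof -
  define D where "D y = frechet_derivative f (at y) b" for y
  have D: "Ck (Suc k) D" unfolding D_def using f b by simp
  \<comment> \<open>The mean value theorem is used twice: for the increment in direction
    \<open>c\<close>, regarded as a function of the step in direction \<open>b\<close>, and then for
    the resulting first derivative in direction \<open>c\<close>.\<close>
  define g where "g r = f (x + s *\<^sub>R c + r *\<^sub>R b) - f (x + r *\<^sub>R b)" for r
  have g: "(g has_real_derivative D (x + s *\<^sub>R c + r *\<^sub>R b) - D (x + r *\<^sub>R b)) (at r)" for r
    unfolding g_def D_def by (intro DERIV_diff Ck_directional[OF f])
  obtain \<xi> where \<xi>: "0 < \<xi>" "\<xi> < s" "g s - g 0 = (s - 0) * (D (x + s *\<^sub>R c + \<xi> *\<^sub>R b) - D (x + \<xi> *\<^sub>R b))"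
    using MVT2[OF s, of g "\<lambda>r. D (x + s *\<^sub>R c + r *\<^sub>R b) - D (x + r *\<^sub>R b)"] g by auto
  define h where "h r = D (x + \<xi> *\<^sub>R b + r *\<^sub>R c)" for r
  have h: "(h has_real_derivative frechet_derivative D (at (x + \<xi> *\<^sub>R b + r *\<^sub>R c)) c) (at r)" for r
    unfolding h_def by (intro Ck_directional[OF D])
  obtain \<eta> where \<eta>: "0 < \<eta>" "\<eta> < s" "h s - h 0 = (s - 0) * frechet_derivative D (at (x + \<xi> *\<^sub>R b + \<eta> *\<^sub>R c)) c"
    using MVT2[OF s, of h "\<lambda>r. frechet_derivative D (at (x + \<xi> *\<^sub>R b + r *\<^sub>R c)) c"] h by auto
  have "f (x + s *\<^sub>R b + s *\<^sub>R c) - f (x + s *\<^sub>R b) - f (x + s *\<^sub>R c) + f x = g s - g 0"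
    by (simp add: g_def algebra_simps)
  also have "\<dots> = s * (h s - h 0)" using \<xi>(3) by (simp add: h_def algebra_simps)
  also have "\<dots> = s * s * frechet_derivative D (at (x + \<xi> *\<^sub>R b + \<eta> *\<^sub>R c)) c"
    using \<eta>(3) by simp
  finally show ?thesis using \<xi> \<eta> unfolding D_def by blast
qed

lemma Ck_mixed_derivatives:
  assumes f: "Ck (Suc (Suc k)) f" and b: "b \<in> Basis" and c: "c \<in> Basis"
  shows "frechet_derivative (\<lambda>y. frechet_derivative f (at y) b) (at x) c
    = frechet_derivative (\<lambda>y. frechet_derivative f (at y) c) (at x) b"
proof -
  define G where "G y = frechet_derivative (\<lambda>y. frechet_derivative f (at y) b) (at y) c" for y
  define H where "H y = frechet_derivative (\<lambda>y. frechet_derivative f (at y) c) (at y) b" for y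
  have "Ck k G" "Ck k H" unfolding G_def H_def using f b c by simp_all
  then have contG: "isCont G x" and contH: "isCont H x"
    using Ck_continuous by (auto simp: continuous_on_eq_continuous_at)
  define s where "s n = inverse (real (Suc n))" for n
  have s0: "0 < s n" for n by (simp add: s_def)
  have "\<exists>\<xi> \<eta> \<xi>' \<eta>'. 0 < \<xi> \<and> \<xi> < s n \<and> 0 < \<eta> \<and> \<eta> < s n \<and> 0 < \<xi>' \<and> \<xi>' < s n \<and> 0 < \<eta>' \<and> \<eta>' < s n
      \<and> G (x + \<xi> *\<^sub>R b + \<eta> *\<^sub>R c) = H (x + \<xi>' *\<^sub>R c + \<eta>' *\<^sub>R b)" for n
  proof -
    obtain \<xi> \<eta> where 1: "0 < \<xi>" "\<xi> < s n" "0 < \<eta>" "\<eta> < s n"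
      "f (x + s n *\<^sub>R b + s n *\<^sub>R c) - f (x + s n *\<^sub>R b) - f (x + s n *\<^sub>R c) + f x
        = s n * s n * G (x + \<xi> *\<^sub>R b + \<eta> *\<^sub>R c)"
      using Ck_second_difference[OF f b s0[of n], of x c] unfolding G_def by blast
    obtain \<xi>' \<eta>' where 2: "0 < \<xi>'" "\<xi>' < s n" "0 < \<eta>'" "\<eta>' < s n"
      "f (x + s n *\<^sub>R c + s n *\<^sub>R b) - f (x + s n *\<^sub>R c) - f (x + s n *\<^sub>R b) + f x
        = s n * s n * H (x + \<xi>' *\<^sub>R c + \<eta>' *\<^sub>R b)"
      using Ck_second_difference[OF f c s0[of n], of x b] unfolding H_def by blast
    have "s n * s n * G (x + \<xi> *\<^sub>R b + \<eta> *\<^sub>R c) = s n * s n * H (x + \<xi>' *\<^sub>R c + \<eta>' *\<^sub>R b)"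
      unfolding 1(5)[symmetric] 2(5)[symmetric] by (simp add: algebra_simps)
    then have "G (x + \<xi> *\<^sub>R b + \<eta> *\<^sub>R c) = H (x + \<xi>' *\<^sub>R c + \<eta>' *\<^sub>R b)" using s0[of n] by simp
    with 1(1-4) 2(1-4) show ?thesis by blast
  qed
  then obtain \<xi> \<eta> \<xi>' \<eta>' where b: "\<And>n. 0 < \<xi> n \<and> \<xi> n < s n \<and> 0 < \<eta> n \<and> \<eta> n < s n \<and> 0 < \<xi>' n \<and> \<xi>' n < s n \<and> 0 < \<eta>' n \<and> \<eta>' n < s n
      \<and> G (x + \<xi> n *\<^sub>R b + \<eta> n *\<^sub>R c) = H (x + \<xi>' n *\<^sub>R c + \<eta>' n *\<^sub>R b)"
    by metis
  have s: "s \<longlonglongrightarrow> 0" unfolding s_def by (rule LIMSEQ_inverse_real_of_nat)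
  have lims: "\<xi> \<longlonglongrightarrow> 0" "\<eta> \<longlonglongrightarrow> 0" "\<xi>' \<longlonglongrightarrow> 0" "\<eta>' \<longlonglongrightarrow> 0"
    using b by (auto intro!: tendsto_sandwich[OF always_eventually always_eventually tendsto_const s] simp: less_imp_le)
  have "(\<lambda>n. x + \<xi> n *\<^sub>R b + \<eta> n *\<^sub>R c) \<longlonglongrightarrow> x + 0 *\<^sub>R b + 0 *\<^sub>R c"
    by (intro tendsto_intros lims)
  then have G: "(\<lambda>n. G (x + \<xi> n *\<^sub>R b + \<eta> n *\<^sub>R c)) \<longlonglongrightarrow> G x"
    by (intro isCont_tendsto_compose[OF contG]) simp
  have "(\<lambda>n. x + \<xi>' n *\<^sub>R c + \<eta>' n *\<^sub>R b) \<longlonglongrightarrow> x + 0 *\<^sub>R c + 0 *\<^sub>R b"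
    by (intro tendsto_intros lims)
  then have "(\<lambda>n. H (x + \<xi>' n *\<^sub>R c + \<eta>' n *\<^sub>R b)) \<longlonglongrightarrow> H x"
    by (intro isCont_tendsto_compose[OF contH]) simp
  with b have "(\<lambda>n. G (x + \<xi> n *\<^sub>R b + \<eta> n *\<^sub>R c)) \<longlonglongrightarrow> H x" by simp
  from LIMSEQ_unique[OF G this] show ?thesis by (simp add: G_def H_def)
qed

lemma test_functions_Ck: "\<psi> \<in> test_functions \<Omega> \<Longrightarrow> Ck k \<psi>"
  by (simp add: test_functions_def)

lemma test_functions_continuous: "\<psi> \<in> test_functions \<Omega> \<Longrightarrow> continuous_on UNIV \<psi>"
  using Ck_continuous[OF test_functions_Ck] .

lemma test_functions_measurable: "\<psi> \<in> test_functions \<Omega> \<Longrightarrow> \<psi> \<in> borel_measurable borel"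
  by (intro borel_measurable_continuous_onI test_functions_continuous)

definition supp :: "('a::euclidean_space \<Rightarrow> real) \<Rightarrow> 'a set" where
  "supp \<psi> = closure {x. \<psi> x \<noteq> 0}"

lemma test_functions_supp:
  assumes "\<psi> \<in> test_functions \<Omega>"
  shows "compact (supp \<psi>)" "supp \<psi> \<subseteq> \<Omega>"
  using assms by (auto simp: test_functions_def supp_def)

lemma not_in_supp: "x \<notin> supp \<psi> \<Longrightarrow> \<psi> x = 0"
  using closure_subset[of "{x. \<psi> x \<noteq> 0}"] by (auto simp: supp_def)

lemma test_functions_deriv_zero:
  assumes "\<psi> \<in> test_functions \<Omega>" "x \<notin> supp \<psi>"
  shows "frechet_derivative \<psi> (at x) b = 0"
proof -
  have "frechet_derivative \<psi> (at x) = frechet_derivative (\<lambda>x. 0) (at x)"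
  proof (rule frechet_derivative_transform_within_open[of _ _ "- supp \<psi>"])
    show "\<psi> differentiable (at x)" using test_functions_Ck[OF assms(1), of "Suc 0"] by simp
    show "open (- supp \<psi>)" by (simp add: supp_def open_Compl)
  qed (use assms not_in_supp in auto)
  then show ?thesis by simp
qed

lemma test_functions_deriv:
  assumes \<psi>: "\<psi> \<in> test_functions \<Omega>" and b: "b \<in> Basis"
  shows "(\<lambda>x. frechet_derivative \<psi> (at x) b) \<in> test_functions \<Omega>"
proof -
  let ?D = "\<lambda>x. frechet_derivative \<psi> (at x) b"
  have "{x. ?D x \<noteq> 0} \<subseteq> supp \<psi>" using test_functions_deriv_zero[OF \<psi>] by blast
  then have sub: "closure {x. ?D x \<noteq> 0} \<subseteq> supp \<psi>"
    by (rule closure_minimal) (simp add: supp_def)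
  then have "closure {x. ?D x \<noteq> 0} = supp \<psi> \<inter> closure {x. ?D x \<noteq> 0}" by blast
  then have "compact (closure {x. ?D x \<noteq> 0})"
    using compact_Int_closed[OF test_functions_supp(1)[OF \<psi>] closed_closure] by metis
  moreover have "Ck k ?D" for k using test_functions_Ck[OF \<psi>, of "Suc k"] b by simp
  ultimately show ?thesis
    using sub test_functions_supp[OF \<psi>] by (auto simp: test_functions_def)
qed

lemma compact_support_bounded:
  fixes f :: "'a::euclidean_space \<Rightarrow> real"
  assumes "continuous_on UNIV f" "compact C" "\<And>x. x \<notin> C \<Longrightarrow> f x = 0"
  obtains B where "0 \<le> B" "\<And>x. \<bar>f x\<bar> \<le> B"
proof -
  have "compact (f ` C)" using assms by (intro compact_continuous_image continuous_on_subset[OF assms(1)]) auto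
  then have "bounded (f ` C)" by (rule compact_imp_bounded)
  then obtain B where B: "\<And>x. x \<in> C \<Longrightarrow> norm (f x) \<le> B" unfolding bounded_iff by blast
  have "\<bar>f x\<bar> \<le> max 0 B" for x using B[of x] assms(3)[of x] by (cases "x \<in> C") auto
  with that[of "max 0 B"] show ?thesis by auto
qed

lemma test_functions_bounded:
  assumes "\<psi> \<in> test_functions \<Omega>"
  obtains B where "0 \<le> B" "\<And>x. \<bar>\<psi> x\<bar> \<le> B"
  using compact_support_bounded[OF test_functions_continuous[OF assms] test_functions_supp(1)[OF assms]
      not_in_supp[of _ \<psi>]] by blast

lemma test_functions_slice:
  fixes \<psi> :: "real \<times> 'a::euclidean_space \<Rightarrow> real"
  assumes \<psi>: "\<psi> \<in> test_functions \<Omega>"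
  shows "(\<lambda>x. \<psi> (t, x - y)) \<in> test_functions UNIV"
proof -
  let ?S = "{x. \<psi> (t, x - y) \<noteq> 0}"
  have "?S \<subseteq> (\<lambda>p. snd p + y) ` supp \<psi>"
  proof
    fix x assume "x \<in> ?S"
    then have "(t, x - y) \<in> supp \<psi>" using not_in_supp[of "(t, x - y)" \<psi>] by auto
    then show "x \<in> (\<lambda>p. snd p + y) ` supp \<psi>" by (rule rev_image_eqI) simp
  qed
  moreover have "compact ((\<lambda>p. snd p + y) ` supp \<psi>)"
    by (intro compact_continuous_image continuous_intros test_functions_supp[OF \<psi>])
  ultimately have "bounded ?S" using compact_imp_bounded bounded_subset by blast
  then have "compact (closure ?S)" by (simp add: compact_closure)
  moreover have "Ck k (\<lambda>x. \<psi> (t, x - y))" for k by (intro Ck_slice test_functions_Ck[OF \<psi>])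
  ultimately show ?thesis by (auto simp: test_functions_def)
qed

subsection \<open>Smooth bump functions\<close>

text \<open>The n-th derivative of \<open>exp (- 1/x)\<close> for positive x is
  \<open>p (1/x) * exp (- 1/x)\<close> with a polynomial p. With \<open>u = 1/x\<close> one has
  \<open>d/dx = - u^2 d/du\<close>, which turns p into \<open>u^2 * (p - p')\<close>.\<close>

primrec bump_poly :: "nat \<Rightarrow> real poly" where
  "bump_poly 0 = 1"
| "bump_poly (Suc n) = monom 1 2 * (bump_poly n - pderiv (bump_poly n))"

definition bump_deriv :: "nat \<Rightarrow> real \<Rightarrow> real" where
  "bump_deriv n x = (if 0 < x then poly (bump_poly n) (1 / x) * exp (- (1 / x)) else 0)"

lemma poly_times_exp_minus_tendsto_0: "((\<lambda>x. poly p x * exp (- x)) \<longlongrightarrow> (0::real)) at_top"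
proof -
  have "((\<lambda>x. \<Sum>i\<le>degree p. coeff p i * (x ^ i / exp x)) \<longlongrightarrow> (\<Sum>i\<le>degree p. coeff p i * 0)) at_top"
    by (intro tendsto_intros tendsto_power_div_exp_0)
  then show ?thesis by (simp add: poly_altdef exp_minus sum_distrib_right divide_inverse mult.assoc)
qed

lemma bump_deriv_has_derivative: "(bump_deriv n has_real_derivative bump_deriv (Suc n) x) (at x)"
proof (cases x "0::real" rule: linorder_cases)
  case less
  have "((\<lambda>x. 0) has_real_derivative 0) (at x)" by simp
  then show ?thesis using less
    by (subst DERIV_cong_ev[OF refl _ refl, of _ "\<lambda>x. 0"])
       (auto simp: bump_deriv_def eventually_nhds intro!: exI[of _ "{..<0}"])
next
  case greater
  have "((\<lambda>x. poly (bump_poly n) (1 / x) * exp (- (1 / x))) has_real_derivative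
      bump_deriv (Suc n) x) (at x)"
    using greater
    by (auto intro!: derivative_eq_intros DERIV_chain2[OF poly_DERIV]
        simp: bump_deriv_def poly_monom field_simps power2_eq_square)
  then show ?thesis using greater
    by (subst DERIV_cong_ev[OF refl _ refl, of _ "\<lambda>x. poly (bump_poly n) (1 / x) * exp (- (1 / x))"])
       (auto simp: bump_deriv_def eventually_nhds intro!: exI[of _ "{0<..}"])
next
  case equal
  \<comment> \<open>At the origin the difference quotient from the right is
    \<open>u * p(u) * exp (- u)\<close> with \<open>u = 1/h\<close>; \<open>pCons 0\<close> supplies
    the additional factor \<open>u\<close>.\<close>
  have "((\<lambda>x. poly (pCons 0 (bump_poly n)) x * exp (- x)) \<longlongrightarrow> 0) at_top"
    by (rule poly_times_exp_minus_tendsto_0)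
  then have "((\<lambda>x. poly (pCons 0 (bump_poly n)) (inverse x) * exp (- inverse x)) \<longlongrightarrow> 0) (at_right 0)"
    by (rule filterlim_compose[OF _ filterlim_inverse_at_top_right])
  moreover have "\<forall>\<^sub>F h in at_right 0. poly (pCons 0 (bump_poly n)) (inverse h) * exp (- inverse h) = bump_deriv n h / h"
    by (rule eventually_at_rightI[of _ 1]) (auto simp: bump_deriv_def field_simps)
  ultimately have R: "((\<lambda>h. bump_deriv n h / h) \<longlongrightarrow> 0) (at_right 0)"
    by (rule Lim_transform_eventually)
  have L: "((\<lambda>h. bump_deriv n h / h) \<longlongrightarrow> 0) (at_left 0)"
  proof (rule tendsto_eventually)
    show "\<forall>\<^sub>F h in at_left 0. bump_deriv n h / h = 0"
      by (rule eventually_at_leftI[of "-1"]) (auto simp: bump_deriv_def)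
  qed
  have "((\<lambda>h. bump_deriv n h / h) \<longlongrightarrow> 0) (at 0)" using L R by (simp add: filterlim_split_at)
  then show ?thesis using equal by (simp add: has_field_derivative_iff bump_deriv_def)
qed

text \<open>A product of one-sided bumps, one for each face of the box. Scaling by
  \<open>Suc m\<close> drives every factor to 1 inside the box, so these test functions tend
  boundedly to the indicator while their supports stay in the same closed box.\<close>

definition bump :: "nat \<Rightarrow> 'a::euclidean_space \<Rightarrow> 'a \<Rightarrow> 'a \<Rightarrow> real" where
  "bump m a c x = (\<Prod>b\<in>Basis. bump_deriv 0 (real (Suc m) * (x \<bullet> b - a \<bullet> b)) * bump_deriv 0 (real (Suc m) * (c \<bullet> b - x \<bullet> b)))"

lemma Ck_bump: "Ck k (bump m a c)"
proof -
  have "Ck k (\<lambda>x. (1 * bump_deriv 0 ((real (Suc m) *\<^sub>R b) \<bullet> x + (- real (Suc m) * (a \<bullet> b))))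
      * (1 * bump_deriv 0 ((- real (Suc m) *\<^sub>R b) \<bullet> x + (real (Suc m) * (c \<bullet> b)))))" for b
    by (intro Ck_mult Ck_comp_inner bump_deriv_has_derivative)
  then have "Ck k (\<lambda>x. \<Prod>b\<in>Basis. (1 * bump_deriv 0 ((real (Suc m) *\<^sub>R b) \<bullet> x + (- real (Suc m) * (a \<bullet> b))))
      * (1 * bump_deriv 0 ((- real (Suc m) *\<^sub>R b) \<bullet> x + (real (Suc m) * (c \<bullet> b)))))"
    by (intro Ck_prod)
  moreover have "(\<lambda>x. \<Prod>b\<in>Basis. (1 * bump_deriv 0 ((real (Suc m) *\<^sub>R b) \<bullet> x + (- real (Suc m) * (a \<bullet> b))))
      * (1 * bump_deriv 0 ((- real (Suc m) *\<^sub>R b) \<bullet> x + (real (Suc m) * (c \<bullet> b))))) = bump m a c"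
    by (simp add: bump_def fun_eq_iff inner_commute right_diff_distrib algebra_simps)
  ultimately show ?thesis by simp
qed

lemma bump_deriv_0_bounds: "0 \<le> bump_deriv 0 x" "bump_deriv 0 x \<le> 1"
  by (auto simp: bump_deriv_def)

lemma bump_bounds: "0 \<le> bump m a c x" "bump m a c x \<le> 1"
proof -
  show "0 \<le> bump m a c x" unfolding bump_def by (intro prod_nonneg mult_nonneg_nonneg bump_deriv_0_bounds ballI)
  show "bump m a c x \<le> 1" unfolding bump_def
    by (intro prod_le_1 mult_nonneg_nonneg mult_le_one conjI bump_deriv_0_bounds)
qed

lemma bump_zero:
  assumes "x \<notin> box a c" shows "bump m a c x = 0"
proof -
  from assms obtain b where b: "b \<in> Basis" "x \<bullet> b \<le> a \<bullet> b \<or> c \<bullet> b \<le> x \<bullet> b"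
    by (force simp: mem_box not_less)
  have "bump_deriv 0 (real (Suc m) * (x \<bullet> b - a \<bullet> b)) * bump_deriv 0 (real (Suc m) * (c \<bullet> b - x \<bullet> b)) = 0"
    using b(2)
  proof
    assume "x \<bullet> b \<le> a \<bullet> b"
    then have "real (Suc m) * (x \<bullet> b - a \<bullet> b) \<le> 0" by (intro mult_nonneg_nonpos) auto
    then show ?thesis by (simp add: bump_deriv_def)
  next
    assume "c \<bullet> b \<le> x \<bullet> b"
    then have "real (Suc m) * (c \<bullet> b - x \<bullet> b) \<le> 0" by (intro mult_nonneg_nonpos) auto
    then show ?thesis by (simp add: bump_deriv_def)
  qed
  with b(1) show ?thesis unfolding bump_def by (intro prod_zero) auto
qed

lemma bump_test_function:
  assumes "cbox a c \<subseteq> \<Omega>" shows "bump m a c \<in> test_functions \<Omega>"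
proof -
  have sub: "closure {x. bump m a c x \<noteq> 0} \<subseteq> cbox a c"
    using bump_zero[of _ a c m] box_subset_cbox[of a c] by (intro closure_minimal) auto
  then have "bounded {x. bump m a c x \<noteq> 0}"
    using bounded_subset[OF bounded_cbox, of _ a c] closure_subset by blast
  then show ?thesis using sub assms Ck_bump by (auto simp: test_functions_def compact_closure)
qed

lemma bump_tendsto: "(\<lambda>m. bump m a c x) \<longlonglongrightarrow> indicator (box a c) x"
proof (cases "x \<in> box a c")
  case True
  have *: "(\<lambda>m. bump_deriv 0 (real (Suc m) * s)) \<longlonglongrightarrow> 1" if "0 < s" for s
  proof -
    have "(\<lambda>m. exp (- (1 / (real (Suc m) * s)))) \<longlonglongrightarrow> 1" using that by real_asymp
    then show ?thesis using that by (simp add: bump_deriv_def zero_less_mult_iff)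
  qed
  have "(\<lambda>m. bump m a c x) \<longlonglongrightarrow> (\<Prod>b\<in>(Basis::'a set). 1 * 1)"
    unfolding bump_def using True by (intro tendsto_intros *) (auto simp: mem_box)
  then show ?thesis using True by simp
qed (simp add: bump_zero)

subsection \<open>Weak derivatives\<close>

lemma lborel_integral_shift:
  fixes f :: "'a::euclidean_space \<Rightarrow> real"
  assumes [measurable]: "f \<in> borel_measurable borel"
  shows "(LINT y|lborel. f (v + y)) = (LINT y|lborel. f y)"
    and "integrable lborel f \<Longrightarrow> integrable lborel (\<lambda>y. f (v + y))"
proof -
  have "lborel = distr lborel borel (\<lambda>y. v + y)" by (rule lborel_distr_plus[symmetric])
  then have "(LINT y|lborel. f y) = (LINT y|distr lborel borel (\<lambda>y. v + y). f y)"
    and i: "integrable lborel f \<longleftrightarrow> integrable (distr lborel borel (\<lambda>y. v + y)) f" by simp_all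
  then show "(LINT y|lborel. f (v + y)) = (LINT y|lborel. f y)" by (simp add: integral_distr)
  show "integrable lborel f \<Longrightarrow> integrable lborel (\<lambda>y. f (v + y))"
    using i by (simp add: integrable_distr_eq)
qed

lemma integrable_compact_support:
  fixes f :: "'a::euclidean_space \<Rightarrow> real"
  assumes "continuous_on UNIV f" "compact C" "\<And>x. x \<notin> C \<Longrightarrow> f x = 0"
  shows "integrable lborel f"
proof -
  have "integrable lborel (\<lambda>x. indicator C x *\<^sub>R f x)"
    using assms(2) by (rule borel_integrable_compact) (rule continuous_on_subset[OF assms(1) subset_UNIV])
  moreover have "(\<lambda>x. indicator C x *\<^sub>R f x) = f"
    using assms(3) by (auto simp: fun_eq_iff split: split_indicator)
  ultimately show ?thesis by simp
qed

text \<open>The integral of a difference quotient vanishes by translation invariance.\<close>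

lemma integral_directional_derivative_eq_0:
  fixes \<Phi> \<Phi>' :: "'a::euclidean_space \<Rightarrow> real"
  assumes cont: "continuous_on UNIV \<Phi>" "continuous_on UNIV \<Phi>'"
    and der: "\<And>y s. ((\<lambda>s. \<Phi> (y + s *\<^sub>R b)) has_real_derivative \<Phi>' (y + s *\<^sub>R b)) (at s)"
    and C: "compact C" "\<And>y. y \<notin> C \<Longrightarrow> \<Phi> y = 0" "\<And>y. y \<notin> C \<Longrightarrow> \<Phi>' y = 0"
  shows "(LINT y|lborel. \<Phi>' y) = 0"
proof -
  obtain B where B: "0 \<le> B" "\<And>y. \<bar>\<Phi>' y\<bar> \<le> B"
    using compact_support_bounded[OF cont(2) C(1) C(3)] by blast
  have [measurable]: "\<Phi> \<in> borel_measurable borel" "\<Phi>' \<in> borel_measurable borel"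
    using cont by (auto intro: borel_measurable_continuous_onI)
  define s where "s n = inverse (real (Suc n))" for n
  have s: "0 < s n" "s n \<le> 1" for n by (auto simp: s_def field_simps)
  define q where "q n y = (\<Phi> (s n *\<^sub>R b + y) - \<Phi> y) / s n" for n y
  have int\<Phi>: "integrable lborel \<Phi>" by (rule integrable_compact_support[OF cont(1) C(1,2)])
  have q0: "(LINT y|lborel. q n y) = 0" for n
    unfolding q_def using int\<Phi> lborel_integral_shift(2)[OF _ int\<Phi>] lborel_integral_shift(1)[of \<Phi>]
    by simp
  \<comment> \<open>All step lengths are at most 1, so the difference quotients vanish outside this
    compact set. Together with the bound on \<open>\<Phi>'\<close> from the mean value theorem it
    provides the integrable majorant.\<close>
  define C' where "C' = (\<lambda>(c, r). c - r *\<^sub>R b) ` (C \<times> {0..1})"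
  have cC': "compact C'" unfolding C'_def case_prod_unfold
    by (intro compact_continuous_image continuous_intros compact_Times C compact_Icc)
  have qB: "\<bar>q n y\<bar> \<le> B * indicator C' y" for n y
  proof (cases "y \<in> C'")
    case True
    obtain \<xi> where "\<Phi> (y + s n *\<^sub>R b) - \<Phi> (y + 0 *\<^sub>R b) = (s n - 0) * \<Phi>' (y + \<xi> *\<^sub>R b)"
      using MVT2[OF s(1)[of n], of "\<lambda>r. \<Phi> (y + r *\<^sub>R b)" "\<lambda>r. \<Phi>' (y + r *\<^sub>R b)"] der by blast
    then have "q n y = \<Phi>' (y + \<xi> *\<^sub>R b)" using s(1)[of n] by (simp add: q_def add.commute)
    then show ?thesis using B True by simp
  next
    case False
    have "y \<notin> C" using False unfolding C'_def by (auto intro: rev_image_eqI[of "(y, 0)"])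
    moreover have "s n *\<^sub>R b + y \<notin> C"
    proof
      assume "s n *\<^sub>R b + y \<in> C"
      then have "y \<in> C'" unfolding C'_def using s[of n]
        by (intro rev_image_eqI[of "(s n *\<^sub>R b + y, s n)"]) auto
      with False show False by simp
    qed
    ultimately show ?thesis using C(2) False by (simp add: q_def)
  qed
  have "(\<lambda>n. LINT y|lborel. q n y) \<longlonglongrightarrow> (LINT y|lborel. \<Phi>' y)"
  proof (rule integral_dominated_convergence[where w = "\<lambda>y. B * indicator C' y"])
    show "integrable lborel (\<lambda>y. B * indicator C' y :: real)"
      using cC' by (intro integrable_mult_right integrable_real_indicator)
        (use emeasure_compact_finite[OF cC'] in \<open>auto simp: compact_imp_closed\<close>)
    show "AE y in lborel. (\<lambda>n. q n y) \<longlonglongrightarrow> \<Phi>' y"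
    proof (rule AE_I2)
      fix y
      have "((\<lambda>h. (\<Phi> (y + h *\<^sub>R b) - \<Phi> y) / h) \<longlongrightarrow> \<Phi>' y) (at 0)"
        using der[of y 0] by (simp add: has_field_derivative_iff)
      moreover have "filterlim s (at 0) sequentially"
      proof (unfold filterlim_at, intro conjI always_eventually allI)
        show "s \<longlonglongrightarrow> 0" unfolding s_def by (rule LIMSEQ_inverse_real_of_nat)
      qed (use less_imp_neq[OF s(1)] in auto)
      ultimately have "(\<lambda>n. (\<Phi> (y + s n *\<^sub>R b) - \<Phi> y) / s n) \<longlonglongrightarrow> \<Phi>' y"
        by (rule filterlim_compose)
      then show "(\<lambda>n. q n y) \<longlonglongrightarrow> \<Phi>' y" by (simp add: q_def add.commute)
    qed
    show "AE y in lborel. norm (q n y) \<le> B * indicator C' y" for n using qB by simp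
    show "q n \<in> borel_measurable lborel" for n unfolding q_def by measurable
  qed simp
  then show ?thesis using q0 by (simp add: LIMSEQ_const_iff)
qed

lemma locally_integrable_continuous:
  assumes "continuous_on UNIV f" shows "locally_integrable \<Omega> f"
  unfolding locally_integrable_def set_integrable_def
  by (intro allI impI borel_integrable_compact continuous_on_subset[OF assms]) auto

lemma test_integrable:
  assumes "locally_integrable \<Omega> v" and \<psi>: "\<psi> \<in> test_functions \<Omega>"
  shows "integrable lborel (\<lambda>y. indicator \<Omega> y * (v y * \<psi> y))"
proof -
  obtain B where B: "0 \<le> B" "\<And>x. \<bar>\<psi> x\<bar> \<le> B" using test_functions_bounded[OF \<psi>] by blast
  have [measurable]: "\<psi> \<in> borel_measurable borel" by (rule test_functions_measurable[OF \<psi>])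
  have v: "integrable lborel (\<lambda>y. indicator (supp \<psi>) y * v y)"
    using assms(1) test_functions_supp[OF \<psi>] by (auto simp: locally_integrable_def set_integrable_def)
  have "integrable lborel (\<lambda>y. (indicator (supp \<psi>) y * v y) * \<psi> y)"
  proof (rule Bochner_Integration.integrable_bound[OF integrable_mult_right[OF v, of B]])
    show "(\<lambda>y. (indicator (supp \<psi>) y * v y) * \<psi> y) \<in> borel_measurable lborel"
      using borel_measurable_integrable[OF v] by measurable
    have "\<bar>indicator (supp \<psi>) y * v y * \<psi> y\<bar> \<le> \<bar>B * (indicator (supp \<psi>) y * v y)\<bar>" for y
      using mult_right_mono[OF B(2)[of y], of "\<bar>indicator (supp \<psi>) y * v y\<bar>"] B(1)
      by (simp add: abs_mult mult.commute mult.left_commute)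
    then show "AE y in lborel. norm (indicator (supp \<psi>) y * v y * \<psi> y) \<le> norm (B * (indicator (supp \<psi>) y * v y))"
      by simp
  qed
  moreover have "(\<lambda>y. (indicator (supp \<psi>) y * v y) * \<psi> y) = (\<lambda>y. indicator \<Omega> y * (v y * \<psi> y))"
    using test_functions_supp(2)[OF \<psi>] not_in_supp[of _ \<psi>] by (auto simp: fun_eq_iff split: split_indicator)
  ultimately show ?thesis by simp
qed

lemma test_integral_eq:
  assumes \<psi>: "\<psi> \<in> test_functions \<Omega>"
  shows "(LINT y:\<Omega>|lborel. v y * \<psi> y) = (LINT y|lborel. v y * \<psi> y)"
  unfolding set_lebesgue_integral_def
  by (intro Bochner_Integration.integral_cong)
     (use test_functions_supp(2)[OF \<psi>] not_in_supp[of _ \<psi>] in \<open>auto split: split_indicator\<close>)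

lemma test_deriv_integral_eq:
  assumes \<psi>: "\<psi> \<in> test_functions \<Omega>"
  shows "(LINT y:\<Omega>|lborel. v y * frechet_derivative \<psi> (at y) b) = (LINT y|lborel. v y * frechet_derivative \<psi> (at y) b)"
  unfolding set_lebesgue_integral_def
  by (intro Bochner_Integration.integral_cong)
     (use test_functions_supp(2)[OF \<psi>] test_functions_deriv_zero[OF \<psi>] in \<open>auto split: split_indicator\<close>)

text \<open>By the product rule \<open>v * D\<psi> + v' * \<psi>\<close> is the directional
  derivative of the compactly supported function \<open>v * \<psi>\<close>, and such a derivative
  integrates to zero.\<close>

lemma weak_deriv_classical:
  assumes v: "continuous_on UNIV v" "continuous_on UNIV v'" and b: "b \<in> Basis"
    and der: "\<And>y s. ((\<lambda>s. v (y + s *\<^sub>R b)) has_real_derivative v' (y + s *\<^sub>R b)) (at s)"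
  shows "weak_deriv \<Omega> b v v'"
proof -
  have "(LINT y|lborel. v y * frechet_derivative \<psi> (at y) b) = - (LINT y|lborel. v' y * \<psi> y)"
    if \<psi>: "\<psi> \<in> test_functions \<Omega>" for \<psi>
  proof -
    let ?D = "\<lambda>y. frechet_derivative \<psi> (at y) b"
    have c: "continuous_on UNIV \<psi>" "continuous_on UNIV ?D"
      using test_functions_continuous[OF \<psi>] test_functions_continuous[OF test_functions_deriv[OF \<psi> b]] .
    note z = not_in_supp[of _ \<psi>] test_functions_deriv_zero[OF \<psi>]
    have "(LINT y|lborel. v y * ?D y + v' y * \<psi> y) = 0"
    proof (rule integral_directional_derivative_eq_0[where \<Phi> = "\<lambda>y. v y * \<psi> y" and C = "supp \<psi>"])
      show "((\<lambda>s. v (y + s *\<^sub>R b) * \<psi> (y + s *\<^sub>R b)) has_real_derivative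
          v (y + s *\<^sub>R b) * ?D (y + s *\<^sub>R b) + v' (y + s *\<^sub>R b) * \<psi> (y + s *\<^sub>R b)) (at s)" for y s
        using DERIV_mult'[OF der Ck_directional[OF test_functions_Ck[OF \<psi>, of "Suc 0"]]] .
    qed (use v c z test_functions_supp[OF \<psi>] in \<open>auto intro!: continuous_intros\<close>)
    moreover have "integrable lborel (\<lambda>y. v y * ?D y)" "integrable lborel (\<lambda>y. v' y * \<psi> y)"
      using v c z test_functions_supp[OF \<psi>]
      by (auto intro!: integrable_compact_support[of _ "supp \<psi>"] continuous_intros)
    ultimately show ?thesis by simp
  qed
  then show ?thesis
    using v by (auto simp: weak_deriv_def locally_integrable_continuous test_integral_eq test_deriv_integral_eq)
qed

lemma weak_deriv_add:
  assumes 1: "weak_deriv \<Omega> b v1 z1" and 2: "weak_deriv \<Omega> b v2 z2" and b: "b \<in> Basis"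
  shows "weak_deriv \<Omega> b (\<lambda>y. v1 y + v2 y) (\<lambda>y. z1 y + z2 y)"
proof -
  have li: "locally_integrable \<Omega> v1" "locally_integrable \<Omega> v2" "locally_integrable \<Omega> z1" "locally_integrable \<Omega> z2"
    using 1 2 by (auto simp: weak_deriv_def)
  have "(LINT y:\<Omega>|lborel. (v1 y + v2 y) * frechet_derivative \<psi> (at y) b) = - (LINT y:\<Omega>|lborel. (z1 y + z2 y) * \<psi> y)"
    if \<psi>: "\<psi> \<in> test_functions \<Omega>" for \<psi>
  proof -
    note i = test_integrable[OF li(3) \<psi>] test_integrable[OF li(4) \<psi>]
      test_integrable[OF li(1) test_functions_deriv[OF \<psi> b]] test_integrable[OF li(2) test_functions_deriv[OF \<psi> b]]
    have "(LINT y:\<Omega>|lborel. v1 y * frechet_derivative \<psi> (at y) b) = - (LINT y:\<Omega>|lborel. z1 y * \<psi> y)"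
      "(LINT y:\<Omega>|lborel. v2 y * frechet_derivative \<psi> (at y) b) = - (LINT y:\<Omega>|lborel. z2 y * \<psi> y)"
      using 1 2 \<psi> by (auto simp: weak_deriv_def)
    then show ?thesis using i by (simp add: set_lebesgue_integral_def distrib_right distrib_left)
  qed
  moreover have "locally_integrable \<Omega> (\<lambda>y. v1 y + v2 y)" "locally_integrable \<Omega> (\<lambda>y. z1 y + z2 y)"
    using li by (auto simp: locally_integrable_def intro!: set_integral_add(1))
  ultimately show ?thesis by (simp add: weak_deriv_def)
qed

text \<open>Measurability with respect to \<open>lborel\<close> is Borel measurability, which a
  change on a null set can destroy; the measurability of the new representative is therefore
  assumed.\<close>

lemma locally_integrable_cong_AE:
  assumes v: "locally_integrable \<Omega> v" and ae: "AE y in lborel. y \<in> \<Omega> \<longrightarrow> v y = v' y"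
    and m: "(\<lambda>y. indicator \<Omega> y * v' y) \<in> borel_measurable borel"
  shows "locally_integrable \<Omega> v'"
  unfolding locally_integrable_def set_integrable_def
proof (intro allI impI)
  fix C assume C: "compact C \<and> C \<subseteq> \<Omega>"
  then have [measurable]: "C \<in> sets borel" by (simp add: compact_imp_closed)
  have i: "integrable lborel (\<lambda>y. indicator C y *\<^sub>R v y)"
    using v C by (auto simp: locally_integrable_def set_integrable_def)
  have eq: "(\<lambda>y. indicator C y *\<^sub>R v' y) = (\<lambda>y. indicator C y * (indicator \<Omega> y * v' y))"
    using C by (auto simp: fun_eq_iff split: split_indicator)
  show "integrable lborel (\<lambda>y. indicator C y *\<^sub>R v' y)"
  proof (rule integrable_cong_AE[THEN iffD1, OF _ _ _ i])
    show "(\<lambda>y. indicator C y *\<^sub>R v' y) \<in> borel_measurable lborel"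
      unfolding eq using m by measurable
    show "AE y in lborel. indicator C y *\<^sub>R v y = indicator C y *\<^sub>R v' y"
      using ae by eventually_elim (use C in \<open>auto split: split_indicator\<close>)
  qed (rule borel_measurable_integrable[OF i])
qed

lemma weak_deriv_cong_AE:
  assumes w: "weak_deriv \<Omega> b v z" and b: "b \<in> Basis"
    and ae: "AE y in lborel. y \<in> \<Omega> \<longrightarrow> v y = v' y \<and> z y = z' y"
    and m: "(\<lambda>y. indicator \<Omega> y * v' y) \<in> borel_measurable borel" "(\<lambda>y. indicator \<Omega> y * z' y) \<in> borel_measurable borel"
  shows "weak_deriv \<Omega> b v' z'"
proof -
  have li: "locally_integrable \<Omega> v" "locally_integrable \<Omega> z" using w by (auto simp: weak_deriv_def)
  have li': "locally_integrable \<Omega> v'" "locally_integrable \<Omega> z'"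
    using ae by (auto intro!: locally_integrable_cong_AE[OF li(1) _ m(1)] locally_integrable_cong_AE[OF li(2) _ m(2)])
  have ieq: "(LINT y:\<Omega>|lborel. u y * \<psi> y) = (LINT y:\<Omega>|lborel. u' y * \<psi> y)"
    if "\<psi> \<in> test_functions \<Omega>" "locally_integrable \<Omega> u" "locally_integrable \<Omega> u'"
      "AE y in lborel. y \<in> \<Omega> \<longrightarrow> u y = u' y" for \<psi> u u'
    unfolding set_lebesgue_integral_def
  proof (rule integral_cong_AE)
    show "(\<lambda>y. indicator \<Omega> y *\<^sub>R (u y * \<psi> y)) \<in> borel_measurable lborel"
      "(\<lambda>y. indicator \<Omega> y *\<^sub>R (u' y * \<psi> y)) \<in> borel_measurable lborel"
      using borel_measurable_integrable[OF test_integrable[OF that(2,1)]]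
        borel_measurable_integrable[OF test_integrable[OF that(3,1)]] by simp_all
    show "AE y in lborel. indicator \<Omega> y *\<^sub>R (u y * \<psi> y) = indicator \<Omega> y *\<^sub>R (u' y * \<psi> y)"
      using that(4) by eventually_elim (auto split: split_indicator)
  qed
  have "(LINT y:\<Omega>|lborel. v' y * frechet_derivative \<psi> (at y) b) = - (LINT y:\<Omega>|lborel. z' y * \<psi> y)"
    if \<psi>: "\<psi> \<in> test_functions \<Omega>" for \<psi>
  proof -
    have "(LINT y:\<Omega>|lborel. v' y * frechet_derivative \<psi> (at y) b) = (LINT y:\<Omega>|lborel. v y * frechet_derivative \<psi> (at y) b)"
      using ae by (intro ieq test_functions_deriv[OF \<psi> b] li li') auto
    also have "\<dots> = - (LINT y:\<Omega>|lborel. z y * \<psi> y)" using w \<psi> by (auto simp: weak_deriv_def)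
    also have "\<dots> = - (LINT y:\<Omega>|lborel. z' y * \<psi> y)"
      using ae by (intro arg_cong[where f = uminus] ieq \<psi> li li') auto
    finally show ?thesis .
  qed
  with li' show ?thesis by (simp add: weak_deriv_def)
qed

definition L1_loc_tendsto :: "'a::euclidean_space set \<Rightarrow> (nat \<Rightarrow> 'a \<Rightarrow> real) \<Rightarrow> ('a \<Rightarrow> real) \<Rightarrow> bool" where
  "L1_loc_tendsto \<Omega> v w \<longleftrightarrow>
    (\<forall>C. compact C \<and> C \<subseteq> \<Omega> \<longrightarrow> (\<lambda>n. LINT y:C|lborel. \<bar>v n y - w y\<bar>) \<longlonglongrightarrow> 0)"

lemma test_integral_tendsto:
  assumes \<psi>: "\<psi> \<in> test_functions \<Omega>" and v: "\<And>n. locally_integrable \<Omega> (v n)" and w: "locally_integrable \<Omega> w"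
    and lim: "L1_loc_tendsto \<Omega> v w"
  shows "(\<lambda>n. LINT y:\<Omega>|lborel. v n y * \<psi> y) \<longlonglongrightarrow> (LINT y:\<Omega>|lborel. w y * \<psi> y)"
proof -
  obtain B where B: "0 \<le> B" "\<And>x. \<bar>\<psi> x\<bar> \<le> B" using test_functions_bounded[OF \<psi>] by blast
  let ?C = "supp \<psi>"
  have C: "compact ?C" "?C \<subseteq> \<Omega>" using test_functions_supp[OF \<psi>] .
  have iv: "set_integrable lborel ?C (v n)" and iw: "set_integrable lborel ?C w" for n
    using v w C by (auto simp: locally_integrable_def)
  have bd: "norm ((LINT y:\<Omega>|lborel. v n y * \<psi> y) - (LINT y:\<Omega>|lborel. w y * \<psi> y)) \<le> B * (LINT y:?C|lborel. \<bar>v n y - w y\<bar>)" for n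
  proof -
    have "(LINT y:\<Omega>|lborel. v n y * \<psi> y) - (LINT y:\<Omega>|lborel. w y * \<psi> y)
        = (LINT y|lborel. indicator \<Omega> y * (v n y * \<psi> y) - indicator \<Omega> y * (w y * \<psi> y))"
      using test_integrable[OF v \<psi>] test_integrable[OF w \<psi>]
      by (simp add: set_lebesgue_integral_def)
    also have "norm \<dots> \<le> (LINT y|lborel. norm (indicator \<Omega> y * (v n y * \<psi> y) - indicator \<Omega> y * (w y * \<psi> y)))"
      by (rule integral_norm_bound)
    also have "\<dots> \<le> (LINT y|lborel. B * (indicator ?C y *\<^sub>R \<bar>v n y - w y\<bar>))"
    proof (rule integral_mono)
      show "integrable lborel (\<lambda>y. norm (indicator \<Omega> y * (v n y * \<psi> y) - indicator \<Omega> y * (w y * \<psi> y)))"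
        using test_integrable[OF v \<psi>] test_integrable[OF w \<psi>] by auto
      show "integrable lborel (\<lambda>y. B * (indicator ?C y *\<^sub>R \<bar>v n y - w y\<bar>))"
        using set_integrable_abs[OF set_integral_diff(1)[OF iv[of n] iw]]
        by (auto simp: set_integrable_def)
      show "norm (indicator \<Omega> y * (v n y * \<psi> y) - indicator \<Omega> y * (w y * \<psi> y)) \<le> B * (indicator ?C y *\<^sub>R \<bar>v n y - w y\<bar>)" for y
      proof (cases "y \<in> ?C")
        case True
        have "\<bar>v n y * \<psi> y - w y * \<psi> y\<bar> = \<bar>\<psi> y\<bar> * \<bar>v n y - w y\<bar>"
          by (simp add: abs_mult[symmetric] algebra_simps)
        also have "\<dots> \<le> B * \<bar>v n y - w y\<bar>" by (intro mult_right_mono B) auto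
        finally show ?thesis using True C by (auto simp: indicator_def)
      qed (simp add: not_in_supp)
    qed
    finally show ?thesis by (simp add: set_lebesgue_integral_def)
  qed
  have "(\<lambda>n. B * (LINT y:?C|lborel. \<bar>v n y - w y\<bar>)) \<longlonglongrightarrow> B * 0"
    using lim C by (intro tendsto_intros) (auto simp: L1_loc_tendsto_def)
  then have *: "(\<lambda>n. B * (LINT y:?C|lborel. \<bar>v n y - w y\<bar>)) \<longlonglongrightarrow> 0" by (simp only: mult_zero_right)
  have "(\<lambda>n. (LINT y:\<Omega>|lborel. v n y * \<psi> y) - (LINT y:\<Omega>|lborel. w y * \<psi> y)) \<longlonglongrightarrow> 0"
    by (rule Lim_null_comparison[OF always_eventually *]) (rule allI, rule bd)
  then show ?thesis by (simp add: LIM_zero_iff)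
qed

text \<open>Closedness of the weak derivative. Test functions and their derivatives are bounded with
  compact support, so both sides of the defining identity are continuous under local L1 convergence.
  Through this lemma the derivatives of explicit solutions pass to general data.\<close>

lemma weak_deriv_limit:
  assumes w: "\<And>n. weak_deriv \<Omega> b (v n) (z n)" and b: "b \<in> Basis"
    and li: "locally_integrable \<Omega> v'" "locally_integrable \<Omega> z'"
    and lim: "L1_loc_tendsto \<Omega> v v'" "L1_loc_tendsto \<Omega> z z'"
  shows "weak_deriv \<Omega> b v' z'"
proof -
  have lin: "locally_integrable \<Omega> (v n)" "locally_integrable \<Omega> (z n)" for n
    using w by (auto simp: weak_deriv_def)
  have "(LINT y:\<Omega>|lborel. v' y * frechet_derivative \<psi> (at y) b) = - (LINT y:\<Omega>|lborel. z' y * \<psi> y)"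
    if \<psi>: "\<psi> \<in> test_functions \<Omega>" for \<psi>
  proof (rule LIMSEQ_unique)
    show "(\<lambda>n. LINT y:\<Omega>|lborel. v n y * frechet_derivative \<psi> (at y) b) \<longlonglongrightarrow> (LINT y:\<Omega>|lborel. v' y * frechet_derivative \<psi> (at y) b)"
      by (intro test_integral_tendsto test_functions_deriv[OF \<psi> b] lin li lim)
    have "(\<lambda>n. - (LINT y:\<Omega>|lborel. z n y * \<psi> y)) \<longlonglongrightarrow> - (LINT y:\<Omega>|lborel. z' y * \<psi> y)"
      by (intro tendsto_minus test_integral_tendsto \<psi> lin li lim)
    then show "(\<lambda>n. LINT y:\<Omega>|lborel. v n y * frechet_derivative \<psi> (at y) b) \<longlonglongrightarrow> - (LINT y:\<Omega>|lborel. z' y * \<psi> y)"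
      using w \<psi> by (simp add: weak_deriv_def)
  qed
  with li show ?thesis by (simp add: weak_deriv_def)
qed

text \<open>Boxes generate the Borel sets and are stable under intersection, so a Dynkin argument
  makes the integral vanish over every Borel set, with \<open>tot\<close> serving the complements.
  The sets where \<open>f\<close> is positive or negative then finish the proof.\<close>

lemma AE_eq_0_if_integral_box_eq_0:
  fixes f :: "'a::euclidean_space \<Rightarrow> real"
  assumes f: "integrable lborel f" and box: "\<And>a c. (LINT y|lborel. indicator (box a c) y * f y) = 0"
    and tot: "(LINT y|lborel. f y) = 0"
  shows "AE y in lborel. f y = 0"
proof -
  have [measurable]: "f \<in> borel_measurable borel" using f by auto
  have i: "integrable lborel (\<lambda>y. indicator A y * f y)" if "A \<in> sets borel" for A
    using integrable_mult_indicator[OF _ f, of A] that by simp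
  have A: "(LINT y|lborel. indicator A y * f y) = 0" if "A \<in> sets borel" for A
  proof -
    have "Int_stable (range (\<lambda>(a, c). box a c :: 'a set))" by (auto simp: Int_stable_def box_Int_box)
    moreover have "range (\<lambda>(a, c). box a c :: 'a set) \<subseteq> Pow UNIV" by auto
    moreover have "A \<in> sigma_sets UNIV (range (\<lambda>(a, c). box a c))" using that by (simp add: borel_eq_box)
    ultimately show ?thesis
    proof (induction rule: sigma_sets_induct_disjoint)
      case (basic A)
      then show ?case using box by auto
    next
      case empty
      then show ?case by simp
    next
      case (compl A)
      then have "A \<in> sets borel" by (simp add: borel_eq_box)
      have "(LINT y|lborel. indicator (UNIV - A) y * f y) = (LINT y|lborel. f y - indicator A y * f y)"
        by (intro Bochner_Integration.integral_cong) (auto split: split_indicator)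
      also have "\<dots> = 0" using f i[OF \<open>A \<in> sets borel\<close>] compl tot by simp
      finally show ?case .
    next
      case (union A)
      then have sb [measurable]: "A i \<in> sets borel" for i by (auto simp: borel_eq_box)
      have "(\<lambda>n. LINT y|lborel. indicator (\<Union>i<n. A i) y * f y) \<longlonglongrightarrow> (LINT y|lborel. indicator (\<Union>i. A i) y * f y)"
      proof (rule integral_dominated_convergence[where w = "\<lambda>y. \<bar>f y\<bar>"])
        show "AE y in lborel. (\<lambda>n. indicator (\<Union>i<n. A i) y * f y) \<longlonglongrightarrow> indicator (\<Union>i. A i) y * f y"
          by (intro AE_I2 tendsto_intros LIMSEQ_indicator_UN)
      qed (use f in \<open>auto split: split_indicator\<close>)
      moreover have "(LINT y|lborel. indicator (\<Union>i<n. A i) y * f y) = 0" for n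
      proof -
        have "indicator (\<Union>i<n. A i) y = (\<Sum>i<n. indicator (A i) y :: real)" for y
          by (rule indicator_UN_disjoint) (use union(1) in \<open>auto simp: disjoint_family_on_def\<close>)
        then have "(LINT y|lborel. indicator (\<Union>i<n. A i) y * f y) = (LINT y|lborel. (\<Sum>i<n. indicator (A i) y * f y))"
          by (simp add: sum_distrib_right)
        also have "\<dots> = (\<Sum>i<n. LINT y|lborel. indicator (A i) y * f y)"
          by (intro Bochner_Integration.integral_sum i sb)
        also have "\<dots> = 0" using union by simp
        finally show ?thesis .
      qed
      ultimately show ?case using LIMSEQ_unique[OF _ tendsto_const[of 0]] by (simp add: LIMSEQ_const_iff)
    qed
  qed
  have "(LINT y|lborel. indicator {y. 0 < f y} y * f y) = 0" by (rule A) measurable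
  then have 1: "AE y in lborel. indicator {y. 0 < f y} y * f y = 0"
    by (subst (asm) integral_nonneg_eq_0_iff_AE) (auto intro!: i split: split_indicator)
  have "(LINT y|lborel. - (indicator {y. f y < 0} y * f y)) = 0" using A[of "{y. f y < 0}"] by simp
  then have 2: "AE y in lborel. - (indicator {y. f y < 0} y * f y) = 0"
    by (subst (asm) integral_nonneg_eq_0_iff_AE) (auto intro!: i split: split_indicator)
  from 1 2 show ?thesis by eventually_elim (auto split: split_indicator_asm)
qed

text \<open>The fundamental lemma of the calculus of variations. Bumps converge boundedly to
  indicators of boxes, so \<open>\<xi>\<close> integrates to zero over each box whose closure lies
  in \<open>\<Omega>\<close>; an open set is a countable union of closed boxes, and their boundaries
  are null.\<close>

lemma test_integral_zero_imp_AE_zero: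
  fixes \<xi> :: "'a::euclidean_space \<Rightarrow> real"
  assumes \<Omega>: "open \<Omega>" and li: "locally_integrable \<Omega> \<xi>"
    and z: "\<And>\<psi>. \<psi> \<in> test_functions \<Omega> \<Longrightarrow> (LINT y:\<Omega>|lborel. \<xi> y * \<psi> y) = 0"
  shows "AE y in lborel. y \<in> \<Omega> \<longrightarrow> \<xi> y = 0"
proof -
  have boxz: "(LINT y|lborel. indicator (box a c) y * \<xi> y) = 0" "integrable lborel (\<lambda>y. indicator (box a c) y * \<xi> y)"
    if sub: "cbox a c \<subseteq> \<Omega>" for a c
  proof -
    have ic: "integrable lborel (\<lambda>y. indicator (cbox a c) y * \<xi> y)"
      using li sub by (auto simp: locally_integrable_def set_integrable_def)
    have eqb: "indicator (box a c) y * \<xi> y = indicator (box a c) y * (indicator (cbox a c) y * \<xi> y)" for y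
      using box_subset_cbox[of a c] by (auto split: split_indicator)
    show ib: "integrable lborel (\<lambda>y. indicator (box a c) y * \<xi> y)"
      unfolding eqb using integrable_mult_indicator[OF _ ic, of "box a c"] by simp
    have eq: "bump m a c y * \<xi> y = bump m a c y * (indicator (box a c) y * \<xi> y)" for m y
      using bump_zero[of y a c m] by (cases "y \<in> box a c") auto
    have [measurable]: "bump m a c \<in> borel_measurable borel" for m
      by (rule test_functions_measurable[OF bump_test_function[OF subset_UNIV]])
    have "(\<lambda>m. LINT y|lborel. bump m a c y * (indicator (box a c) y * \<xi> y)) \<longlonglongrightarrow> (LINT y|lborel. indicator (box a c) y * \<xi> y)"
    proof (rule integral_dominated_convergence[where w = "\<lambda>y. \<bar>indicator (box a c) y * \<xi> y\<bar>"])
      show "AE y in lborel. (\<lambda>m. bump m a c y * (indicator (box a c) y * \<xi> y)) \<longlonglongrightarrow> indicator (box a c) y * \<xi> y"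
      proof (rule AE_I2)
        fix y
        have "(\<lambda>m. bump m a c y * (indicator (box a c) y * \<xi> y)) \<longlonglongrightarrow> indicator (box a c) y * (indicator (box a c) y * \<xi> y)"
          by (intro tendsto_intros bump_tendsto)
        then show "(\<lambda>m. bump m a c y * (indicator (box a c) y * \<xi> y)) \<longlonglongrightarrow> indicator (box a c) y * \<xi> y"
          by (cases "y \<in> box a c") simp_all
      qed
      show "AE y in lborel. norm (bump m a c y * (indicator (box a c) y * \<xi> y)) \<le> \<bar>indicator (box a c) y * \<xi> y\<bar>" for m
        using mult_right_mono[OF bump_bounds(2)[of m a c]] bump_bounds(1)[of m a c]
        by (intro AE_I2) (simp add: abs_mult mult_left_le_one_le)
    qed (use ib borel_measurable_integrable[OF ib] in auto)
    moreover have "(LINT y|lborel. bump m a c y * (indicator (box a c) y * \<xi> y)) = 0" for m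
      using z[OF bump_test_function[OF sub], of m] test_integral_eq[OF bump_test_function[OF sub], of \<xi> m]
      unfolding eq[symmetric] by (simp add: mult.commute)
    ultimately show "(LINT y|lborel. indicator (box a c) y * \<xi> y) = 0" by (simp add: LIMSEQ_const_iff)
  qed
  have cb: "AE y in lborel. y \<in> cbox a c \<longrightarrow> \<xi> y = 0" if sub: "cbox a c \<subseteq> \<Omega>" for a c
  proof -
    have "AE y in lborel. indicator (box a c) y * \<xi> y = 0"
    proof (rule AE_eq_0_if_integral_box_eq_0)
      fix a' c' :: 'a
      obtain a'' c'' where bb: "box a' c' \<inter> box a c = box a'' c''" by (rule that[OF box_Int_box])
      \<comment> \<open>When the intersection is empty, nothing ties the corners \<open>a''\<close>
        and \<open>c''\<close> to \<open>\<Omega>\<close>, and a degenerate closed box may leave it;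
        hence the disjunction.\<close>
      have "cbox a'' c'' \<subseteq> \<Omega> \<or> box a'' c'' = {}"
      proof (cases "box a'' c'' = {}")
        case False
        then have "cbox a'' c'' = closure (box a'' c'')" by (simp add: closure_box)
        also have "\<dots> \<subseteq> closure (box a c)" using bb by (intro closure_mono) auto
        also have "\<dots> \<subseteq> cbox a c" by (intro closure_minimal box_subset_cbox closed_cbox)
        finally show ?thesis using sub by blast
      qed simp
      moreover have eq: "indicator (box a' c') y * (indicator (box a c) y * \<xi> y) = indicator (box a'' c'') y * \<xi> y" for y
        by (simp add: bb[symmetric] indicator_inter_arith)
      ultimately show "(LINT y|lborel. indicator (box a' c') y * (indicator (box a c) y * \<xi> y)) = 0"
        unfolding eq using boxz(1)[of a'' c''] by auto
    qed (use boxz[OF sub] in auto)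
    moreover have "AE y in lborel. y \<notin> cbox a c - box a c"
      by (rule AE_not_in) (auto intro!: null_setsI simp: emeasure_Diff emeasure_lborel_box_eq emeasure_lborel_cbox_eq subset_box)
    ultimately show ?thesis by eventually_elim (auto split: split_indicator_asm)
  qed
  obtain D where D: "countable D" "D \<subseteq> Pow \<Omega>" "\<And>X. X \<in> D \<Longrightarrow> \<exists>a b. X = cbox a b" "\<Union>D = \<Omega>"
    using open_countable_Union_open_cbox[OF \<Omega>] by metis
  have "AE y in lborel. \<forall>X\<in>D. y \<in> X \<longrightarrow> \<xi> y = 0"
  proof (subst AE_ball_countable[OF D(1)], intro ballI)
    fix X assume X: "X \<in> D"
    then obtain a b where "X = cbox a b" using D by blast
    with X D(2) show "AE y in lborel. y \<in> X \<longrightarrow> \<xi> y = 0" using cb[of a b] by auto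
  qed
  then show ?thesis by eventually_elim (use D(4) in blast)
qed

lemma weak_deriv_unique:
  assumes \<Omega>: "open \<Omega>" and 1: "weak_deriv \<Omega> b v z" and 2: "weak_deriv \<Omega> b v z'"
  shows "AE y in lborel. y \<in> \<Omega> \<longrightarrow> z y = z' y"
proof -
  have li: "locally_integrable \<Omega> z" "locally_integrable \<Omega> z'" using 1 2 by (auto simp: weak_deriv_def)
  have "AE y in lborel. y \<in> \<Omega> \<longrightarrow> z y - z' y = 0"
  proof (rule test_integral_zero_imp_AE_zero[OF \<Omega>])
    show "locally_integrable \<Omega> (\<lambda>y. z y - z' y)"
      using li by (auto simp: locally_integrable_def intro!: set_integral_diff(1))
    fix \<psi> assume \<psi>: "\<psi> \<in> test_functions \<Omega>"
    have "(LINT y:\<Omega>|lborel. z y * \<psi> y) = (LINT y:\<Omega>|lborel. z' y * \<psi> y)"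
      using 1 2 \<psi> by (auto simp: weak_deriv_def)
    then show "(LINT y:\<Omega>|lborel. (z y - z' y) * \<psi> y) = 0"
      using test_integrable[OF li(1) \<psi>] test_integrable[OF li(2) \<psi>]
      by (simp add: set_lebesgue_integral_def left_diff_distrib right_diff_distrib)
  qed
  then show ?thesis by simp
qed

text \<open>Both derivatives are moved onto the test function, where Schwarz's theorem applies; the
  fundamental lemma then compares the two densities. This is the origin of the symmetry of weak
  Hessians.\<close>

lemma weak_deriv_symmetric:
  assumes \<Omega>: "open \<Omega>" and b: "b \<in> Basis" and c: "c \<in> Basis"
    and 1: "weak_deriv \<Omega> b v zb" "weak_deriv \<Omega> c zb zbc"
    and 2: "weak_deriv \<Omega> c v zc" "weak_deriv \<Omega> b zc zcb"
  shows "AE y in lborel. y \<in> \<Omega> \<longrightarrow> zbc y = zcb y"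
proof -
  have li: "locally_integrable \<Omega> zbc" "locally_integrable \<Omega> zcb" using 1 2 by (auto simp: weak_deriv_def)
  have "AE y in lborel. y \<in> \<Omega> \<longrightarrow> zbc y - zcb y = 0"
  proof (rule test_integral_zero_imp_AE_zero[OF \<Omega>])
    show "locally_integrable \<Omega> (\<lambda>y. zbc y - zcb y)"
      using li by (auto simp: locally_integrable_def intro!: set_integral_diff(1))
    fix \<psi> assume \<psi>: "\<psi> \<in> test_functions \<Omega>"
    have two: "(LINT y:\<Omega>|lborel. zbc y * \<psi> y) = (LINT y:\<Omega>|lborel. v y * frechet_derivative (\<lambda>x. frechet_derivative \<psi> (at x) c) (at y) b)"
      if "weak_deriv \<Omega> b v zb" "weak_deriv \<Omega> c zb zbc" "c \<in> Basis" for b c zb zbc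
    proof -
      have "(LINT y:\<Omega>|lborel. zb y * frechet_derivative \<psi> (at y) c) = - (LINT y:\<Omega>|lborel. zbc y * \<psi> y)"
        using that(2) \<psi> by (auto simp: weak_deriv_def)
      moreover have "(LINT y:\<Omega>|lborel. v y * frechet_derivative (\<lambda>x. frechet_derivative \<psi> (at x) c) (at y) b)
          = - (LINT y:\<Omega>|lborel. zb y * frechet_derivative \<psi> (at y) c)"
        using that(1) test_functions_deriv[OF \<psi> that(3)] by (auto simp: weak_deriv_def)
      ultimately show ?thesis by simp
    qed
    have "(LINT y:\<Omega>|lborel. zbc y * \<psi> y) = (LINT y:\<Omega>|lborel. zcb y * \<psi> y)"
      unfolding two[OF 1 c] two[OF 2 b] Ck_mixed_derivatives[OF test_functions_Ck[OF \<psi>] b c] ..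
    then show "(LINT y:\<Omega>|lborel. (zbc y - zcb y) * \<psi> y) = 0"
      using test_integrable[OF li(1) \<psi>] test_integrable[OF li(2) \<psi>]
      by (simp add: set_lebesgue_integral_def left_diff_distrib right_diff_distrib)
  qed
  then show ?thesis by simp
qed

section \<open>Gaussian laws, Brownian transition laws and the occupation measure\<close>

subsection \<open>Gaussian measures\<close>

lemma Basis_real_vec: "(Basis :: (real ^ 'n) set) = range (\<lambda>i. axis i 1)"
  by (auto simp: Basis_vec_def)

lemma prod_Basis_vec: "(\<Prod>b\<in>(Basis :: (real ^ 'n) set). f b) = (\<Prod>i\<in>UNIV. f (axis i 1))"
  unfolding Basis_real_vec by (subst prod.reindex) (auto simp: inj_on_def axis_eq_axis)

lemma axis_in_Basis [simp]: "axis k 1 \<in> (Basis :: (real ^ 'n) set)"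
  by (simp add: Basis_real_vec)

lemma axis_prod_in_Basis [simp]: "(0, axis k 1) \<in> (Basis :: (real \<times> (real ^ 'n)) set)"
  by (simp add: Basis_prod_def)

lemma borel_measurable_vec_nth [measurable (raw)]:
  fixes f :: "'a \<Rightarrow> 'b::euclidean_space ^ 'n"
  assumes "f \<in> borel_measurable M"
  shows "(\<lambda>x. f x $ i) \<in> borel_measurable M"
  by (rule borel_measurable_continuous_on[OF _ assms, of "\<lambda>x. x $ i"]) (auto intro!: continuous_intros)

lemma borel_measurable_vec_lambda [measurable (raw)]:
  fixes f :: "'a \<Rightarrow> 'n::finite \<Rightarrow> 'b::euclidean_space"
  assumes "\<And>i. (\<lambda>x. f x i) \<in> borel_measurable M"
  shows "(\<lambda>x. \<chi> i. f x i) \<in> borel_measurable M"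
proof (subst borel_measurable_euclidean_space, intro ballI)
  fix b :: "'b ^ 'n" assume "b \<in> Basis"
  then obtain i u where b: "b = axis i u" by (auto simp: Basis_vec_def)
  have "(\<lambda>x. f x i \<bullet> u) \<in> borel_measurable M" using assms[of i] by measurable
  then show "(\<lambda>x. (\<chi> i. f x i) \<bullet> b) \<in> borel_measurable M" by (simp add: b inner_axis)
qed

lemma gauss_density_eq_Basis:
  "gauss_density m r x = (\<Prod>b\<in>Basis. normal_density (m \<bullet> b) (sqrt r) (x \<bullet> b))"
  by (simp add: gauss_density_def prod_Basis_vec inner_axis)

lemma gauss_density_measurable [measurable (raw)]:
  assumes "f \<in> borel_measurable M" "g \<in> borel_measurable M"
  shows "(\<lambda>x. gauss_density m (f x) (g x)) \<in> borel_measurable M"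
  unfolding gauss_density_def normal_density_def using assms by measurable

lemma gauss_density_pos: "0 < r \<Longrightarrow> 0 < gauss_density m r x"
  by (auto simp: gauss_density_def intro!: prod_pos normal_density_pos)

lemma gauss_density_nonneg: "0 \<le> gauss_density m r x"
  by (auto simp: gauss_density_def intro!: prod_nonneg)

lemma gauss_density_continuous_on:
  "continuous_on ({0<..} \<times> UNIV) (\<lambda>p. gauss_density m (fst p) (snd p))"
  unfolding gauss_density_def normal_density_def
  by (intro continuous_intros) auto

lemma gauss_density_shift: "gauss_density m r x = gauss_density 0 r (x - m)"
  by (simp add: gauss_density_def normal_density_def)

lemma space_gaussian [simp]: "space (gaussian m r) = UNIV"
  and sets_gaussian [simp, measurable_cong]: "sets (gaussian m r) = sets borel"
  by (simp_all add: gaussian_def)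

lemma nn_integral_gaussian:
  "\<phi> \<in> borel_measurable borel \<Longrightarrow>
    (\<integral>\<^sup>+x. \<phi> x \<partial>gaussian m r) = (\<integral>\<^sup>+x. ennreal (gauss_density m r x) * \<phi> x \<partial>lborel)"
  unfolding gaussian_def by (subst nn_integral_density) auto

lemma nn_integral_gaussian_shift:
  assumes [measurable]: "\<phi> \<in> borel_measurable borel"
  shows "(\<integral>\<^sup>+x. \<phi> x \<partial>gaussian m r) = (\<integral>\<^sup>+y. \<phi> (m + y) \<partial>gaussian 0 r)"
proof -
  have "(\<integral>\<^sup>+x. \<phi> x \<partial>gaussian m r) = (\<integral>\<^sup>+x. ennreal (gauss_density m r x) * \<phi> x \<partial>distr lborel borel (\<lambda>y. m + y))"
    by (simp add: nn_integral_gaussian lborel_distr_plus)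
  also have "\<dots> = (\<integral>\<^sup>+y. ennreal (gauss_density 0 r y) * \<phi> (m + y) \<partial>lborel)"
    by (subst nn_integral_distr) (simp_all add: gauss_density_shift[of m])
  also have "\<dots> = (\<integral>\<^sup>+y. \<phi> (m + y) \<partial>gaussian 0 r)"
    by (simp add: nn_integral_gaussian)
  finally show ?thesis .
qed

lemma distr_shift_gaussian: "distr (gaussian 0 r) borel (\<lambda>y. m + y) = gaussian m r"
proof (rule measure_eqI)
  fix A assume "A \<in> sets (distr (gaussian 0 r) borel (\<lambda>y. m + y))"
  then have [measurable]: "A \<in> sets borel" by simp
  have "emeasure (gaussian m r) A = (\<integral>\<^sup>+y. indicator A (m + y) \<partial>gaussian 0 r)"
    by (subst nn_integral_gaussian_shift[symmetric]) auto
  also have "\<dots> = (\<integral>\<^sup>+y. indicator A y \<partial>distr (gaussian 0 r) borel (\<lambda>y. m + y))"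
    by (subst nn_integral_distr) auto
  finally show "emeasure (distr (gaussian 0 r) borel (\<lambda>y. m + y)) A = emeasure (gaussian m r) A" by simp
qed simp

lemma integral_lborel_prod_complex:
  fixes f :: "'a::euclidean_space \<Rightarrow> real \<Rightarrow> complex"
  assumes f: "\<And>b. b \<in> Basis \<Longrightarrow> integrable lborel (f b)"
  shows "(LINT x|lborel. (\<Prod>b\<in>Basis. f b (x \<bullet> b))) = (\<Prod>b\<in>(Basis::'a set). LINT x|lborel. f b x)"
proof -
  interpret finite_product_sigma_finite "\<lambda>_. lborel :: real measure" "Basis :: 'a set"
    by standard simp
  have [measurable]: "\<And>b. b \<in> Basis \<Longrightarrow> f b \<in> borel_measurable borel" using f by fastforce
  have m: "(\<lambda>x. \<Prod>b\<in>Basis. f b (x \<bullet> b)) \<in> borel_measurable borel"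
    by measurable
  have "(LINT x|lborel. (\<Prod>b\<in>Basis. f b (x \<bullet> b)))
      = (LINT g|(\<Pi>\<^sub>M b\<in>Basis. lborel). (\<Prod>b\<in>(Basis::'a set). f b (g b)))"
    by (subst lborel_eq, subst integral_distr) (use m in \<open>auto intro!: Bochner_Integration.integral_cong prod.cong\<close>)
  also have "\<dots> = (\<Prod>b\<in>(Basis::'a set). LINT x|lborel. f b x)"
    using f by (intro product_integral_prod) auto
  finally show ?thesis .
qed

lemma normal_density_char:
  assumes s: "0 < s"
  shows "integrable lborel (\<lambda>x. normal_density 0 s x *\<^sub>R iexp (a * x))"
    and "(LINT x|lborel. normal_density 0 s x *\<^sub>R iexp (a * x)) = exp (- ((a * s)\<^sup>2 / 2))"
proof -
  have "integrable lborel (\<lambda>x. complex_of_real (normal_density 0 s x))"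
    using integrable_normal_density[OF s] by simp
  then show "integrable lborel (\<lambda>x. normal_density 0 s x *\<^sub>R iexp (a * x))"
    by (rule Bochner_Integration.integrable_bound) (auto simp: norm_mult scaleR_conv_of_real)
  have eq: "normal_density 0 s (s * u) = std_normal_density u / s" for u
    using s by (simp add: normal_density_def real_sqrt_mult power_mult_distrib)
  have "(LINT x|lborel. normal_density 0 s x *\<^sub>R iexp (a * x))
      = \<bar>s\<bar> *\<^sub>R (LINT u|lborel. normal_density 0 s (0 + s * u) *\<^sub>R iexp (a * (0 + s * u)))"
    using s by (subst lborel_integral_real_affine[where c = s and t = 0]) auto
  also have "\<dots> = (LINT u|lborel. s *\<^sub>R (normal_density 0 s (0 + s * u) *\<^sub>R iexp (a * (0 + s * u))))"
    using s by (simp del: scaleR_scaleR)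
  also have "\<dots> = (LINT u|lborel. std_normal_density u *\<^sub>R iexp ((a * s) * u))"
    using s by (intro Bochner_Integration.integral_cong) (auto simp: eq mult.assoc)
  also have "\<dots> = char std_normal_distribution (a * s)"
    unfolding char_def by (subst integral_density) auto
  also have "\<dots> = exp (- ((a * s)\<^sup>2 / 2))" by (simp add: char_std_normal_distribution)
  finally show "(LINT x|lborel. normal_density 0 s x *\<^sub>R iexp (a * x)) = exp (- ((a * s)\<^sup>2 / 2))" .
qed

lemma gaussian_char:
  assumes r: "0 < r"
  shows "(LINT y|gaussian 0 r. iexp (l \<bullet> y)) = exp (- (r * (norm l)\<^sup>2 / 2))"
proof -
  have "(LINT y|gaussian 0 r. iexp (l \<bullet> y)) = (LINT y|lborel. gauss_density 0 r y *\<^sub>R iexp (l \<bullet> y))"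
    unfolding gaussian_def by (subst integral_density) (auto simp: gauss_density_nonneg)
  also have "\<dots> = (LINT y|lborel. (\<Prod>b\<in>Basis. normal_density 0 (sqrt r) (y \<bullet> b) *\<^sub>R iexp ((l \<bullet> b) * (y \<bullet> b))))"
  proof (intro Bochner_Integration.integral_cong refl)
    fix y
    have "iexp (l \<bullet> y) = exp (\<Sum>b\<in>Basis. \<i> * complex_of_real ((l \<bullet> b) * (y \<bullet> b)))"
      by (subst euclidean_inner) (simp add: sum_distrib_left)
    also have "\<dots> = (\<Prod>b\<in>Basis. iexp ((l \<bullet> b) * (y \<bullet> b)))" by (simp add: exp_sum)
    finally show "gauss_density 0 r y *\<^sub>R iexp (l \<bullet> y)
        = (\<Prod>b\<in>Basis. normal_density 0 (sqrt r) (y \<bullet> b) *\<^sub>R iexp ((l \<bullet> b) * (y \<bullet> b)))"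
      by (simp add: gauss_density_eq_Basis scaleR_conv_of_real prod.distrib)
  qed
  also have "\<dots> = (\<Prod>b\<in>(Basis::(real^'a) set). LINT x|lborel. normal_density 0 (sqrt r) x *\<^sub>R iexp ((l \<bullet> b) * x))"
    using r by (intro integral_lborel_prod_complex normal_density_char) auto
  also have "\<dots> = (\<Prod>b\<in>(Basis::(real^'a) set). exp (- (((l \<bullet> b) * sqrt r)\<^sup>2 / 2)))"
    using r by (subst normal_density_char) auto
  also have "\<dots> = exp (complex_of_real (\<Sum>b\<in>(Basis::(real^'a) set). - (((l \<bullet> b) * sqrt r)\<^sup>2 / 2)))"
    by (simp only: exp_of_real exp_sum[OF finite_Basis] of_real_prod)
  also have "(\<Sum>b\<in>(Basis::(real^'a) set). - (((l \<bullet> b) * sqrt r)\<^sup>2 / 2)) = - (r * (norm l)\<^sup>2 / 2)"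
  proof -
    have "(norm l)\<^sup>2 = (\<Sum>b\<in>Basis. (l \<bullet> b)\<^sup>2)"
      unfolding power2_norm_eq_inner by (subst euclidean_inner) (simp add: power2_eq_square)
    then show ?thesis using r
      by (simp add: power_mult_distrib sum_negf sum_divide_distrib[symmetric] sum_distrib_left mult.commute)
  qed
  finally show ?thesis by (simp only: exp_of_real)
qed

lemma prob_space_gaussian:
  assumes r: "0 < r" shows "prob_space (gaussian m r)"
proof (rule prob_spaceI)
  have 1: "(\<integral>\<^sup>+x. ennreal (normal_density (m \<bullet> b) (sqrt r) x) \<partial>lborel) = 1" for b
    using prob_space.emeasure_space_1[OF prob_space_normal_density[of "sqrt r" "m \<bullet> b"]] r
    by (simp add: emeasure_density)
  have "emeasure (gaussian m r) (space (gaussian m r)) = (\<integral>\<^sup>+x. ennreal (gauss_density m r x) \<partial>lborel)"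
    by (simp add: gaussian_def emeasure_density)
  also have "\<dots> = (\<integral>\<^sup>+x. (\<Prod>b\<in>Basis. ennreal (normal_density (m \<bullet> b) (sqrt r) (x \<bullet> b))) \<partial>lborel)"
    by (simp add: gauss_density_eq_Basis prod_ennreal)
  also have "\<dots> = (\<Prod>b\<in>(Basis::(real^'a) set). (\<integral>\<^sup>+x. ennreal (normal_density (m \<bullet> b) (sqrt r) x) \<partial>lborel))"
    by (rule nn_integral_lborel_prod[where f = "\<lambda>b x. ennreal (normal_density (m \<bullet> b) (sqrt r) x)"]) auto
  also have "\<dots> = 1" by (simp add: 1)
  finally show "emeasure (gaussian m r) (space (gaussian m r)) = 1" .
qed

lemma gaussian_integrable_bounded:
  fixes f :: "real ^ 'n \<Rightarrow> real"
  assumes "0 < r" "f \<in> borel_measurable borel" "\<And>x. \<bar>f x\<bar> \<le> B"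
  shows "integrable (gaussian m r) f"
proof -
  interpret prob_space "gaussian m r" by (rule prob_space_gaussian[OF assms(1)])
  show ?thesis using assms by (intro integrable_const_bound[of _ B]) auto
qed

lemma gaussian_cos_sin:
  assumes r: "0 < r"
  shows "(LINT y|gaussian 0 r. cos (l \<bullet> y)) = exp (- (r * (norm l)\<^sup>2 / 2))"
    and "(LINT y|gaussian 0 r. sin (l \<bullet> y)) = 0"
proof -
  interpret prob_space "gaussian (0 :: real ^ 'a) r" by (rule prob_space_gaussian[OF r])
  have i: "integrable (gaussian 0 r) (\<lambda>y. iexp (l \<bullet> y))"
    by (rule integrable_const_bound[of _ 1]) auto
  have "Re (LINT y|gaussian 0 r. iexp (l \<bullet> y)) = (LINT y|gaussian 0 r. Re (iexp (l \<bullet> y)))"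
    "Im (LINT y|gaussian 0 r. iexp (l \<bullet> y)) = (LINT y|gaussian 0 r. Im (iexp (l \<bullet> y)))"
    using i by simp_all
  then show "(LINT y|gaussian 0 r. cos (l \<bullet> y)) = exp (- (r * (norm l)\<^sup>2 / 2))"
    "(LINT y|gaussian 0 r. sin (l \<bullet> y)) = 0"
    unfolding gaussian_char[OF r] by (simp_all add: Re_exp Im_exp)
qed

text \<open>Sines integrate to zero against the centred Gaussian, so averaging only damps a cosine
  wave and keeps its frequency and phase. The waves used later carry a growing exponential that
  undoes precisely this damping.\<close>

lemma gaussian_cos_shift:
  assumes r: "0 < r"
  shows "(LINT y|gaussian 0 r. cos (l \<bullet> (x + y) + \<theta>)) = exp (- (r * (norm l)\<^sup>2 / 2)) * cos (l \<bullet> x + \<theta>)"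
proof -
  have i: "integrable (gaussian 0 r) (\<lambda>y. cos (l \<bullet> y))" "integrable (gaussian 0 r) (\<lambda>y. sin (l \<bullet> y))"
    using r by (auto intro!: gaussian_integrable_bounded[of _ _ 1])
  have "(LINT y|gaussian 0 r. cos (l \<bullet> (x + y) + \<theta>))
      = (LINT y|gaussian 0 r. cos (l \<bullet> x + \<theta>) * cos (l \<bullet> y) - sin (l \<bullet> x + \<theta>) * sin (l \<bullet> y))"
    by (simp add: inner_add_right cos_add[symmetric] add.commute add.left_commute)
  also have "\<dots> = exp (- (r * (norm l)\<^sup>2 / 2)) * cos (l \<bullet> x + \<theta>)"
    using i gaussian_cos_sin[OF r, of l] by simp
  finally show ?thesis .
qed

lemma integral_gaussian_shift:
  fixes \<phi> :: "real ^ 'n \<Rightarrow> real"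
  assumes [measurable]: "\<phi> \<in> borel_measurable borel"
  shows "(LINT x|gaussian m r. \<phi> x) = (LINT y|gaussian 0 r. \<phi> (m + y))"
  by (subst distr_shift_gaussian[symmetric], subst integral_distr) auto

lemma gaussian_cos_centered:
  assumes r: "0 < r"
  shows "(LINT x|gaussian m r. cos (l \<bullet> (x - m) + \<theta>)) = exp (- (r * (norm l)\<^sup>2 / 2)) * cos \<theta>"
proof -
  have "(LINT x|gaussian m r. cos (l \<bullet> (x - m) + \<theta>)) = (LINT y|gaussian 0 r. cos (l \<bullet> (0 + y) + \<theta>))"
    by (subst integral_gaussian_shift) auto
  also have "\<dots> = exp (- (r * (norm l)\<^sup>2 / 2)) * cos \<theta>" using gaussian_cos_shift[OF r, of l 0 \<theta>] by simp
  finally show ?thesis .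
qed

subsection \<open>Brownian motion\<close>

context
  fixes M :: "'w measure" and W :: "real \<Rightarrow> 'w \<Rightarrow> real ^ 'n"
  assumes BM: "brownian_motion M W"
begin

lemma BM_prob_space: "prob_space M"
  using BM by (simp add: brownian_motion_def)

lemma BM_measurable: "0 \<le> t \<Longrightarrow> W t \<in> borel_measurable M"
  using BM by (simp add: brownian_motion_def)

lemma BM_zero: "AE \<omega> in M. W 0 \<omega> = 0"
  using BM by (simp add: brownian_motion_def)

lemma BM_increment: "0 \<le> s \<Longrightarrow> s < t \<Longrightarrow> distr M borel (\<lambda>\<omega>. W t \<omega> - W s \<omega>) = gaussian 0 (t - s)"
  using BM unfolding brownian_motion_def by blast

lemma BM_distr:
  assumes t: "0 < t" shows "distr M borel (W t) = gaussian 0 t"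
proof -
  have [measurable]: "W t \<in> borel_measurable M" "W 0 \<in> borel_measurable M"
    using t by (simp_all add: BM_measurable)
  have "distr M borel (W t) = distr M borel (\<lambda>\<omega>. W t \<omega> - W 0 \<omega>)"
    using BM_zero by (intro distr_cong_AE) auto
  then show ?thesis using BM_increment[of 0 t] t by simp
qed

lemma law_eq_gaussian:
  assumes t: "0 < t" shows "law M W x0 t = gaussian x0 t"
proof -
  have "law M W x0 t = distr (distr M borel (W t)) borel (\<lambda>y. x0 + y)"
    unfolding law_def using t by (subst distr_distr) (auto simp: comp_def BM_measurable)
  then show ?thesis by (simp add: BM_distr[OF t] distr_shift_gaussian)
qed

lemma heat_eq_gaussian:
  assumes r: "0 < r" and [measurable]: "\<phi> \<in> borel_measurable borel"
  shows "heat M W r \<phi> x = (LINT y|gaussian 0 r. \<phi> (x + y))"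
    and "integrable M (\<lambda>\<omega>. \<phi> (x + W r \<omega>)) \<longleftrightarrow> integrable (gaussian 0 r) (\<lambda>y. \<phi> (x + y))"
  unfolding heat_def BM_distr[OF r, symmetric] using r
  by (auto simp: integral_distr integrable_distr_eq BM_measurable)

text \<open>Chapman--Kolmogorov, from the independence of \<open>W\<^sub>t\<close> and \<open>W\<^sub>r - W\<^sub>t\<close>.\<close>

lemma gaussian_semigroup:
  fixes x0 :: "real ^ 'n"
  assumes t: "0 < t" and r: "t < r" and [measurable]: "\<phi> \<in> borel_measurable borel"
  shows "(\<integral>\<^sup>+x. \<phi> x \<partial>gaussian x0 r) = (\<integral>\<^sup>+x. \<integral>\<^sup>+y. \<phi> (x + y) \<partial>gaussian 0 (r - t) \<partial>gaussian x0 t)"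
proof -
  interpret prob_space M by (rule BM_prob_space)
  have [measurable]: "W t \<in> borel_measurable M" "W 0 \<in> borel_measurable M" "W r \<in> borel_measurable M"
    using t r by (simp_all add: BM_measurable)
  \<comment> \<open>\<open>brownian_motion\<close> asks for an infinite monotone sequence of times.
    This one runs 0, t, r, r, ..., and only its first two increments are used; \<open>W 0\<close>
    stays visible because it vanishes only almost surely.\<close>
  define \<tau> where "\<tau> i = (if i = 0 then 0 else if i = Suc 0 then t else r)" for i :: nat
  have "0 \<le> \<tau> 0 \<and> mono \<tau>" using t r by (auto simp: \<tau>_def mono_def)
  then have iv: "indep_vars (\<lambda>_. borel) (\<lambda>i \<omega>. W (\<tau> (Suc i)) \<omega> - W (\<tau> i) \<omega>) {..<2}"
    using BM unfolding brownian_motion_def by blast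
  let ?X = "\<lambda>i \<omega>. W (\<tau> (Suc i)) \<omega> - W (\<tau> i) \<omega>"
  have "indep_var (Pi\<^sub>M {0} (\<lambda>_. borel)) (\<lambda>\<omega>. restrict (\<lambda>i. ?X i \<omega>) {0})
      (Pi\<^sub>M {1} (\<lambda>_. borel)) (\<lambda>\<omega>. restrict (\<lambda>i. ?X i \<omega>) {1})"
    by (rule indep_var_restrict[OF iv]) auto
  then have "indep_var borel ((\<lambda>f. f (0::nat)) \<circ> (\<lambda>\<omega>. restrict (\<lambda>i. ?X i \<omega>) {0}))
      borel ((\<lambda>f. f (1::nat)) \<circ> (\<lambda>\<omega>. restrict (\<lambda>i. ?X i \<omega>) {1}))"
    by (rule indep_var_compose) (auto intro: measurable_component_singleton)
  then have "indep_var borel (\<lambda>\<omega>. ?X 0 \<omega>) borel (\<lambda>\<omega>. ?X 1 \<omega>)"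
    by (simp add: comp_def)
  then have ind: "indep_var borel (\<lambda>\<omega>. W t \<omega> - W 0 \<omega>) borel (\<lambda>\<omega>. W r \<omega> - W t \<omega>)"
    by (simp add: \<tau>_def)
  have joint: "distr M (borel \<Otimes>\<^sub>M borel) (\<lambda>\<omega>. (W t \<omega> - W 0 \<omega>, W r \<omega> - W t \<omega>)) = gaussian 0 t \<Otimes>\<^sub>M gaussian 0 (r - t)"
    using ind[unfolded indep_var_distribution_eq] BM_increment[of 0 t] BM_increment[of t r] t r by simp
  interpret G: prob_space "gaussian (0::real^'n) (r - t)" using r by (intro prob_space_gaussian) simp
  have "(\<integral>\<^sup>+x. \<phi> x \<partial>gaussian x0 r) = (\<integral>\<^sup>+y. \<phi> (x0 + y) \<partial>distr M borel (\<lambda>\<omega>. W r \<omega> - W 0 \<omega>))"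
    using BM_increment[of 0 r] t r by (simp add: nn_integral_gaussian_shift[of _ x0])
  also have "\<dots> = (\<integral>\<^sup>+\<omega>. \<phi> (x0 + (W r \<omega> - W 0 \<omega>)) \<partial>M)"
    using t r by (subst nn_integral_distr) auto
  also have "\<dots> = (\<integral>\<^sup>+\<omega>. (\<lambda>(a, b). \<phi> (x0 + a + b)) (W t \<omega> - W 0 \<omega>, W r \<omega> - W t \<omega>) \<partial>M)"
    by (intro nn_integral_cong) (simp add: algebra_simps)
  also have "\<dots> = (\<integral>\<^sup>+p. (\<lambda>(a, b). \<phi> (x0 + a + b)) p \<partial>(gaussian 0 t \<Otimes>\<^sub>M gaussian 0 (r - t)))"
    unfolding joint[symmetric] using t r by (subst nn_integral_distr) auto
  also have "\<dots> = (\<integral>\<^sup>+x. \<integral>\<^sup>+y. \<phi> (x0 + x + y) \<partial>gaussian 0 (r - t) \<partial>gaussian 0 t)"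
    by (subst G.nn_integral_fst[symmetric]) auto
  also have "\<dots> = (\<integral>\<^sup>+x. \<integral>\<^sup>+y. \<phi> (x + y) \<partial>gaussian 0 (r - t) \<partial>gaussian x0 t)"
    by (subst nn_integral_gaussian_shift[of _ x0]) (auto simp: add.assoc intro!: G.borel_measurable_nn_integral)
  finally show ?thesis .
qed

end

subsection \<open>The occupation measure\<close>

lemma spacetime_borel [measurable]: "spacetime T \<in> sets borel"
  by (simp add: spacetime_def borel_open open_Times)

lemma open_spacetime: "open (spacetime T)"
  by (simp add: spacetime_def open_Times)

lemma space_nu [simp]: "space (nu T x0 \<beta>) = spacetime T"
  by (simp add: nu_def space_restrict_space)

lemma sets_nu: "sets (nu T x0 \<beta>) = sets (restrict_space borel (spacetime T))"
  by (simp add: nu_def sets_restrict_space)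

lemma measurable_nu: "borel_measurable (nu T x0 \<beta>) = borel_measurable (restrict_space borel (spacetime T))"
  by (intro measurable_cong_sets sets_nu refl)

lemma borel_measurable_nuI: "f \<in> borel_measurable borel \<Longrightarrow> f \<in> borel_measurable (nu T x0 \<beta>)"
  by (simp add: measurable_nu measurable_restrict_space1)

text \<open>The occupation measure lives on the trace of the Borel sets on
  \<open>spacetime T\<close>, while joint measurability and Fubini need Borel functions on the whole
  space. Extension by zero translates between the two.\<close>

definition ext :: "real \<Rightarrow> (real \<times> (real ^ 'n) \<Rightarrow> 'b::euclidean_space) \<Rightarrow> real \<times> (real ^ 'n) \<Rightarrow> 'b" where
  "ext T F p = indicator (spacetime T) p *\<^sub>R F p"

lemma ext_eq: "p \<in> spacetime T \<Longrightarrow> ext T F p = F p"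
  by (simp add: ext_def)

lemma ext_measurable: "F \<in> borel_measurable (nu T x0 \<beta>) \<longleftrightarrow> ext T F \<in> borel_measurable borel"
  unfolding ext_def by (simp add: measurable_nu borel_measurable_restrict_space_iff)

definition nu_density :: "real \<Rightarrow> real ^ 'n \<Rightarrow> real \<Rightarrow> real \<times> (real ^ 'n) \<Rightarrow> real" where
  "nu_density T x0 \<beta> p = exp (- 2 * \<beta> * (T - fst p)) * gauss_density x0 (fst p) (snd p)"

lemma nu_density_measurable [measurable]: "nu_density T x0 \<beta> \<in> borel_measurable borel"
  unfolding nu_density_def[abs_def] borel_prod[symmetric] by measurable

lemma nu_density_pos: "p \<in> spacetime T \<Longrightarrow> 0 < nu_density T x0 \<beta> p"
  by (auto simp: nu_density_def spacetime_def gauss_density_pos)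

lemma nu_eq: "nu T x0 \<beta> = density (restrict_space lborel (spacetime T)) (\<lambda>p. ennreal (nu_density T x0 \<beta> p))"
  by (simp add: nu_def nu_density_def case_prod_unfold)

lemma nn_integral_nu_lborel:
  assumes [measurable]: "h \<in> borel_measurable borel"
  shows "(\<integral>\<^sup>+p. h p \<partial>nu T x0 \<beta>) = (\<integral>\<^sup>+p. indicator (spacetime T) p * (ennreal (nu_density T x0 \<beta> p) * h p) \<partial>lborel)"
proof -
  have "(\<integral>\<^sup>+p. h p \<partial>nu T x0 \<beta>) = (\<integral>\<^sup>+p. ennreal (nu_density T x0 \<beta> p) * h p \<partial>restrict_space lborel (spacetime T))"
    unfolding nu_eq by (subst nn_integral_density) (auto intro!: measurable_restrict_space1)
  then show ?thesis by (subst (asm) nn_integral_restrict_space) (auto simp: mult.commute)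
qed

lemma nn_integral_nu:
  fixes x0 :: "real ^ 'n"
  assumes [measurable]: "h \<in> borel_measurable borel"
  shows "(\<integral>\<^sup>+p. h p \<partial>nu T x0 \<beta>)
    = (\<integral>\<^sup>+t. indicator {0<..<T} t * (ennreal (exp (- 2 * \<beta> * (T - t))) * (\<integral>\<^sup>+x. h (t, x) \<partial>gaussian x0 t)) \<partial>lborel)"
proof -
  have hm [measurable]: "h \<in> borel_measurable (borel \<Otimes>\<^sub>M borel)" by (simp add: borel_prod)
  have nm [measurable]: "nu_density T x0 \<beta> \<in> borel_measurable (borel \<Otimes>\<^sub>M borel)" by (simp add: borel_prod)
  have "(\<integral>\<^sup>+p. h p \<partial>nu T x0 \<beta>) = (\<integral>\<^sup>+p. indicator (spacetime T) p * (ennreal (nu_density T x0 \<beta> p) * h p) \<partial>(lborel \<Otimes>\<^sub>M lborel))"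
    by (subst nn_integral_nu_lborel) (simp_all add: lborel_prod)
  also have "\<dots> = (\<integral>\<^sup>+t. \<integral>\<^sup>+x. indicator {0<..<T} t * (ennreal (exp (- 2 * \<beta> * (T - t))) * (ennreal (gauss_density x0 t x) * h (t, x))) \<partial>lborel \<partial>lborel)"
  proof (subst lborel.nn_integral_fst[symmetric])
    have [measurable]: "(spacetime T :: (real \<times> (real ^ 'n)) set) \<in> sets (borel \<Otimes>\<^sub>M borel)"
      unfolding borel_prod by (rule spacetime_borel)
    show "(\<lambda>p. indicator (spacetime T) p * (ennreal (nu_density T x0 \<beta> p) * h p)) \<in> borel_measurable (lborel \<Otimes>\<^sub>M lborel)"
      by measurable
  qed (auto simp: nu_density_def spacetime_def ennreal_mult gauss_density_nonneg mult.assoc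
        split: split_indicator intro!: nn_integral_cong)
  also have "\<dots> = (\<integral>\<^sup>+t. indicator {0<..<T} t * (ennreal (exp (- 2 * \<beta> * (T - t))) * (\<integral>\<^sup>+x. h (t, x) \<partial>gaussian x0 t)) \<partial>lborel)"
    by (intro nn_integral_cong) (simp add: nn_integral_cmult nn_integral_gaussian)
  finally show ?thesis .
qed

text \<open>The density is strictly positive on space-time, so the null sets do not depend on
  \<open>\<beta>\<close> or \<open>x0\<close>. Statements about weak derivatives, made with Lebesgue
  measure, transfer to the occupation measure and back.\<close>

lemma AE_nu_iff:
  "(AE p in nu T x0 \<beta>. P p) \<longleftrightarrow> (AE p in lborel. p \<in> spacetime T \<longrightarrow> P p)"
proof -
  have "(AE p in nu T x0 \<beta>. P p) \<longleftrightarrow> (AE p in restrict_space lborel (spacetime T). 0 < ennreal (nu_density T x0 \<beta> p) \<longrightarrow> P p)"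
    unfolding nu_eq by (rule AE_density) (auto intro!: measurable_restrict_space1)
  also have "\<dots> \<longleftrightarrow> (AE p in lborel. p \<in> spacetime T \<longrightarrow> P p)"
    by (subst AE_restrict_space_iff) (auto simp: nu_density_pos intro!: AE_cong)
  finally show ?thesis .
qed

section \<open>A priori estimates for explicit solutions, degree by degree\<close>

subsection \<open>Estimates for a single mode\<close>

text \<open>All estimates come from integrating the derivative of \<open>w t\<^sup>m G\<^sup>2\<close> over \<open>[0, T]\<close>,
  where \<open>w(t) = exp (- 2 \<beta> (T - t))\<close> is the weight and \<open>G' = -\<phi>\<close>, \<open>G(T) = 0\<close>.\<close>

context
  fixes T \<beta> :: real and G \<phi> :: "real \<Rightarrow> real"
  assumes T: "0 < T" and \<phi>: "continuous_on {0..T} \<phi>"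
    and G: "\<And>t. t \<in> {0..T} \<Longrightarrow> (G has_real_derivative - \<phi> t) (at t within {0..T})"
    and GT: "G T = 0"
begin

private definition w where "w t = exp (- 2 * \<beta> * (T - t))"

lemma mode_cont: "continuous_on {0..T} G"
  by (rule DERIV_continuous_on[OF G])

lemma mode_energy:
  "integral {0..T} (\<lambda>t. 2 * \<beta> * (w t * t ^ m * (G t)\<^sup>2) + real m * (w t * t ^ (m - 1) * (G t)\<^sup>2)
      - 2 * (w t * t ^ m * (G t * \<phi> t))) \<le> 0"
proof -
  let ?H = "\<lambda>t. w t * t ^ m * (G t)\<^sup>2"
  have "((\<lambda>t. 2 * \<beta> * (w t * t ^ m * (G t)\<^sup>2) + real m * (w t * t ^ (m - 1) * (G t)\<^sup>2)
      - 2 * (w t * t ^ m * (G t * \<phi> t))) has_integral ?H T - ?H 0) {0..T}"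
  proof (rule fundamental_theorem_of_calculus)
    fix t assume t: "t \<in> {0..T}"
    show "(?H has_vector_derivative 2 * \<beta> * (w t * t ^ m * (G t)\<^sup>2) + real m * (w t * t ^ (m - 1) * (G t)\<^sup>2)
      - 2 * (w t * t ^ m * (G t * \<phi> t))) (at t within {0..T})"
    proof -
      have 1: "(w has_real_derivative 2 * \<beta> * w t) (at t within {0..T})"
        unfolding w_def by (auto intro!: derivative_eq_intros)
      have 2: "((\<lambda>t. t ^ m) has_real_derivative real m * t ^ (m - 1)) (at t within {0..T})"
        by (auto intro!: derivative_eq_intros)
      have 3: "((\<lambda>t. (G t)\<^sup>2) has_real_derivative 2 * G t * - \<phi> t) (at t within {0..T})"
        using DERIV_power[OF G[OF t], of 2] by (simp add: mult_ac)
      from DERIV_mult[OF DERIV_mult[OF 1 2] 3] show ?thesis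
        unfolding has_real_derivative_iff_has_vector_derivative[symmetric]
        by (rule DERIV_cong) (simp add: algebra_simps)
    qed
  qed (use T in simp)
  then have "integral {0..T} (\<lambda>t. 2 * \<beta> * (w t * t ^ m * (G t)\<^sup>2) + real m * (w t * t ^ (m - 1) * (G t)\<^sup>2)
      - 2 * (w t * t ^ m * (G t * \<phi> t))) = ?H T - ?H 0" by (rule integral_unique)
  \<comment> \<open>The end T contributes nothing since \<open>G T = 0\<close>, and the end 0 enters
    with a favourable sign. It is really present for \<open>m = 0\<close>, where
    \<open>0 ^ 0 = 1\<close>.\<close>
  also have "\<dots> \<le> 0" by (simp add: GT w_def)
  finally show ?thesis .
qed

lemma mode_integrable:
  "(\<lambda>t. w t * t ^ m * (G t)\<^sup>2) integrable_on {0..T}"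
  "(\<lambda>t. w t * t ^ m * (\<phi> t)\<^sup>2) integrable_on {0..T}"
  "(\<lambda>t. w t * t ^ m * (G t * \<phi> t)) integrable_on {0..T}"
  unfolding w_def
  by (intro integrable_continuous_real continuous_intros mode_cont \<phi>)+

lemma mode_energy':
  "2 * \<beta> * integral {0..T} (\<lambda>t. w t * t ^ m * (G t)\<^sup>2) + real m * integral {0..T} (\<lambda>t. w t * t ^ (m - 1) * (G t)\<^sup>2)
    \<le> 2 * integral {0..T} (\<lambda>t. w t * t ^ m * (G t * \<phi> t))"
proof -
  note i = mode_integrable[of m] mode_integrable(1)[of "m - 1"]
  have "integral {0..T} (\<lambda>t. 2 * \<beta> * (w t * t ^ m * (G t)\<^sup>2) + real m * (w t * t ^ (m - 1) * (G t)\<^sup>2)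
      - 2 * (w t * t ^ m * (G t * \<phi> t)))
    = 2 * \<beta> * integral {0..T} (\<lambda>t. w t * t ^ m * (G t)\<^sup>2) + real m * integral {0..T} (\<lambda>t. w t * t ^ (m - 1) * (G t)\<^sup>2)
      - 2 * integral {0..T} (\<lambda>t. w t * t ^ m * (G t * \<phi> t))"
    by (subst integral_diff integral_add integral_mult_right;
        (intro integrable_add integrable_on_mult_right i)?)+ simp
  with mode_energy[of m] show ?thesis by linarith
qed

text \<open>Young's inequality with parameter \<open>\<beta>\<close> spends half of the coefficient
  \<open>2 * \<beta>\<close> on the left. Both surviving terms are nonnegative: the first alone
  yields the bound \<open>1 / \<beta>\<^sup>2\<close> for the solution, the second alone the bound
  \<open>1 / \<beta>\<close> for its gradient.\<close>

lemma mode_estimate_01: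
  assumes \<beta>: "0 < \<beta>"
  shows "\<beta> * integral {0..T} (\<lambda>t. w t * t ^ m * (G t)\<^sup>2) + real m * integral {0..T} (\<lambda>t. w t * t ^ (m - 1) * (G t)\<^sup>2)
    \<le> (1 / \<beta>) * integral {0..T} (\<lambda>t. w t * t ^ m * (\<phi> t)\<^sup>2)"
proof -
  have "2 * integral {0..T} (\<lambda>t. w t * t ^ m * (G t * \<phi> t))
      = integral {0..T} (\<lambda>t. 2 * (w t * t ^ m * (G t * \<phi> t)))" by simp
  also have "\<dots> \<le> integral {0..T} (\<lambda>t. \<beta> * (w t * t ^ m * (G t)\<^sup>2) + (1 / \<beta>) * (w t * t ^ m * (\<phi> t)\<^sup>2))"
  proof (rule integral_le)
    fix t assume t: "t \<in> {0..T}"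
    have "2 * (G t * \<phi> t) \<le> \<beta> * (G t)\<^sup>2 + (1 / \<beta>) * (\<phi> t)\<^sup>2"
    proof -
      have "\<beta> * (G t)\<^sup>2 + (1 / \<beta>) * (\<phi> t)\<^sup>2 - 2 * (G t * \<phi> t) = (\<beta> * G t - \<phi> t)\<^sup>2 / \<beta>"
        using \<beta> by (simp add: power2_eq_square field_simps)
      also have "\<dots> \<ge> 0" using \<beta> by simp
      finally show ?thesis by simp
    qed
    from mult_left_mono[OF this, of "w t * t ^ m"] t
    show "2 * (w t * t ^ m * (G t * \<phi> t)) \<le> \<beta> * (w t * t ^ m * (G t)\<^sup>2) + (1 / \<beta>) * (w t * t ^ m * (\<phi> t)\<^sup>2)"
      by (simp add: w_def algebra_simps)
  qed (intro integrable_add integrable_on_mult_right mode_integrable)+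
  also have "\<dots> = \<beta> * integral {0..T} (\<lambda>t. w t * t ^ m * (G t)\<^sup>2) + (1 / \<beta>) * integral {0..T} (\<lambda>t. w t * t ^ m * (\<phi> t)\<^sup>2)"
    by (subst integral_add; (intro integrable_on_mult_right mode_integrable)?) simp
  finally show ?thesis using mode_energy'[of m] by (simp add: algebra_simps)
qed

text \<open>Hardy's inequality. In degree \<open>n = m + 2\<close> it gives the constant \<open>4 n / (n - 1)\<close>, which is largest
  for \<open>n = 2\<close>; this is the origin of the factor \<open>2 sqrt 2\<close>.\<close>

lemma mode_estimate_2:
  assumes \<beta>: "0 \<le> \<beta>"
  shows "real (Suc (Suc m)) * real (Suc m) * integral {0..T} (\<lambda>t. w t * t ^ m * (G t)\<^sup>2)
    \<le> 8 * integral {0..T} (\<lambda>t. w t * t ^ Suc (Suc m) * (\<phi> t)\<^sup>2)"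
proof -
  let ?A = "integral {0..T} (\<lambda>t. w t * t ^ m * (G t)\<^sup>2)"
  let ?C = "integral {0..T} (\<lambda>t. w t * t ^ Suc (Suc m) * (\<phi> t)\<^sup>2)"
  \<comment> \<open>In terms of the degree \<open>n = m + 2\<close> of the chaos component,
    \<open>c\<close> is \<open>n - 1\<close>.\<close>
  define c where "c = real (Suc m)"
  have c: "1 \<le> c" by (simp add: c_def)
  have "2 * integral {0..T} (\<lambda>t. w t * t ^ Suc m * (G t * \<phi> t))
      = integral {0..T} (\<lambda>t. 2 * (w t * t ^ Suc m * (G t * \<phi> t)))" by simp
  \<comment> \<open>Young's inequality with weights \<open>c / 2\<close> and \<open>2 / c\<close>
    absorbs half of the term \<open>c * ?A\<close> from the energy inequality. What remains is
    Hardy's inequality \<open>c * c * ?A \<le> 4 * ?C\<close>.\<close>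
  also have "\<dots> \<le> integral {0..T} (\<lambda>t. (c / 2) * (w t * t ^ m * (G t)\<^sup>2) + (2 / c) * (w t * t ^ Suc (Suc m) * (\<phi> t)\<^sup>2))"
  proof (rule integral_le)
    fix t assume t: "t \<in> {0..T}"
    have "2 * (t * (G t * \<phi> t)) \<le> (c / 2) * (G t)\<^sup>2 + (2 / c) * (t * t * (\<phi> t)\<^sup>2)"
    proof -
      have "(c / 2) * (G t)\<^sup>2 + (2 / c) * (t * t * (\<phi> t)\<^sup>2) - 2 * (t * (G t * \<phi> t)) = (c * G t - 2 * t * \<phi> t)\<^sup>2 / (2 * c)"
        using c by (simp add: power2_eq_square field_simps)
      also have "\<dots> \<ge> 0" using c by simp
      finally show ?thesis by simp
    qed
    from mult_left_mono[OF this, of "w t * t ^ m"] t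
    show "2 * (w t * t ^ Suc m * (G t * \<phi> t)) \<le> (c / 2) * (w t * t ^ m * (G t)\<^sup>2) + (2 / c) * (w t * t ^ Suc (Suc m) * (\<phi> t)\<^sup>2)"
      by (simp add: w_def algebra_simps)
  qed (intro integrable_add integrable_on_mult_right mode_integrable)+
  also have "\<dots> = (c / 2) * ?A + (2 / c) * ?C"
    by (subst integral_add; (intro integrable_on_mult_right mode_integrable)?) simp
  finally have "2 * integral {0..T} (\<lambda>t. w t * t ^ Suc m * (G t * \<phi> t)) \<le> (c / 2) * ?A + (2 / c) * ?C" .
  moreover have "0 \<le> 2 * \<beta> * integral {0..T} (\<lambda>t. w t * t ^ Suc m * (G t)\<^sup>2)"
    using \<beta> by (intro mult_nonneg_nonneg integral_nonneg mode_integrable) (auto simp: w_def)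
  ultimately have "c * ?A \<le> (c / 2) * ?A + (2 / c) * ?C"
    using mode_energy'[of "Suc m"] by (simp add: c_def)
  then have "c * c * ?A \<le> 4 * ?C" using c by (simp add: field_simps)
  moreover have "0 \<le> ?C" by (intro integral_nonneg mode_integrable) (auto simp: w_def)
  moreover have "0 \<le> ?A" by (intro integral_nonneg mode_integrable) (auto simp: w_def)
  \<comment> \<open>This is \<open>n \<le> 2 * (n - 1)\<close>, with equality exactly for
    \<open>n = 2\<close>; it doubles the 4 to the uniform constant 8.\<close>
  then have "(c + 1) * c * ?A \<le> (2 * c) * c * ?A" using c by (intro mult_right_mono) auto
  ultimately have "(c + 1) * c * ?A \<le> 8 * ?C" by simp
  then show ?thesis by (simp add: c_def add.commute)
qed

lemmas mode_estimates = mode_estimate_01[unfolded w_def] mode_estimate_2[unfolded w_def]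

end

subsection \<open>Trigonometric solutions of the heat equation\<close>

text \<open>The Gram entry of two waves is half of
  \<open>cos (a - b) * exp c + cos (a + b) * exp (- c)\<close>. In its power series even degrees
  collect the product of cosines and odd degrees the product of sines of the two phases.\<close>

definition parity_trig :: "nat \<Rightarrow> real \<Rightarrow> real" where
  "parity_trig n \<theta> = (if even n then cos \<theta> else sin \<theta>)"

lemma parity_trig_mult:
  "parity_trig n a * parity_trig n b = (cos (a - b) + (-1) ^ n * cos (a + b)) / 2"
  by (simp add: parity_trig_def cos_add cos_diff)

text \<open>A quarter turn exchanges cosine and sine up to a sign, and the sign cancels in the
  product. Differentiation thus raises the parity index by one.\<close>

lemma parity_trig_shift:
  "parity_trig n (a + pi / 2) * parity_trig n (b + pi / 2) = parity_trig (Suc n) a * parity_trig (Suc n) b"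
  by (simp add: parity_trig_def cos_add sin_add)

text \<open>Up to the factor \<open>t\<^sup>n / n!\<close> this is the squared norm in \<open>L\<^sup>2(\<mu>\<^sub>t)\<close> of the \<open>n\<close>-th Wiener
  chaos component of a combination of the waves \<open>exp (t \<bar>l\<bar>\<^sup>2 / 2) cos (l \<bullet> (x - x0) + \<theta>)\<close>.\<close>

definition chaos :: "nat \<Rightarrow> nat \<Rightarrow> (nat \<Rightarrow> real) \<Rightarrow> (nat \<Rightarrow> real ^ 'n) \<Rightarrow> (nat \<Rightarrow> real) \<Rightarrow> real" where
  "chaos N n A l \<theta> = (\<Sum>i<N. \<Sum>j<N. A i * A j * (l i \<bullet> l j) ^ n * (parity_trig n (\<theta> i) * parity_trig n (\<theta> j)))"

text \<open>The component, at the index word \<open>p\<close>, of the tensor obtained by summing the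
  n-th tensor powers of the frequencies \<open>l i\<close> with coefficients. It is linear in
  \<open>A\<close>, so it turns the vector of time coefficients into one scalar function to which
  the one-dimensional estimates apply.\<close>

definition mode :: "nat \<Rightarrow> nat \<Rightarrow> (nat \<Rightarrow> real ^ 'n) \<Rightarrow> (nat \<Rightarrow> real) \<Rightarrow> (nat \<Rightarrow> 'n) \<Rightarrow> (nat \<Rightarrow> real) \<Rightarrow> real" where
  "mode N n l \<theta> p A = (\<Sum>i<N. A i * (parity_trig n (\<theta> i) * (\<Prod>m<n. l i $ p m)))"

abbreviation words :: "nat \<Rightarrow> (nat \<Rightarrow> 'n) set" where
  "words n \<equiv> PiE {..<n} (\<lambda>_. UNIV)"

lemma inner_power_eq_sum_words:
  fixes a b :: "real ^ 'n"
  shows "(a \<bullet> b) ^ n = (\<Sum>p\<in>words n. (\<Prod>m<n. a $ p m) * (\<Prod>m<n. b $ p m))"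
proof -
  have "(a \<bullet> b) ^ n = (\<Prod>m<n. \<Sum>k\<in>(UNIV::'n set). a $ k * b $ k)" by (simp add: inner_vec_def)
  also have "\<dots> = (\<Sum>p\<in>words n. \<Prod>m<n. a $ p m * b $ p m)" by (rule prod_sum_PiE) auto
  finally show ?thesis by (simp add: prod.distrib)
qed

text \<open>The form is positive because \<open>(a \<bullet> b)\<^sup>n\<close> is the inner product of the \<open>n\<close>-th tensor powers.\<close>

lemma chaos_eq_modes:
  "chaos N n A l \<theta> = (\<Sum>p\<in>words n. (mode N n l \<theta> p A)\<^sup>2)"
proof -
  have "chaos N n A l \<theta> = (\<Sum>i<N. \<Sum>j<N. \<Sum>p\<in>words n.
      (A i * (parity_trig n (\<theta> i) * (\<Prod>m<n. l i $ p m))) * (A j * (parity_trig n (\<theta> j) * (\<Prod>m<n. l j $ p m))))"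
    by (simp add: chaos_def inner_power_eq_sum_words sum_distrib_left sum_distrib_right mult_ac)
  also have "\<dots> = (\<Sum>p\<in>words n. \<Sum>i<N. \<Sum>j<N.
      (A i * (parity_trig n (\<theta> i) * (\<Prod>m<n. l i $ p m))) * (A j * (parity_trig n (\<theta> j) * (\<Prod>m<n. l j $ p m))))"
    by (subst (2) sum.swap, subst sum.swap) simp
  also have "\<dots> = (\<Sum>p\<in>words n. (mode N n l \<theta> p A)\<^sup>2)"
    by (simp add: mode_def power2_eq_square sum_product)
  finally show ?thesis .
qed

lemma chaos_nonneg: "0 \<le> chaos N n A l \<theta>"
  by (auto simp: chaos_eq_modes intro: sum_nonneg)

text \<open>Summing \<open>l i $ k * l j $ k\<close> over \<open>k\<close> supplies one more factor
  \<open>l i \<bullet> l j\<close>, and the phase shift raises the parity in step with it.\<close>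

lemma chaos_deriv:
  "(\<Sum>k\<in>UNIV. chaos N n (\<lambda>i. A i * l i $ k) l (\<lambda>i. \<theta> i + pi / 2)) = chaos N (Suc n) A l \<theta>"
proof -
  have "(\<Sum>k\<in>UNIV. chaos N n (\<lambda>i. A i * l i $ k) l (\<lambda>i. \<theta> i + pi / 2))
      = (\<Sum>k\<in>UNIV. \<Sum>i<N. \<Sum>j<N. (A i * A j * (l i \<bullet> l j) ^ n * (parity_trig (Suc n) (\<theta> i) * parity_trig (Suc n) (\<theta> j))) * (l i $ k * l j $ k))"
    unfolding chaos_def parity_trig_shift by (simp add: mult_ac)
  also have "\<dots> = (\<Sum>i<N. \<Sum>j<N. \<Sum>k\<in>UNIV. (A i * A j * (l i \<bullet> l j) ^ n * (parity_trig (Suc n) (\<theta> i) * parity_trig (Suc n) (\<theta> j))) * (l i $ k * l j $ k))"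
    by (subst sum.swap, subst (2) sum.swap) simp
  also have "\<dots> = chaos N (Suc n) A l \<theta>"
    unfolding chaos_def
    by (intro sum.cong refl, simp only: sum_distrib_left[symmetric]) (simp add: inner_vec_def mult_ac)
  finally show ?thesis .
qed

text \<open>A solution of the backward heat equation: the exponential compensates the damping by the
  semigroup. Centring at \<open>x0\<close> removes the starting point from all Gram
  matrices.\<close>

definition heat_wave :: "real ^ 'n \<Rightarrow> real ^ 'n \<Rightarrow> real \<Rightarrow> real \<Rightarrow> real ^ 'n \<Rightarrow> real" where
  "heat_wave x0 l \<theta> t x = exp (t * (norm l)\<^sup>2 / 2) * cos (l \<bullet> (x - x0) + \<theta>)"

lemma heat_wave_measurable [measurable (raw)]:
  "f \<in> borel_measurable M \<Longrightarrow> g \<in> borel_measurable M \<Longrightarrow> (\<lambda>x. heat_wave x0 l \<theta> (f x) (g x)) \<in> borel_measurable M"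
proof -
  assume [measurable]: "f \<in> borel_measurable M" "g \<in> borel_measurable M"
  have "(\<lambda>x. (f x, g x)) \<in> borel_measurable M" by measurable
  moreover have "continuous_on UNIV (\<lambda>p. heat_wave x0 l \<theta> (fst p) (snd p))"
    unfolding heat_wave_def by (intro continuous_intros) auto
  ultimately have "(\<lambda>x. heat_wave x0 l \<theta> (fst (f x, g x)) (snd (f x, g x))) \<in> borel_measurable M"
    by (rule borel_measurable_continuous_on[rotated])
  then show "(\<lambda>x. heat_wave x0 l \<theta> (f x) (g x)) \<in> borel_measurable M" by simp
qed

lemma heat_wave_bounded: "\<bar>heat_wave x0 l \<theta> t x\<bar> \<le> exp (t * (norm l)\<^sup>2 / 2)"
  using mult_left_mono[OF abs_cos_le_one, of "exp (t * (norm l)\<^sup>2 / 2)" "l \<bullet> (x - x0) + \<theta>"]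
  by (simp add: heat_wave_def abs_mult)

text \<open>The product-to-sum formula gives frequencies \<open>l - l'\<close> and
  \<open>l + l'\<close>. Their Gaussian damping combines with the growth factors of the two waves,
  the squares of \<open>l\<close> and \<open>l'\<close> cancel, and only the inner product
  survives.\<close>

lemma heat_wave_gram:
  assumes t: "0 < t"
  shows "(LINT x|gaussian x0 t. heat_wave x0 l \<theta> t x * heat_wave x0 l' \<theta>' t x)
    = (cos (\<theta> - \<theta>') * exp (t * (l \<bullet> l')) + cos (\<theta> + \<theta>') * exp (- (t * (l \<bullet> l')))) / 2"
    (is "?L = _")
proof -
  define c where "c = exp (t * (norm l)\<^sup>2 / 2) * exp (t * (norm l')\<^sup>2 / 2)"
  have i: "integrable (gaussian x0 t) (\<lambda>x. cos (v \<bullet> (x - x0) + \<eta>))" for v :: "real ^ 'a" and \<eta>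
    by (intro gaussian_integrable_bounded[OF t, of _ 1]) auto
  have "?L = (LINT x|gaussian x0 t. (c / 2) * (cos ((l - l') \<bullet> (x - x0) + (\<theta> - \<theta>')) + cos ((l + l') \<bullet> (x - x0) + (\<theta> + \<theta>'))))"
  proof (intro Bochner_Integration.integral_cong refl)
    fix x
    have "heat_wave x0 l \<theta> t x * heat_wave x0 l' \<theta>' t x
        = c * (cos (l \<bullet> (x - x0) + \<theta>) * cos (l' \<bullet> (x - x0) + \<theta>'))" by (simp add: heat_wave_def c_def)
    also have "cos (l \<bullet> (x - x0) + \<theta>) * cos (l' \<bullet> (x - x0) + \<theta>')
        = (cos ((l \<bullet> (x - x0) + \<theta>) - (l' \<bullet> (x - x0) + \<theta>')) + cos ((l \<bullet> (x - x0) + \<theta>) + (l' \<bullet> (x - x0) + \<theta>'))) / 2"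
      by (rule cos_times_cos)
    also have "(l \<bullet> (x - x0) + \<theta>) - (l' \<bullet> (x - x0) + \<theta>') = (l - l') \<bullet> (x - x0) + (\<theta> - \<theta>')"
      by (simp add: inner_diff_left)
    also have "(l \<bullet> (x - x0) + \<theta>) + (l' \<bullet> (x - x0) + \<theta>') = (l + l') \<bullet> (x - x0) + (\<theta> + \<theta>')"
      by (simp add: inner_add_left)
    finally show "heat_wave x0 l \<theta> t x * heat_wave x0 l' \<theta>' t x
        = (c / 2) * (cos ((l - l') \<bullet> (x - x0) + (\<theta> - \<theta>')) + cos ((l + l') \<bullet> (x - x0) + (\<theta> + \<theta>')))" by simp
  qed
  also have "\<dots> = (c / 2) * (exp (- (t * (norm (l - l'))\<^sup>2 / 2)) * cos (\<theta> - \<theta>') + exp (- (t * (norm (l + l'))\<^sup>2 / 2)) * cos (\<theta> + \<theta>'))"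
    using i by (simp add: gaussian_cos_centered[OF t])
  also have "\<dots> = (cos (\<theta> - \<theta>') * (c * exp (- (t * (norm (l - l'))\<^sup>2 / 2))) + cos (\<theta> + \<theta>') * (c * exp (- (t * (norm (l + l'))\<^sup>2 / 2)))) / 2"
    by (simp add: algebra_simps)
  also have "c * exp (- (t * (norm (l - l'))\<^sup>2 / 2)) = exp (t * (l \<bullet> l'))"
    unfolding c_def exp_add[symmetric]
    by (simp add: power2_norm_eq_inner inner_diff_left inner_diff_right inner_commute field_simps)
  also have "c * exp (- (t * (norm (l + l'))\<^sup>2 / 2)) = exp (- (t * (l \<bullet> l')))"
    unfolding c_def exp_add[symmetric]
    by (simp add: power2_norm_eq_inner inner_add_left inner_add_right inner_commute field_simps)
  finally show ?thesis .
qed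

lemma heat_wave_gram_sums:
  assumes t: "0 < t"
  shows "(\<lambda>n. t ^ n / fact n * (l \<bullet> l') ^ n * (parity_trig n \<theta> * parity_trig n \<theta>'))
    sums (LINT x|gaussian x0 t. heat_wave x0 l \<theta> t x * heat_wave x0 l' \<theta>' t x)"
proof -
  let ?c = "t * (l \<bullet> l')"
  have e: "(\<lambda>n. c ^ n / fact n) sums exp c" for c :: real
    using exp_converges[of c] by (simp add: field_simps)
  have "(\<lambda>n. (cos (\<theta> - \<theta>') * (?c ^ n / fact n) + cos (\<theta> + \<theta>') * ((- ?c) ^ n / fact n)) / 2)
    sums ((cos (\<theta> - \<theta>') * exp ?c + cos (\<theta> + \<theta>') * exp (- ?c)) / 2)"
    by (intro sums_divide sums_add sums_mult e)
  moreover have "(cos (\<theta> - \<theta>') * (?c ^ n / fact n) + cos (\<theta> + \<theta>') * ((- ?c) ^ n / fact n)) / 2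
      = t ^ n / fact n * (l \<bullet> l') ^ n * (parity_trig n \<theta> * parity_trig n \<theta>')" for n
    by (simp add: parity_trig_mult power_mult_distrib power_minus[of "t * _"] field_simps)
  ultimately show ?thesis by (simp add: heat_wave_gram[OF t])
qed

text \<open>Since \<open>chaos\<close> is nonnegative, the series can be read in
  \<open>ennreal\<close>, where it may later be interchanged with time integrals and finite sums
  without summability conditions.\<close>

lemma nn_integral_heat_wave_sum_sq:
  assumes t: "0 < t"
  shows "(\<integral>\<^sup>+x. ennreal ((\<Sum>i<N. A i * heat_wave x0 (l i) (\<theta> i) t x)\<^sup>2) \<partial>gaussian x0 t)
    = (\<Sum>n. ennreal (t ^ n / fact n * chaos N n A l \<theta>))"
proof -
  have i: "integrable (gaussian x0 t) (\<lambda>x. heat_wave x0 (l i) (\<theta> i) t x * heat_wave x0 (l j) (\<theta> j) t x)" for i j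
    by (rule gaussian_integrable_bounded[OF t, of _ "exp (t * (norm (l i))\<^sup>2 / 2) * exp (t * (norm (l j))\<^sup>2 / 2)"])
       (auto simp: abs_mult intro!: mult_mono heat_wave_bounded)
  have eq: "(\<Sum>i<N. A i * heat_wave x0 (l i) (\<theta> i) t x)\<^sup>2
      = (\<Sum>i<N. \<Sum>j<N. A i * A j * (heat_wave x0 (l i) (\<theta> i) t x * heat_wave x0 (l j) (\<theta> j) t x))" for x
    by (simp add: power2_eq_square sum_product mult_ac)
  have int: "integrable (gaussian x0 t) (\<lambda>x. (\<Sum>i<N. A i * heat_wave x0 (l i) (\<theta> i) t x)\<^sup>2)"
    unfolding eq using i by (intro Bochner_Integration.integrable_sum integrable_mult_right)
  have "(\<lambda>n. \<Sum>i<N. \<Sum>j<N. A i * A j * (t ^ n / fact n * (l i \<bullet> l j) ^ n * (parity_trig n (\<theta> i) * parity_trig n (\<theta> j))))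
    sums (\<Sum>i<N. \<Sum>j<N. A i * A j * (LINT x|gaussian x0 t. heat_wave x0 (l i) (\<theta> i) t x * heat_wave x0 (l j) (\<theta> j) t x))"
    by (intro sums_sum sums_mult heat_wave_gram_sums t)
  also have "(\<lambda>n. \<Sum>i<N. \<Sum>j<N. A i * A j * (t ^ n / fact n * (l i \<bullet> l j) ^ n * (parity_trig n (\<theta> i) * parity_trig n (\<theta> j))))
    = (\<lambda>n. t ^ n / fact n * chaos N n A l \<theta>)"
    by (simp add: chaos_def sum_distrib_left mult_ac)
  also have "(\<Sum>i<N. \<Sum>j<N. A i * A j * (LINT x|gaussian x0 t. heat_wave x0 (l i) (\<theta> i) t x * heat_wave x0 (l j) (\<theta> j) t x))
    = (LINT x|gaussian x0 t. (\<Sum>i<N. A i * heat_wave x0 (l i) (\<theta> i) t x)\<^sup>2)"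
    unfolding eq using i by (simp add: Bochner_Integration.integral_sum)
  finally have s: "(\<lambda>n. t ^ n / fact n * chaos N n A l \<theta>) sums (LINT x|gaussian x0 t. (\<Sum>i<N. A i * heat_wave x0 (l i) (\<theta> i) t x)\<^sup>2)" .
  have "(\<Sum>n. ennreal (t ^ n / fact n * chaos N n A l \<theta>)) = ennreal (LINT x|gaussian x0 t. (\<Sum>i<N. A i * heat_wave x0 (l i) (\<theta> i) t x)\<^sup>2)"
    using s t by (simp add: suminf_ennreal2 chaos_nonneg sums_iff)
  also have "\<dots> = (\<integral>\<^sup>+x. ennreal ((\<Sum>i<N. A i * heat_wave x0 (l i) (\<theta> i) t x)\<^sup>2) \<partial>gaussian x0 t)"
    using int by (intro nn_integral_eq_integral[symmetric]) auto
  finally show ?thesis by simp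
qed

definition wave_sum :: "real ^ 'n \<Rightarrow> nat \<Rightarrow> (nat \<Rightarrow> real \<Rightarrow> real) \<Rightarrow> (nat \<Rightarrow> real ^ 'n) \<Rightarrow> (nat \<Rightarrow> real) \<Rightarrow> real \<times> (real ^ 'n) \<Rightarrow> real" where
  "wave_sum x0 N A l \<theta> p = (\<Sum>i<N. A i (fst p) * heat_wave x0 (l i) (\<theta> i) (fst p) (snd p))"

text \<open>Differentiating a cosine in direction \<open>k\<close> multiplies by
  \<open>l i $ k\<close> and advances the phase by \<open>pi / 2\<close>. Each component is again a
  wave sum, so every result on wave sums applies to derivatives too.\<close>

definition wave_grad where
  "wave_grad x0 N A l \<theta> p = (\<chi> k. wave_sum x0 N (\<lambda>i t. A i t * l i $ k) l (\<lambda>i. \<theta> i + pi / 2) p)"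

definition wave_hess where
  "wave_hess x0 N A l \<theta> p = (\<chi> k. wave_grad x0 N (\<lambda>i t. A i t * l i $ k) l (\<lambda>i. \<theta> i + pi / 2) p)"

lemma wave_sum_continuous:
  assumes "\<And>i. continuous_on UNIV (A i)"
  shows "continuous_on UNIV (wave_sum x0 N A l \<theta>)"
  unfolding wave_sum_def[abs_def] heat_wave_def
  by (intro continuous_intros continuous_on_compose2[OF assms]) auto

lemma wave_sum_directional:
  "((\<lambda>s. wave_sum x0 N A l \<theta> (p + s *\<^sub>R (0, axis k 1))) has_real_derivative
    wave_grad x0 N A l \<theta> (p + s *\<^sub>R (0, axis k 1)) $ k) (at s)"
proof -
  have c: "cos (y + (\<eta> + pi / 2)) = - sin (y + \<eta>)" for y \<eta> :: real
    by (simp add: cos_add sin_add)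
  show ?thesis
    unfolding wave_grad_def wave_sum_def heat_wave_def vec_lambda_beta c
    by (auto intro!: derivative_eq_intros sum.cong
        simp: inner_add_right inner_diff_right inner_axis algebra_simps)
qed

lemma wave_sum_weak_deriv:
  assumes A: "\<And>i. continuous_on UNIV (A i)"
  shows "weak_deriv \<Omega> (0, axis k 1) (wave_sum x0 N A l \<theta>) (\<lambda>p. wave_grad x0 N A l \<theta> p $ k)"
proof (rule weak_deriv_classical[OF _ _ _ wave_sum_directional])
  have "(\<lambda>p. wave_grad x0 N A l \<theta> p $ k) = wave_sum x0 N (\<lambda>i t. A i t * l i $ k) l (\<lambda>i. \<theta> i + pi / 2)"
    by (simp add: wave_grad_def fun_eq_iff)
  then show "continuous_on UNIV (\<lambda>p. wave_grad x0 N A l \<theta> p $ k)"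
    by (simp only:) (intro wave_sum_continuous continuous_intros A)
qed (simp_all add: wave_sum_continuous A)

lemma norm_vec_sq:
  fixes z :: "'a::real_normed_vector ^ 'n"
  shows "(norm z)\<^sup>2 = (\<Sum>k\<in>UNIV. (norm (z $ k))\<^sup>2)"
  by (simp add: norm_vec_def L2_set_def sum_nonneg)

subsection \<open>Norms of trigonometric solutions\<close>

lemma nn_integral_Ioo_eq_integral:
  fixes f :: "real \<Rightarrow> real"
  assumes f: "continuous_on {a..b} f" "\<And>t. t \<in> {a..b} \<Longrightarrow> 0 \<le> f t"
  shows "(\<integral>\<^sup>+t. indicator {a<..<b} t * ennreal (f t) \<partial>lborel) = ennreal (integral {a..b} f)"
proof -
  have i: "integrable lborel (\<lambda>t. indicator {a..b} t *\<^sub>R f t)"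
    using f(1) by (intro borel_integrable_compact) auto
  have "AE t in lborel. t \<noteq> a" "AE t in lborel. t \<noteq> b" by (rule AE_lborel_singleton)+
  then have "(\<integral>\<^sup>+t. indicator {a<..<b} t * ennreal (f t) \<partial>lborel) = (\<integral>\<^sup>+t. ennreal (indicator {a..b} t *\<^sub>R f t) \<partial>lborel)"
    by (intro nn_integral_cong_AE) (auto split: split_indicator)
  also have "\<dots> = ennreal (LINT t|lborel. indicator {a..b} t *\<^sub>R f t)"
    using i f(2) by (intro nn_integral_eq_integral) (auto split: split_indicator)
  also have "(LINT t|lborel. indicator {a..b} t *\<^sub>R f t) = integral {a..b} f"
    using set_borel_integral_eq_integral(2)[of "{a..b}" f] i
    by (simp add: set_integrable_def set_lebesgue_integral_def)
  finally show ?thesis .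
qed

lemma chaos_continuous:
  assumes "\<And>i. continuous_on S (A i)"
  shows "continuous_on S (\<lambda>t. chaos N n (\<lambda>i. A i t) l \<theta>)"
  unfolding chaos_def by (intro continuous_intros assms)

text \<open>The power \<open>m\<close> of \<open>t\<close> and the degree \<open>n\<close> of the
  form are separate parameters, because each derivative raises the degree by one relative to the
  power.\<close>

definition weighted_chaos ::
  "real \<Rightarrow> real \<Rightarrow> nat \<Rightarrow> nat \<Rightarrow> nat \<Rightarrow> (nat \<Rightarrow> real \<Rightarrow> real) \<Rightarrow> (nat \<Rightarrow> real ^ 'n) \<Rightarrow> (nat \<Rightarrow> real) \<Rightarrow> real" where
  "weighted_chaos T \<beta> N m n A l \<theta> =
    integral {0..T} (\<lambda>t. exp (- 2 * \<beta> * (T - t)) * t ^ m * chaos N n (\<lambda>i. A i t) l \<theta>)"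

lemma weighted_chaos_integrable:
  assumes "\<And>i. continuous_on UNIV (A i)"
  shows "(\<lambda>t. exp (- 2 * \<beta> * (T - t)) * t ^ m * chaos N n (\<lambda>i. A i t) l \<theta>) integrable_on {0..T::real}"
  by (intro integrable_continuous_real continuous_intros chaos_continuous continuous_on_subset[OF assms]) auto

lemma weighted_chaos_nonneg:
  assumes "\<And>i. continuous_on UNIV (A i)"
  shows "0 \<le> weighted_chaos T \<beta> N m n A l \<theta>"
  unfolding weighted_chaos_def
  by (intro integral_nonneg weighted_chaos_integrable assms) (auto simp: chaos_nonneg)

lemma weighted_chaos_deriv:
  assumes A: "\<And>i. continuous_on UNIV (A i)"
  shows "(\<Sum>k\<in>UNIV. weighted_chaos T \<beta> N m n (\<lambda>i t. A i t * l i $ k) l (\<lambda>i. \<theta> i + pi / 2))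
    = weighted_chaos T \<beta> N m (Suc n) A l \<theta>"
  unfolding weighted_chaos_def chaos_deriv[symmetric] sum_distrib_left
  by (rule integral_sum[symmetric], simp, intro weighted_chaos_integrable continuous_intros A)

lemma nn_integral_nu_wave_sum:
  assumes A: "\<And>i. continuous_on UNIV (A i)"
  shows "(\<integral>\<^sup>+p. ennreal ((wave_sum x0 N A l \<theta> p)\<^sup>2) \<partial>nu T x0 \<beta>)
    = (\<Sum>n. ennreal (weighted_chaos T \<beta> N n n A l \<theta> / fact n))"
proof -
  have [measurable]: "wave_sum x0 N A l \<theta> \<in> borel_measurable borel"
    by (intro borel_measurable_continuous_onI wave_sum_continuous A)
  let ?f = "\<lambda>n t. exp (- 2 * \<beta> * (T - t)) * t ^ n * chaos N n (\<lambda>i. A i t) l \<theta>"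
  have [measurable]: "?f n \<in> borel_measurable borel" for n
    by (intro borel_measurable_continuous_onI continuous_intros chaos_continuous A)
  have "(\<integral>\<^sup>+p. ennreal ((wave_sum x0 N A l \<theta> p)\<^sup>2) \<partial>nu T x0 \<beta>)
    = (\<integral>\<^sup>+t. indicator {0<..<T} t * (ennreal (exp (- 2 * \<beta> * (T - t))) *
        (\<integral>\<^sup>+x. ennreal ((wave_sum x0 N A l \<theta> (t, x))\<^sup>2) \<partial>gaussian x0 t)) \<partial>lborel)"
    by (rule nn_integral_nu) measurable
  also have "\<dots> = (\<integral>\<^sup>+t. (\<Sum>n. indicator {0<..<T} t * ennreal (?f n t / fact n)) \<partial>lborel)"
  proof (intro nn_integral_cong)
    fix t :: real
    show "indicator {0<..<T} t * (ennreal (exp (- 2 * \<beta> * (T - t))) *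
        (\<integral>\<^sup>+x. ennreal ((wave_sum x0 N A l \<theta> (t, x))\<^sup>2) \<partial>gaussian x0 t))
      = (\<Sum>n. indicator {0<..<T} t * ennreal (?f n t / fact n))"
    proof (cases "t \<in> {0<..<T}")
      case True
      then have t: "0 < t" by simp
      have "ennreal (exp (- 2 * \<beta> * (T - t))) * ennreal (t ^ n / fact n * chaos N n (\<lambda>i. A i t) l \<theta>) = ennreal (?f n t / fact n)" for n
      proof (subst ennreal_mult[symmetric])
        show "0 \<le> t ^ n / fact n * chaos N n (\<lambda>i. A i t) l \<theta>"
          using t by (intro mult_nonneg_nonneg chaos_nonneg) auto
      qed (simp_all add: mult_ac)
      then show ?thesis using True t
        by (simp add: wave_sum_def nn_integral_heat_wave_sum_sq ennreal_suminf_cmult[symmetric] del: ennreal_suminf_cmult)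
    qed simp
  qed
  also have "\<dots> = (\<Sum>n. \<integral>\<^sup>+t. indicator {0<..<T} t * ennreal (?f n t / fact n) \<partial>lborel)"
    by (rule nn_integral_suminf) measurable
  also have "(\<lambda>n. \<integral>\<^sup>+t. indicator {0<..<T} t * ennreal (?f n t / fact n) \<partial>lborel)
      = (\<lambda>n. ennreal (weighted_chaos T \<beta> N n n A l \<theta> / fact n))"
  proof
    fix n
    have "(\<integral>\<^sup>+t. indicator {0<..<T} t * ennreal (?f n t / fact n) \<partial>lborel) = ennreal (integral {0..T} (\<lambda>t. ?f n t / fact n))"
      by (rule nn_integral_Ioo_eq_integral)
         (auto intro!: continuous_intros chaos_continuous continuous_on_subset[OF A] chaos_nonneg
            divide_nonneg_nonneg mult_nonneg_nonneg)
    then show "(\<integral>\<^sup>+t. indicator {0<..<T} t * ennreal (?f n t / fact n) \<partial>lborel)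
        = ennreal (weighted_chaos T \<beta> N n n A l \<theta> / fact n)"
      by (simp add: weighted_chaos_def)
  qed
  finally show ?thesis .
qed

lemma ennreal_norm_vec_sq:
  fixes z :: "'a::euclidean_space ^ 'n"
  shows "ennreal ((norm z)\<^sup>2) = (\<Sum>k\<in>UNIV. ennreal ((norm (z $ k))\<^sup>2))"
  by (simp add: norm_vec_sq)

lemma wave_grad_continuous:
  assumes A: "\<And>i. continuous_on UNIV (A i)"
  shows "continuous_on UNIV (wave_grad x0 N A l \<theta>)"
  unfolding wave_grad_def[abs_def]
  by (intro continuous_on_vec_lambda wave_sum_continuous continuous_intros A)

lemma wave_hess_continuous:
  assumes A: "\<And>i. continuous_on UNIV (A i)"
  shows "continuous_on UNIV (wave_hess x0 N A l \<theta>)"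
  unfolding wave_hess_def[abs_def]
  by (intro continuous_on_vec_lambda wave_grad_continuous continuous_intros A)

lemma nn_integral_nu_wave_grad:
  assumes A: "\<And>i. continuous_on UNIV (A i)"
  shows "(\<integral>\<^sup>+p. ennreal ((norm (wave_grad x0 N A l \<theta> p))\<^sup>2) \<partial>nu T x0 \<beta>)
    = (\<Sum>n. ennreal (weighted_chaos T \<beta> N n (Suc n) A l \<theta> / fact n))"
proof -
  have A': "continuous_on UNIV (\<lambda>t. A i t * l i $ k)" for i k by (intro continuous_intros A)
  have [measurable]: "wave_sum x0 N (\<lambda>i t. A i t * l i $ k) l (\<lambda>i. \<theta> i + pi / 2) \<in> borel_measurable (nu T x0 \<beta>)" for k
    by (intro borel_measurable_nuI borel_measurable_continuous_onI wave_sum_continuous A')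
  have "(\<integral>\<^sup>+p. ennreal ((norm (wave_grad x0 N A l \<theta> p))\<^sup>2) \<partial>nu T x0 \<beta>)
    = (\<Sum>k\<in>UNIV. \<integral>\<^sup>+p. ennreal ((wave_sum x0 N (\<lambda>i t. A i t * l i $ k) l (\<lambda>i. \<theta> i + pi / 2) p)\<^sup>2) \<partial>nu T x0 \<beta>)"
    unfolding ennreal_norm_vec_sq by (subst nn_integral_sum) (auto simp: wave_grad_def)
  also have "\<dots> = (\<Sum>k\<in>UNIV. \<Sum>n. ennreal (weighted_chaos T \<beta> N n n (\<lambda>i t. A i t * l i $ k) l (\<lambda>i. \<theta> i + pi / 2) / fact n))"
    by (intro sum.cong refl nn_integral_nu_wave_sum A')
  also have "\<dots> = (\<Sum>n. \<Sum>k\<in>UNIV. ennreal (weighted_chaos T \<beta> N n n (\<lambda>i t. A i t * l i $ k) l (\<lambda>i. \<theta> i + pi / 2) / fact n))"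
    by (rule suminf_sum[symmetric]) simp
  also have "\<dots> = (\<Sum>n. ennreal (\<Sum>k\<in>UNIV. weighted_chaos T \<beta> N n n (\<lambda>i t. A i t * l i $ k) l (\<lambda>i. \<theta> i + pi / 2) / fact n))"
    by (subst sum_ennreal) (auto intro!: divide_nonneg_nonneg weighted_chaos_nonneg A')
  also have "\<dots> = (\<Sum>n. ennreal (weighted_chaos T \<beta> N n (Suc n) A l \<theta> / fact n))"
    by (simp add: sum_divide_distrib[symmetric] weighted_chaos_deriv[OF A])
  finally show ?thesis .
qed

lemma nn_integral_nu_wave_hess:
  assumes A: "\<And>i. continuous_on UNIV (A i)"
  shows "(\<integral>\<^sup>+p. ennreal ((norm (wave_hess x0 N A l \<theta> p))\<^sup>2) \<partial>nu T x0 \<beta>)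
    = (\<Sum>n. ennreal (weighted_chaos T \<beta> N n (Suc (Suc n)) A l \<theta> / fact n))"
proof -
  have A': "continuous_on UNIV (\<lambda>t. A i t * l i $ k)" for i k by (intro continuous_intros A)
  have [measurable]: "wave_grad x0 N (\<lambda>i t. A i t * l i $ k) l (\<lambda>i. \<theta> i + pi / 2) \<in> borel_measurable (nu T x0 \<beta>)" for k
    by (intro borel_measurable_nuI borel_measurable_continuous_onI wave_grad_continuous A')
  have "(\<integral>\<^sup>+p. ennreal ((norm (wave_hess x0 N A l \<theta> p))\<^sup>2) \<partial>nu T x0 \<beta>)
    = (\<Sum>k\<in>UNIV. \<integral>\<^sup>+p. ennreal ((norm (wave_grad x0 N (\<lambda>i t. A i t * l i $ k) l (\<lambda>i. \<theta> i + pi / 2) p))\<^sup>2) \<partial>nu T x0 \<beta>)"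
    unfolding ennreal_norm_vec_sq[of "wave_hess x0 N A l \<theta> _"] by (subst nn_integral_sum) (auto simp: wave_hess_def)
  also have "\<dots> = (\<Sum>k\<in>UNIV. \<Sum>n. ennreal (weighted_chaos T \<beta> N n (Suc n) (\<lambda>i t. A i t * l i $ k) l (\<lambda>i. \<theta> i + pi / 2) / fact n))"
    by (intro sum.cong refl nn_integral_nu_wave_grad A')
  also have "\<dots> = (\<Sum>n. \<Sum>k\<in>UNIV. ennreal (weighted_chaos T \<beta> N n (Suc n) (\<lambda>i t. A i t * l i $ k) l (\<lambda>i. \<theta> i + pi / 2) / fact n))"
    by (rule suminf_sum[symmetric]) simp
  also have "\<dots> = (\<Sum>n. ennreal (\<Sum>k\<in>UNIV. weighted_chaos T \<beta> N n (Suc n) (\<lambda>i t. A i t * l i $ k) l (\<lambda>i. \<theta> i + pi / 2) / fact n))"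
    by (subst sum_ennreal) (auto intro!: divide_nonneg_nonneg weighted_chaos_nonneg A')
  also have "\<dots> = (\<Sum>n. ennreal (weighted_chaos T \<beta> N n (Suc (Suc n)) A l \<theta> / fact n))"
    by (simp add: sum_divide_distrib[symmetric] weighted_chaos_deriv[OF A])
  finally show ?thesis .
qed

lemma weighted_chaos_eq_modes:
  assumes A: "\<And>i. continuous_on UNIV (A i)"
  shows "weighted_chaos T \<beta> N m n A l \<theta>
    = (\<Sum>p\<in>words n. integral {0..T} (\<lambda>t. exp (- 2 * \<beta> * (T - t)) * t ^ m * (mode N n l \<theta> p (\<lambda>i. A i t))\<^sup>2))"
  unfolding weighted_chaos_def chaos_eq_modes sum_distrib_left mode_def
  by (intro integral_sum integrable_continuous_real continuous_intros continuous_on_subset[OF A])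
     (auto intro!: finite_PiE)

text \<open>Differentiation annihilates the lowest degrees, so estimates of derivatives only meet a
  tail of the series for the norm of the source.\<close>

lemma suminf_shift_le:
  fixes f :: "nat \<Rightarrow> ennreal"
  shows "(\<Sum>n. f (n + k)) \<le> (\<Sum>n. f n)"
  by (subst (2) suminf_offset[of _ k]) (auto simp: add_increasing)

lemma ennreal_le_multI:
  "x \<le> c * y \<Longrightarrow> 0 \<le> c \<Longrightarrow> 0 \<le> y \<Longrightarrow> ennreal x \<le> ennreal c * ennreal y"
  by (subst ennreal_mult[symmetric]) (auto intro: ennreal_leI)

context
  fixes T \<beta> :: real and N :: nat and A a :: "nat \<Rightarrow> real \<Rightarrow> real"
    and l :: "nat \<Rightarrow> real ^ 'n" and \<theta> :: "nat \<Rightarrow> real"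
  assumes T: "0 < T" and \<beta>: "0 < \<beta>"
    and A: "\<And>i. continuous_on UNIV (A i)" and a: "\<And>i. continuous_on UNIV (a i)"
    and der: "\<And>i t. t \<in> {0..T} \<Longrightarrow> (A i has_real_derivative - a i t) (at t within {0..T})"
    and AT: "\<And>i. A i T = 0"
begin

lemma mode_assms:
  "continuous_on {0..T} (\<lambda>t. mode N n l \<theta> p (\<lambda>i. a i t))"
  "t \<in> {0..T} \<Longrightarrow> ((\<lambda>t. mode N n l \<theta> p (\<lambda>i. A i t)) has_real_derivative - mode N n l \<theta> p (\<lambda>i. a i t)) (at t within {0..T})"
  "mode N n l \<theta> p (\<lambda>i. A i T) = 0"
  unfolding mode_def
  by (auto intro!: continuous_intros continuous_on_subset[OF a] derivative_eq_intros der simp: sum_negf[symmetric] AT)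

lemma weighted_chaos_estimate_0:
  "weighted_chaos T \<beta> N n n A l \<theta> \<le> (1 / \<beta>\<^sup>2) * weighted_chaos T \<beta> N n n a l \<theta>"
proof -
  have "integral {0..T} (\<lambda>t. exp (- 2 * \<beta> * (T - t)) * t ^ n * (mode N n l \<theta> p (\<lambda>i. A i t))\<^sup>2)
    \<le> (1 / \<beta>\<^sup>2) * integral {0..T} (\<lambda>t. exp (- 2 * \<beta> * (T - t)) * t ^ n * (mode N n l \<theta> p (\<lambda>i. a i t))\<^sup>2)"
    (is "?X \<le> _ * ?C") for p
  proof -
    have "0 \<le> integral {0..T} (\<lambda>t. exp (- 2 * \<beta> * (T - t)) * t ^ (n - 1) * (mode N n l \<theta> p (\<lambda>i. A i t))\<^sup>2)"
      unfolding mode_def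
      by (intro integral_nonneg integrable_continuous_real continuous_intros continuous_on_subset[OF A]) auto
    from mult_nonneg_nonneg[OF of_nat_0_le_iff[of n] this] have "\<beta> * ?X \<le> (1 / \<beta>) * ?C"
      using mode_estimates(1)[OF T mode_assms \<beta>, of n n p] by linarith
    from mult_left_mono[OF this, of "1 / \<beta>"] show ?thesis using \<beta> by (simp add: power2_eq_square)
  qed
  then show ?thesis
    unfolding weighted_chaos_eq_modes[OF A] weighted_chaos_eq_modes[OF a] sum_distrib_left by (intro sum_mono)
qed

text \<open>The energy estimate at power \<open>Suc n\<close>, now discarding the term with factor
  \<open>\<beta>\<close> and keeping the one in which the power of \<open>t\<close> has
  dropped.\<close>

lemma weighted_chaos_estimate_1:
  "real (Suc n) * weighted_chaos T \<beta> N n (Suc n) A l \<theta> \<le> (1 / \<beta>) * weighted_chaos T \<beta> N (Suc n) (Suc n) a l \<theta>"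
proof -
  have "real (Suc n) * integral {0..T} (\<lambda>t. exp (- 2 * \<beta> * (T - t)) * t ^ n * (mode N (Suc n) l \<theta> p (\<lambda>i. A i t))\<^sup>2)
    \<le> (1 / \<beta>) * integral {0..T} (\<lambda>t. exp (- 2 * \<beta> * (T - t)) * t ^ Suc n * (mode N (Suc n) l \<theta> p (\<lambda>i. a i t))\<^sup>2)" for p
  proof -
    have "0 \<le> \<beta> * integral {0..T} (\<lambda>t. exp (- 2 * \<beta> * (T - t)) * t ^ Suc n * (mode N (Suc n) l \<theta> p (\<lambda>i. A i t))\<^sup>2)"
      unfolding mode_def using \<beta>
      by (intro mult_nonneg_nonneg integral_nonneg integrable_continuous_real continuous_intros continuous_on_subset[OF A]) auto
    then show ?thesis
      using mode_estimates(1)[OF T mode_assms \<beta>, of "Suc n" "Suc n" p] unfolding diff_Suc_1 by linarith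
  qed
  then show ?thesis
    unfolding weighted_chaos_eq_modes[OF A] weighted_chaos_eq_modes[OF a] sum_distrib_left by (intro sum_mono)
qed

lemma weighted_chaos_estimate_2:
  "real (Suc (Suc n)) * real (Suc n) * weighted_chaos T \<beta> N n (Suc (Suc n)) A l \<theta>
    \<le> 8 * weighted_chaos T \<beta> N (Suc (Suc n)) (Suc (Suc n)) a l \<theta>"
  unfolding weighted_chaos_eq_modes[OF A] weighted_chaos_eq_modes[OF a] sum_distrib_left
  using mode_estimates(2)[OF T mode_assms less_imp_le[OF \<beta>]] by (intro sum_mono)

lemma nu_wave_sum_le:
  "(\<integral>\<^sup>+p. ennreal ((wave_sum x0 N A l \<theta> p)\<^sup>2) \<partial>nu T x0 \<beta>)
    \<le> ennreal (1 / \<beta>\<^sup>2) * (\<integral>\<^sup>+p. ennreal ((wave_sum x0 N a l \<theta> p)\<^sup>2) \<partial>nu T x0 \<beta>)"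
  unfolding nn_integral_nu_wave_sum[OF A] nn_integral_nu_wave_sum[OF a] ennreal_suminf_cmult[symmetric]
proof (intro suminf_le)
  fix n
  show "ennreal (weighted_chaos T \<beta> N n n A l \<theta> / fact n) \<le> ennreal (1 / \<beta>\<^sup>2) * ennreal (weighted_chaos T \<beta> N n n a l \<theta> / fact n)"
    using weighted_chaos_estimate_0[of n] weighted_chaos_nonneg[OF a]
    by (subst ennreal_mult[symmetric]) (auto intro!: ennreal_leI simp: field_simps)
qed auto

lemma nu_wave_grad_le:
  "(\<integral>\<^sup>+p. ennreal ((norm (wave_grad x0 N A l \<theta> p))\<^sup>2) \<partial>nu T x0 \<beta>)
    \<le> ennreal (1 / \<beta>) * (\<integral>\<^sup>+p. ennreal ((wave_sum x0 N a l \<theta> p)\<^sup>2) \<partial>nu T x0 \<beta>)"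
proof -
  have "(\<Sum>n. ennreal (weighted_chaos T \<beta> N n (Suc n) A l \<theta> / fact n))
    \<le> (\<Sum>n. ennreal (1 / \<beta>) * ennreal (weighted_chaos T \<beta> N (n + 1) (n + 1) a l \<theta> / fact (n + 1)))"
  proof (intro suminf_le)
    fix n
    have "weighted_chaos T \<beta> N n (Suc n) A l \<theta> / fact n
      = real (Suc n) * weighted_chaos T \<beta> N n (Suc n) A l \<theta> / fact (Suc n)"
      unfolding fact_Suc by (simp del: of_nat_Suc)
    also have "\<dots> \<le> (1 / \<beta>) * weighted_chaos T \<beta> N (Suc n) (Suc n) a l \<theta> / fact (Suc n)"
      by (intro divide_right_mono weighted_chaos_estimate_1) simp
    also have "\<dots> = (1 / \<beta>) * (weighted_chaos T \<beta> N (n + 1) (n + 1) a l \<theta> / fact (n + 1))" by simp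
    finally show "ennreal (weighted_chaos T \<beta> N n (Suc n) A l \<theta> / fact n)
      \<le> ennreal (1 / \<beta>) * ennreal (weighted_chaos T \<beta> N (n + 1) (n + 1) a l \<theta> / fact (n + 1))"
      by (rule ennreal_le_multI) (use \<beta> in \<open>auto intro!: divide_nonneg_nonneg weighted_chaos_nonneg a simp del: fact_Suc\<close>)
  qed auto
  also have "\<dots> \<le> ennreal (1 / \<beta>) * (\<Sum>n. ennreal (weighted_chaos T \<beta> N n n a l \<theta> / fact n))"
    unfolding ennreal_suminf_cmult by (intro mult_left_mono suminf_shift_le) auto
  finally show ?thesis unfolding nn_integral_nu_wave_grad[OF A] nn_integral_nu_wave_sum[OF a] .
qed

lemma nu_wave_hess_le:
  "(\<integral>\<^sup>+p. ennreal ((norm (wave_hess x0 N A l \<theta> p))\<^sup>2) \<partial>nu T x0 \<beta>)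
    \<le> ennreal 8 * (\<integral>\<^sup>+p. ennreal ((wave_sum x0 N a l \<theta> p)\<^sup>2) \<partial>nu T x0 \<beta>)"
proof -
  have "(\<Sum>n. ennreal (weighted_chaos T \<beta> N n (Suc (Suc n)) A l \<theta> / fact n))
    \<le> (\<Sum>n. ennreal 8 * ennreal (weighted_chaos T \<beta> N (n + 2) (n + 2) a l \<theta> / fact (n + 2)))"
  proof (intro suminf_le)
    fix n
    \<comment> \<open>Rewriting \<open>1 / fact n\<close> over \<open>fact (Suc (Suc n))\<close>
      aligns the term with degree \<open>n + 2\<close> of the source and produces exactly the
      prefactor of the Hardy estimate.\<close>
    have "weighted_chaos T \<beta> N n (Suc (Suc n)) A l \<theta> / fact n
      = real (Suc (Suc n)) * real (Suc n) * weighted_chaos T \<beta> N n (Suc (Suc n)) A l \<theta> / fact (Suc (Suc n))"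
      unfolding fact_Suc by (simp del: of_nat_Suc)
    also have "\<dots> \<le> 8 * weighted_chaos T \<beta> N (Suc (Suc n)) (Suc (Suc n)) a l \<theta> / fact (Suc (Suc n))"
      by (intro divide_right_mono weighted_chaos_estimate_2) simp
    also have "\<dots> = 8 * (weighted_chaos T \<beta> N (n + 2) (n + 2) a l \<theta> / fact (n + 2))" by simp
    finally show "ennreal (weighted_chaos T \<beta> N n (Suc (Suc n)) A l \<theta> / fact n)
      \<le> ennreal 8 * ennreal (weighted_chaos T \<beta> N (n + 2) (n + 2) a l \<theta> / fact (n + 2))"
      by (rule ennreal_le_multI) (auto intro!: divide_nonneg_nonneg weighted_chaos_nonneg a simp del: fact_Suc)
  qed auto
  also have "\<dots> \<le> ennreal 8 * (\<Sum>n. ennreal (weighted_chaos T \<beta> N n n a l \<theta> / fact n))"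
    unfolding ennreal_suminf_cmult by (intro mult_left_mono suminf_shift_le) auto
  finally show ?thesis unfolding nn_integral_nu_wave_hess[OF A] nn_integral_nu_wave_sum[OF a] .
qed

end

text \<open>Constant coefficients describe the pure heat flow. The weight is at most 1, and
  integrating \<open>t ^ n\<close> over [0, T] gives \<open>T ^ (n + 1) / (n + 1)\<close>, which
  completes the factorial: degree \<open>n + 1\<close> of the gradient is bounded by degree
  \<open>n + 1\<close> of the terminal norm, without loss.\<close>

lemma nu_wave_grad_const_le:
  assumes T: "0 < T" and \<beta>: "0 < \<beta>"
  shows "(\<integral>\<^sup>+p. ennreal ((norm (wave_grad x0 N (\<lambda>i t. c i) l \<theta> p))\<^sup>2) \<partial>nu T x0 \<beta>)
    \<le> (\<integral>\<^sup>+x. ennreal ((\<Sum>i<N. c i * heat_wave x0 (l i) (\<theta> i) T x)\<^sup>2) \<partial>gaussian x0 T)"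
proof -
  have A: "continuous_on UNIV (\<lambda>t::real. c i)" for i by simp
  have "(\<Sum>n. ennreal (weighted_chaos T \<beta> N n (Suc n) (\<lambda>i t. c i) l \<theta> / fact n))
    \<le> (\<Sum>n. ennreal (T ^ (n + 1) / fact (n + 1) * chaos N (n + 1) c l \<theta>))"
  proof (intro suminf_le ennreal_leI)
    fix n
    have "weighted_chaos T \<beta> N n (Suc n) (\<lambda>i t. c i) l \<theta> \<le> integral {0..T} (\<lambda>t. t ^ n * chaos N (Suc n) c l \<theta>)"
      unfolding weighted_chaos_def
    proof (rule integral_le[OF weighted_chaos_integrable[OF A]])
      fix t assume t: "t \<in> {0..T}"
      then have "exp (- 2 * \<beta> * (T - t)) \<le> 1" using \<beta> by simp
      then have "exp (- 2 * \<beta> * (T - t)) * (t ^ n * chaos N (Suc n) c l \<theta>) \<le> 1 * (t ^ n * chaos N (Suc n) c l \<theta>)"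
        using t by (intro mult_right_mono) (auto simp: chaos_nonneg)
      then show "exp (- 2 * \<beta> * (T - t)) * t ^ n * chaos N (Suc n) c l \<theta> \<le> t ^ n * chaos N (Suc n) c l \<theta>"
        by (simp add: mult.assoc)
    qed (intro integrable_continuous_real continuous_intros)
    also have "((\<lambda>t. t ^ n * chaos N (Suc n) c l \<theta>) has_integral
        T ^ Suc n / real (Suc n) * chaos N (Suc n) c l \<theta> - 0 ^ Suc n / real (Suc n) * chaos N (Suc n) c l \<theta>) {0..T}"
      using T
      by (intro fundamental_theorem_of_calculus)
         (auto simp: has_real_derivative_iff_has_vector_derivative[symmetric] simp del: of_nat_Suc power_Suc intro!: derivative_eq_intros)
    from integral_unique[OF this] have "integral {0..T} (\<lambda>t. t ^ n * chaos N (Suc n) c l \<theta>) = T ^ Suc n / real (Suc n) * chaos N (Suc n) c l \<theta>"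
      by simp
    finally have "weighted_chaos T \<beta> N n (Suc n) (\<lambda>i t. c i) l \<theta> / fact n
        \<le> T ^ Suc n / real (Suc n) * chaos N (Suc n) c l \<theta> / fact n"
      by (intro divide_right_mono) auto
    also have "\<dots> = T ^ (n + 1) / fact (n + 1) * chaos N (n + 1) c l \<theta>" by (simp add: field_simps)
    finally show "weighted_chaos T \<beta> N n (Suc n) (\<lambda>i t. c i) l \<theta> / fact n
        \<le> T ^ (n + 1) / fact (n + 1) * chaos N (n + 1) c l \<theta>" .
  qed auto
  also have "\<dots> \<le> (\<Sum>n. ennreal (T ^ n / fact n * chaos N n c l \<theta>))"
    by (rule suminf_shift_le)
  finally show ?thesis
    unfolding nn_integral_nu_wave_grad[OF A] nn_integral_heat_wave_sum_sq[OF T] .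
qed

section \<open>The heat flow and the Duhamel integral as bounded operators\<close>

subsection \<open>The Duhamel operator on the occupation space\<close>

text \<open>Cauchy--Schwarz against the constant 1. For a function that is not integrable the
  Bochner integral is 0 and the bound is trivial.\<close>

lemma square_integral_le:
  fixes f :: "'a \<Rightarrow> real"
  assumes [measurable]: "f \<in> borel_measurable M"
  shows "ennreal ((LINT x|M. f x)\<^sup>2) \<le> emeasure M (space M) * (\<integral>\<^sup>+x. ennreal ((f x)\<^sup>2) \<partial>M)"
proof -
  have "ennreal \<bar>LINT x|M. f x\<bar> \<le> (\<integral>\<^sup>+x. ennreal \<bar>f x\<bar> \<partial>M)"
  proof (cases "integrable M f")
    case True
    then show ?thesis using integral_norm_bound_ennreal[OF True] by simp
  qed (simp add: not_integrable_integral_eq)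
  then have "(ennreal \<bar>LINT x|M. f x\<bar>)\<^sup>2 \<le> (\<integral>\<^sup>+x. 1 * ennreal \<bar>f x\<bar> \<partial>M)\<^sup>2"
    by (intro power_mono) auto
  also have "\<dots> \<le> (\<integral>\<^sup>+x. 1 ^ 2 \<partial>M) * (\<integral>\<^sup>+x. (ennreal \<bar>f x\<bar>) ^ 2 \<partial>M)"
    by (rule Cauchy_Schwarz_nn_integral) auto
  finally show ?thesis by (simp add: ennreal_power)
qed

lemma integrable_if_square_integrable:
  fixes f :: "'a \<Rightarrow> real"
  assumes [measurable]: "f \<in> borel_measurable M" and "emeasure M (space M) < \<infinity>"
    and "(\<integral>\<^sup>+x. ennreal ((f x)\<^sup>2) \<partial>M) < \<infinity>"
  shows "integrable M f"
proof (rule integrableI_bounded)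
  have "(\<integral>\<^sup>+x. ennreal (norm (f x)) \<partial>M) \<le> (\<integral>\<^sup>+x. 1 + ennreal ((f x)\<^sup>2) \<partial>M)"
  proof (intro nn_integral_mono)
    fix x
    have "\<bar>f x\<bar> \<le> 1 + (f x)\<^sup>2"
      using sum_squares_ge_zero[of "\<bar>f x\<bar> - 1/2" 0] by (auto simp: power2_eq_square algebra_simps)
    then have "ennreal (norm (f x)) \<le> ennreal (1 + (f x)\<^sup>2)" by (intro ennreal_leI) simp
    then show "ennreal (norm (f x)) \<le> 1 + ennreal ((f x)\<^sup>2)" by (simp add: ennreal_plus)
  qed
  also have "\<dots> < \<infinity>" using assms(2,3) by (subst nn_integral_add) auto
  finally show "(\<integral>\<^sup>+x. ennreal (norm (f x)) \<partial>M) < \<infinity>" .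
qed simp

lemma integral_gaussian_lborel:
  fixes \<phi> :: "real ^ 'n \<Rightarrow> real"
  assumes "\<phi> \<in> borel_measurable borel"
  shows "(LINT y|gaussian 0 r. \<phi> (x + y)) = (LINT y|lborel. gauss_density 0 r y * \<phi> (x + y))"
  unfolding gaussian_def using assms by (subst integral_density) (auto simp: gauss_density_nonneg)

lemma weight_integral_le:
  assumes "0 < T" "0 < \<beta>"
  shows "(\<integral>\<^sup>+t. indicator {0<..<T} t * ennreal (exp (- 2 * \<beta> * (T - t))) \<partial>lborel) \<le> ennreal (1 / \<beta>)"
proof -
  have "((\<lambda>t. exp (- 2 * \<beta> * (T - t))) has_integral exp (- 2 * \<beta> * (T - T)) / (2 * \<beta>) - exp (- 2 * \<beta> * (T - 0)) / (2 * \<beta>)) {0..T}"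
    using assms
    by (intro fundamental_theorem_of_calculus)
       (auto simp: has_real_derivative_iff_has_vector_derivative[symmetric] intro!: derivative_eq_intros)
  then have "integral {0..T} (\<lambda>t. exp (- 2 * \<beta> * (T - t))) \<le> 1 / (2 * \<beta>)"
    using assms by (auto dest!: integral_unique)
  also have "\<dots> \<le> 1 / \<beta>" using assms by (simp add: field_simps)
  finally show ?thesis
    by (subst nn_integral_Ioo_eq_integral) (auto intro!: continuous_intros ennreal_leI)
qed

lemma nu_emeasure_finite:
  assumes T: "0 < T" and \<beta>: "0 < \<beta>"
  shows "(\<integral>\<^sup>+p. 1 \<partial>nu T x0 \<beta>) \<le> ennreal (1 / \<beta>)"
proof -
  have "(\<integral>\<^sup>+p. 1 \<partial>nu T x0 \<beta>) = (\<integral>\<^sup>+t. indicator {0<..<T} t * (ennreal (exp (- 2 * \<beta> * (T - t))) * (\<integral>\<^sup>+x. 1 \<partial>gaussian x0 t)) \<partial>lborel)"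
    by (rule nn_integral_nu) simp
  also have "\<dots> = (\<integral>\<^sup>+t. indicator {0<..<T} t * ennreal (exp (- 2 * \<beta> * (T - t))) \<partial>lborel)"
    using prob_space.emeasure_space_1[OF prob_space_gaussian, of _ x0]
    by (intro nn_integral_cong) (auto split: split_indicator)
  finally show ?thesis using weight_integral_le[OF T \<beta>] by simp
qed

text \<open>The semigroup as a Lebesgue integral against the explicit density. In this form it is
  jointly Borel in time and space, and the probability space of the Brownian motion no longer
  occurs.\<close>

definition heat_ker :: "real \<Rightarrow> (real ^ 'n \<Rightarrow> real) \<Rightarrow> real \<times> (real ^ 'n) \<Rightarrow> real" where
  "heat_ker T \<eta> p = (LINT y|lborel. gauss_density 0 (T - fst p) y * \<eta> (snd p + y))"

definition duh_ker :: "real \<Rightarrow> (real \<times> (real ^ 'n) \<Rightarrow> real) \<Rightarrow> real \<times> (real ^ 'n) \<Rightarrow> real" where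
  "duh_ker T F p = (LINT r:{fst p<..<T}|lborel. LINT y|lborel. gauss_density 0 (r - fst p) y * F (r, snd p + y))"

lemma heat_ker_measurable:
  assumes [measurable]: "\<eta> \<in> borel_measurable borel"
  shows "heat_ker T \<eta> \<in> borel_measurable borel"
  unfolding heat_ker_def[abs_def] borel_prod[symmetric] by measurable

lemma duh_ker_measurable:
  assumes F: "F \<in> borel_measurable borel"
  shows "duh_ker T F \<in> borel_measurable borel"
proof -
  have [measurable]: "F \<in> borel_measurable (borel \<Otimes>\<^sub>M borel)" using F by (simp add: borel_prod)
  \<comment> \<open>The moving interval of integration is written as a conditional on
    \<open>(p, r)\<close>, which exhibits joint measurability.\<close>
  have "(\<lambda>p. LINT r|lborel. (if fst p < r \<and> r < T then 1 else 0) * (LINT y|lborel. gauss_density 0 (r - fst p) y * F (r, snd p + y)))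
      \<in> borel_measurable (borel \<Otimes>\<^sub>M borel)"
    by measurable
  moreover have "(\<lambda>p. LINT r|lborel. (if fst p < r \<and> r < T then 1 else 0) * (LINT y|lborel. gauss_density 0 (r - fst p) y * F (r, snd p + y)))
      = duh_ker T F"
    by (auto simp: duh_ker_def set_lebesgue_integral_def fun_eq_iff intro!: Bochner_Integration.integral_cong split: split_indicator)
  ultimately show ?thesis by (simp add: borel_prod)
qed

lemma heat_ker_sq_le:
  assumes T: "fst p < T" and [measurable]: "\<eta> \<in> borel_measurable borel"
  shows "ennreal ((heat_ker T \<eta> p)\<^sup>2) \<le> (\<integral>\<^sup>+y. ennreal ((\<eta> (snd p + y))\<^sup>2) \<partial>gaussian 0 (T - fst p))"
proof -
  interpret prob_space "gaussian (0 :: real ^ 'a) (T - fst p)" using T by (intro prob_space_gaussian) simp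
  have "heat_ker T \<eta> p = (LINT y|gaussian 0 (T - fst p). \<eta> (snd p + y))"
    by (simp add: heat_ker_def integral_gaussian_lborel)
  moreover have "(\<lambda>y. \<eta> (snd p + y)) \<in> borel_measurable (gaussian 0 (T - fst p))" by measurable
  ultimately show ?thesis
    using square_integral_le[of "\<lambda>y. \<eta> (snd p + y)" "gaussian 0 (T - fst p)"] emeasure_space_1 by simp
qed

text \<open>Time integral of the squares along the heat flow; it dominates the square of the Duhamel integral.\<close>

definition nn_duh :: "real \<Rightarrow> (real \<times> (real ^ 'n) \<Rightarrow> real) \<Rightarrow> real \<times> (real ^ 'n) \<Rightarrow> ennreal" where
  "nn_duh T F p = (\<integral>\<^sup>+r. indicator {fst p<..<T} r *
    (\<integral>\<^sup>+y. ennreal (gauss_density 0 (r - fst p) y) * ennreal ((F (r, snd p + y))\<^sup>2) \<partial>lborel) \<partial>lborel)"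

lemma nn_duh_measurable:
  assumes F: "F \<in> borel_measurable borel"
  shows "nn_duh T F \<in> borel_measurable borel"
proof -
  have [measurable]: "F \<in> borel_measurable (borel \<Otimes>\<^sub>M borel)" using F by (simp add: borel_prod)
  have "(\<lambda>p. \<integral>\<^sup>+r. (if fst p < r \<and> r < T then 1 else 0) *
    (\<integral>\<^sup>+y. ennreal (gauss_density 0 (r - fst p) y) * ennreal ((F (r, snd p + y))\<^sup>2) \<partial>lborel) \<partial>lborel)
      \<in> borel_measurable (borel \<Otimes>\<^sub>M borel)"
    by measurable
  moreover have "(\<lambda>p. \<integral>\<^sup>+r. (if fst p < r \<and> r < T then 1 else 0) *
    (\<integral>\<^sup>+y. ennreal (gauss_density 0 (r - fst p) y) * ennreal ((F (r, snd p + y))\<^sup>2) \<partial>lborel) \<partial>lborel) = nn_duh T F"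
    by (auto simp: nn_duh_def fun_eq_iff intro!: nn_integral_cong split: split_indicator)
  ultimately show ?thesis by (simp add: borel_prod)
qed

lemma slice_measurable: "F \<in> borel_measurable borel \<Longrightarrow> (\<lambda>y. F (r :: real, y :: real ^ 'n)) \<in> borel_measurable borel"
  by (rule measurable_compose[where N = borel]) (simp_all flip: borel_prod)

text \<open>Finiteness of \<open>nn_duh\<close> is a condition at a single point that makes every
  integral in the Duhamel formula converge there. The square bound uses Cauchy--Schwarz twice:
  against a Gaussian probability measure in space, and on a time interval of length at most
  T.\<close>

lemma duh_ker_facts:
  fixes F :: "real \<times> (real ^ 'n) \<Rightarrow> real"
  assumes F: "F \<in> borel_measurable borel" and p: "p \<in> spacetime T" and fin: "nn_duh T F p < \<infinity>"
  shows "ennreal ((duh_ker T F p)\<^sup>2) \<le> ennreal T * nn_duh T F p"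
    and "AE r in lborel. r \<in> {fst p<..<T} \<longrightarrow> integrable (gaussian 0 (r - fst p)) (\<lambda>y. F (r, snd p + y))"
    and "set_integrable lborel {fst p<..<T} (\<lambda>r. LINT y|lborel. gauss_density 0 (r - fst p) y * F (r, snd p + y))"
proof -
  have [measurable]: "F \<in> borel_measurable (borel \<Otimes>\<^sub>M borel)" using F by (simp add: borel_prod)
  have sl [measurable]: "(\<lambda>y. F (r, y)) \<in> borel_measurable borel" for r by (rule slice_measurable[OF F])
  let ?S = "\<lambda>r. (\<integral>\<^sup>+y. ennreal (gauss_density 0 (r - fst p) y) * ennreal ((F (r, snd p + y))\<^sup>2) \<partial>lborel)"
  let ?H = "\<lambda>r. LINT y|lborel. gauss_density 0 (r - fst p) y * F (r, snd p + y)"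
  have [measurable]: "?S \<in> borel_measurable borel" "?H \<in> borel_measurable borel" by measurable
  have Seq: "?S r = (\<integral>\<^sup>+y. ennreal ((F (r, snd p + y))\<^sup>2) \<partial>gaussian 0 (r - fst p))" for r
    by (simp add: nn_integral_gaussian)
  have HS: "ennreal ((?H r)\<^sup>2) \<le> ?S r" if "fst p < r" for r
  proof -
    interpret prob_space "gaussian (0 :: real ^ 'n) (r - fst p)" using that by (intro prob_space_gaussian) simp
    have "?H r = (LINT y|gaussian 0 (r - fst p). F (r, snd p + y))"
      using integral_gaussian_lborel[OF sl, of "r - fst p" r "snd p"] by simp
    moreover have "(\<lambda>y. F (r, snd p + y)) \<in> borel_measurable (gaussian 0 (r - fst p))" by measurable
    ultimately show ?thesis unfolding Seq
      using square_integral_le[of "\<lambda>y. F (r, snd p + y)" "gaussian 0 (r - fst p)"] emeasure_space_1 by simp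
  qed
  have "AE r in lborel. indicator {fst p<..<T} r * ?S r \<noteq> \<infinity>"
    using fin unfolding nn_duh_def by (intro nn_integral_PInf_AE) auto
  then show "AE r in lborel. r \<in> {fst p<..<T} \<longrightarrow> integrable (gaussian 0 (r - fst p)) (\<lambda>y. F (r, snd p + y))"
  proof eventually_elim
    case (elim r)
    show ?case
    proof
      assume r: "r \<in> {fst p<..<T}"
      interpret prob_space "gaussian (0 :: real ^ 'n) (r - fst p)" using r by (intro prob_space_gaussian) simp
      show "integrable (gaussian 0 (r - fst p)) (\<lambda>y. F (r, snd p + y))"
        using elim r emeasure_space_1 unfolding Seq
        by (intro integrable_if_square_integrable) (auto simp: less_top)
    qed
  qed
  have p': "0 < fst p" "fst p < T" using p by (auto simp: spacetime_def)
  define R where "R = density lborel (\<lambda>r. ennreal (indicator {fst p<..<T} r))"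
  have [simp, measurable_cong]: "sets R = sets borel" "space R = UNIV" by (simp_all add: R_def)
  have eR: "emeasure R (space R) = ennreal (T - fst p)"
    using p' by (simp add: R_def emeasure_density ennreal_indicator)
  have H2: "(\<integral>\<^sup>+r. ennreal ((?H r)\<^sup>2) \<partial>R) \<le> nn_duh T F p"
    unfolding R_def nn_duh_def using HS
    by (subst nn_integral_density) (auto intro!: nn_integral_mono simp: ennreal_indicator split: split_indicator)
  have "integrable R ?H"
    using eR le_less_trans[OF H2 fin] by (intro integrable_if_square_integrable) auto
  then show "set_integrable lborel {fst p<..<T} ?H"
    unfolding R_def set_integrable_def
    by (subst (asm) integrable_density) auto
  have "duh_ker T F p = (LINT r|R. ?H r)"
    unfolding R_def duh_ker_def set_lebesgue_integral_def
    by (subst integral_density) auto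
  then have "ennreal ((duh_ker T F p)\<^sup>2) \<le> emeasure R (space R) * (\<integral>\<^sup>+r. ennreal ((?H r)\<^sup>2) \<partial>R)"
    using square_integral_le[of ?H R] by simp
  also have "\<dots> \<le> ennreal T * nn_duh T F p"
    unfolding eR using p' by (intro mult_mono H2 ennreal_leI) auto
  finally show "ennreal ((duh_ker T F p)\<^sup>2) \<le> ennreal T * nn_duh T F p" .
qed

context
  fixes M :: "'w measure" and W :: "real \<Rightarrow> 'w \<Rightarrow> real ^ 'n" and T :: real and x0 :: "real ^ 'n"
  assumes BM: "brownian_motion M W" and T: "0 < T"
begin

text \<open>For fixed \<open>t\<close>, averaging the law of the increment over the law at time
  \<open>t\<close> gives the law at time \<open>r\<close>, by Chapman--Kolmogorov. The weight
  increases in time, so its value at \<open>t\<close> may be replaced by the larger one at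
  \<open>r\<close>; the remaining integral over \<open>t\<close> costs the factor T.\<close>

lemma nn_duh_integral_le:
  assumes F: "F \<in> borel_measurable borel" and \<beta>: "0 \<le> \<beta>"
  shows "(\<integral>\<^sup>+p. nn_duh T F p \<partial>nu T x0 \<beta>) \<le> ennreal T * (\<integral>\<^sup>+p. ennreal ((F p)\<^sup>2) \<partial>nu T x0 \<beta>)"
proof -
  have Fm [measurable]: "F \<in> borel_measurable (borel \<Otimes>\<^sub>M borel)" using F by (simp add: borel_prod)
  have sl [measurable]: "(\<lambda>y. F (r, y)) \<in> borel_measurable borel" for r by (rule slice_measurable[OF F])
  let ?w = "\<lambda>t. ennreal (exp (- 2 * \<beta> * (T - t)))"
  let ?H = "\<lambda>r. \<integral>\<^sup>+y. ennreal ((F (r, y))\<^sup>2) \<partial>gaussian x0 r"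
  have [measurable]: "?H \<in> borel_measurable borel" by (simp add: nn_integral_gaussian)
  have inner: "(\<integral>\<^sup>+x. nn_duh T F (t, x) \<partial>gaussian x0 t) = (\<integral>\<^sup>+r. indicator {t<..<T} r * ?H r \<partial>lborel)" if t: "0 < t" for t
  proof -
    interpret G: prob_space "gaussian x0 t" by (rule prob_space_gaussian[OF t])
    interpret P: pair_sigma_finite "gaussian x0 t" lborel ..
    have "(\<integral>\<^sup>+x. nn_duh T F (t, x) \<partial>gaussian x0 t) = (\<integral>\<^sup>+r. (\<integral>\<^sup>+x. indicator {t<..<T} r *
        (\<integral>\<^sup>+y. ennreal (gauss_density 0 (r - t) y) * ennreal ((F (r, x + y))\<^sup>2) \<partial>lborel) \<partial>gaussian x0 t) \<partial>lborel)"
      unfolding nn_duh_def fst_conv snd_conv by (subst P.Fubini') auto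
    also have "\<dots> = (\<integral>\<^sup>+r. indicator {t<..<T} r * ?H r \<partial>lborel)"
    proof (intro nn_integral_cong)
      fix r
      show "(\<integral>\<^sup>+x. indicator {t<..<T} r *
        (\<integral>\<^sup>+y. ennreal (gauss_density 0 (r - t) y) * ennreal ((F (r, x + y))\<^sup>2) \<partial>lborel) \<partial>gaussian x0 t) = indicator {t<..<T} r * ?H r"
      proof (cases "r \<in> {t<..<T}")
        case True
        then show ?thesis
          using gaussian_semigroup[OF BM t, of r "\<lambda>y. ennreal ((F (r, y))\<^sup>2)" x0]
          by (simp add: nn_integral_gaussian[of _ 0])
      qed simp
    qed
    finally show ?thesis .
  qed
  have "(\<integral>\<^sup>+p. nn_duh T F p \<partial>nu T x0 \<beta>)
      = (\<integral>\<^sup>+t. indicator {0<..<T} t * (?w t * (\<integral>\<^sup>+x. nn_duh T F (t, x) \<partial>gaussian x0 t)) \<partial>lborel)"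
    by (rule nn_integral_nu[OF nn_duh_measurable[OF F]])
  also have "\<dots> \<le> (\<integral>\<^sup>+t. indicator {0<..<T} t * (\<integral>\<^sup>+p. ennreal ((F p)\<^sup>2) \<partial>nu T x0 \<beta>) \<partial>lborel)"
  proof (intro nn_integral_mono)
    fix t :: real
    show "indicator {0<..<T} t * (?w t * (\<integral>\<^sup>+x. nn_duh T F (t, x) \<partial>gaussian x0 t))
      \<le> indicator {0<..<T} t * (\<integral>\<^sup>+p. ennreal ((F p)\<^sup>2) \<partial>nu T x0 \<beta>)"
    proof (cases "t \<in> {0<..<T}")
      case True
      then have t: "0 < t" by simp
      have "?w t * (\<integral>\<^sup>+x. nn_duh T F (t, x) \<partial>gaussian x0 t) = (\<integral>\<^sup>+r. ?w t * (indicator {t<..<T} r * ?H r) \<partial>lborel)"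
        unfolding inner[OF t] by (rule nn_integral_cmult[symmetric]) measurable
      also have "\<dots> \<le> (\<integral>\<^sup>+r. indicator {0<..<T} r * (?w r * ?H r) \<partial>lborel)"
        using True \<beta> by (intro nn_integral_mono) (auto split: split_indicator intro!: mult_right_mono ennreal_leI mult_left_mono)
      also have "\<dots> = (\<integral>\<^sup>+p. ennreal ((F p)\<^sup>2) \<partial>nu T x0 \<beta>)"
        by (rule nn_integral_nu[symmetric]) (use F in measurable)
      finally show ?thesis using True by simp
    qed simp
  qed
  also have "\<dots> = ennreal T * (\<integral>\<^sup>+p. ennreal ((F p)\<^sup>2) \<partial>nu T x0 \<beta>)"
    using T by (subst nn_integral_multc) (auto simp: nn_integral_indicator)
  finally show ?thesis .
qed

lemma nn_heat_integral_le:
  assumes [measurable]: "\<eta> \<in> borel_measurable borel" and \<beta>: "0 < \<beta>"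
  shows "(\<integral>\<^sup>+p. (\<integral>\<^sup>+y. ennreal (gauss_density 0 (T - fst p) y) * ennreal ((\<eta> (snd p + y))\<^sup>2) \<partial>lborel) \<partial>nu T x0 \<beta>)
    \<le> ennreal (1 / \<beta>) * (\<integral>\<^sup>+x. ennreal ((\<eta> x)\<^sup>2) \<partial>gaussian x0 T)"
proof -
  let ?w = "\<lambda>t. ennreal (exp (- 2 * \<beta> * (T - t)))"
  let ?S = "\<lambda>p. (\<integral>\<^sup>+y. ennreal (gauss_density 0 (T - fst p) y) * ennreal ((\<eta> (snd p + y))\<^sup>2) \<partial>lborel)"
  have "?S \<in> borel_measurable borel" unfolding borel_prod[symmetric] by measurable
  then have "(\<integral>\<^sup>+p. ?S p \<partial>nu T x0 \<beta>) = (\<integral>\<^sup>+t. indicator {0<..<T} t * (?w t * (\<integral>\<^sup>+x. ?S (t, x) \<partial>gaussian x0 t)) \<partial>lborel)"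
    by (rule nn_integral_nu)
  also have "\<dots> = (\<integral>\<^sup>+t. (indicator {0<..<T} t * ?w t) * (\<integral>\<^sup>+x. ennreal ((\<eta> x)\<^sup>2) \<partial>gaussian x0 T) \<partial>lborel)"
  proof (intro nn_integral_cong)
    fix t :: real
    show "indicator {0<..<T} t * (?w t * (\<integral>\<^sup>+x. ?S (t, x) \<partial>gaussian x0 t))
      = (indicator {0<..<T} t * ?w t) * (\<integral>\<^sup>+x. ennreal ((\<eta> x)\<^sup>2) \<partial>gaussian x0 T)"
    proof (cases "t \<in> {0<..<T}")
      case True
      then show ?thesis
        using gaussian_semigroup[OF BM, of t T "\<lambda>y. ennreal ((\<eta> y)\<^sup>2)" x0]
        by (simp add: nn_integral_gaussian[of _ 0])
    qed simp
  qed
  also have "\<dots> = (\<integral>\<^sup>+t. indicator {0<..<T} t * ?w t \<partial>lborel) * (\<integral>\<^sup>+x. ennreal ((\<eta> x)\<^sup>2) \<partial>gaussian x0 T)"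
    by (rule nn_integral_multc) measurable
  also have "\<dots> \<le> ennreal (1 / \<beta>) * (\<integral>\<^sup>+x. ennreal ((\<eta> x)\<^sup>2) \<partial>gaussian x0 T)"
    by (intro mult_right_mono weight_integral_le T \<beta>) simp
  finally show ?thesis .
qed

lemma heat_eq_ker:
  assumes "\<eta> \<in> borel_measurable borel" "p \<in> spacetime T"
  shows "heat M W (T - fst p) \<eta> (snd p) = heat_ker T \<eta> p"
proof -
  have "0 < T - fst p" using assms(2) by (auto simp: spacetime_def)
  then show ?thesis
    using heat_eq_gaussian(1)[OF BM _ assms(1)] integral_gaussian_lborel[OF assms(1)]
    by (simp add: heat_ker_def)
qed

lemma ext_slice:
  assumes "F \<in> borel_measurable (nu T x0 \<beta>)" "p \<in> spacetime T" "r \<in> {fst p<..<T}"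
  shows "(\<lambda>y. F (r, y)) = (\<lambda>y. ext T F (r, y))" "(\<lambda>y. F (r, y)) \<in> borel_measurable borel"
proof -
  have "(r, y) \<in> spacetime T" for y :: "real ^ 'n" using assms(2,3) by (auto simp: spacetime_def)
  then show eq: "(\<lambda>y. F (r, y)) = (\<lambda>y. ext T F (r, y))" by (simp add: ext_eq)
  show "(\<lambda>y. F (r, y)) \<in> borel_measurable borel"
    unfolding eq using assms(1) ext_measurable slice_measurable by blast
qed

lemma duhamel_slice_eq:
  assumes "F \<in> borel_measurable (nu T x0 \<beta>)" "p \<in> spacetime T" "r \<in> {fst p<..<T}"
  shows "heat M W (r - fst p) (\<lambda>y. F (r, y)) (snd p) = (LINT y|lborel. gauss_density 0 (r - fst p) y * ext T F (r, snd p + y))"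
    and "integrable M (\<lambda>\<omega>. F (r, snd p + W (r - fst p) \<omega>)) \<longleftrightarrow> integrable (gaussian 0 (r - fst p)) (\<lambda>y. ext T F (r, snd p + y))"
proof -
  have r: "0 < r - fst p" using assms(3) by auto
  note eq = ext_slice(1)[OF assms] and m = ext_slice(2)[OF assms]
  have "heat M W (r - fst p) (\<lambda>y. F (r, y)) (snd p) = (LINT y|gaussian 0 (r - fst p). F (r, snd p + y))"
    using heat_eq_gaussian(1)[OF BM r m] by simp
  also have "\<dots> = (LINT y|lborel. gauss_density 0 (r - fst p) y * F (r, snd p + y))"
    using integral_gaussian_lborel[OF m] by simp
  finally show "heat M W (r - fst p) (\<lambda>y. F (r, y)) (snd p) = (LINT y|lborel. gauss_density 0 (r - fst p) y * ext T F (r, snd p + y))"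
    using fun_cong[OF eq] by simp
  show "integrable M (\<lambda>\<omega>. F (r, snd p + W (r - fst p) \<omega>)) \<longleftrightarrow> integrable (gaussian 0 (r - fst p)) (\<lambda>y. ext T F (r, snd p + y))"
    using heat_eq_gaussian(2)[OF BM r m, of "snd p"] fun_cong[OF eq] by simp
qed

lemma duhamel_eq_ker:
  assumes F: "F \<in> borel_measurable (nu T x0 \<beta>)" and \<eta>: "\<eta> \<in> borel_measurable borel" and p: "p \<in> spacetime T"
  shows "duhamel M W T F \<eta> p = heat_ker T \<eta> p + duh_ker T (ext T F) p"
proof -
  have "(LINT r:{fst p<..<T}|lborel. heat M W (r - fst p) (\<lambda>y. F (r, y)) (snd p)) = duh_ker T (ext T F) p"
    unfolding duh_ker_def set_lebesgue_integral_def
    by (intro Bochner_Integration.integral_cong) (use duhamel_slice_eq(1)[OF F p] in \<open>auto split: split_indicator\<close>)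
  then show ?thesis
    using heat_eq_ker[OF \<eta> p] by (simp add: duhamel_def case_prod_unfold)
qed

lemma ext_L2: "F \<in> L2_space (nu T x0 \<beta>) \<Longrightarrow> ext T F \<in> borel_measurable borel"
  using ext_measurable by (auto simp: L2_space_def)

lemma ext_nn_integral:
  fixes F :: "real \<times> (real ^ 'n) \<Rightarrow> real"
  assumes "F \<in> L2_space (nu T x0 \<beta>)"
  shows "(\<integral>\<^sup>+p. ennreal ((ext T F p)\<^sup>2) \<partial>nu T x0 \<beta>) = ennreal ((L2_norm (nu T x0 \<beta>) F)\<^sup>2)"
  unfolding L2_norm_sq_nn[OF assms] by (intro nn_integral_cong) (simp add: ext_eq)

lemma AE_nn_duh_finite:
  assumes F: "F \<in> L2_space (nu T x0 \<beta>)" and \<beta>: "0 \<le> \<beta>"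
  shows "AE p in nu T x0 \<beta>. nn_duh T (ext T F) p < \<infinity>"
proof -
  have "(\<integral>\<^sup>+p. nn_duh T (ext T F) p \<partial>nu T x0 \<beta>) \<le> ennreal T * ennreal ((L2_norm (nu T x0 \<beta>) F)\<^sup>2)"
    using nn_duh_integral_le[OF ext_L2[OF F] \<beta>] ext_nn_integral[OF F] by simp
  then have "(\<integral>\<^sup>+p. nn_duh T (ext T F) p \<partial>nu T x0 \<beta>) \<noteq> \<infinity>"
    by (auto simp: ennreal_mult[symmetric] top_unique T less_imp_le)
  from nn_integral_PInf_AE[OF borel_measurable_nuI[OF nn_duh_measurable[OF ext_L2[OF F]]] this]
  show ?thesis by (simp add: less_top)
qed

lemma AE_heat_integrable:
  fixes \<eta> :: "real ^ 'n \<Rightarrow> real"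
  assumes [measurable]: "\<eta> \<in> borel_measurable borel" and \<eta>: "\<eta> \<in> L2_space (gaussian x0 T)" and \<beta>: "0 < \<beta>"
  shows "AE p in nu T x0 \<beta>. integrable (gaussian 0 (T - fst p)) (\<lambda>y. \<eta> (snd p + y))"
proof -
  let ?S = "\<lambda>p. (\<integral>\<^sup>+y. ennreal (gauss_density 0 (T - fst p) y) * ennreal ((\<eta> (snd p + y))\<^sup>2) \<partial>lborel)"
  have [measurable]: "?S \<in> borel_measurable borel" unfolding borel_prod[symmetric] by measurable
  have "(\<integral>\<^sup>+p. ?S p \<partial>nu T x0 \<beta>) \<le> ennreal (1 / \<beta>) * ennreal ((L2_norm (gaussian x0 T) \<eta>)\<^sup>2)"
    using nn_heat_integral_le[OF assms(1) \<beta>] L2_norm_sq_nn[OF \<eta>] by simp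
  then have "(\<integral>\<^sup>+p. ?S p \<partial>nu T x0 \<beta>) \<noteq> \<infinity>"
    using \<beta> by (auto simp: ennreal_mult[symmetric] top_unique)
  then have "AE p in nu T x0 \<beta>. ?S p \<noteq> \<infinity>"
    by (intro nn_integral_PInf_AE borel_measurable_nuI) auto
  then show ?thesis
  proof (rule AE_mp, intro AE_I2 impI)
    fix p assume p: "p \<in> space (nu T x0 \<beta>)" and S: "?S p \<noteq> \<infinity>"
    interpret prob_space "gaussian (0 :: real ^ 'n) (T - fst p)" using p by (intro prob_space_gaussian) (auto simp: spacetime_def)
    show "integrable (gaussian 0 (T - fst p)) (\<lambda>y. \<eta> (snd p + y))"
      using S emeasure_space_1 by (intro integrable_if_square_integrable) (auto simp: nn_integral_gaussian less_top)
  qed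
qed

text \<open>The factor T is not the constant of the contraction. It serves continuity, by which
  limits of explicit solutions are recognised as Duhamel integrals; the constant
  \<open>1 / \<beta>\<close> comes later by density.\<close>

lemma duh_ker_L2:
  fixes F :: "real \<times> (real ^ 'n) \<Rightarrow> real"
  assumes F: "F \<in> L2_space (nu T x0 \<beta>)" and \<beta>: "0 \<le> \<beta>"
  shows "duh_ker T (ext T F) \<in> L2_space (nu T x0 \<beta>)"
    and "L2_norm (nu T x0 \<beta>) (duh_ker T (ext T F)) \<le> T * L2_norm (nu T x0 \<beta>) F"
proof -
  have "AE p in nu T x0 \<beta>. ennreal ((duh_ker T (ext T F) p)\<^sup>2) \<le> ennreal T * nn_duh T (ext T F) p"
    using AE_nn_duh_finite[OF F \<beta>]
    by (rule AE_mp) (auto intro!: AE_I2 duh_ker_facts(1)[OF ext_L2[OF F]])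
  then have "(\<integral>\<^sup>+p. ennreal ((norm (duh_ker T (ext T F) p))\<^sup>2) \<partial>nu T x0 \<beta>) \<le> (\<integral>\<^sup>+p. ennreal T * nn_duh T (ext T F) p \<partial>nu T x0 \<beta>)"
    by (intro nn_integral_mono_AE) auto
  also have "\<dots> = ennreal T * (\<integral>\<^sup>+p. nn_duh T (ext T F) p \<partial>nu T x0 \<beta>)"
    by (intro nn_integral_cmult borel_measurable_nuI nn_duh_measurable ext_L2[OF F])
  also have "\<dots> \<le> ennreal T * (ennreal T * ennreal ((L2_norm (nu T x0 \<beta>) F)\<^sup>2))"
    unfolding ext_nn_integral[OF F, symmetric] by (intro mult_left_mono nn_duh_integral_le ext_L2[OF F] \<beta>) auto
  also have "\<dots> = ennreal ((T * L2_norm (nu T x0 \<beta>) F)\<^sup>2)"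
    using T by (simp add: ennreal_mult[symmetric] power_mult_distrib power2_eq_square mult_ac)
  finally have "(\<integral>\<^sup>+p. ennreal ((norm (duh_ker T (ext T F) p))\<^sup>2) \<partial>nu T x0 \<beta>) \<le> ennreal ((T * L2_norm (nu T x0 \<beta>) F)\<^sup>2)" .
  from L2_norm_leI[OF borel_measurable_nuI[OF duh_ker_measurable[OF ext_L2[OF F]]] this] T
  show "duh_ker T (ext T F) \<in> L2_space (nu T x0 \<beta>)" "L2_norm (nu T x0 \<beta>) (duh_ker T (ext T F)) \<le> T * L2_norm (nu T x0 \<beta>) F"
    by auto
qed

lemma heat_ker_L2:
  assumes \<eta>: "\<eta> \<in> L2_space (gaussian x0 T)" and \<beta>: "0 < \<beta>"
  shows "heat_ker T \<eta> \<in> L2_space (nu T x0 \<beta>)"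
    and "L2_norm (nu T x0 \<beta>) (heat_ker T \<eta>) \<le> sqrt (1 / \<beta>) * L2_norm (gaussian x0 T) \<eta>"
proof -
  have [measurable]: "\<eta> \<in> borel_measurable borel" using L2_space_measurable[OF \<eta>] by simp
  have "(\<integral>\<^sup>+p. ennreal ((norm (heat_ker T \<eta> p))\<^sup>2) \<partial>nu T x0 \<beta>)
    \<le> (\<integral>\<^sup>+p. (\<integral>\<^sup>+y. ennreal (gauss_density 0 (T - fst p) y) * ennreal ((\<eta> (snd p + y))\<^sup>2) \<partial>lborel) \<partial>nu T x0 \<beta>)"
    using heat_ker_sq_le[of _ T \<eta>]
    by (intro nn_integral_mono) (auto simp: spacetime_def nn_integral_gaussian)
  also have "\<dots> \<le> ennreal (1 / \<beta>) * ennreal ((L2_norm (gaussian x0 T) \<eta>)\<^sup>2)"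
    using nn_heat_integral_le[OF _ \<beta>, of \<eta>] L2_norm_sq_nn[OF \<eta>] by simp
  also have "\<dots> = ennreal ((sqrt (1 / \<beta>) * L2_norm (gaussian x0 T) \<eta>)\<^sup>2)"
    using \<beta> by (simp add: ennreal_mult[symmetric] power_mult_distrib)
  finally have "(\<integral>\<^sup>+p. ennreal ((norm (heat_ker T \<eta> p))\<^sup>2) \<partial>nu T x0 \<beta>) \<le> ennreal ((sqrt (1 / \<beta>) * L2_norm (gaussian x0 T) \<eta>)\<^sup>2)" .
  from L2_norm_leI[OF borel_measurable_nuI[OF heat_ker_measurable] this] \<beta>
  show "heat_ker T \<eta> \<in> L2_space (nu T x0 \<beta>)"
    "L2_norm (nu T x0 \<beta>) (heat_ker T \<eta>) \<le> sqrt (1 / \<beta>) * L2_norm (gaussian x0 T) \<eta>"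
    by auto
qed

text \<open>Bochner integrals are additive only on integrable functions, so linearity is available
  at the points where \<open>nn_duh\<close> is finite for both sources, which is almost
  everywhere.\<close>

lemma duh_ker_diff:
  fixes F F' :: "real \<times> (real ^ 'n) \<Rightarrow> real"
  assumes F: "F \<in> L2_space (nu T x0 \<beta>)" "F' \<in> L2_space (nu T x0 \<beta>)" and \<beta>: "0 \<le> \<beta>"
  shows "AE p in nu T x0 \<beta>. duh_ker T (ext T (\<lambda>p. F p - F' p)) p = duh_ker T (ext T F) p - duh_ker T (ext T F') p"
  using AE_nn_duh_finite[OF F(1) \<beta>] AE_nn_duh_finite[OF F(2) \<beta>] AE_space
proof eventually_elim
  case (elim p)
  then have p: "p \<in> spacetime T" by simp
  note 1 = duh_ker_facts[OF ext_L2[OF F(1)] p elim(1)] and 2 = duh_ker_facts[OF ext_L2[OF F(2)] p elim(2)]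
  have sm: "(\<lambda>y. ext T F (r, snd p + y)) \<in> borel_measurable borel" "(\<lambda>y. ext T F' (r, snd p + y)) \<in> borel_measurable borel" for r
    using slice_measurable[OF ext_L2[OF F(1)]] slice_measurable[OF ext_L2[OF F(2)]] by measurable
  have e: "ext T (\<lambda>p. F p - F' p) q = ext T F q - ext T F' q" for q by (simp add: ext_def right_diff_distrib)
  let ?H = "\<lambda>F r. LINT y|lborel. gauss_density 0 (r - fst p) y * F (r, snd p + y)"
  have "(LINT r:{fst p<..<T}|lborel. ?H (ext T (\<lambda>p. F p - F' p)) r) = (LINT r:{fst p<..<T}|lborel. ?H (ext T F) r - ?H (ext T F') r)"
    unfolding set_lebesgue_integral_def
  proof (rule integral_cong_AE)
    have "ext T F \<in> borel_measurable (borel \<Otimes>\<^sub>M borel)" "ext T F' \<in> borel_measurable (borel \<Otimes>\<^sub>M borel)"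
      using ext_L2[OF F(1)] ext_L2[OF F(2)] by (simp_all add: borel_prod)
    note [measurable] = this
    show "(\<lambda>r. indicator {fst p<..<T} r *\<^sub>R (?H (ext T F) r - ?H (ext T F') r)) \<in> borel_measurable lborel"
      by measurable
    show "(\<lambda>r. indicator {fst p<..<T} r *\<^sub>R ?H (ext T (\<lambda>p. F p - F' p)) r) \<in> borel_measurable lborel"
      unfolding e by measurable
    show "AE r in lborel. indicator {fst p<..<T} r *\<^sub>R ?H (ext T (\<lambda>p. F p - F' p)) r
        = indicator {fst p<..<T} r *\<^sub>R (?H (ext T F) r - ?H (ext T F') r)"
      using 1(2) 2(2)
    proof eventually_elim
      case (elim r)
      show ?case
      proof (cases "r \<in> {fst p<..<T}")
        case True
        with elim have "integrable lborel (\<lambda>y. gauss_density 0 (r - fst p) y * ext T F (r, snd p + y))"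
          "integrable lborel (\<lambda>y. gauss_density 0 (r - fst p) y * ext T F' (r, snd p + y))"
          unfolding gaussian_def using sm by (auto simp: integrable_density gauss_density_nonneg)
        then show ?thesis unfolding e by (simp add: right_diff_distrib)
      qed simp
    qed
  qed
  also have "\<dots> = (LINT r:{fst p<..<T}|lborel. ?H (ext T F) r) - (LINT r:{fst p<..<T}|lborel. ?H (ext T F') r)"
    using 1(3) 2(3) by (rule set_integral_diff(2))
  finally show ?case unfolding duh_ker_def .
qed

lemma heat_ker_diff:
  assumes \<eta>: "\<eta> \<in> L2_space (gaussian x0 T)" "\<eta>' \<in> L2_space (gaussian x0 T)" and \<beta>: "0 < \<beta>"
  shows "AE p in nu T x0 \<beta>. heat_ker T (\<lambda>x. \<eta> x - \<eta>' x) p = heat_ker T \<eta> p - heat_ker T \<eta>' p"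
proof -
  have [measurable]: "\<eta> \<in> borel_measurable borel" "\<eta>' \<in> borel_measurable borel"
    using L2_space_measurable[OF \<eta>(1)] L2_space_measurable[OF \<eta>(2)] by simp_all
  have "AE p in nu T x0 \<beta>. integrable (gaussian 0 (T - fst p)) (\<lambda>y. \<eta> (snd p + y))"
    "AE p in nu T x0 \<beta>. integrable (gaussian 0 (T - fst p)) (\<lambda>y. \<eta>' (snd p + y))"
    by (intro AE_heat_integrable \<eta> \<beta>; simp)+
  then show ?thesis
  proof eventually_elim
    case (elim p)
    then have "integrable lborel (\<lambda>y. gauss_density 0 (T - fst p) y * \<eta> (snd p + y))"
      "integrable lborel (\<lambda>y. gauss_density 0 (T - fst p) y * \<eta>' (snd p + y))"
      unfolding gaussian_def by (auto simp: integrable_density gauss_density_nonneg)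
    then show ?case by (simp add: heat_ker_def right_diff_distrib)
  qed
qed

lemma duhamel_converges_AE:
  assumes F: "F \<in> L2_space (nu T x0 \<beta>)" and \<eta>: "\<eta> \<in> L2_space (gaussian x0 T)" and \<beta>: "0 < \<beta>"
  shows "AE p in nu T x0 \<beta>. duhamel_converges M W T F \<eta> p"
proof -
  have \<eta>m: "\<eta> \<in> borel_measurable borel" using L2_space_measurable[OF \<eta>] by simp
  have Fm: "F \<in> borel_measurable (nu T x0 \<beta>)" by (rule L2_space_measurable[OF F])
  show ?thesis
    using AE_nn_duh_finite[OF F less_imp_le[OF \<beta>]] AE_heat_integrable[OF \<eta>m \<eta> \<beta>] AE_space
  proof eventually_elim
    case (elim p)
    then have p: "p \<in> spacetime T" by simp
    then have Tp: "0 < T - fst p" by (auto simp: spacetime_def)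
    note 1 = duh_ker_facts[OF ext_L2[OF F] p elim(1)]
    have "integrable M (\<lambda>\<omega>. \<eta> (snd p + W (T - fst p) \<omega>))"
      using heat_eq_gaussian(2)[OF BM Tp \<eta>m] elim(2) by blast
    moreover have "AE r in lborel. r \<in> {fst p<..<T} \<longrightarrow> integrable M (\<lambda>\<omega>. F (r, snd p + W (r - fst p) \<omega>))"
      using 1(2) by eventually_elim (use duhamel_slice_eq(2)[OF Fm p] in blast)
    moreover have "set_integrable lborel {fst p<..<T} (\<lambda>r. heat M W (r - fst p) (\<lambda>y. F (r, y)) (snd p))"
    proof -
      have "(\<lambda>r. indicator {fst p<..<T} r *\<^sub>R heat M W (r - fst p) (\<lambda>y. F (r, y)) (snd p))
          = (\<lambda>r. indicator {fst p<..<T} r *\<^sub>R (LINT y|lborel. gauss_density 0 (r - fst p) y * ext T F (r, snd p + y)))"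
        using duhamel_slice_eq(1)[OF Fm p] by (auto simp: fun_eq_iff split: split_indicator)
      with 1(3) show ?thesis unfolding set_integrable_def by (simp only:)
    qed
    ultimately show ?case by (simp add: duhamel_converges_def case_prod_unfold)
  qed
qed

end

section \<open>From explicit solutions to all data by density and closedness\<close>

subsection \<open>Limits in the occupation space\<close>

text \<open>Extension by continuity, phrased for sequences instead of an operator, since derivatives
  of approximants are only given as accompanying functions. The two measures may differ: terminal
  data live on space, their jets on space-time.\<close>

lemma L2_limit_exists:
  fixes z :: "nat \<Rightarrow> 'a \<Rightarrow> 'b::euclidean_space" and F :: "nat \<Rightarrow> 'c \<Rightarrow> real"
  assumes z: "\<And>n. z n \<in> L2_space M" and F: "\<And>n. F n \<in> L2_space N" and G: "G \<in> L2_space N"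
    and lim: "(\<lambda>n. L2_norm N (\<lambda>x. F n x - G x)) \<longlonglongrightarrow> 0"
    and est: "\<And>m n. L2_norm M (\<lambda>x. z m x - z n x) \<le> C * L2_norm N (\<lambda>x. F m x - F n x)"
    and est0: "\<And>n. L2_norm M (z n) \<le> C * L2_norm N (F n)" and C: "0 \<le> C"
  obtains z' where "z' \<in> L2_space M" "(\<lambda>n. L2_norm M (\<lambda>x. z n x - z' x)) \<longlonglongrightarrow> 0"
    "L2_norm M z' \<le> C * L2_norm N G"
proof -
  have "\<exists>n0. \<forall>m\<ge>n0. \<forall>n\<ge>n0. L2_norm M (\<lambda>x. z m x - z n x) \<le> e" if e: "0 < e" for e
  proof -
    have "0 < e / (2 * (C + 1))" using e C by simp
    from order_tendstoD(2)[OF lim this] obtain n0 where n0: "\<And>n. n0 \<le> n \<Longrightarrow> L2_norm N (\<lambda>x. F n x - G x) < e / (2 * (C + 1))"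
      by (auto simp: eventually_sequentially)
    have "L2_norm M (\<lambda>x. z m x - z n x) \<le> e" if "n0 \<le> m" "n0 \<le> n" for m n
    proof -
      have "L2_norm N (\<lambda>x. F m x - F n x) \<le> L2_norm N (\<lambda>x. F m x - G x) + L2_norm N (\<lambda>x. G x - F n x)"
        by (intro L2_norm_triangle F G)
      also have "\<dots> \<le> e / (2 * (C + 1)) + e / (2 * (C + 1))"
        using n0[OF that(1)] n0[OF that(2)] by (simp add: L2_norm_diff_commute[of N G])
      also have "e / (2 * (C + 1)) + e / (2 * (C + 1)) = e / (C + 1)"
      proof -
        have "e / (2 * D) + e / (2 * D) = e / D" for D :: real by (simp add: add_divide_distrib[symmetric])
        then show ?thesis .
      qed
      finally have "C * L2_norm N (\<lambda>x. F m x - F n x) \<le> C * (e / (C + 1))" using C by (intro mult_left_mono)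
      also have "\<dots> \<le> e" using C e by (simp add: field_simps)
      finally show ?thesis using est[of m n] by simp
    qed
    then show ?thesis by blast
  qed
  from L2_complete[OF z this] obtain z' where z': "z' \<in> L2_space M" "(\<lambda>n. L2_norm M (\<lambda>x. z n x - z' x)) \<longlonglongrightarrow> 0"
    by blast
  have "L2_norm M z' \<le> C * L2_norm N G"
  proof (rule LIMSEQ_le_const)
    have "(\<lambda>n. C * (L2_norm N G + L2_norm N (\<lambda>x. F n x - G x)) + L2_norm M (\<lambda>x. z n x - z' x))
      \<longlonglongrightarrow> C * (L2_norm N G + 0) + 0" by (intro tendsto_intros lim z'(2))
    then show "(\<lambda>n. C * (L2_norm N G + L2_norm N (\<lambda>x. F n x - G x)) + L2_norm M (\<lambda>x. z n x - z' x)) \<longlonglongrightarrow> C * L2_norm N G"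
      by simp
    have "L2_norm M z' \<le> C * (L2_norm N G + L2_norm N (\<lambda>x. F n x - G x)) + L2_norm M (\<lambda>x. z n x - z' x)" for n
    proof -
      have "L2_norm M z' \<le> L2_norm M (z n) + L2_norm M (\<lambda>x. z' x - z n x)"
        by (rule L2_norm_le_add_diff[OF z'(1) z])
      also have "L2_norm M (z n) \<le> C * L2_norm N (F n)" by (rule est0)
      also have "C * L2_norm N (F n) \<le> C * (L2_norm N G + L2_norm N (\<lambda>x. F n x - G x))"
        by (intro mult_left_mono L2_norm_le_add_diff F G C)
      finally show ?thesis by (simp add: L2_norm_diff_commute[of M z'])
    qed
    then show "\<exists>n0. \<forall>n\<ge>n0. L2_norm M z' \<le> C * (L2_norm N G + L2_norm N (\<lambda>x. F n x - G x)) + L2_norm M (\<lambda>x. z n x - z' x)"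
      by blast
  qed
  with z' that show ?thesis by blast
qed

lemma nu_density_continuous: "continuous_on (spacetime T) (nu_density T x0 \<beta>)"
  unfolding nu_density_def[abs_def]
  by (intro continuous_intros continuous_on_subset[OF gauss_density_continuous_on]) (auto simp: spacetime_def)

text \<open>The density of the occupation measure is bounded below on compact subsets of space-time.\<close>

lemma nu_L1_bound:
  assumes C: "compact C" "C \<subseteq> spacetime T"
  obtains K where "\<And>h :: real \<times> (real ^ 'n) \<Rightarrow> real. h \<in> L2_space (nu T x0 \<beta>) \<Longrightarrow>
    set_integrable lborel C h \<and> (LINT y:C|lborel. \<bar>h y\<bar>) \<le> K * L2_norm (nu T x0 \<beta>) h"
proof -
  have [measurable]: "C \<in> sets borel" using C by (simp add: compact_imp_closed)
  have "\<exists>c>0. \<forall>p\<in>C. c \<le> nu_density T x0 \<beta> p"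
  proof (cases "C = {}")
    case False
    obtain q where "q \<in> C" "\<And>p. p \<in> C \<Longrightarrow> nu_density T x0 \<beta> q \<le> nu_density T x0 \<beta> p"
      using continuous_attains_inf[OF C(1) False continuous_on_subset[OF nu_density_continuous C(2)]] by blast
    then show ?thesis using nu_density_pos[of q T x0 \<beta>] C(2) by blast
  qed (auto intro: exI[of _ 1])
  then obtain c where c: "0 < c" "\<And>p. p \<in> C \<Longrightarrow> c \<le> nu_density T x0 \<beta> p" by blast
  have Cfin: "emeasure lborel C < \<infinity>" using emeasure_compact_finite[OF C(1)] .
  define m where "m = measure lborel C"
  have m: "emeasure lborel C = ennreal m" using Cfin by (simp add: m_def emeasure_eq_ennreal_measure)
  define R where "R = density lborel (\<lambda>p. ennreal (indicator C p))"
  have [simp, measurable_cong]: "sets R = sets borel" "space R = UNIV" by (simp_all add: R_def)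
  have eR: "emeasure R (space R) = ennreal m" by (simp add: R_def emeasure_density ennreal_indicator m[symmetric])
  show ?thesis
  proof (rule that[of "sqrt (m / c)"])
    fix h :: "real \<times> (real ^ 'n) \<Rightarrow> real" assume h: "h \<in> L2_space (nu T x0 \<beta>)"
    have [measurable]: "ext T h \<in> borel_measurable borel"
      by (rule ext_measurable[THEN iffD1, OF L2_space_measurable[OF h]])
    have "(\<integral>\<^sup>+p. ennreal ((ext T h p)\<^sup>2) \<partial>R) \<le> (\<integral>\<^sup>+p. ennreal (1 / c) * (indicator (spacetime T) p * (ennreal (nu_density T x0 \<beta> p) * ennreal ((ext T h p)\<^sup>2))) \<partial>lborel)"
    proof -
      have "(\<integral>\<^sup>+p. ennreal ((ext T h p)\<^sup>2) \<partial>R) = (\<integral>\<^sup>+p. ennreal (indicator C p) * ennreal ((ext T h p)\<^sup>2) \<partial>lborel)"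
        unfolding R_def by (subst nn_integral_density) auto
      also have "\<dots> \<le> (\<integral>\<^sup>+p. ennreal (1 / c) * (indicator (spacetime T) p * (ennreal (nu_density T x0 \<beta> p) * ennreal ((ext T h p)\<^sup>2))) \<partial>lborel)"
      proof (intro nn_integral_mono)
        fix p :: "real \<times> (real ^ 'n)"
        show "ennreal (indicator C p) * ennreal ((ext T h p)\<^sup>2)
          \<le> ennreal (1 / c) * (indicator (spacetime T) p * (ennreal (nu_density T x0 \<beta> p) * ennreal ((ext T h p)\<^sup>2)))"
        proof (cases "p \<in> C")
          case True
          have "1 \<le> (1 / c) * nu_density T x0 \<beta> p" using c(1) c(2)[OF True] by (simp add: field_simps)
          then have "1 * ennreal ((ext T h p)\<^sup>2) \<le> ennreal ((1 / c) * nu_density T x0 \<beta> p) * ennreal ((ext T h p)\<^sup>2)"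
            by (intro mult_right_mono) (metis ennreal_1 ennreal_leI, simp)
          moreover have "ennreal ((1 / c) * nu_density T x0 \<beta> p) = ennreal (1 / c) * ennreal (nu_density T x0 \<beta> p)"
            using c(1) c(2)[OF True] by (intro ennreal_mult) auto
          moreover have "p \<in> spacetime T" using True C(2) by blast
          ultimately show ?thesis using True by (simp only: indicator_simps mult_1 mult.assoc ennreal_1)
        qed simp
      qed
      finally show ?thesis .
    qed
    also have "\<dots> = ennreal (1 / c) * (\<integral>\<^sup>+p. ennreal ((ext T h p)\<^sup>2) \<partial>nu T x0 \<beta>)"
      by (subst nn_integral_nu_lborel, measurable) (rule nn_integral_cmult, measurable)
    also have "(\<integral>\<^sup>+p. ennreal ((ext T h p)\<^sup>2) \<partial>nu T x0 \<beta>) = ennreal ((L2_norm (nu T x0 \<beta>) h)\<^sup>2)"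
      unfolding L2_norm_sq_nn[OF h] by (intro nn_integral_cong) (simp add: ext_eq)
    also have "ennreal (1 / c) * ennreal ((L2_norm (nu T x0 \<beta>) h)\<^sup>2) = ennreal ((L2_norm (nu T x0 \<beta>) h)\<^sup>2 / c)"
      using c by (simp add: ennreal_mult[symmetric])
    finally have sq: "(\<integral>\<^sup>+p. ennreal ((ext T h p)\<^sup>2) \<partial>R) \<le> ennreal ((L2_norm (nu T x0 \<beta>) h)\<^sup>2 / c)" .
    have eq: "indicator C p *\<^sub>R h p = indicator C p * ext T h p" for p
      using C(2) by (auto simp: ext_eq split: split_indicator)
    have "integrable R (ext T h)"
      by (rule integrable_if_square_integrable) (use sq eR in \<open>auto intro: le_less_trans\<close>)
    then have int: "integrable lborel (\<lambda>p. indicator C p * ext T h p)"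
      unfolding R_def by (subst (asm) integrable_density) auto
    have "(LINT y:C|lborel. \<bar>h y\<bar>) = (LINT p|R. \<bar>ext T h p\<bar>)"
      unfolding R_def set_lebesgue_integral_def
      by (subst integral_density) (use C(2) in \<open>auto simp: ext_eq intro!: Bochner_Integration.integral_cong split: split_indicator\<close>)
    then have "ennreal ((LINT y:C|lborel. \<bar>h y\<bar>)\<^sup>2) \<le> emeasure R (space R) * (\<integral>\<^sup>+p. ennreal ((ext T h p)\<^sup>2) \<partial>R)"
      using square_integral_le[of "\<lambda>p. \<bar>ext T h p\<bar>" R] by simp
    also have "\<dots> \<le> ennreal m * ennreal ((L2_norm (nu T x0 \<beta>) h)\<^sup>2 / c)"
      unfolding eR by (intro mult_left_mono sq) simp
    also have "\<dots> = ennreal ((sqrt (m / c) * L2_norm (nu T x0 \<beta>) h)\<^sup>2)"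
      using c by (simp add: ennreal_mult[symmetric] power_mult_distrib m_def)
    finally have "(LINT y:C|lborel. \<bar>h y\<bar>)\<^sup>2 \<le> (sqrt (m / c) * L2_norm (nu T x0 \<beta>) h)\<^sup>2"
      by (simp add: ennreal_le_iff)
    then have "(LINT y:C|lborel. \<bar>h y\<bar>) \<le> sqrt (m / c) * L2_norm (nu T x0 \<beta>) h"
      by (rule power2_le_imp_le) (use c in \<open>auto simp: m_def\<close>)
    with int show "set_integrable lborel C h \<and> (LINT y:C|lborel. \<bar>h y\<bar>) \<le> sqrt (m / c) * L2_norm (nu T x0 \<beta>) h"
      by (simp only: set_integrable_def eq simp_thms)
  qed
qed

lemma locally_integrable_L2: "h \<in> L2_space (nu T x0 \<beta>) \<Longrightarrow> locally_integrable (spacetime T) h"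
  unfolding locally_integrable_def by (meson nu_L1_bound)

lemma L1_loc_tendsto_L2:
  assumes v: "\<And>n. v n \<in> L2_space (nu T x0 \<beta>)" "w \<in> L2_space (nu T x0 \<beta>)"
    and lim: "(\<lambda>n. L2_norm (nu T x0 \<beta>) (\<lambda>p. v n p - w p)) \<longlonglongrightarrow> 0"
  shows "L1_loc_tendsto (spacetime T) v w"
  unfolding L1_loc_tendsto_def
proof (intro allI impI)
  fix C :: "(real \<times> (real ^ 'a)) set" assume C: "compact C \<and> C \<subseteq> spacetime T"
  obtain K where K: "\<And>h :: real \<times> (real ^ 'a) \<Rightarrow> real. h \<in> L2_space (nu T x0 \<beta>) \<Longrightarrow>
    set_integrable lborel C h \<and> (LINT y:C|lborel. \<bar>h y\<bar>) \<le> K * L2_norm (nu T x0 \<beta>) h"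
    using nu_L1_bound[of C T x0 \<beta>] C by blast
  have "(\<lambda>n. K * L2_norm (nu T x0 \<beta>) (\<lambda>p. v n p - w p)) \<longlonglongrightarrow> K * 0"
    by (intro tendsto_intros lim)
  then have K0: "(\<lambda>n. K * L2_norm (nu T x0 \<beta>) (\<lambda>p. v n p - w p)) \<longlonglongrightarrow> 0" by simp
  have "norm (LINT y:C|lborel. \<bar>v n y - w y\<bar>) \<le> K * L2_norm (nu T x0 \<beta>) (\<lambda>p. v n p - w p)" for n
    using K[OF L2_space_diff[OF v(1)[of n] v(2)]] by (simp add: set_lebesgue_integral_def)
  then show "(\<lambda>n. LINT y:C|lborel. \<bar>v n y - w y\<bar>) \<longlonglongrightarrow> 0"
    by (intro Lim_null_comparison[OF always_eventually K0]) blast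
qed

lemma L2_component:
  fixes z :: "'a \<Rightarrow> 'b::euclidean_space ^ 'n"
  assumes z: "z \<in> L2_space M"
  shows "(\<lambda>p. z p $ k) \<in> L2_space M" "L2_norm M (\<lambda>p. z p $ k) \<le> L2_norm M z"
proof -
  have "(\<lambda>p. z p $ k) \<in> borel_measurable M" using L2_space_measurable[OF z] by measurable
  moreover have "AE p in M. norm (z p $ k) \<le> norm (z p)" by (simp add: Finite_Cartesian_Product.norm_nth_le)
  ultimately show "(\<lambda>p. z p $ k) \<in> L2_space M" "L2_norm M (\<lambda>p. z p $ k) \<le> L2_norm M z"
    by (rule L2_norm_mono[OF _ z])+
qed

lemma L2_component_tendsto:
  fixes z :: "nat \<Rightarrow> 'a \<Rightarrow> 'b::euclidean_space ^ 'n"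
  assumes "\<And>n. z n \<in> L2_space M" "z' \<in> L2_space M" "(\<lambda>n. L2_norm M (\<lambda>p. z n p - z' p)) \<longlonglongrightarrow> 0"
  shows "(\<lambda>n. L2_norm M (\<lambda>p. z n p $ k - z' p $ k)) \<longlonglongrightarrow> 0"
proof (rule Lim_null_comparison[OF always_eventually assms(3)], rule allI)
  fix n
  show "norm (L2_norm M (\<lambda>p. z n p $ k - z' p $ k)) \<le> L2_norm M (\<lambda>p. z n p - z' p)"
    using L2_component(2)[OF L2_space_diff[OF assms(1,2)], of n k] by simp
qed

lemma L2_spaceI_component:
  fixes z :: "'a \<Rightarrow> 'b::euclidean_space ^ 'n"
  assumes z: "\<And>k. (\<lambda>p. z p $ k) \<in> L2_space M"
  shows "z \<in> L2_space M" "(L2_norm M z)\<^sup>2 = (\<Sum>k\<in>UNIV. (L2_norm M (\<lambda>p. z p $ k))\<^sup>2)"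
proof -
  have "(\<lambda>p. \<chi> k. z p $ k) \<in> borel_measurable M"
    using L2_space_measurable[OF z] by (rule borel_measurable_vec_lambda)
  then show "z \<in> L2_space M"
    using L2_space_integrable[OF z] by (auto simp: L2_space_def norm_vec_sq)
  show "(L2_norm M z)\<^sup>2 = (\<Sum>k\<in>UNIV. (L2_norm M (\<lambda>p. z p $ k))\<^sup>2)"
    unfolding L2_norm_sq norm_vec_sq using L2_space_integrable[OF z] by (rule Bochner_Integration.integral_sum)
qed

lemma weak_Dx_limit:
  assumes w: "\<And>n. weak_Dx T (v n) (z n)"
    and v: "\<And>n. v n \<in> L2_space (nu T x0 \<beta>)" "v' \<in> L2_space (nu T x0 \<beta>)"
      "(\<lambda>n. L2_norm (nu T x0 \<beta>) (\<lambda>p. v n p - v' p)) \<longlonglongrightarrow> 0"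
    and z: "\<And>n. z n \<in> L2_space (nu T x0 \<beta>)" "z' \<in> L2_space (nu T x0 \<beta>)"
      "(\<lambda>n. L2_norm (nu T x0 \<beta>) (\<lambda>p. z n p - z' p)) \<longlonglongrightarrow> 0"
  shows "weak_Dx T v' z'"
  unfolding weak_Dx_def
proof
  fix k
  have a: "weak_deriv (spacetime T) (0, axis k 1) (v n) (\<lambda>p. z n p $ k)" for n
    using w[of n] by (simp add: weak_Dx_def)
  have b: "L1_loc_tendsto (spacetime T) (\<lambda>n p. z n p $ k) (\<lambda>p. z' p $ k)"
    by (rule L1_loc_tendsto_L2[OF L2_component(1)[OF z(1)] L2_component(1)[OF z(2)] L2_component_tendsto[OF z]])
  show "weak_deriv (spacetime T) (0, axis k 1) v' (\<lambda>p. z' p $ k)"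
    by (rule weak_deriv_limit[OF a axis_prod_in_Basis locally_integrable_L2[OF v(2)]
          locally_integrable_L2[OF L2_component(1)[OF z(2)]] L1_loc_tendsto_L2[OF v] b])
qed

lemma weak_Dx_add:
  "weak_Dx T v z \<Longrightarrow> weak_Dx T v' z' \<Longrightarrow> weak_Dx T (\<lambda>p. v p + v' p) (\<lambda>p. z p + z' p)"
  by (simp add: weak_Dx_def weak_deriv_add)

lemma indicator_times_measurable_nu:
  "(v :: real \<times> (real ^ 'n) \<Rightarrow> real) \<in> borel_measurable (nu T x0 \<beta>) \<Longrightarrow> (\<lambda>p. indicator (spacetime T) p * v p) \<in> borel_measurable borel"
  using ext_measurable[of v T x0 \<beta>] by (simp add: ext_def[abs_def])

lemma weak_Dx_cong_AE:
  assumes w: "weak_Dx T v z" and ae: "AE p in nu T x0 \<beta>. v p = v' p \<and> z p = z' p"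
    and m: "v' \<in> borel_measurable (nu T x0 \<beta>)" "z' \<in> borel_measurable (nu T x0 \<beta>)"
  shows "weak_Dx T v' z'"
  unfolding weak_Dx_def
proof
  fix k
  from ae have ae': "AE p in lborel. p \<in> spacetime T \<longrightarrow> v p = v' p \<and> z p $ k = z' p $ k"
    unfolding AE_nu_iff by eventually_elim auto
  have m': "(\<lambda>p. z' p $ k) \<in> borel_measurable (nu T x0 \<beta>)" using m(2) by measurable
  have w': "weak_deriv (spacetime T) (0, axis k 1) v (\<lambda>p. z p $ k)" using w by (simp add: weak_Dx_def)
  show "weak_deriv (spacetime T) (0, axis k 1) v' (\<lambda>p. z' p $ k)"
    by (rule weak_deriv_cong_AE[OF w' axis_prod_in_Basis ae' indicator_times_measurable_nu[OF m(1)]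
          indicator_times_measurable_nu[OF m']])
qed

lemma weak_Dx_unique:
  fixes z :: "real \<times> (real ^ 'n) \<Rightarrow> real ^ 'n"
  assumes "weak_Dx T v z" "weak_Dx T v z'"
  shows "AE p in nu T x0 \<beta>. z p = z' p"
proof -
  have "AE p in lborel. \<forall>k. p \<in> spacetime T \<longrightarrow> z p $ k = z' p $ k"
    using assms by (subst AE_all_countable) (auto simp: weak_Dx_def intro!: weak_deriv_unique[OF open_spacetime])
  then show ?thesis unfolding AE_nu_iff by eventually_elim (simp add: vec_eq_iff)
qed

subsection \<open>A dense class of exact solutions\<close>

text \<open>Joins two coefficient families into one. Differences of explicit solutions thereby
  become explicit solutions, so the a priori estimates apply to them and show that approximating
  jets form Cauchy sequences.\<close>

definition cat :: "nat \<Rightarrow> (nat \<Rightarrow> 'a) \<Rightarrow> (nat \<Rightarrow> 'a) \<Rightarrow> nat \<Rightarrow> 'a" where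
  "cat N f g i = (if i < N then f i else g (i - N))"

lemma sum_cat:
  fixes h :: "nat \<Rightarrow> 'b::comm_monoid_add"
  assumes "\<And>i. i < N \<Longrightarrow> h i = f i" "\<And>i. h (N + i) = g i"
  shows "(\<Sum>i<N + N'. h i) = (\<Sum>i<N. f i) + (\<Sum>i<N'. g i)"
proof (induction N')
  case 0
  then show ?case using assms by simp
next
  case (Suc N')
  then show ?case using assms(2)[of N'] by (simp add: add.assoc)
qed

lemma wave_sum_cat:
  "wave_sum x0 (N + N') (cat N A A') (cat N l l') (cat N \<theta> \<theta>') p = wave_sum x0 N A l \<theta> p + wave_sum x0 N' A' l' \<theta>' p"
  unfolding wave_sum_def by (rule sum_cat) (auto simp: cat_def)

lemma cat_shift:
  "(\<lambda>i t. cat N A A' i t * cat N l l' i $ k) = cat N (\<lambda>i t. A i t * l i $ k) (\<lambda>i t. A' i t * l' i $ k)"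
  "(\<lambda>i. cat N \<theta> \<theta>' i + c) = cat N (\<lambda>i. \<theta> i + c) (\<lambda>i. \<theta>' i + c)"
  by (auto simp: cat_def fun_eq_iff)

lemma wave_grad_cat:
  "wave_grad x0 (N + N') (cat N A A') (cat N l l') (cat N \<theta> \<theta>') p = wave_grad x0 N A l \<theta> p + wave_grad x0 N' A' l' \<theta>' p"
  by (simp add: wave_grad_def vec_eq_iff cat_shift wave_sum_cat)

lemma wave_hess_cat:
  "wave_hess x0 (N + N') (cat N A A') (cat N l l') (cat N \<theta> \<theta>') p = wave_hess x0 N A l \<theta> p + wave_hess x0 N' A' l' \<theta>' p"
  by (simp add: wave_hess_def vec_eq_iff[of "\<chi> k. _ k"] cat_shift wave_grad_cat)

lemma wave_minus:
  "wave_sum x0 N (\<lambda>i t. - A i t) l \<theta> p = - wave_sum x0 N A l \<theta> p"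
  "wave_grad x0 N (\<lambda>i t. - A i t) l \<theta> p = - wave_grad x0 N A l \<theta> p"
  "wave_hess x0 N (\<lambda>i t. - A i t) l \<theta> p = - wave_hess x0 N A l \<theta> p"
proof -
  show 1: "wave_sum x0 N (\<lambda>i t. - A i t) l \<theta> p = - wave_sum x0 N A l \<theta> p" for A \<theta>
    by (simp add: wave_sum_def sum_negf)
  show 2: "wave_grad x0 N (\<lambda>i t. - A i t) l \<theta> p = - wave_grad x0 N A l \<theta> p" for A \<theta>
    by (simp add: wave_grad_def vec_eq_iff 1)
  show "wave_hess x0 N (\<lambda>i t. - A i t) l \<theta> p = - wave_hess x0 N A l \<theta> p"
    using 2[of "\<lambda>i t. A i t * l i $ _"] by (simp add: wave_hess_def vec_eq_iff[of "\<chi> k. _ k"])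
qed

text \<open>A relation and not a function of F, since a wave sum has many representations. The
  derivative \<open>- a i\<close> together with \<open>A i T = 0\<close> encodes that
  \<open>A i t\<close> is the integral of \<open>a i\<close> from \<open>t\<close> to
  \<open>T\<close>.\<close>

definition wave_jet where
  "wave_jet T x0 F u z \<gamma> \<longleftrightarrow> (\<exists>N a A l \<theta>.
    (\<forall>i. continuous_on UNIV (a i)) \<and> (\<forall>i. continuous_on UNIV (A i)) \<and>
    (\<forall>i. \<forall>t\<in>{0..T}. (A i has_real_derivative - a i t) (at t within {0..T})) \<and> (\<forall>i. A i T = 0) \<and>
    F = wave_sum x0 N a l \<theta> \<and> u = wave_sum x0 N A l \<theta> \<and> z = wave_grad x0 N A l \<theta> \<and> \<gamma> = wave_hess x0 N A l \<theta>)"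

lemma wave_jet_diff:
  assumes 1: "wave_jet T x0 F u z \<gamma>" and 2: "wave_jet T x0 F' u' z' \<gamma>'"
  shows "wave_jet T x0 (\<lambda>p. F p - F' p) (\<lambda>p. u p - u' p) (\<lambda>p. z p - z' p) (\<lambda>p. \<gamma> p - \<gamma>' p)"
proof -
  obtain N a A l \<theta> where 1: "\<And>i. continuous_on UNIV (a i)" "\<And>i. continuous_on UNIV (A i)"
    "\<And>i t. t \<in> {0..T} \<Longrightarrow> (A i has_real_derivative - a i t) (at t within {0..T})" "\<And>i. A i T = 0"
    "F = wave_sum x0 N a l \<theta>" "u = wave_sum x0 N A l \<theta>" "z = wave_grad x0 N A l \<theta>" "\<gamma> = wave_hess x0 N A l \<theta>"
    using 1 unfolding wave_jet_def by blast
  obtain N' a' A' l' \<theta>' where 2: "\<And>i. continuous_on UNIV (a' i)" "\<And>i. continuous_on UNIV (A' i)"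
    "\<And>i t. t \<in> {0..T} \<Longrightarrow> (A' i has_real_derivative - a' i t) (at t within {0..T})" "\<And>i. A' i T = 0"
    "F' = wave_sum x0 N' a' l' \<theta>'" "u' = wave_sum x0 N' A' l' \<theta>'" "z' = wave_grad x0 N' A' l' \<theta>'" "\<gamma>' = wave_hess x0 N' A' l' \<theta>'"
    using 2 unfolding wave_jet_def by blast
  let ?a = "cat N a (\<lambda>i t. - a' i t)" and ?A = "cat N A (\<lambda>i t. - A' i t)"
  have "\<forall>i. continuous_on UNIV (?a i)" "\<forall>i. continuous_on UNIV (?A i)" "\<forall>i. ?A i T = 0"
    using 1 2 by (auto simp: cat_def intro!: continuous_intros)
  moreover have "\<forall>i. \<forall>t\<in>{0..T}. (?A i has_real_derivative - ?a i t) (at t within {0..T})"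
    using 1(3) DERIV_minus[OF 2(3)] by (auto simp: cat_def)
  moreover have "(\<lambda>p. F p - F' p) = wave_sum x0 (N + N') ?a (cat N l l') (cat N \<theta> \<theta>')"
    "(\<lambda>p. u p - u' p) = wave_sum x0 (N + N') ?A (cat N l l') (cat N \<theta> \<theta>')"
    "(\<lambda>p. z p - z' p) = wave_grad x0 (N + N') ?A (cat N l l') (cat N \<theta> \<theta>')"
    "(\<lambda>p. \<gamma> p - \<gamma>' p) = wave_hess x0 (N + N') ?A (cat N l l') (cat N \<theta> \<theta>')"
    using 1 2 by (simp_all add: fun_eq_iff wave_sum_cat wave_grad_cat wave_hess_cat wave_minus)
  ultimately show ?thesis unfolding wave_jet_def by blast
qed

lemma wave_jet_estimates:
  assumes T: "0 < T" and \<beta>: "0 < \<beta>" and w: "wave_jet T x0 F u z \<gamma>" and F: "F \<in> L2_space (nu T x0 \<beta>)"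
  shows "u \<in> L2_space (nu T x0 \<beta>)" "L2_norm (nu T x0 \<beta>) u \<le> (1 / \<beta>) * L2_norm (nu T x0 \<beta>) F"
    "z \<in> L2_space (nu T x0 \<beta>)" "L2_norm (nu T x0 \<beta>) z \<le> (1 / sqrt \<beta>) * L2_norm (nu T x0 \<beta>) F"
    "\<gamma> \<in> L2_space (nu T x0 \<beta>)" "L2_norm (nu T x0 \<beta>) \<gamma> \<le> 2 * sqrt 2 * L2_norm (nu T x0 \<beta>) F"
proof -
  obtain N a A l \<theta> where a: "\<And>i. continuous_on UNIV (a i)" "\<And>i. continuous_on UNIV (A i)"
    "\<And>i t. t \<in> {0..T} \<Longrightarrow> (A i has_real_derivative - a i t) (at t within {0..T})" "\<And>i. A i T = 0"
    and eq: "F = wave_sum x0 N a l \<theta>" "u = wave_sum x0 N A l \<theta>" "z = wave_grad x0 N A l \<theta>" "\<gamma> = wave_hess x0 N A l \<theta>"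
    using w unfolding wave_jet_def by blast
  have m: "u \<in> borel_measurable (nu T x0 \<beta>)" "z \<in> borel_measurable (nu T x0 \<beta>)" "\<gamma> \<in> borel_measurable (nu T x0 \<beta>)"
    unfolding eq by (intro borel_measurable_nuI borel_measurable_continuous_onI wave_sum_continuous wave_grad_continuous wave_hess_continuous a)+
  have Fn: "(\<integral>\<^sup>+p. ennreal ((wave_sum x0 N a l \<theta> p)\<^sup>2) \<partial>nu T x0 \<beta>) = ennreal ((L2_norm (nu T x0 \<beta>) F)\<^sup>2)"
    using L2_norm_sq_nn[OF F] by (simp add: eq)
  note E = nu_wave_sum_le[where A = A and a = a and N = N and l = l and \<theta> = \<theta>, OF T \<beta> a(2,1,3,4), of x0]
    nu_wave_grad_le[where A = A and a = a and N = N and l = l and \<theta> = \<theta>, OF T \<beta> a(2,1,3,4), of x0]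
    nu_wave_hess_le[where A = A and a = a and N = N and l = l and \<theta> = \<theta>, OF T \<beta> a(2,1,3,4), of x0]
  have "(\<integral>\<^sup>+p. ennreal ((norm (u p))\<^sup>2) \<partial>nu T x0 \<beta>) \<le> ennreal (((1 / \<beta>) * L2_norm (nu T x0 \<beta>) F)\<^sup>2)"
    using E(1) unfolding Fn eq(2)
    by (simp add: ennreal_mult[symmetric] power_mult_distrib power_divide)
  from L2_norm_leI[OF m(1) this] \<beta> show "u \<in> L2_space (nu T x0 \<beta>)" "L2_norm (nu T x0 \<beta>) u \<le> (1 / \<beta>) * L2_norm (nu T x0 \<beta>) F"
    by auto
  have "(\<integral>\<^sup>+p. ennreal ((norm (z p))\<^sup>2) \<partial>nu T x0 \<beta>) \<le> ennreal (((1 / sqrt \<beta>) * L2_norm (nu T x0 \<beta>) F)\<^sup>2)"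
    using E(2) \<beta> unfolding Fn eq(3)
    by (simp add: ennreal_mult[symmetric] power_mult_distrib power_divide)
  from L2_norm_leI[OF m(2) this] \<beta> show "z \<in> L2_space (nu T x0 \<beta>)" "L2_norm (nu T x0 \<beta>) z \<le> (1 / sqrt \<beta>) * L2_norm (nu T x0 \<beta>) F"
    by auto
  have "(\<integral>\<^sup>+p. ennreal ((norm (\<gamma> p))\<^sup>2) \<partial>nu T x0 \<beta>) \<le> ennreal ((2 * sqrt 2 * L2_norm (nu T x0 \<beta>) F)\<^sup>2)"
  proof -
    have "ennreal ((2 * sqrt 2 * L2_norm (nu T x0 \<beta>) F)\<^sup>2) = ennreal 8 * ennreal ((L2_norm (nu T x0 \<beta>) F)\<^sup>2)"
      by (subst ennreal_mult[symmetric]) (auto simp: power_mult_distrib)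
    then show ?thesis using E(3) unfolding Fn eq(4) by (simp only:)
  qed
  from L2_norm_leI[OF m(3) this] show "\<gamma> \<in> L2_space (nu T x0 \<beta>)" "L2_norm (nu T x0 \<beta>) \<gamma> \<le> 2 * sqrt 2 * L2_norm (nu T x0 \<beta>) F"
    by auto
qed

lemma wave_grad_weak_deriv:
  assumes A: "\<And>i. continuous_on UNIV (A i)"
  shows "weak_Dx T (wave_sum x0 N A l \<theta>) (wave_grad x0 N A l \<theta>)"
    and "weak_Dx T (\<lambda>p. wave_grad x0 N A l \<theta> p $ k) (\<lambda>p. wave_hess x0 N A l \<theta> p $ k)"
proof -
  have *: "weak_Dx T (wave_sum x0 N A l \<theta>) (wave_grad x0 N A l \<theta>)" if "\<And>i. continuous_on UNIV (A i)" for A \<theta>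
    by (simp add: weak_Dx_def wave_sum_weak_deriv that)
  show "weak_Dx T (wave_sum x0 N A l \<theta>) (wave_grad x0 N A l \<theta>)" by (rule *[OF A])
  from *[of "\<lambda>i t. A i t * l i $ k" "\<lambda>i. \<theta> i + pi / 2"]
  show "weak_Dx T (\<lambda>p. wave_grad x0 N A l \<theta> p $ k) (\<lambda>p. wave_hess x0 N A l \<theta> p $ k)"
    by (simp add: wave_grad_def[of _ _ A] wave_hess_def A continuous_intros)
qed

lemma wave_jet_weak:
  assumes "wave_jet T x0 F u z \<gamma>"
  shows "weak_Dx T u z" "weak_Dx T (\<lambda>p. z p $ k) (\<lambda>p. \<gamma> p $ k)"
  using assms wave_grad_weak_deriv unfolding wave_jet_def by blast+

text \<open>The semigroup damps the wave by \<open>exp (- (r - t) * q / 2)\<close> with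
  \<open>q = (norm l)\<^sup>2\<close>, which lowers its growth factor from time \<open>r\<close> to
  time \<open>t\<close>.\<close>

lemma gaussian_heat_wave:
  assumes r: "t < r"
  shows "(LINT y|gaussian 0 (r - t). heat_wave x0 l \<theta> r (x + y)) = heat_wave x0 l \<theta> t x"
proof -
  have "(LINT y|gaussian 0 (r - t). heat_wave x0 l \<theta> r (x + y))
    = (LINT y|gaussian 0 (r - t). exp (r * (norm l)\<^sup>2 / 2) * cos (l \<bullet> ((x - x0) + y) + \<theta>))"
    unfolding heat_wave_def by (simp only: add_diff_eq diff_add_eq)
  also have "\<dots> = exp (r * (norm l)\<^sup>2 / 2) * (exp (- ((r - t) * (norm l)\<^sup>2 / 2)) * cos (l \<bullet> (x - x0) + \<theta>))"
    using r by (simp only: Bochner_Integration.integral_mult_right_zero gaussian_cos_shift diff_gt_0_iff_gt)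
  also have "\<dots> = heat_wave x0 l \<theta> t x"
  proof -
    have "exp (r * q / 2) * exp (- ((r - t) * q / 2)) = exp (t * q / 2)" for q :: real
      by (simp add: exp_add[symmetric] left_diff_distrib diff_divide_distrib)
    then show ?thesis by (simp add: heat_wave_def mult.assoc[symmetric])
  qed
  finally show ?thesis .
qed

lemma gaussian_wave_sum:
  assumes r: "t < r"
  shows "(LINT y|lborel. gauss_density 0 (r - t) y * (\<Sum>i<N. c i * heat_wave x0 (l i) (\<theta> i) r (x + y)))
    = (\<Sum>i<N. c i * heat_wave x0 (l i) (\<theta> i) t x)"
proof -
  have i: "integrable (gaussian 0 (r - t)) (\<lambda>y. heat_wave x0 (l i) (\<theta> i) r (x + y))" for i
    using r by (intro gaussian_integrable_bounded[of _ _ "exp (r * (norm (l i))\<^sup>2 / 2)"] heat_wave_bounded) auto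
  have "(LINT y|lborel. gauss_density 0 (r - t) y * (\<Sum>i<N. c i * heat_wave x0 (l i) (\<theta> i) r (x + y)))
    = (LINT y|gaussian 0 (r - t). (\<Sum>i<N. c i * heat_wave x0 (l i) (\<theta> i) r (x + y)))"
    by (rule integral_gaussian_lborel[symmetric]) measurable
  also have "\<dots> = (\<Sum>i<N. c i * heat_wave x0 (l i) (\<theta> i) t x)"
    using i by (subst Bochner_Integration.integral_sum) (auto simp: gaussian_heat_wave[OF r])
  finally show ?thesis .
qed

lemma wave_jet_duhamel:
  assumes w: "wave_jet T x0 F u z \<gamma>" and p: "p \<in> spacetime T"
  shows "duh_ker T (ext T F) p = u p"
proof -
  obtain N a A l \<theta> where a: "\<And>i. continuous_on UNIV (a i)" "\<And>i. continuous_on UNIV (A i)"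
    "\<And>i t. t \<in> {0..T} \<Longrightarrow> (A i has_real_derivative - a i t) (at t within {0..T})" "\<And>i. A i T = 0"
    and eq: "F = wave_sum x0 N a l \<theta>" "u = wave_sum x0 N A l \<theta>"
    using w unfolding wave_jet_def by blast
  obtain t x where tx: "p = (t, x)" by (cases p)
  have t: "0 < t" "t < T" using p by (auto simp: tx spacetime_def)
  have "duh_ker T (ext T F) p = (LINT r:{t<..<T}|lborel. \<Sum>i<N. a i r * heat_wave x0 (l i) (\<theta> i) t x)"
    unfolding duh_ker_def set_lebesgue_integral_def tx fst_conv snd_conv
  proof (intro Bochner_Integration.integral_cong refl)
    fix r
    show "indicator {t<..<T} r *\<^sub>R (LINT y|lborel. gauss_density 0 (r - t) y * ext T F (r, x + y))
      = indicator {t<..<T} r *\<^sub>R (\<Sum>i<N. a i r * heat_wave x0 (l i) (\<theta> i) t x)"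
    proof (cases "r \<in> {t<..<T}")
      case True
      then have "(r, x + y) \<in> spacetime T" for y using t by (auto simp: spacetime_def)
      then have "(LINT y|lborel. gauss_density 0 (r - t) y * ext T F (r, x + y))
        = (LINT y|lborel. gauss_density 0 (r - t) y * (\<Sum>i<N. a i r * heat_wave x0 (l i) (\<theta> i) r (x + y)))"
        by (simp add: ext_eq eq wave_sum_def)
      also have "\<dots> = (\<Sum>i<N. a i r * heat_wave x0 (l i) (\<theta> i) t x)"
        using True by (intro gaussian_wave_sum) auto
      finally show ?thesis by simp
    qed simp
  qed
  also have "\<dots> = (\<Sum>i<N. A i t * heat_wave x0 (l i) (\<theta> i) t x)"
  proof -
    have si: "set_integrable lborel {t<..<T} (a i)" for i
    proof (rule set_integrable_subset[of _ "{t..T}"])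
      show "set_integrable lborel {t..T} (a i)"
        unfolding set_integrable_def by (intro borel_integrable_compact compact_Icc continuous_on_subset[OF a(1)]) auto
    qed auto
    have "(LINT r:{t<..<T}|lborel. a i r) = A i t" for i
    proof -
      have "((\<lambda>r. - a i r) has_integral (A i T - A i t)) {t..T}"
      proof (rule fundamental_theorem_of_calculus)
        fix r assume r: "r \<in> {t..T}"
        then have "r \<in> {0..T}" "{t..T} \<subseteq> {0..T}" using t by auto
        then have "(A i has_real_derivative - a i r) (at r within {t..T})"
          using DERIV_subset[OF a(3)] by blast
        then show "(A i has_vector_derivative - a i r) (at r within {t..T})"
          by (simp add: has_real_derivative_iff_has_vector_derivative)
      qed (use t in simp)
      from integral_unique[OF has_integral_neg[OF this]] have "integral {t..T} (a i) = A i t"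
        by (simp add: a(4))
      then show ?thesis
        using set_borel_integral_eq_integral(2)[OF si] by (simp add: integral_open_interval_real)
    qed
    moreover have "(LINT r:{t<..<T}|lborel. \<Sum>i<N. a i r * heat_wave x0 (l i) (\<theta> i) t x)
      = (\<Sum>i<N. (LINT r:{t<..<T}|lborel. a i r) * heat_wave x0 (l i) (\<theta> i) t x)"
    proof -
      have eqs: "indicator {t<..<T} r *\<^sub>R (\<Sum>i<N. a i r * heat_wave x0 (l i) (\<theta> i) t x)
          = (\<Sum>i<N. (indicator {t<..<T} r *\<^sub>R a i r) * heat_wave x0 (l i) (\<theta> i) t x)" for r
        by (simp add: sum_distrib_left mult.assoc)
      show ?thesis
        unfolding set_lebesgue_integral_def eqs using si[unfolded set_integrable_def]
        by (subst Bochner_Integration.integral_sum) (auto intro!: integrable_mult_left)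
    qed
    ultimately show ?thesis by simp
  qed
  finally show ?thesis by (simp add: eq wave_sum_def tx)
qed

lemma wave_jet_exists:
  assumes T: "0 < T" and a: "\<And>i. continuous_on UNIV (a i)"
  shows "\<exists>u z \<gamma>. wave_jet T x0 (wave_sum x0 N a l \<theta>) u z \<gamma>"
proof -
  \<comment> \<open>Clamping the time to [0, T] makes the antiderivative continuous on the whole
    line, as \<open>wave_jet\<close> demands; its derivative is only claimed within [0, T].\<close>
  define A where "A i t = integral {0..T} (a i) - integral {0..max 0 (min T t)} (a i)" for i t
  have "continuous_on UNIV (A i)" for i
  proof -
    have "continuous_on {0..T} (\<lambda>t. integral {0..t} (a i))"
      by (intro indefinite_integral_continuous_1 integrable_continuous_real continuous_on_subset[OF a]) auto
    then have "continuous_on UNIV (\<lambda>t. integral {0..max 0 (min T t)} (a i))"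
      by (rule continuous_on_compose2) (use T in \<open>auto intro!: continuous_intros\<close>)
    then show ?thesis unfolding A_def by (intro continuous_intros)
  qed
  moreover have "(A i has_real_derivative - a i t) (at t within {0..T})" if t: "t \<in> {0..T}" for i t
  proof (rule has_field_derivative_transform_within[of "\<lambda>t. integral {0..T} (a i) - integral {0..t} (a i)" _ _ _ 1])
    have "((\<lambda>t. integral {0..t} (a i)) has_real_derivative a i t) (at t within {0..T})"
      using t by (intro integral_has_real_derivative continuous_on_subset[OF a]) auto
    from DERIV_diff[OF DERIV_const this]
    show "((\<lambda>t. integral {0..T} (a i) - integral {0..t} (a i)) has_real_derivative - a i t) (at t within {0..T})" by simp
  qed (use t in \<open>auto simp: A_def\<close>)
  moreover have "A i T = 0" for i using T by (simp add: A_def)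
  ultimately show ?thesis unfolding wave_jet_def using a by blast
qed

text \<open>The addition theorem splits a space-time cosine into two waves of the same spatial
  frequency with phases \<open>pi / 2\<close> apart. Their coefficients are the cosine and the sine
  in time, divided by the growth factor of the wave.\<close>

lemma trig_polys_wave:
  fixes f :: "real \<times> (real ^ 'n) \<Rightarrow> real"
  assumes "f \<in> trig_polys"
  shows "\<exists>N a l \<theta>. (\<forall>i. continuous_on UNIV (a i)) \<and> f = wave_sum x0 N a l \<theta>"
  using assms
proof induction
  case (atom c v \<theta>)
  obtain \<tau> l where v: "v = (\<tau>, l)" by (cases v)
  define a where "a i t = (if i = 0 then c * cos (\<tau> * t) else c * sin (\<tau> * t)) * exp (- (t * (norm l)\<^sup>2 / 2))" for i :: nat and t
  define \<eta> where "\<eta> i = \<theta> + l \<bullet> x0 + (if i = 0 then 0 else pi / 2)" for i :: nat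
  have "continuous_on UNIV (a i)" for i by (cases "i = 0") (auto simp: a_def[abs_def] intro!: continuous_intros)
  moreover have "(\<lambda>p. c * cos (v \<bullet> p + \<theta>)) = wave_sum x0 2 a (\<lambda>_. l) \<eta>"
  proof
    fix p :: "real \<times> (real ^ 'n)"
    obtain t x where p: "p = (t, x)" by (cases p)
    let ?y = "l \<bullet> x + \<theta>"
    have e: "exp (- (t * (norm l)\<^sup>2 / 2)) * exp (t * (norm l)\<^sup>2 / 2) = 1" by (simp add: exp_minus)
    have s: "l \<bullet> (x - x0) + (\<theta> + l \<bullet> x0 + b) = ?y + b" for b by (simp add: inner_diff_right)
    have "wave_sum x0 2 a (\<lambda>_. l) \<eta> p
      = (exp (- (t * (norm l)\<^sup>2 / 2)) * exp (t * (norm l)\<^sup>2 / 2)) * (c * cos (\<tau> * t) * cos ?y + c * sin (\<tau> * t) * cos (?y + pi / 2))"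
      unfolding wave_sum_def heat_wave_def a_def \<eta>_def s p
      by (simp add: lessThan_Suc numeral_2_eq_2 algebra_simps s[of 0, simplified])
    also have "\<dots> = c * (cos (\<tau> * t) * cos ?y - sin (\<tau> * t) * sin ?y)"
      unfolding e by (simp add: cos_add right_diff_distrib)
    also have "\<dots> = c * cos (v \<bullet> p + \<theta>)"
      unfolding cos_add[symmetric] by (simp add: v p inner_commute[of \<tau>] add.assoc mult.commute)
    finally show "c * cos (v \<bullet> p + \<theta>) = wave_sum x0 2 a (\<lambda>_. l) \<eta> p" by simp
  qed
  ultimately show ?case by blast
next
  case (add f g)
  obtain N a l \<theta> where 1: "\<forall>i. continuous_on UNIV (a i)" "f = wave_sum x0 N a l \<theta>" using add.IH(1) by blast
  obtain N' a' l' \<theta>' where 2: "\<forall>i. continuous_on UNIV (a' i)" "g = wave_sum x0 N' a' l' \<theta>'" using add.IH(2) by blast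
  have "\<forall>i. continuous_on UNIV (cat N a a' i)" using 1 2 by (simp add: cat_def)
  moreover have "(\<lambda>x. f x + g x) = wave_sum x0 (N + N') (cat N a a') (cat N l l') (cat N \<theta> \<theta>')"
    using 1 2 by (simp add: fun_eq_iff wave_sum_cat)
  ultimately show ?case by blast
qed

text \<open>The density theorem is stated for finite measures on the Borel sets of the whole space.
  \<open>R\<close> is the occupation measure continued by zero outside space-time; it is finite
  because its total mass is at most \<open>1 / \<beta>\<close>.\<close>

lemma nu_trig_polys_dense:
  fixes F :: "real \<times> (real ^ 'n) \<Rightarrow> real"
  assumes T: "0 < T" and \<beta>: "0 < \<beta>" and F: "F \<in> L2_space (nu T x0 \<beta>)" and e: "0 < e"
  obtains g where "g \<in> trig_polys" "g \<in> L2_space (nu T x0 \<beta>)" "L2_norm (nu T x0 \<beta>) (\<lambda>p. F p - g p) < e"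
proof -
  define R where "R = density lborel (\<lambda>p. indicator (spacetime T) p * ennreal (nu_density T x0 \<beta> p))"
  have [simp, measurable_cong]: "sets R = sets borel" "space R = UNIV" by (simp_all add: R_def)
  have R: "(\<integral>\<^sup>+p. h p \<partial>R) = (\<integral>\<^sup>+p. h p \<partial>nu T x0 \<beta>)" if "h \<in> borel_measurable borel" for h
    unfolding R_def nn_integral_nu_lborel[OF that] using that
    by (subst nn_integral_density) (auto simp: mult.assoc)
  have fin: "finite_measure R"
  proof
    have "emeasure R (space R) = (\<integral>\<^sup>+p. 1 \<partial>nu T x0 \<beta>)" by (subst R[symmetric]) auto
    then show "emeasure R (space R) \<noteq> \<infinity>" using nu_emeasure_finite[OF T \<beta>, of x0] by (auto simp: top_unique)
  qed
  have Fm [measurable]: "ext T F \<in> borel_measurable borel"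
    by (rule ext_measurable[THEN iffD1, OF L2_space_measurable[OF F]])
  have sq: "(\<integral>\<^sup>+p. ennreal ((norm (F p - g p))\<^sup>2) \<partial>nu T x0 \<beta>) = (\<integral>\<^sup>+p. ennreal ((norm (ext T F p - g p))\<^sup>2) \<partial>R)"
    if [measurable]: "g \<in> borel_measurable borel" for g
    by (subst R) (auto intro!: nn_integral_cong simp: ext_eq)
  have "ext T F \<in> L2_space R"
    using F sq[of "\<lambda>_. 0"] by (auto simp: L2_space_iff)
  from trig_polys_dense[OF fin _ this e] obtain g where g: "g \<in> trig_polys" "g \<in> L2_space R" "L2_norm R (\<lambda>p. ext T F p - g p) < e"
    by auto
  have gm [measurable]: "g \<in> borel_measurable borel" using g(1) by (rule trig_polys_measurable)
  have Fg: "(\<lambda>p. ext T F p - g p) \<in> L2_space R" by (intro L2_space_diff g \<open>ext T F \<in> L2_space R\<close>)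
  have "(\<lambda>p. F p - g p) \<in> borel_measurable (nu T x0 \<beta>)"
    using L2_space_measurable[OF F] borel_measurable_nuI[OF gm] by measurable
  from L2_norm_leI[OF this, of "L2_norm R (\<lambda>p. ext T F p - g p)"]
  have *: "(\<lambda>p. F p - g p) \<in> L2_space (nu T x0 \<beta>)" "L2_norm (nu T x0 \<beta>) (\<lambda>p. F p - g p) \<le> L2_norm R (\<lambda>p. ext T F p - g p)"
    using sq[OF gm] L2_norm_sq_nn[OF Fg] by auto
  from L2_space_diff[OF F *(1)] have "g \<in> L2_space (nu T x0 \<beta>)" by simp
  with that g(1) *(2) g(3) show ?thesis by fastforce
qed

lemma trig_polys_terminal:
  fixes f :: "real ^ 'n \<Rightarrow> real"
  assumes "f \<in> trig_polys"
  shows "\<exists>(N :: nat) c l \<theta>. f = (\<lambda>x. \<Sum>i<N. c i * heat_wave x0 (l i) (\<theta> i) T x)"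
  using assms
proof induction
  case (atom c v \<theta>)
  have e: "exp (- (T * (norm v)\<^sup>2 / 2)) * exp (T * (norm v)\<^sup>2 / 2) = 1" by (simp add: exp_minus)
  have eq: "(\<lambda>x. c * cos (v \<bullet> x + \<theta>)) = (\<lambda>x. \<Sum>i<Suc 0. (c * exp (- (T * (norm v)\<^sup>2 / 2))) * heat_wave x0 v (\<theta> + v \<bullet> x0) T x)"
  proof
    fix x
    have "(\<Sum>i<Suc 0. (c * exp (- (T * (norm v)\<^sup>2 / 2))) * heat_wave x0 v (\<theta> + v \<bullet> x0) T x)
      = (exp (- (T * (norm v)\<^sup>2 / 2)) * exp (T * (norm v)\<^sup>2 / 2)) * (c * cos (v \<bullet> x + \<theta>))"
      by (simp add: heat_wave_def inner_diff_right)
    then show "c * cos (v \<bullet> x + \<theta>) = (\<Sum>i<Suc 0. (c * exp (- (T * (norm v)\<^sup>2 / 2))) * heat_wave x0 v (\<theta> + v \<bullet> x0) T x)"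
      by (simp only: e mult_1)
  qed
  show ?case
    by (rule exI[of _ "Suc 0"], rule exI[of _ "\<lambda>_. c * exp (- (T * (norm v)\<^sup>2 / 2))"],
        rule exI[of _ "\<lambda>_. v"], rule exI[of _ "\<lambda>_. \<theta> + v \<bullet> x0"], rule eq)
next
  case (add f g)
  obtain N :: nat and c l \<theta> where 1: "f = (\<lambda>x. \<Sum>i<N. c i * heat_wave x0 (l i) (\<theta> i) T x)" using add.IH(1) by blast
  obtain N' :: nat and c' l' \<theta>' where 2: "g = (\<lambda>x. \<Sum>i<N'. c' i * heat_wave x0 (l' i) (\<theta>' i) T x)" using add.IH(2) by blast
  have "(\<lambda>x. f x + g x) = (\<lambda>x. \<Sum>i<N + N'. cat N c c' i * heat_wave x0 (cat N l l' i) (cat N \<theta> \<theta>' i) T x)"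
    unfolding 1 2 by (rule ext, rule sum_cat[symmetric]) (auto simp: cat_def)
  then show ?case by blast
qed

text \<open>Only the gradient is recorded. Second derivatives of the heat flow are obtained by
  applying the gradient bound to the components of the weak gradient of the datum.\<close>

definition terminal_jet where
  "terminal_jet T x0 \<eta> u z \<longleftrightarrow> (\<exists>N c l \<theta>. \<eta> = (\<lambda>x. \<Sum>i<N. c i * heat_wave x0 (l i) (\<theta> i) T x) \<and>
    u = wave_sum x0 N (\<lambda>i t. c i) l \<theta> \<and> z = wave_grad x0 N (\<lambda>i t. c i) l \<theta>)"

lemma terminal_jet_diff:
  assumes 1: "terminal_jet T x0 \<eta> u z" and 2: "terminal_jet T x0 \<eta>' u' z'"
  shows "terminal_jet T x0 (\<lambda>x. \<eta> x - \<eta>' x) (\<lambda>p. u p - u' p) (\<lambda>p. z p - z' p)"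
proof -
  obtain N c l \<theta> where 1: "\<eta> = (\<lambda>x. \<Sum>i<N. c i * heat_wave x0 (l i) (\<theta> i) T x)"
    "u = wave_sum x0 N (\<lambda>i t. c i) l \<theta>" "z = wave_grad x0 N (\<lambda>i t. c i) l \<theta>"
    using 1 unfolding terminal_jet_def by blast
  obtain N' c' l' \<theta>' where 2: "\<eta>' = (\<lambda>x. \<Sum>i<N'. c' i * heat_wave x0 (l' i) (\<theta>' i) T x)"
    "u' = wave_sum x0 N' (\<lambda>i t. c' i) l' \<theta>'" "z' = wave_grad x0 N' (\<lambda>i t. c' i) l' \<theta>'"
    using 2 unfolding terminal_jet_def by blast
  let ?c = "cat N c (\<lambda>i. - c' i)"
  have c: "(\<lambda>i t. ?c i) = cat N (\<lambda>i t. c i) (\<lambda>i t. - c' i)" by (auto simp: cat_def fun_eq_iff)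
  have "\<eta> x - \<eta>' x = (\<Sum>i<N + N'. ?c i * heat_wave x0 (cat N l l' i) (cat N \<theta> \<theta>' i) T x)" for x
  proof -
    have "(\<Sum>i<N + N'. ?c i * heat_wave x0 (cat N l l' i) (cat N \<theta> \<theta>' i) T x)
      = (\<Sum>i<N. c i * heat_wave x0 (l i) (\<theta> i) T x) + (\<Sum>i<N'. - (c' i * heat_wave x0 (l' i) (\<theta>' i) T x))"
      by (rule sum_cat) (auto simp: cat_def)
    then show ?thesis by (simp add: 1 2 sum_negf)
  qed
  moreover have "(\<lambda>p. u p - u' p) = wave_sum x0 (N + N') (\<lambda>i t. ?c i) (cat N l l') (cat N \<theta> \<theta>')"
    "(\<lambda>p. z p - z' p) = wave_grad x0 (N + N') (\<lambda>i t. ?c i) (cat N l l') (cat N \<theta> \<theta>')"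
    unfolding c 1 2 by (simp_all add: fun_eq_iff wave_sum_cat wave_grad_cat wave_minus)
  ultimately show ?thesis unfolding terminal_jet_def by blast
qed

lemma terminal_jet_props:
  assumes T: "0 < T" and \<beta>: "0 < \<beta>" and w: "terminal_jet T x0 \<eta> u z" and \<eta>: "\<eta> \<in> L2_space (gaussian x0 T)"
  shows "z \<in> L2_space (nu T x0 \<beta>)" "L2_norm (nu T x0 \<beta>) z \<le> L2_norm (gaussian x0 T) \<eta>"
    "weak_Dx T u z" "p \<in> spacetime T \<Longrightarrow> heat_ker T \<eta> p = u p" "u \<in> borel_measurable (nu T x0 \<beta>)"
proof -
  obtain N c l \<theta> where eq: "\<eta> = (\<lambda>x. \<Sum>i<N. c i * heat_wave x0 (l i) (\<theta> i) T x)"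
    "u = wave_sum x0 N (\<lambda>i t. c i) l \<theta>" "z = wave_grad x0 N (\<lambda>i t. c i) l \<theta>"
    using w unfolding terminal_jet_def by blast
  have zm: "z \<in> borel_measurable (nu T x0 \<beta>)"
    unfolding eq by (intro borel_measurable_nuI borel_measurable_continuous_onI wave_grad_continuous) simp
  show "u \<in> borel_measurable (nu T x0 \<beta>)"
    unfolding eq by (intro borel_measurable_nuI borel_measurable_continuous_onI wave_sum_continuous) simp
  have "(\<integral>\<^sup>+p. ennreal ((norm (z p))\<^sup>2) \<partial>nu T x0 \<beta>) \<le> ennreal ((L2_norm (gaussian x0 T) \<eta>)\<^sup>2)"
    using nu_wave_grad_const_le[where N = N and c = c and l = l and \<theta> = \<theta>, OF T \<beta>, of x0] L2_norm_sq_nn[OF \<eta>]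
    by (simp add: eq)
  from L2_norm_leI[OF zm this] show "z \<in> L2_space (nu T x0 \<beta>)" "L2_norm (nu T x0 \<beta>) z \<le> L2_norm (gaussian x0 T) \<eta>"
    by auto
  show "weak_Dx T u z" unfolding eq by (intro wave_grad_weak_deriv) simp
  show "heat_ker T \<eta> p = u p" if "p \<in> spacetime T"
    using that gaussian_wave_sum[where t = "fst p" and r = T and N = N and c = c and l = l and \<theta> = \<theta> and x = "snd p", of x0]
    by (auto simp: heat_ker_def eq wave_sum_def spacetime_def)
qed

subsection \<open>Jets of Duhamel integrals and of the heat flow\<close>

context
  fixes M :: "'w measure" and W :: "real \<Rightarrow> 'w \<Rightarrow> real ^ 'n" and T \<beta> :: real and x0 :: "real ^ 'n"
  assumes BM: "brownian_motion M W" and T: "0 < T" and \<beta>: "0 < \<beta>"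
begin

private abbreviation (input) \<nu> where "\<nu> \<equiv> nu T x0 \<beta>"

private abbreviation (input) \<mu> where "\<mu> \<equiv> gaussian x0 T"

lemma null_sequence_inverse: "(\<And>n. 0 \<le> f n \<and> f n < inverse (real (Suc n))) \<Longrightarrow> f \<longlonglongrightarrow> (0::real)"
  by (rule tendsto_sandwich[OF _ _ tendsto_const LIMSEQ_inverse_real_of_nat])
     (auto intro!: always_eventually simp: less_imp_le)

text \<open>Sources are approximated by wave sums. The estimates applied to differences make the
  gradients and Hessians Cauchy, and closedness of the weak derivative identifies their limits as
  the jet of the limiting solution; the constants survive the limit.\<close>

lemma duhamel_jet:
  assumes F: "F \<in> L2_space \<nu>"
  obtains z \<gamma> where "z \<in> L2_space \<nu>" "\<gamma> \<in> L2_space \<nu>"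
    "weak_Dx T (duh_ker T (ext T F)) z" "\<And>k. weak_Dx T (\<lambda>p. z p $ k) (\<lambda>p. \<gamma> p $ k)"
    "L2_norm \<nu> (duh_ker T (ext T F)) \<le> (1 / \<beta>) * L2_norm \<nu> F"
    "L2_norm \<nu> z \<le> (1 / sqrt \<beta>) * L2_norm \<nu> F"
    "L2_norm \<nu> \<gamma> \<le> 2 * sqrt 2 * L2_norm \<nu> F"
proof -
  have "\<exists>g u z \<gamma>. wave_jet T x0 g u z \<gamma> \<and> g \<in> L2_space \<nu> \<and> L2_norm \<nu> (\<lambda>p. F p - g p) < inverse (real (Suc n))" for n
  proof -
    obtain g where g: "g \<in> trig_polys" "g \<in> L2_space \<nu>" "L2_norm \<nu> (\<lambda>p. F p - g p) < inverse (real (Suc n))"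
      using nu_trig_polys_dense[OF T \<beta> F, of "inverse (real (Suc n))"] by auto
    obtain N a l \<theta> where "\<And>i. continuous_on UNIV (a i)" "g = wave_sum x0 N a l \<theta>"
      using trig_polys_wave[OF g(1), of x0] by blast
    with wave_jet_exists[OF T, of a x0 N l \<theta>] g show ?thesis by blast
  qed
  then obtain g u z \<gamma> where w: "\<And>n. wave_jet T x0 (g n) (u n) (z n) (\<gamma> n)" and g: "\<And>n. g n \<in> L2_space \<nu>"
    and gF: "\<And>n. L2_norm \<nu> (\<lambda>p. F p - g n p) < inverse (real (Suc n))" by metis
  have lim: "(\<lambda>n. L2_norm \<nu> (\<lambda>p. g n p - F p)) \<longlonglongrightarrow> 0"
    using gF by (intro null_sequence_inverse) (simp add: L2_norm_diff_commute[of _ F])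
  note e = wave_jet_estimates[OF T \<beta> w g]
  note d = wave_jet_estimates[OF T \<beta> wave_jet_diff[OF w w] L2_space_diff[OF g g]]
  have \<beta>': "0 \<le> 1 / sqrt \<beta>" using \<beta> by simp
  obtain z' where z': "z' \<in> L2_space \<nu>" "(\<lambda>n. L2_norm \<nu> (\<lambda>x. z n x - z' x)) \<longlonglongrightarrow> 0" "L2_norm \<nu> z' \<le> (1 / sqrt \<beta>) * L2_norm \<nu> F"
    using L2_limit_exists[OF e(3) g F lim d(4) e(4) \<beta>'] by blast
  obtain \<gamma>' where \<gamma>': "\<gamma>' \<in> L2_space \<nu>" "(\<lambda>n. L2_norm \<nu> (\<lambda>x. \<gamma> n x - \<gamma>' x)) \<longlonglongrightarrow> 0" "L2_norm \<nu> \<gamma>' \<le> 2 * sqrt 2 * L2_norm \<nu> F"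
    using L2_limit_exists[OF e(5) g F lim d(6) e(6)] by auto
  let ?D = "\<lambda>F. duh_ker T (ext T F)"
  have D: "?D F \<in> L2_space \<nu>" by (rule duh_ker_L2(1)[OF BM T F less_imp_le[OF \<beta>]])
  \<comment> \<open>The limit of the explicit solutions has to be the Duhamel integral of F itself.
    Linearity almost everywhere and the continuity bound with factor T provide this.\<close>
  have uD: "L2_norm \<nu> (\<lambda>p. u n p - ?D F p) \<le> T * L2_norm \<nu> (\<lambda>p. g n p - F p)" for n
  proof -
    have "L2_norm \<nu> (\<lambda>p. u n p - ?D F p) = L2_norm \<nu> (?D (\<lambda>p. g n p - F p))"
    proof (rule L2_norm_cong_AE)
      show "AE p in \<nu>. norm (u n p - ?D F p) = norm (?D (\<lambda>p. g n p - F p) p)"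
        using duh_ker_diff[OF BM T g[of n] F less_imp_le[OF \<beta>]] AE_space
        by eventually_elim (simp add: wave_jet_duhamel[OF w])
    qed (intro L2_space_measurable L2_space_diff e(1) D duh_ker_L2(1)[OF BM T L2_space_diff[OF g F] less_imp_le[OF \<beta>]])+
    also have "\<dots> \<le> T * L2_norm \<nu> (\<lambda>p. g n p - F p)"
      by (rule duh_ker_L2(2)[OF BM T L2_space_diff[OF g F] less_imp_le[OF \<beta>]])
    finally show ?thesis .
  qed
  have "(\<lambda>n. T * L2_norm \<nu> (\<lambda>p. g n p - F p)) \<longlonglongrightarrow> T * 0" by (intro tendsto_intros lim)
  then have T0: "(\<lambda>n. T * L2_norm \<nu> (\<lambda>p. g n p - F p)) \<longlonglongrightarrow> 0" by simp
  have ulim: "(\<lambda>n. L2_norm \<nu> (\<lambda>p. u n p - ?D F p)) \<longlonglongrightarrow> 0"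
    by (rule Lim_null_comparison[OF always_eventually T0]) (use uD in simp)
  have "L2_norm \<nu> (?D F) \<le> (1 / \<beta>) * L2_norm \<nu> F"
  proof (rule LIMSEQ_le_const)
    have "(\<lambda>n. (1 / \<beta>) * (L2_norm \<nu> F + L2_norm \<nu> (\<lambda>p. g n p - F p)) + L2_norm \<nu> (\<lambda>p. u n p - ?D F p))
      \<longlonglongrightarrow> (1 / \<beta>) * (L2_norm \<nu> F + 0) + 0" by (intro tendsto_intros lim ulim)
    then show "(\<lambda>n. (1 / \<beta>) * (L2_norm \<nu> F + L2_norm \<nu> (\<lambda>p. g n p - F p)) + L2_norm \<nu> (\<lambda>p. u n p - ?D F p))
      \<longlonglongrightarrow> (1 / \<beta>) * L2_norm \<nu> F" by simp
    have "L2_norm \<nu> (?D F) \<le> (1 / \<beta>) * (L2_norm \<nu> F + L2_norm \<nu> (\<lambda>p. g n p - F p)) + L2_norm \<nu> (\<lambda>p. u n p - ?D F p)" for n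
    proof -
      have "L2_norm \<nu> (?D F) \<le> L2_norm \<nu> (u n) + L2_norm \<nu> (\<lambda>p. ?D F p - u n p)"
        by (rule L2_norm_le_add_diff[OF D e(1)])
      also have "L2_norm \<nu> (u n) \<le> (1 / \<beta>) * L2_norm \<nu> (g n)" by (rule e(2))
      also have "(1 / \<beta>) * L2_norm \<nu> (g n) \<le> (1 / \<beta>) * (L2_norm \<nu> F + L2_norm \<nu> (\<lambda>p. g n p - F p))"
        using \<beta> by (intro mult_left_mono L2_norm_le_add_diff g F) auto
      finally show ?thesis by (simp add: L2_norm_diff_commute[of _ "?D F"])
    qed
    then show "\<exists>n0. \<forall>n\<ge>n0. L2_norm \<nu> (?D F) \<le> (1 / \<beta>) * (L2_norm \<nu> F + L2_norm \<nu> (\<lambda>p. g n p - F p)) + L2_norm \<nu> (\<lambda>p. u n p - ?D F p)"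
      by blast
  qed
  moreover have "weak_Dx T (?D F) z'"
    by (rule weak_Dx_limit[OF wave_jet_weak(1)[OF w] e(1) D ulim e(3) z'(1,2)])
  moreover have "weak_Dx T (\<lambda>p. z' p $ k) (\<lambda>p. \<gamma>' p $ k)" for k
    by (rule weak_Dx_limit[OF wave_jet_weak(2)[OF w] L2_component(1)[OF e(3)] L2_component(1)[OF z'(1)]
          L2_component_tendsto[OF e(3) z'(1,2)] L2_component(1)[OF e(5)] L2_component(1)[OF \<gamma>'(1)]
          L2_component_tendsto[OF e(5) \<gamma>'(1,2)]])
  ultimately show ?thesis using that z' \<gamma>' by blast
qed

text \<open>The datum is merely square integrable: averaging over time regains one derivative, with
  constant 1. The limit argument is the one for the Duhamel integral, with the terminal law in place
  of the occupation measure on the side of the data.\<close>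

lemma heat_flow_gradient:
  assumes \<eta>: "\<eta> \<in> L2_space \<mu>"
  obtains z where "z \<in> L2_space \<nu>" "weak_Dx T (heat_ker T \<eta>) z" "L2_norm \<nu> z \<le> L2_norm \<mu> \<eta>"
proof -
  have fin: "finite_measure \<mu>" using prob_space_gaussian[OF T, of x0] by (simp add: prob_space_def)
  have "\<exists>g u z. terminal_jet T x0 g u z \<and> g \<in> L2_space \<mu> \<and> L2_norm \<mu> (\<lambda>p. \<eta> p - g p) < inverse (real (Suc n))" for n
  proof -
    obtain g where g: "g \<in> trig_polys" "g \<in> L2_space \<mu>" "L2_norm \<mu> (\<lambda>p. \<eta> p - g p) < inverse (real (Suc n))"
      using trig_polys_dense[OF fin _ \<eta>, of "inverse (real (Suc n))"] by auto
    with trig_polys_terminal[OF g(1), of x0 T] show ?thesis unfolding terminal_jet_def by blast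
  qed
  then obtain g u z where w: "\<And>n. terminal_jet T x0 (g n) (u n) (z n)" and g: "\<And>n. g n \<in> L2_space \<mu>"
    and gF: "\<And>n. L2_norm \<mu> (\<lambda>p. \<eta> p - g n p) < inverse (real (Suc n))" by metis
  have lim: "(\<lambda>n. L2_norm \<mu> (\<lambda>p. g n p - \<eta> p)) \<longlonglongrightarrow> 0"
    using gF by (intro null_sequence_inverse) (simp add: L2_norm_diff_commute[of _ \<eta>])
  note e = terminal_jet_props[OF T \<beta> w g]
  note d = terminal_jet_props[OF T \<beta> terminal_jet_diff[OF w w] L2_space_diff[OF g g]]
  have "L2_norm \<nu> (z n) \<le> 1 * L2_norm \<mu> (g n)" "L2_norm \<nu> (\<lambda>x. z m x - z n x) \<le> 1 * L2_norm \<mu> (\<lambda>x. g m x - g n x)" for m n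
    using e(2) d(2) by simp_all
  from L2_limit_exists[OF e(1) g \<eta> lim this(2) this(1)]
  obtain z' where z': "z' \<in> L2_space \<nu>" "(\<lambda>n. L2_norm \<nu> (\<lambda>x. z n x - z' x)) \<longlonglongrightarrow> 0" "L2_norm \<nu> z' \<le> L2_norm \<mu> \<eta>"
    by auto
  have D: "heat_ker T \<eta> \<in> L2_space \<nu>" by (rule heat_ker_L2(1)[OF BM T \<eta> \<beta>])
  have u: "u n \<in> L2_space \<nu>" for n
    by (rule L2_space_cong_AE[OF heat_ker_L2(1)[OF BM T g \<beta>] e(5)]) (auto intro!: AE_I2 e(4))
  have uD: "L2_norm \<nu> (\<lambda>p. u n p - heat_ker T \<eta> p) \<le> sqrt (1 / \<beta>) * L2_norm \<mu> (\<lambda>p. g n p - \<eta> p)" for n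
  proof -
    have "L2_norm \<nu> (\<lambda>p. u n p - heat_ker T \<eta> p) = L2_norm \<nu> (heat_ker T (\<lambda>p. g n p - \<eta> p))"
    proof (rule L2_norm_cong_AE)
      show "AE p in \<nu>. norm (u n p - heat_ker T \<eta> p) = norm (heat_ker T (\<lambda>p. g n p - \<eta> p) p)"
        using heat_ker_diff[OF BM T g[of n] \<eta> \<beta>] AE_space
        by eventually_elim (simp add: e(4))
    qed (intro L2_space_measurable L2_space_diff u D heat_ker_L2(1)[OF BM T L2_space_diff[OF g \<eta>] \<beta>])+
    also have "\<dots> \<le> sqrt (1 / \<beta>) * L2_norm \<mu> (\<lambda>p. g n p - \<eta> p)"
      by (rule heat_ker_L2(2)[OF BM T L2_space_diff[OF g \<eta>] \<beta>])
    finally show ?thesis .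
  qed
  have "(\<lambda>n. sqrt (1 / \<beta>) * L2_norm \<mu> (\<lambda>p. g n p - \<eta> p)) \<longlonglongrightarrow> sqrt (1 / \<beta>) * 0" by (intro tendsto_intros lim)
  then have T0: "(\<lambda>n. sqrt (1 / \<beta>) * L2_norm \<mu> (\<lambda>p. g n p - \<eta> p)) \<longlonglongrightarrow> 0" by simp
  have ulim: "(\<lambda>n. L2_norm \<nu> (\<lambda>p. u n p - heat_ker T \<eta> p)) \<longlonglongrightarrow> 0"
    by (rule Lim_null_comparison[OF always_eventually T0]) (use uD in simp)
  have "weak_Dx T (heat_ker T \<eta>) z'"
    by (rule weak_Dx_limit[OF e(3) u D ulim e(1) z'(1,2)])
  with that z' show ?thesis by blast
qed

text \<open>Fubini for the pairing of the heat flow with a test function. Absolute integrability is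
  checked with the flow of \<open>\<bar>\<phi>\<bar>\<close>, which lies in L2 of the occupation
  measure and is therefore locally integrable on the support of \<open>\<rho>\<close>.\<close>

lemma heat_test_integral:
  fixes \<phi> :: "real ^ 'n \<Rightarrow> real"
  assumes \<phi>: "\<phi> \<in> L2_space \<mu>" and \<rho>: "\<rho> \<in> test_functions (spacetime T)"
  defines "H \<equiv> \<lambda>p y. gauss_density 0 (T - fst p) y * \<phi> (snd p + y) * \<rho> p"
  shows "integrable (lborel \<Otimes>\<^sub>M lborel) (\<lambda>(p, y). H p y)"
    and "(LINT p|lborel. heat_ker T \<phi> p * \<rho> p) = (LINT y|lborel. LINT p|lborel. H p y)"
proof -
  have [measurable]: "\<phi> \<in> borel_measurable borel" using L2_space_measurable[OF \<phi>] by simp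
  have [measurable]: "\<rho> \<in> borel_measurable borel" by (rule test_functions_measurable[OF \<rho>])
  have [measurable]: "(fst :: real \<times> (real ^ 'n) \<Rightarrow> real) \<in> borel_measurable borel"
    "(snd :: real \<times> (real ^ 'n) \<Rightarrow> real ^ 'n) \<in> borel_measurable borel"
    by (auto intro!: borel_measurable_continuous_onI continuous_intros)
  have a\<phi>: "(\<lambda>x. \<bar>\<phi> x\<bar>) \<in> L2_space \<mu>" using \<phi> by (auto simp: L2_space_def)
  show int: "integrable (lborel \<Otimes>\<^sub>M lborel) (\<lambda>(p, y). H p y)"
  proof (rule lborel_pair.Fubini_integrable)
    show "(\<lambda>(p, y). H p y) \<in> borel_measurable (lborel \<Otimes>\<^sub>M lborel)"
      unfolding H_def by measurable
    have eq: "(LINT y|lborel. norm (case (p, y) of (p, y) \<Rightarrow> H p y)) = \<bar>indicator (spacetime T) p * (heat_ker T (\<lambda>x. \<bar>\<phi> x\<bar>) p * \<rho> p)\<bar>" for p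
    proof -
      have nn: "0 \<le> heat_ker T (\<lambda>x. \<bar>\<phi> x\<bar>) p"
        unfolding heat_ker_def by (intro Bochner_Integration.integral_nonneg) (simp add: gauss_density_nonneg)
      have "(LINT y|lborel. norm (case (p, y) of (p, y) \<Rightarrow> H p y)) = heat_ker T (\<lambda>x. \<bar>\<phi> x\<bar>) p * \<bar>\<rho> p\<bar>"
        by (simp add: H_def heat_ker_def abs_mult gauss_density_nonneg)
      moreover have "p \<notin> spacetime T \<Longrightarrow> \<rho> p = 0"
        using test_functions_supp(2)[OF \<rho>] not_in_supp[of p \<rho>] by blast
      ultimately show ?thesis using nn by (cases "p \<in> spacetime T") (auto simp: abs_mult)
    qed
    show "integrable lborel (\<lambda>p. LINT y|lborel. norm (case (p, y) of (p, y) \<Rightarrow> H p y))"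
      unfolding eq
      by (intro integrable_abs test_integrable[OF locally_integrable_L2[OF heat_ker_L2(1)[OF BM T a\<phi> \<beta>]] \<rho>])
    have "AE p in lborel. p \<in> spacetime T \<longrightarrow> integrable (gaussian 0 (T - fst p)) (\<lambda>y. \<phi> (snd p + y))"
      using AE_heat_integrable[OF BM T _ \<phi> \<beta>] unfolding AE_nu_iff by simp
    then show "AE p in lborel. integrable lborel (\<lambda>y. case (p, y) of (p, y) \<Rightarrow> H p y)"
    proof eventually_elim
      case (elim p)
      show ?case
      proof (cases "p \<in> spacetime T")
        case True
        with elim have "integrable lborel (\<lambda>y. gauss_density 0 (T - fst p) y * \<phi> (snd p + y))"
          unfolding gaussian_def by (auto simp: integrable_density gauss_density_nonneg)
        then show ?thesis by (simp add: H_def)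
      next
        case False
        then have "\<rho> p = 0" using test_functions_supp(2)[OF \<rho>] not_in_supp[of p \<rho>] by blast
        then show ?thesis by (simp add: H_def)
      qed
    qed
  qed
  have "(LINT p|lborel. heat_ker T \<phi> p * \<rho> p) = (LINT p|lborel. LINT y|lborel. H p y)"
    by (simp add: heat_ker_def H_def)
  also have "\<dots> = (LINT y|lborel. LINT p|lborel. H p y)"
    using lborel_pair.Fubini_integral[OF int] by simp
  finally show "(LINT p|lborel. heat_ker T \<phi> p * \<rho> p) = (LINT y|lborel. LINT p|lborel. H p y)" .
qed

text \<open>The heat flow commutes with the weak gradient: for fixed \<open>t\<close> and \<open>y\<close> the shifted slice
  \<open>\<psi>(t, \<sqdot> - y)\<close> is an admissible test function for the terminal datum.\<close>

lemma heat_flow_commutes: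
  assumes \<eta>: "\<eta> \<in> L2_space \<mu>" and \<zeta>: "\<zeta> \<in> L2_space \<mu>" and grad: "weak_gradient \<eta> \<zeta>"
  shows "weak_Dx T (heat_ker T \<eta>) (\<lambda>p. \<chi> k. heat_ker T (\<lambda>x. \<zeta> x $ k) p)"
  unfolding weak_Dx_def vec_lambda_beta
proof
  fix k
  have \<zeta>k: "(\<lambda>x. \<zeta> x $ k) \<in> L2_space \<mu>" by (rule L2_component(1)[OF \<zeta>])
  have [measurable]: "\<eta> \<in> borel_measurable borel" "(\<lambda>x. \<zeta> x $ k) \<in> borel_measurable borel"
    using L2_space_measurable[OF \<eta>] L2_space_measurable[OF \<zeta>k] by simp_all
  have "(LINT p|lborel. heat_ker T \<eta> p * frechet_derivative \<psi> (at p) (0, axis k 1))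
      = - (LINT p|lborel. heat_ker T (\<lambda>x. \<zeta> x $ k) p * \<psi> p)"
    if \<psi>: "\<psi> \<in> test_functions (spacetime T)" for \<psi>
  proof -
    let ?\<rho> = "\<lambda>p. frechet_derivative \<psi> (at p) (0, axis k 1)"
    have \<rho>: "?\<rho> \<in> test_functions (spacetime T)" by (rule test_functions_deriv[OF \<psi>]) simp
    have [measurable]: "\<psi> \<in> borel_measurable borel" "?\<rho> \<in> borel_measurable borel"
      by (rule test_functions_measurable[OF \<psi>], rule test_functions_measurable[OF \<rho>])
    have slm [measurable]: "(\<lambda>x. \<psi> (t, x)) \<in> borel_measurable borel" "(\<lambda>x. ?\<rho> (t, x)) \<in> borel_measurable borel" for t
      by (auto intro!: slice_measurable)
    let ?H1 = "\<lambda>p y. gauss_density 0 (T - fst p) y * \<eta> (snd p + y) * ?\<rho> p"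
    let ?H2 = "\<lambda>p y. gauss_density 0 (T - fst p) y * \<zeta> (snd p + y) $ k * \<psi> p"
    note i1 = heat_test_integral[OF \<eta> \<rho>] and i2 = heat_test_integral[OF \<zeta>k \<psi>]
    have inner: "(LINT x|lborel. \<eta> (x + y) * ?\<rho> (t, x)) = - (LINT x|lborel. \<zeta> (x + y) $ k * \<psi> (t, x))" for t y
    proof -
      let ?\<psi> = "\<lambda>x. \<psi> (t, x - y)"
      have t\<psi>: "?\<psi> \<in> test_functions UNIV" by (rule test_functions_slice[OF \<psi>])
      have fd: "frechet_derivative ?\<psi> (at x) (axis k 1) = ?\<rho> (t, x - y)" for x
        using frechet_derivative_at[OF slice_has_derivative[OF test_functions_Ck[OF \<psi>, of "Suc 0"], of t y x], symmetric]
        by simp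
      have "(LINT x:UNIV|lborel. \<eta> x * frechet_derivative ?\<psi> (at x) (axis k 1)) = - (LINT x:UNIV|lborel. \<zeta> x $ k * ?\<psi> x)"
        using grad t\<psi> by (auto simp: weak_gradient_def weak_deriv_def)
      then have "(LINT x|lborel. \<eta> x * ?\<rho> (t, x - y)) = - (LINT x|lborel. \<zeta> x $ k * \<psi> (t, x - y))"
        by (simp add: fd set_lebesgue_integral_def)
      moreover have "(LINT x|lborel. \<eta> (y + x) * ?\<rho> (t, y + x - y)) = (LINT x|lborel. \<eta> x * ?\<rho> (t, x - y))"
        by (rule lborel_integral_shift(1)[of "\<lambda>x. \<eta> x * ?\<rho> (t, x - y)" y]) measurable
      moreover have "(LINT x|lborel. \<zeta> (y + x) $ k * \<psi> (t, y + x - y)) = (LINT x|lborel. \<zeta> x $ k * \<psi> (t, x - y))"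
        by (rule lborel_integral_shift(1)[of "\<lambda>x. \<zeta> x $ k * \<psi> (t, x - y)" y]) measurable
      ultimately show ?thesis by (simp add: add.commute)
    qed
    have "AE y in lborel. integrable lborel (\<lambda>p. ?H1 p y)" "AE y in lborel. integrable lborel (\<lambda>p. ?H2 p y)"
      using lborel_pair.AE_integrable_snd[OF i1(1)] lborel_pair.AE_integrable_snd[OF i2(1)] by simp_all
    then have "AE y in lborel. (LINT p|lborel. ?H1 p y) = - (LINT p|lborel. ?H2 p y)"
    proof eventually_elim
      case (elim y)
      have 1: "(LINT p|lborel. ?H1 p y) = (LINT t|lborel. LINT x|lborel. ?H1 (t, x) y)"
        using lborel_pair.integral_fst'[of "\<lambda>p. ?H1 p y"] elim(1) by (simp add: lborel_prod)
      have 2: "(LINT p|lborel. ?H2 p y) = (LINT t|lborel. LINT x|lborel. ?H2 (t, x) y)"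
        using lborel_pair.integral_fst'[of "\<lambda>p. ?H2 p y"] elim(2) by (simp add: lborel_prod)
      have "(LINT x|lborel. ?H1 (t, x) y) = - (LINT x|lborel. ?H2 (t, x) y)" for t
        using inner[of y t] by (simp add: mult.assoc)
      then show ?case unfolding 1 2 by simp
    qed
    then have "(LINT y|lborel. LINT p|lborel. ?H1 p y) = (LINT y|lborel. - (LINT p|lborel. ?H2 p y))"
    proof (rule integral_cong_AE[rotated 2])
      show "(\<lambda>y. LINT p|lborel. ?H1 p y) \<in> borel_measurable lborel"
        using borel_measurable_integrable[OF lborel_pair.integrable_snd[OF i1(1)]] by simp
      show "(\<lambda>y. - (LINT p|lborel. ?H2 p y)) \<in> borel_measurable lborel"
        using borel_measurable_integrable[OF lborel_pair.integrable_snd[OF i2(1)]] by simp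
    qed
    then show ?thesis unfolding i1(2) i2(2) by simp
  qed
  then show "weak_deriv (spacetime T) (0, axis k 1) (heat_ker T \<eta>) (heat_ker T (\<lambda>x. \<zeta> x $ k))"
    using locally_integrable_L2[OF heat_ker_L2(1)[OF BM T \<eta> \<beta>]] locally_integrable_L2[OF heat_ker_L2(1)[OF BM T \<zeta>k \<beta>]]
    by (simp add: weak_deriv_def test_integral_eq test_deriv_integral_eq)
qed

text \<open>The gradient is the heat flow of \<open>\<zeta>\<close>, by commutation, while its norm
  bound by \<open>\<eta>\<close> is borrowed from \<open>heat_flow_gradient\<close> through
  uniqueness of the weak derivative. Row \<open>k\<close> of the Hessian is the gradient of the flow
  of component \<open>k\<close> of \<open>\<zeta>\<close>; squared norms add over \<open>k\<close>,
  so the constant stays 1.\<close>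

lemma heat_flow_jet:
  assumes \<eta>: "\<eta> \<in> L2_space \<mu>" and \<zeta>: "\<zeta> \<in> L2_space \<mu>" and grad: "weak_gradient \<eta> \<zeta>"
  obtains z \<gamma> where "z \<in> L2_space \<nu>" "\<gamma> \<in> L2_space \<nu>" "weak_Dx T (heat_ker T \<eta>) z"
    "\<And>k. weak_Dx T (\<lambda>p. z p $ k) (\<lambda>p. \<gamma> p $ k)"
    "L2_norm \<nu> z \<le> L2_norm \<mu> \<eta>" "L2_norm \<nu> \<gamma> \<le> L2_norm \<mu> \<zeta>"
proof -
  let ?z = "\<lambda>p. \<chi> k. heat_ker T (\<lambda>x. \<zeta> x $ k) p"
  have w: "weak_Dx T (heat_ker T \<eta>) ?z" by (rule heat_flow_commutes[OF \<eta> \<zeta> grad])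
  obtain z1 where z1: "z1 \<in> L2_space \<nu>" "weak_Dx T (heat_ker T \<eta>) z1" "L2_norm \<nu> z1 \<le> L2_norm \<mu> \<eta>"
    using heat_flow_gradient[OF \<eta>] by blast
  have z: "?z \<in> L2_space \<nu>"
    using heat_ker_L2(1)[OF BM T L2_component(1)[OF \<zeta>] \<beta>] by (intro L2_spaceI_component) simp
  have "AE p in \<nu>. ?z p = z1 p" by (rule weak_Dx_unique[OF w z1(2)])
  then have "L2_norm \<nu> ?z = L2_norm \<nu> z1"
    by (intro L2_norm_cong_AE L2_space_measurable z z1) auto
  then have zn: "L2_norm \<nu> ?z \<le> L2_norm \<mu> \<eta>" using z1(3) by simp
  have "\<exists>h. h \<in> L2_space \<nu> \<and> weak_Dx T (heat_ker T (\<lambda>x. \<zeta> x $ k)) h \<and> L2_norm \<nu> h \<le> L2_norm \<mu> (\<lambda>x. \<zeta> x $ k)" for k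
    using heat_flow_gradient[OF L2_component(1)[OF \<zeta>]] by metis
  then obtain h where h: "\<And>k. h k \<in> L2_space \<nu>" "\<And>k. weak_Dx T (heat_ker T (\<lambda>x. \<zeta> x $ k)) (h k)"
    "\<And>k. L2_norm \<nu> (h k) \<le> L2_norm \<mu> (\<lambda>x. \<zeta> x $ k)" by metis
  let ?\<gamma> = "\<lambda>p. \<chi> k. h k p"
  have \<gamma>: "?\<gamma> \<in> L2_space \<nu>" "(L2_norm \<nu> ?\<gamma>)\<^sup>2 = (\<Sum>k\<in>UNIV. (L2_norm \<nu> (h k))\<^sup>2)"
    using L2_spaceI_component[of ?\<gamma> \<nu>] h(1) by simp_all
  have "(L2_norm \<nu> ?\<gamma>)\<^sup>2 \<le> (\<Sum>k\<in>UNIV. (L2_norm \<mu> (\<lambda>x. \<zeta> x $ k))\<^sup>2)"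
    unfolding \<gamma>(2) by (intro sum_mono power_mono h) simp
  also have "\<dots> = (L2_norm \<mu> \<zeta>)\<^sup>2" by (rule L2_spaceI_component(2)[symmetric, OF L2_component(1)[OF \<zeta>]])
  finally have "L2_norm \<nu> ?\<gamma> \<le> L2_norm \<mu> \<zeta>" by (rule power2_le_imp_le) simp
  moreover have "weak_Dx T (\<lambda>p. ?z p $ k) (\<lambda>p. ?\<gamma> p $ k)" for k using h(2) by simp
  ultimately show ?thesis using that[OF z \<gamma>(1) w] zn by blast
qed

end

section \<open>Jets, the contraction and the nonlinear problem\<close>

subsection \<open>Occupation mild jets\<close>

text \<open>The part of a jet that is preserved by sums and by measurable changes on null sets.
  Symmetry at every point is not preserved by such changes and is restored separately.\<close>

definition pre_jet where
  "pre_jet T x0 \<beta> v z \<gamma> \<longleftrightarrow>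
     v \<in> L2_space (nu T x0 \<beta>) \<and> z \<in> L2_space (nu T x0 \<beta>) \<and> \<gamma> \<in> L2_space (nu T x0 \<beta>) \<and>
     weak_Dx T v z \<and> (\<forall>k. weak_Dx T (\<lambda>p. z p $ k) (\<lambda>p. \<gamma> p $ k))"

lemma occupation_mild_jet_iff:
  "occupation_mild_jet T x0 \<beta> v z \<gamma> \<longleftrightarrow> pre_jet T x0 \<beta> v z \<gamma> \<and> (\<forall>p\<in>spacetime T. \<gamma> p \<in> sym_mats)"
  by (auto simp: occupation_mild_jet_def pre_jet_def)

lemma pre_jet_L2:
  assumes "pre_jet T x0 \<beta> v z \<gamma>"
  shows "v \<in> L2_space (nu T x0 \<beta>)" "z \<in> L2_space (nu T x0 \<beta>)" "\<gamma> \<in> L2_space (nu T x0 \<beta>)"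
  using assms by (auto simp: pre_jet_def)

lemma pre_jet_add:
  assumes "pre_jet T x0 \<beta> v z \<gamma>" "pre_jet T x0 \<beta> v' z' \<gamma>'"
  shows "pre_jet T x0 \<beta> (\<lambda>p. v p + v' p) (\<lambda>p. z p + z' p) (\<lambda>p. \<gamma> p + \<gamma>' p)"
  using assms by (auto simp: pre_jet_def intro!: L2_space_add weak_Dx_add)

lemma pre_jet_cong_AE:
  assumes j: "pre_jet T x0 \<beta> v z \<gamma>"
    and ae: "AE p in nu T x0 \<beta>. v p = v' p" "AE p in nu T x0 \<beta>. z p = z' p" "AE p in nu T x0 \<beta>. \<gamma> p = \<gamma>' p"
    and m: "v' \<in> borel_measurable (nu T x0 \<beta>)" "z' \<in> borel_measurable (nu T x0 \<beta>)" "\<gamma>' \<in> borel_measurable (nu T x0 \<beta>)"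
  shows "pre_jet T x0 \<beta> v' z' \<gamma>'"
proof -
  note L = pre_jet_L2[OF j]
  have 1: "v' \<in> L2_space (nu T x0 \<beta>)" "z' \<in> L2_space (nu T x0 \<beta>)" "\<gamma>' \<in> L2_space (nu T x0 \<beta>)"
    using L2_space_cong_AE[OF L(1) m(1) ae(1)] L2_space_cong_AE[OF L(2) m(2) ae(2)] L2_space_cong_AE[OF L(3) m(3) ae(3)] .
  have "AE p in nu T x0 \<beta>. v p = v' p \<and> z p = z' p" using ae(1,2) by eventually_elim simp
  note vz = this
  have "weak_Dx T v z" using j by (simp add: pre_jet_def)
  then have 2: "weak_Dx T v' z'" by (rule weak_Dx_cong_AE[OF _ vz m(1,2)])
  have 3: "weak_Dx T (\<lambda>p. z' p $ k) (\<lambda>p. \<gamma>' p $ k)" for k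
  proof (rule weak_Dx_cong_AE)
    show "weak_Dx T (\<lambda>p. z p $ k) (\<lambda>p. \<gamma> p $ k)" using j by (simp add: pre_jet_def)
    show "AE p in nu T x0 \<beta>. z p $ k = z' p $ k \<and> \<gamma> p $ k = \<gamma>' p $ k" using ae(2,3) by eventually_elim simp
  qed (use m in measurable)
  from 1 2 3 show ?thesis by (simp add: pre_jet_def)
qed

lemma pre_jet_unique:
  assumes j: "pre_jet T x0 \<beta> v z \<gamma>" and j': "pre_jet T x0 \<beta> v' z' \<gamma>'"
    and ae: "AE p in nu T x0 \<beta>. v p = v' p"
  shows "AE p in nu T x0 \<beta>. z p = z' p \<and> \<gamma> p = \<gamma>' p"
proof -
  note L = pre_jet_L2[OF j, THEN L2_space_measurable] and L' = pre_jet_L2[OF j', THEN L2_space_measurable]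
  have "AE p in nu T x0 \<beta>. v' p = v p \<and> z' p = z' p" using ae by eventually_elim simp
  note vz = this
  have w: "weak_Dx T v z" "weak_Dx T v' z'" using j j' by (simp_all add: pre_jet_def)
  have z: "AE p in nu T x0 \<beta>. z p = z' p"
    by (rule weak_Dx_unique[OF w(1) weak_Dx_cong_AE[OF w(2) vz L(1) L'(2)]])
  have "AE p in nu T x0 \<beta>. \<gamma> p $ k = \<gamma>' p $ k" for k
  proof -
    have [measurable]: "z \<in> borel_measurable (nu T x0 \<beta>)" "\<gamma>' \<in> borel_measurable (nu T x0 \<beta>)" by (rule L(2), rule L'(3))
    have "weak_Dx T (\<lambda>p. z p $ k) (\<lambda>p. \<gamma>' p $ k)"
    proof (rule weak_Dx_cong_AE)
      show "weak_Dx T (\<lambda>p. z' p $ k) (\<lambda>p. \<gamma>' p $ k)" using j' by (simp add: pre_jet_def)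
      show "AE p in nu T x0 \<beta>. z' p $ k = z p $ k \<and> \<gamma>' p $ k = \<gamma>' p $ k" using z by eventually_elim simp
    qed measurable
    moreover have "weak_Dx T (\<lambda>p. z p $ k) (\<lambda>p. \<gamma> p $ k)" using j by (simp add: pre_jet_def)
    ultimately show ?thesis by (rule weak_Dx_unique[rotated])
  qed
  then have "AE p in nu T x0 \<beta>. \<forall>k. \<gamma> p $ k = \<gamma>' p $ k" by (subst AE_all_countable) auto
  with z show ?thesis by eventually_elim (simp add: vec_eq_iff)
qed

lemma pre_jet_symmetric:
  assumes j: "pre_jet T x0 \<beta> v z \<gamma>"
  shows "AE p in nu T x0 \<beta>. transpose (\<gamma> p) = \<gamma> p"
proof -
  have "AE p in lborel. p \<in> spacetime T \<longrightarrow> \<gamma> p $ k $ m = \<gamma> p $ m $ k" for k m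
    using j by (intro weak_deriv_symmetric[OF open_spacetime axis_prod_in_Basis axis_prod_in_Basis, of T k v "\<lambda>p. z p $ k" m _ "\<lambda>p. z p $ m"])
      (auto simp: pre_jet_def weak_Dx_def)
  then have "AE p in lborel. \<forall>k m. p \<in> spacetime T \<longrightarrow> \<gamma> p $ k $ m = \<gamma> p $ m $ k"
    by (subst AE_all_countable, intro allI, subst AE_all_countable) auto
  then show ?thesis unfolding AE_nu_iff by eventually_elim (simp add: vec_eq_iff transpose_def)
qed

text \<open>A jet has to be symmetric everywhere, so the second derivative is symmetrised on a null set.\<close>

lemma pre_jet_imp_occupation_mild_jet:
  assumes j: "pre_jet T x0 \<beta> v z \<gamma>"
  shows "occupation_mild_jet T x0 \<beta> v z (\<lambda>p. (1/2) *\<^sub>R (\<gamma> p + transpose (\<gamma> p)))"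
  unfolding occupation_mild_jet_iff
proof
  have [measurable]: "\<gamma> \<in> borel_measurable (nu T x0 \<beta>)" by (rule L2_space_measurable[OF pre_jet_L2(3)[OF j]])
  show "pre_jet T x0 \<beta> v z (\<lambda>p. (1/2) *\<^sub>R (\<gamma> p + transpose (\<gamma> p)))"
  proof (rule pre_jet_cong_AE[OF j])
    show "AE p in nu T x0 \<beta>. \<gamma> p = (1/2) *\<^sub>R (\<gamma> p + transpose (\<gamma> p))"
      using pre_jet_symmetric[OF j] by eventually_elim (simp add: scaleR_2[symmetric])
    show "(\<lambda>p. (1/2) *\<^sub>R (\<gamma> p + transpose (\<gamma> p))) \<in> borel_measurable (nu T x0 \<beta>)"
      unfolding transpose_def by measurable
  qed (auto intro: L2_space_measurable[OF pre_jet_L2(1)[OF j]] L2_space_measurable[OF pre_jet_L2(2)[OF j]])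
  show "\<forall>p\<in>spacetime T. (1/2) *\<^sub>R (\<gamma> p + transpose (\<gamma> p)) \<in> sym_mats"
    by (simp add: sym_mats_def transpose_def vec_eq_iff)
qed

lemma jet_of_occupation_mild_jet:
  assumes "has_occupation_mild_jet T x0 \<beta> v"
  shows "occupation_mild_jet T x0 \<beta> v (Dx T x0 \<beta> v) (D2x T x0 \<beta> v)"
proof -
  have "\<exists>q. (\<lambda>(z, \<gamma>). occupation_mild_jet T x0 \<beta> v z \<gamma>) q"
    using assms by (auto simp: has_occupation_mild_jet_def)
  from someI_ex[OF this] show ?thesis
    by (simp add: Dx_def D2x_def jet_of_def case_prod_unfold)
qed

lemma L2_nu_mono:
  fixes F :: "real \<times> (real ^ 'n) \<Rightarrow> real"
  assumes F: "F \<in> L2_space (nu T x0 0)" and \<beta>: "0 \<le> \<beta>"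
  shows "F \<in> L2_space (nu T x0 \<beta>)" "L2_norm (nu T x0 \<beta>) F \<le> L2_norm (nu T x0 0) F"
proof -
  have Fm: "F \<in> borel_measurable (nu T x0 \<beta>)" using L2_space_measurable[OF F] by (simp add: measurable_nu)
  have [measurable]: "ext T F \<in> borel_measurable borel" by (rule ext_measurable[THEN iffD1, OF Fm])
  have "(\<integral>\<^sup>+p. ennreal ((norm (F p))\<^sup>2) \<partial>nu T x0 \<beta>) = (\<integral>\<^sup>+p. ennreal ((ext T F p)\<^sup>2) \<partial>nu T x0 \<beta>)"
    by (intro nn_integral_cong) (simp add: ext_eq)
  also have "\<dots> \<le> (\<integral>\<^sup>+p. ennreal ((ext T F p)\<^sup>2) \<partial>nu T x0 0)"
  proof -
    have "nu_density T x0 \<beta> p \<le> nu_density T x0 0 p" if "p \<in> spacetime T" for p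
      using that \<beta> by (auto simp: nu_density_def spacetime_def intro!: mult_left_le_one_le gauss_density_nonneg)
    then show ?thesis
      by (subst (1 2) nn_integral_nu_lborel)
         (auto intro!: nn_integral_mono mult_right_mono ennreal_leI split: split_indicator)
  qed
  also have "\<dots> = ennreal ((L2_norm (nu T x0 0) F)\<^sup>2)"
    unfolding L2_norm_sq_nn[OF F] by (intro nn_integral_cong) (simp add: ext_eq)
  finally have "(\<integral>\<^sup>+p. ennreal ((norm (F p))\<^sup>2) \<partial>nu T x0 \<beta>) \<le> ennreal ((L2_norm (nu T x0 0) F)\<^sup>2)" .
  from L2_norm_leI[OF Fm this] show "F \<in> L2_space (nu T x0 \<beta>)" "L2_norm (nu T x0 \<beta>) F \<le> L2_norm (nu T x0 0) F"
    by auto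
qed

lemma L2_norm_cmult_norm:
  assumes "F \<in> L2_space M" "0 \<le> c"
  shows "(\<lambda>x. c * norm (F x)) \<in> L2_space M" "L2_norm M (\<lambda>x. c * norm (F x)) = c * L2_norm M F"
proof -
  have "(\<lambda>x. norm (F x)) \<in> L2_space M" using assms by (auto simp: L2_space_def)
  from L2_space_scaleR[OF this, of c] show "(\<lambda>x. c * norm (F x)) \<in> L2_space M" by simp
  show "L2_norm M (\<lambda>x. c * norm (F x)) = c * L2_norm M F"
    using L2_norm_scaleR[of M c "\<lambda>x. norm (F x)"] assms(2) by (simp add: L2_norm_def)
qed

subsection \<open>Contractions of \<open>L2\<close>\<close>

text \<open>Banach's theorem for functions instead of classes: the fixed point equation and
  uniqueness hold almost everywhere. The norm bound comes from comparing \<open>\<Phi> Fs\<close>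
  with \<open>\<Phi>\<close> at zero and solving the resulting inequality for the norm of
  \<open>Fs\<close>.\<close>

lemma L2_contraction_fixed_point:
  fixes \<Phi> :: "('a \<Rightarrow> 'b::euclidean_space) \<Rightarrow> 'a \<Rightarrow> 'b"
  assumes \<Phi>: "\<And>F. F \<in> L2_space M \<Longrightarrow> \<Phi> F \<in> L2_space M"
    and con: "\<And>F G. F \<in> L2_space M \<Longrightarrow> G \<in> L2_space M \<Longrightarrow>
      L2_norm M (\<lambda>x. \<Phi> F x - \<Phi> G x) \<le> c * L2_norm M (\<lambda>x. F x - G x)"
    and c: "0 \<le> c" "c < 1"
  obtains Fs where "Fs \<in> L2_space M" "AE x in M. \<Phi> Fs x = Fs x"
    "\<And>F. F \<in> L2_space M \<Longrightarrow> AE x in M. \<Phi> F x = F x \<Longrightarrow> AE x in M. F x = Fs x"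
    "L2_norm M Fs \<le> L2_norm M (\<Phi> (\<lambda>x. 0)) / (1 - c)"
proof -
  define d where "d = L2_norm M (\<Phi> (\<lambda>x. 0))"
  have step: "L2_norm M (\<Phi> F) \<le> d + c * L2_norm M F" if F: "F \<in> L2_space M" for F
    using L2_norm_le_add_diff[OF \<Phi>[OF F] \<Phi>[OF L2_space_zero]] con[OF F L2_space_zero]
    by (simp add: d_def)
  define X where "X n = (\<Phi> ^^ n) (\<lambda>x. 0)" for n
  have X: "X n \<in> L2_space M" for n by (induction n) (auto simp: X_def \<Phi>)
  have XS: "X (Suc n) = \<Phi> (X n)" for n by (simp add: X_def)
  \<comment> \<open>The radius with \<open>d + c * D = D\<close>: the ball of this radius is mapped
    into itself and contains all iterates, so the differences of iterates decay like
    \<open>c ^ n * D\<close>.\<close>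
  define D where "D = d / (1 - c)"
  have D: "0 \<le> D" "d + c * D = D" using c by (auto simp: D_def d_def field_simps)
  have bnd: "L2_norm M (X n) \<le> D" for n
  proof (induction n)
    case 0
    then show ?case using D by (simp add: X_def L2_norm_def)
  next
    case (Suc n)
    have "L2_norm M (X (Suc n)) \<le> d + c * L2_norm M (X n)" unfolding XS by (rule step[OF X])
    also have "\<dots> \<le> d + c * D" using Suc c by (intro add_left_mono mult_left_mono)
    finally show ?case using D by simp
  qed
  have diff: "L2_norm M (\<lambda>x. X (n + k) x - X n x) \<le> c ^ n * D" for n k
  proof (induction n)
    case 0
    then show ?case using bnd[of k] by (simp add: X_def)
  next
    case (Suc n)
    have "L2_norm M (\<lambda>x. X (Suc n + k) x - X (Suc n) x) \<le> c * L2_norm M (\<lambda>x. X (n + k) x - X n x)"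
      using con[OF X X, of "n + k" n] by (simp add: XS)
    also have "\<dots> \<le> c * (c ^ n * D)" using Suc c by (intro mult_left_mono)
    finally show ?case by simp
  qed
  have "\<exists>N. \<forall>m\<ge>N. \<forall>n\<ge>N. L2_norm M (\<lambda>x. X m x - X n x) \<le> e" if e: "0 < e" for e
  proof -
    have "(\<lambda>n. c ^ n * D) \<longlonglongrightarrow> 0 * D" using c by (intro tendsto_intros) auto
    then have "eventually (\<lambda>n. c ^ n * D < e / 2) sequentially" using e by (intro order_tendstoD(2)) auto
    then obtain N where N: "c ^ N * D < e / 2" by (auto simp: eventually_sequentially)
    have XN: "L2_norm M (\<lambda>x. X m x - X N x) \<le> e / 2" if "N \<le> m" for m
      using diff[of N "m - N"] N that by simp
    have "L2_norm M (\<lambda>x. X m x - X n x) \<le> e" if "N \<le> m" "N \<le> n" for m n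
      using L2_norm_triangle[OF X X X, of m n N] XN[OF that(1)] XN[OF that(2)]
      by (simp add: L2_norm_diff_commute[of M "X N"])
    then show ?thesis by blast
  qed
  from L2_complete[OF X this] obtain Fs where Fs: "Fs \<in> L2_space M" "(\<lambda>n. L2_norm M (\<lambda>x. X n x - Fs x)) \<longlonglongrightarrow> 0"
    by blast
  have "L2_norm M (\<lambda>x. \<Phi> Fs x - Fs x) \<le> 0"
  proof (rule LIMSEQ_le_const)
    have "(\<lambda>n. c * L2_norm M (\<lambda>x. X n x - Fs x) + L2_norm M (\<lambda>x. X (Suc n) x - Fs x)) \<longlonglongrightarrow> c * 0 + 0"
      by (intro tendsto_intros Fs LIMSEQ_Suc)
    then show "(\<lambda>n. c * L2_norm M (\<lambda>x. X n x - Fs x) + L2_norm M (\<lambda>x. X (Suc n) x - Fs x)) \<longlonglongrightarrow> 0" by simp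
    have "L2_norm M (\<lambda>x. \<Phi> Fs x - Fs x) \<le> c * L2_norm M (\<lambda>x. X n x - Fs x) + L2_norm M (\<lambda>x. X (Suc n) x - Fs x)" for n
      using L2_norm_triangle[OF \<Phi>[OF Fs(1)] X[of "Suc n"] Fs(1)] con[OF Fs(1) X[of n]]
      by (simp add: XS L2_norm_diff_commute[of M Fs])
    then show "\<exists>N. \<forall>n\<ge>N. L2_norm M (\<lambda>x. \<Phi> Fs x - Fs x) \<le> c * L2_norm M (\<lambda>x. X n x - Fs x) + L2_norm M (\<lambda>x. X (Suc n) x - Fs x)"
      by blast
  qed
  then have "L2_norm M (\<lambda>x. \<Phi> Fs x - Fs x) = 0" using L2_norm_nonneg[of M "\<lambda>x. \<Phi> Fs x - Fs x"] by linarith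
  then have fix_Fs: "AE x in M. \<Phi> Fs x = Fs x"
    using L2_norm_eq_0_iff[OF L2_space_diff[OF \<Phi>[OF Fs(1)] Fs(1)]] by simp
  have uniq: "AE x in M. F x = Fs x" if F: "F \<in> L2_space M" and fix_F: "AE x in M. \<Phi> F x = F x" for F
  proof -
    have "L2_norm M (\<lambda>x. F x - Fs x) = L2_norm M (\<lambda>x. \<Phi> F x - \<Phi> Fs x)"
    proof (rule L2_norm_cong_AE)
      show "AE x in M. norm (F x - Fs x) = norm (\<Phi> F x - \<Phi> Fs x)"
        using fix_F fix_Fs by eventually_elim simp
    qed (intro L2_space_measurable L2_space_diff F Fs \<Phi>)+
    also have "\<dots> \<le> c * L2_norm M (\<lambda>x. F x - Fs x)" by (rule con[OF F Fs(1)])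
    finally have "(1 - c) * L2_norm M (\<lambda>x. F x - Fs x) \<le> 0" by (simp add: algebra_simps)
    then have "L2_norm M (\<lambda>x. F x - Fs x) = 0"
      using c L2_norm_nonneg[of M "\<lambda>x. F x - Fs x"] by (simp add: mult_le_0_iff)
    then show ?thesis using L2_norm_eq_0_iff[OF L2_space_diff[OF F Fs(1)]] by simp
  qed
  have "L2_norm M Fs = L2_norm M (\<Phi> Fs)"
    using fix_Fs by (intro L2_norm_cong_AE L2_space_measurable Fs \<Phi>) auto
  also have "\<dots> \<le> d + c * L2_norm M Fs" by (rule step[OF Fs(1)])
  finally have "L2_norm M Fs \<le> d / (1 - c)" using c by (simp add: field_simps)
  with that Fs(1) fix_Fs uniq show ?thesis unfolding d_def by blast
qed

subsection \<open>The fixed-point map\<close>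

lemma eventually_contraction_const_less_1:
  assumes "2 * sqrt 2 * L2 < 1"
  shows "\<forall>\<^sub>F b in at_top. contraction_const L0 L1 L2 b < 1"
proof -
  have "((\<lambda>b::real. 1 / b) \<longlongrightarrow> 0) at_top" "((\<lambda>b::real. 1 / sqrt b) \<longlongrightarrow> 0) at_top" by real_asymp+
  then have "((\<lambda>b. L0 * (1 / b) + L1 * (1 / sqrt b) + 2 * sqrt 2 * L2) \<longlongrightarrow> L0 * 0 + L1 * 0 + 2 * sqrt 2 * L2) at_top"
    by (intro tendsto_intros)
  then have "\<forall>\<^sub>F b in at_top. L0 * (1 / b) + L1 * (1 / sqrt b) + 2 * sqrt 2 * L2 < 1"
    using assms by (intro order_tendstoD(2)) auto
  then show ?thesis by eventually_elim (simp add: contraction_const_def)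
qed

context
  fixes M :: "'w measure" and W :: "real \<Rightarrow> 'w \<Rightarrow> real ^ 'n" and x0 :: "real ^ 'n"
    and T K L0 L1 L2 \<beta> :: real
    and f :: "real \<Rightarrow> real ^ 'n \<Rightarrow> real \<Rightarrow> real ^ 'n \<Rightarrow> real ^ 'n ^ 'n \<Rightarrow> real"
    and g :: "real ^ 'n \<Rightarrow> real"
  assumes T: "T > 0" and BM: "brownian_motion M W"
    and fm: "(\<lambda>(t, x, y, z, \<gamma>). f t x y z \<gamma>)
      \<in> borel_measurable (restrict_space borel ({0..T} \<times> UNIV \<times> UNIV \<times> UNIV \<times> sym_mats))"
    and f0: "(\<lambda>(t, x). f t x 0 0 0) \<in> L2_space (nu T x0 0)"
    and g: "g \<in> H1_space (law M W x0 T)"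
    and K: "K \<ge> 0" and L: "L0 \<ge> 0" "L1 \<ge> 0" "L2 \<ge> 0"
    and f0K: "L2_norm (nu T x0 0) (\<lambda>(t, x). f t x 0 0 0) \<le> K"
    and gK: "H1_norm (law M W x0 T) g \<le> K"
    and Lip: "\<And>t x y z \<gamma> y' z' \<gamma>'.
      \<lbrakk>t \<in> {0..T}; \<gamma> \<in> sym_mats; \<gamma>' \<in> sym_mats\<rbrakk> \<Longrightarrow>
      \<bar>f t x y z \<gamma> - f t x y' z' \<gamma>'\<bar>
        \<le> L0 * \<bar>y - y'\<bar> + L1 * norm (z - z') + L2 * norm (\<gamma> - \<gamma>')"
    and \<beta>: "\<beta> > 0"
begin

private abbreviation (input) N where "N \<equiv> nu T x0 \<beta>"

private abbreviation (input) U where "U F \<equiv> duhamel M W T F g"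

text \<open>The composition is defined for arbitrary triples, not only for jets, so that the source
  at the zero triple and the differences of sources are covered by one Lipschitz estimate.\<close>

private definition compose_f where
  "compose_f v z \<gamma> = (\<lambda>(t, x). f t x (v (t, x)) (z (t, x)) (\<gamma> (t, x)))"

lemma law_T: "law M W x0 T = gaussian x0 T"
  by (rule law_eq_gaussian[OF BM T])

text \<open>\<open>H1_norm\<close> refers to one weak gradient selected by choice. The bound by
  \<open>K\<close> is known for that selection, so \<open>\<zeta>\<close> has to be the same
  choice.\<close>

lemma terminal_datum:
  obtains \<zeta> where "g \<in> L2_space (gaussian x0 T)" "\<zeta> \<in> L2_space (gaussian x0 T)" "weak_gradient g \<zeta>"
    "L2_norm (gaussian x0 T) g \<le> K" "L2_norm (gaussian x0 T) \<zeta> \<le> K"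
proof -
  let ?P = "\<lambda>\<zeta>. \<zeta> \<in> L2_space (gaussian x0 T) \<and> weak_gradient g \<zeta>"
  have gL: "g \<in> L2_space (gaussian x0 T)" and ex: "\<exists>\<zeta>. ?P \<zeta>"
    using g by (auto simp: H1_space_def law_T)
  define \<zeta> where "\<zeta> = (SOME \<zeta>. ?P \<zeta>)"
  have \<zeta>: "?P \<zeta>" unfolding \<zeta>_def by (rule someI_ex[OF ex])
  have "sqrt ((L2_norm (gaussian x0 T) g)\<^sup>2 + (L2_norm (gaussian x0 T) \<zeta>)\<^sup>2) \<le> K"
    using gK by (simp add: H1_norm_def law_T \<zeta>_def)
  moreover have "L2_norm (gaussian x0 T) g \<le> sqrt ((L2_norm (gaussian x0 T) g)\<^sup>2 + (L2_norm (gaussian x0 T) \<zeta>)\<^sup>2)"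
    "L2_norm (gaussian x0 T) \<zeta> \<le> sqrt ((L2_norm (gaussian x0 T) g)\<^sup>2 + (L2_norm (gaussian x0 T) \<zeta>)\<^sup>2)"
    by (auto intro!: real_le_rsqrt)
  ultimately show ?thesis using that[of \<zeta>] gL \<zeta> by linarith
qed

lemma g_L2: "g \<in> L2_space (gaussian x0 T)"
  using terminal_datum by blast

lemma U_eq:
  assumes "F \<in> L2_space N" "p \<in> spacetime T"
  shows "U F p = heat_ker T g p + duh_ker T (ext T F) p"
  using duhamel_eq_ker[OF BM T L2_space_measurable[OF assms(1)] _ assms(2)] L2_space_measurable[OF g_L2] by simp

lemma U_measurable:
  assumes F: "F \<in> L2_space N" shows "U F \<in> borel_measurable N"
proof -
  have "(\<lambda>p. heat_ker T g p + duh_ker T (ext T F) p) \<in> borel_measurable N"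
    using heat_ker_L2(1)[OF BM T g_L2 \<beta>] duh_ker_L2(1)[OF BM T F less_imp_le[OF \<beta>]]
    by (intro L2_space_measurable L2_space_add)
  then show ?thesis by (subst measurable_cong[OF U_eq[OF F]]) auto
qed

lemma pre_jet_U:
  assumes F: "F \<in> L2_space N" and j: "pre_jet T x0 \<beta> (\<lambda>p. heat_ker T g p + duh_ker T (ext T F) p) z \<gamma>"
  shows "pre_jet T x0 \<beta> (U F) z \<gamma>"
  by (rule pre_jet_cong_AE[OF j _ _ _ U_measurable[OF F] L2_space_measurable[OF pre_jet_L2(2)[OF j]]
        L2_space_measurable[OF pre_jet_L2(3)[OF j]]]) (rule AE_I2, simp_all add: U_eq[OF F])

lemma U_has_jet:
  assumes F: "F \<in> L2_space N"
  shows "has_occupation_mild_jet T x0 \<beta> (U F)"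
proof -
  obtain \<zeta> where \<zeta>: "\<zeta> \<in> L2_space (gaussian x0 T)" "weak_gradient g \<zeta>" using terminal_datum by blast
  obtain z1 \<gamma>1 where 1: "z1 \<in> L2_space N" "\<gamma>1 \<in> L2_space N" "weak_Dx T (heat_ker T g) z1"
    "\<And>k. weak_Dx T (\<lambda>p. z1 p $ k) (\<lambda>p. \<gamma>1 p $ k)"
    using heat_flow_jet[OF BM T \<beta> g_L2 \<zeta>] by metis
  obtain z2 \<gamma>2 where 2: "z2 \<in> L2_space N" "\<gamma>2 \<in> L2_space N" "weak_Dx T (duh_ker T (ext T F)) z2"
    "\<And>k. weak_Dx T (\<lambda>p. z2 p $ k) (\<lambda>p. \<gamma>2 p $ k)"
    using duhamel_jet[OF BM T \<beta> F] by metis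
  have "pre_jet T x0 \<beta> (heat_ker T g) z1 \<gamma>1" "pre_jet T x0 \<beta> (duh_ker T (ext T F)) z2 \<gamma>2"
    using 1 2 heat_ker_L2(1)[OF BM T g_L2 \<beta>] duh_ker_L2(1)[OF BM T F less_imp_le[OF \<beta>]] by (auto simp: pre_jet_def)
  from pre_jet_imp_occupation_mild_jet[OF pre_jet_U[OF F pre_jet_add[OF this]]]
  show ?thesis by (auto simp: has_occupation_mild_jet_def)
qed

lemma U_jet:
  assumes F: "F \<in> L2_space N"
  shows "pre_jet T x0 \<beta> (U F) (Dx T x0 \<beta> (U F)) (D2x T x0 \<beta> (U F))"
    "p \<in> spacetime T \<Longrightarrow> D2x T x0 \<beta> (U F) p \<in> sym_mats"
  using jet_of_occupation_mild_jet[OF U_has_jet[OF F]] by (auto simp: occupation_mild_jet_iff)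

text \<open>The heat flow of \<open>g\<close> cancels and leaves the Duhamel integral of the
  difference. The chosen jet of \<open>U F\<close> agrees almost everywhere with the chosen jet of
  \<open>U F'\<close> plus the constructed jet of that integral, so the three bounds carry over to
  the choices.\<close>

lemma U_diff_estimates:
  assumes F: "F \<in> L2_space N" and F': "F' \<in> L2_space N"
  shows "L2_norm N (\<lambda>p. U F p - U F' p) \<le> (1 / \<beta>) * L2_norm N (\<lambda>p. F p - F' p)"
    and "L2_norm N (\<lambda>p. Dx T x0 \<beta> (U F) p - Dx T x0 \<beta> (U F') p) \<le> (1 / sqrt \<beta>) * L2_norm N (\<lambda>p. F p - F' p)"
    and "L2_norm N (\<lambda>p. D2x T x0 \<beta> (U F) p - D2x T x0 \<beta> (U F') p) \<le> 2 * sqrt 2 * L2_norm N (\<lambda>p. F p - F' p)"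
proof -
  let ?G = "\<lambda>p. F p - F' p"
  have G: "?G \<in> L2_space N" by (rule L2_space_diff[OF F F'])
  obtain z \<gamma> where 1: "z \<in> L2_space N" "\<gamma> \<in> L2_space N" "weak_Dx T (duh_ker T (ext T ?G)) z"
    "\<And>k. weak_Dx T (\<lambda>p. z p $ k) (\<lambda>p. \<gamma> p $ k)"
    and n: "L2_norm N (duh_ker T (ext T ?G)) \<le> (1 / \<beta>) * L2_norm N ?G"
    "L2_norm N z \<le> (1 / sqrt \<beta>) * L2_norm N ?G" "L2_norm N \<gamma> \<le> 2 * sqrt 2 * L2_norm N ?G"
    by (rule duhamel_jet[OF BM T \<beta> G]) (rule that)
  have D: "duh_ker T (ext T ?G) \<in> L2_space N" by (rule duh_ker_L2(1)[OF BM T G less_imp_le[OF \<beta>]])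
  have j: "pre_jet T x0 \<beta> (duh_ker T (ext T ?G)) z \<gamma>" using 1 D by (simp add: pre_jet_def)
  note J = U_jet(1)[OF F] and J' = U_jet(1)[OF F']
  have v: "AE p in N. U F p = U F' p + duh_ker T (ext T ?G) p"
    using duh_ker_diff[OF BM T F F' less_imp_le[OF \<beta>]] AE_space
    by eventually_elim (simp add: U_eq[OF F] U_eq[OF F'])
  note u = pre_jet_unique[OF J pre_jet_add[OF J' j] v]
  have "AE p in N. norm (U F p - U F' p) = norm (duh_ker T (ext T ?G) p)" using v by eventually_elim simp
  then have "L2_norm N (\<lambda>p. U F p - U F' p) = L2_norm N (duh_ker T (ext T ?G))"
    by (rule L2_norm_cong_AE[OF L2_space_measurable[OF L2_space_diff[OF pre_jet_L2(1)[OF J] pre_jet_L2(1)[OF J']]]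
          L2_space_measurable[OF D]])
  then show "L2_norm N (\<lambda>p. U F p - U F' p) \<le> (1 / \<beta>) * L2_norm N ?G" using n(1) by simp
  have "AE p in N. norm (Dx T x0 \<beta> (U F) p - Dx T x0 \<beta> (U F') p) = norm (z p)" using u by eventually_elim simp
  then have "L2_norm N (\<lambda>p. Dx T x0 \<beta> (U F) p - Dx T x0 \<beta> (U F') p) = L2_norm N z"
    by (rule L2_norm_cong_AE[OF L2_space_measurable[OF L2_space_diff[OF pre_jet_L2(2)[OF J] pre_jet_L2(2)[OF J']]]
          L2_space_measurable[OF 1(1)]])
  then show "L2_norm N (\<lambda>p. Dx T x0 \<beta> (U F) p - Dx T x0 \<beta> (U F') p) \<le> (1 / sqrt \<beta>) * L2_norm N ?G" using n(2) by simp
  have "AE p in N. norm (D2x T x0 \<beta> (U F) p - D2x T x0 \<beta> (U F') p) = norm (\<gamma> p)" using u by eventually_elim simp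
  then have "L2_norm N (\<lambda>p. D2x T x0 \<beta> (U F) p - D2x T x0 \<beta> (U F') p) = L2_norm N \<gamma>"
    by (rule L2_norm_cong_AE[OF L2_space_measurable[OF L2_space_diff[OF pre_jet_L2(3)[OF J] pre_jet_L2(3)[OF J']]]
          L2_space_measurable[OF 1(2)]])
  then show "L2_norm N (\<lambda>p. D2x T x0 \<beta> (U F) p - D2x T x0 \<beta> (U F') p) \<le> 2 * sqrt 2 * L2_norm N ?G" using n(3) by simp
qed

text \<open>With zero source only the heat flow of \<open>g\<close> remains: its value is controlled
  through the mass of the time weight, its gradient by the norm of \<open>g\<close>, its Hessian by
  the norm of the weak gradient. Weighted by the Lipschitz constants these give the numerator of the
  a priori bound.\<close>

lemma U_zero_estimates:
  "L2_norm N (U (\<lambda>p. 0)) \<le> (1 / sqrt \<beta>) * K"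
  "L2_norm N (Dx T x0 \<beta> (U (\<lambda>p. 0))) \<le> K"
  "L2_norm N (D2x T x0 \<beta> (U (\<lambda>p. 0))) \<le> K"
proof -
  obtain \<zeta> where \<zeta>: "\<zeta> \<in> L2_space (gaussian x0 T)" "weak_gradient g \<zeta>"
    "L2_norm (gaussian x0 T) g \<le> K" "L2_norm (gaussian x0 T) \<zeta> \<le> K" using terminal_datum by blast
  obtain z \<gamma> where 1: "z \<in> L2_space N" "\<gamma> \<in> L2_space N" "weak_Dx T (heat_ker T g) z"
    "\<And>k. weak_Dx T (\<lambda>p. z p $ k) (\<lambda>p. \<gamma> p $ k)"
    and n: "L2_norm N z \<le> L2_norm (gaussian x0 T) g" "L2_norm N \<gamma> \<le> L2_norm (gaussian x0 T) \<zeta>"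
    by (rule heat_flow_jet[OF BM T \<beta> g_L2 \<zeta>(1,2)]) (rule that)
  have H: "heat_ker T g \<in> L2_space N" by (rule heat_ker_L2(1)[OF BM T g_L2 \<beta>])
  have j: "pre_jet T x0 \<beta> (heat_ker T g) z \<gamma>" using 1 H by (simp add: pre_jet_def)
  note J = U_jet(1)[OF L2_space_zero]
  have v: "AE p in N. U (\<lambda>p. 0) p = heat_ker T g p"
    by (intro AE_I2) (simp add: U_eq duh_ker_def ext_def set_lebesgue_integral_def)
  note u = pre_jet_unique[OF J j v]
  have "AE p in N. norm (U (\<lambda>p. 0) p) = norm (heat_ker T g p)" using v by eventually_elim simp
  then have "L2_norm N (U (\<lambda>p. 0)) = L2_norm N (heat_ker T g)"
    by (rule L2_norm_cong_AE[OF L2_space_measurable[OF pre_jet_L2(1)[OF J]] L2_space_measurable[OF H]])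
  also have "\<dots> \<le> sqrt (1 / \<beta>) * L2_norm (gaussian x0 T) g" by (rule heat_ker_L2(2)[OF BM T g_L2 \<beta>])
  also have "\<dots> \<le> sqrt (1 / \<beta>) * K" using \<beta> by (intro mult_left_mono \<zeta>) auto
  finally show "L2_norm N (U (\<lambda>p. 0)) \<le> (1 / sqrt \<beta>) * K" by (simp add: real_sqrt_divide)
  have "AE p in N. norm (Dx T x0 \<beta> (U (\<lambda>p. 0)) p) = norm (z p)" using u by eventually_elim simp
  then have "L2_norm N (Dx T x0 \<beta> (U (\<lambda>p. 0))) = L2_norm N z"
    by (rule L2_norm_cong_AE[OF L2_space_measurable[OF pre_jet_L2(2)[OF J]] L2_space_measurable[OF 1(1)]])
  then show "L2_norm N (Dx T x0 \<beta> (U (\<lambda>p. 0))) \<le> K" using n(1) \<zeta>(3) by simp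
  have "AE p in N. norm (D2x T x0 \<beta> (U (\<lambda>p. 0)) p) = norm (\<gamma> p)" using u by eventually_elim simp
  then have "L2_norm N (D2x T x0 \<beta> (U (\<lambda>p. 0))) = L2_norm N \<gamma>"
    by (rule L2_norm_cong_AE[OF L2_space_measurable[OF pre_jet_L2(3)[OF J]] L2_space_measurable[OF 1(2)]])
  then show "L2_norm N (D2x T x0 \<beta> (U (\<lambda>p. 0))) \<le> K" using n(2) \<zeta>(4) by simp
qed

text \<open>The nonlinearity is Borel only on symmetric matrices, so the triple must take values
  there at every point of space-time. This is why jets are required to be symmetric everywhere and
  not just almost everywhere.\<close>

lemma compose_f_measurable:
  assumes [measurable]: "v \<in> borel_measurable N" "z \<in> borel_measurable N" "\<gamma> \<in> borel_measurable N"
    and sym: "\<And>p. p \<in> spacetime T \<Longrightarrow> \<gamma> p \<in> sym_mats"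
  shows "compose_f v z \<gamma> \<in> borel_measurable N"
proof -
  have [measurable]: "fst \<in> borel_measurable N" "snd \<in> borel_measurable N"
    by (auto intro!: borel_measurable_nuI borel_measurable_continuous_onI continuous_intros)
  let ?S = "{0..T} \<times> UNIV \<times> UNIV \<times> UNIV \<times> sym_mats"
  have "(\<lambda>p. (fst p, snd p, v p, z p, \<gamma> p)) \<in> measurable N (restrict_space borel ?S)"
  proof (rule measurable_restrict_space2)
    show "(\<lambda>p. (fst p, snd p, v p, z p, \<gamma> p)) \<in> space N \<rightarrow> ?S"
      using sym by (auto simp: spacetime_def)
    show "(\<lambda>p. (fst p, snd p, v p, z p, \<gamma> p)) \<in> borel_measurable N"
      unfolding borel_prod[symmetric] by measurable
  qed
  from measurable_compose[OF this fm] show ?thesis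
    by (simp add: compose_f_def case_prod_unfold)
qed

lemma compose_f_diff:
  assumes 1: "v \<in> L2_space N" "z \<in> L2_space N" "\<gamma> \<in> L2_space N" "\<And>p. p \<in> spacetime T \<Longrightarrow> \<gamma> p \<in> sym_mats"
    and 2: "v' \<in> L2_space N" "z' \<in> L2_space N" "\<gamma>' \<in> L2_space N" "\<And>p. p \<in> spacetime T \<Longrightarrow> \<gamma>' p \<in> sym_mats"
  shows "(\<lambda>p. compose_f v z \<gamma> p - compose_f v' z' \<gamma>' p) \<in> L2_space N"
    and "L2_norm N (\<lambda>p. compose_f v z \<gamma> p - compose_f v' z' \<gamma>' p)
      \<le> L0 * L2_norm N (\<lambda>p. v p - v' p) + L1 * L2_norm N (\<lambda>p. z p - z' p) + L2 * L2_norm N (\<lambda>p. \<gamma> p - \<gamma>' p)"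
proof -
  let ?a = "\<lambda>p. L0 * norm (v p - v' p)" and ?b = "\<lambda>p. L1 * norm (z p - z' p)" and ?c = "\<lambda>p. L2 * norm (\<gamma> p - \<gamma>' p)"
  have a: "?a \<in> L2_space N" "?b \<in> L2_space N" "?c \<in> L2_space N"
    by (intro L2_norm_cmult_norm L2_space_diff 1 2 L)+
  have m: "(\<lambda>p. compose_f v z \<gamma> p - compose_f v' z' \<gamma>' p) \<in> borel_measurable N"
    by (intro borel_measurable_diff compose_f_measurable L2_space_measurable 1 2)
  have bd: "AE p in N. norm (compose_f v z \<gamma> p - compose_f v' z' \<gamma>' p) \<le> norm (?a p + ?b p + ?c p)"
  proof (rule AE_I2)
    fix p assume "p \<in> space N"
    then obtain t x where p: "p = (t, x)" "p \<in> spacetime T" "t \<in> {0..T}" by (cases p) (auto simp: spacetime_def)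
    have "norm (compose_f v z \<gamma> p - compose_f v' z' \<gamma>' p) \<le> ?a p + ?b p + ?c p"
      using Lip[OF p(3) 1(4)[OF p(2)] 2(4)[OF p(2)], of x "v p" "z p" "v' p" "z' p"] by (simp add: compose_f_def p(1))
    then show "norm (compose_f v z \<gamma> p - compose_f v' z' \<gamma>' p) \<le> norm (?a p + ?b p + ?c p)" by simp
  qed
  have n: "L2_norm N ?a = L0 * L2_norm N (\<lambda>p. v p - v' p)" "L2_norm N ?b = L1 * L2_norm N (\<lambda>p. z p - z' p)"
    "L2_norm N ?c = L2 * L2_norm N (\<lambda>p. \<gamma> p - \<gamma>' p)"
    by (intro L2_norm_cmult_norm(2) L2_space_diff 1 2 L)+
  note mono = L2_norm_mono[OF m L2_space_add[OF L2_space_add[OF a(1,2)] a(3)] bd]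
  from mono(1) show "(\<lambda>p. compose_f v z \<gamma> p - compose_f v' z' \<gamma>' p) \<in> L2_space N" .
  note mono(2)
  also have "L2_norm N (\<lambda>p. ?a p + ?b p + ?c p) \<le> L2_norm N (\<lambda>p. ?a p + ?b p) + L2_norm N ?c"
    by (rule L2_norm_add_le[OF L2_space_add[OF a(1,2)] a(3)])
  also have "L2_norm N (\<lambda>p. ?a p + ?b p) \<le> L2_norm N ?a + L2_norm N ?b"
    by (rule L2_norm_add_le[OF a(1,2)])
  finally show "L2_norm N (\<lambda>p. compose_f v z \<gamma> p - compose_f v' z' \<gamma>' p)
      \<le> L0 * L2_norm N (\<lambda>p. v p - v' p) + L1 * L2_norm N (\<lambda>p. z p - z' p) + L2 * L2_norm N (\<lambda>p. \<gamma> p - \<gamma>' p)"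
    unfolding n by simp
qed

private abbreviation (input) \<Phi> where "\<Phi> \<equiv> Phi M W T x0 \<beta> f g"

lemma Phi_eq: "\<Phi> F = compose_f (U F) (Dx T x0 \<beta> (U F)) (D2x T x0 \<beta> (U F))"
  by (simp add: Phi_def nonlin_def compose_f_def)

lemma f0_eq: "(\<lambda>(t, x). f t x 0 0 0) = compose_f (\<lambda>p. 0) (\<lambda>p. 0) (\<lambda>p. 0)"
  by (simp add: compose_f_def)

lemma f0_L2: "compose_f (\<lambda>p. 0) (\<lambda>p. 0) (\<lambda>p. 0) \<in> L2_space N"
  and f0_norm: "L2_norm N (compose_f (\<lambda>p. 0) (\<lambda>p. 0) (\<lambda>p. 0)) \<le> K"
  using L2_nu_mono[OF f0 less_imp_le[OF \<beta>]] f0K unfolding f0_eq by auto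

lemma zero_sym: "0 \<in> sym_mats"
  by (simp add: sym_mats_def transpose_def vec_eq_iff)

lemma Phi_L2:
  assumes F: "F \<in> L2_space N" shows "\<Phi> F \<in> L2_space N"
proof -
  have "(\<lambda>p. compose_f (U F) (Dx T x0 \<beta> (U F)) (D2x T x0 \<beta> (U F)) p - compose_f (\<lambda>p. 0) (\<lambda>p. 0) (\<lambda>p. 0) p) \<in> L2_space N"
    by (intro compose_f_diff(1) pre_jet_L2[OF U_jet(1)[OF F]] U_jet(2)[OF F] L2_space_zero zero_sym)
  from L2_space_add[OF this f0_L2] show ?thesis by (simp add: Phi_eq)
qed

lemma Phi_contraction:
  assumes F: "F \<in> L2_space N" and F': "F' \<in> L2_space N"
  shows "L2_norm N (\<lambda>p. \<Phi> F p - \<Phi> F' p) \<le> contraction_const L0 L1 L2 \<beta> * L2_norm N (\<lambda>p. F p - F' p)"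
proof -
  let ?d = "L2_norm N (\<lambda>p. F p - F' p)"
  have "L2_norm N (\<lambda>p. \<Phi> F p - \<Phi> F' p) \<le> L0 * L2_norm N (\<lambda>p. U F p - U F' p)
      + L1 * L2_norm N (\<lambda>p. Dx T x0 \<beta> (U F) p - Dx T x0 \<beta> (U F') p) + L2 * L2_norm N (\<lambda>p. D2x T x0 \<beta> (U F) p - D2x T x0 \<beta> (U F') p)"
    unfolding Phi_eq
    by (intro compose_f_diff(2) pre_jet_L2[OF U_jet(1)[OF F]] U_jet(2)[OF F] pre_jet_L2[OF U_jet(1)[OF F']] U_jet(2)[OF F'])
  also have "\<dots> \<le> L0 * ((1 / \<beta>) * ?d) + L1 * ((1 / sqrt \<beta>) * ?d) + L2 * (2 * sqrt 2 * ?d)"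
    by (intro add_mono mult_left_mono U_diff_estimates F F' L)
  also have "\<dots> = contraction_const L0 L1 L2 \<beta> * ?d" by (simp add: contraction_const_def algebra_simps)
  finally show ?thesis .
qed

lemma Phi_zero: "L2_norm N (\<Phi> (\<lambda>p. 0)) \<le> (1 + L0 * \<beta> powr (- 1 / 2) + L1 + L2) * K"
proof -
  note Z = L2_space_zero[of N]
  let ?f0 = "compose_f (\<lambda>p. 0) (\<lambda>p. 0) (\<lambda>p. 0)"
  have "L2_norm N (\<Phi> (\<lambda>p. 0)) \<le> L2_norm N ?f0 + L2_norm N (\<lambda>p. \<Phi> (\<lambda>p. 0) p - ?f0 p)"
    by (rule L2_norm_le_add_diff[OF Phi_L2[OF Z] f0_L2])
  also have "L2_norm N (\<lambda>p. \<Phi> (\<lambda>p. 0) p - ?f0 p) \<le> L0 * L2_norm N (\<lambda>p. U (\<lambda>p. 0) p - 0)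
      + L1 * L2_norm N (\<lambda>p. Dx T x0 \<beta> (U (\<lambda>p. 0)) p - 0) + L2 * L2_norm N (\<lambda>p. D2x T x0 \<beta> (U (\<lambda>p. 0)) p - 0)"
    unfolding Phi_eq
    by (intro compose_f_diff(2) pre_jet_L2[OF U_jet(1)[OF Z]] U_jet(2)[OF Z] L2_space_zero zero_sym)
  also have "\<dots> \<le> L0 * ((1 / sqrt \<beta>) * K) + L1 * K + L2 * K"
    using U_zero_estimates by (intro add_mono mult_left_mono L) simp_all
  also have "L2_norm N ?f0 \<le> K" by (rule f0_norm)
  also have "1 / sqrt \<beta> = \<beta> powr (- 1 / 2)"
  proof -
    have "\<beta> powr (- (1 / 2)) = inverse (\<beta> powr (1 / 2))" by (rule powr_minus)
    then show ?thesis using \<beta> by (simp add: powr_half_sqrt inverse_eq_divide)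
  qed
  finally show ?thesis by (simp add: algebra_simps)
qed

lemma contraction_const_nonneg: "0 \<le> contraction_const L0 L1 L2 \<beta>"
  using L \<beta> by (simp add: contraction_const_def)

text \<open>The derivatives of \<open>v\<close> and of \<open>U F\<close> are chosen independently
  of each other. Uniqueness of jets makes them agree almost everywhere as soon as the two functions
  do.\<close>

lemma nonlin_cong_AE:
  assumes v: "has_occupation_mild_jet T x0 \<beta> v" and F: "F \<in> L2_space N" and ae: "AE p in N. v p = U F p"
  shows "AE p in N. nonlin T x0 \<beta> f v p = \<Phi> F p"
proof -
  have "pre_jet T x0 \<beta> v (Dx T x0 \<beta> v) (D2x T x0 \<beta> v)"
    using jet_of_occupation_mild_jet[OF v] by (simp add: occupation_mild_jet_iff)
  from pre_jet_unique[OF this U_jet(1)[OF F] ae] ae show ?thesis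
    by eventually_elim (simp add: Phi_def nonlin_def case_prod_unfold)
qed

text \<open>Read off from the norm estimate: sources at distance zero have Duhamel images at
  distance zero. No separate treatment of the null sets met by the inner integrals is
  required.\<close>

lemma U_cong_AE:
  assumes F: "F \<in> L2_space N" and F': "F' \<in> L2_space N" and ae: "AE p in N. F p = F' p"
  shows "AE p in N. U F p = U F' p"
proof -
  have "L2_norm N (\<lambda>p. F p - F' p) = 0"
    using L2_norm_eq_0_iff[OF L2_space_diff[OF F F']] ae by simp
  then have "L2_norm N (\<lambda>p. U F p - U F' p) = 0"
    using U_diff_estimates(1)[OF F F'] L2_norm_nonneg[of N "\<lambda>p. U F p - U F' p"] by simp
  then show ?thesis
    using L2_norm_eq_0_iff[OF L2_space_diff[OF pre_jet_L2(1)[OF U_jet(1)[OF F]] pre_jet_L2(1)[OF U_jet(1)[OF F']]]] by simp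
qed

lemma Phi_cong_AE:
  assumes F: "F \<in> L2_space N" and F': "F' \<in> L2_space N" and ae: "AE p in N. F p = F' p"
  shows "AE p in N. \<Phi> F p = \<Phi> F' p"
  using nonlin_cong_AE[OF U_has_jet[OF F] F' U_cong_AE[OF F F' ae]] by (simp add: Phi_def)

text \<open>Fixed points and mild solutions correspond: \<open>U Fs\<close> reproduces
  \<open>Fs\<close> as its nonlinearity, and conversely the nonlinearity of any mild solution
  \<open>v\<close> is a fixed point, because \<open>v\<close> equals \<open>U\<close> of it almost
  everywhere. Uniqueness of the fixed point thus becomes uniqueness of the solution.\<close>

lemma fixed_point_solution:
  assumes lt: "contraction_const L0 L1 L2 \<beta> < 1"
  shows "\<exists>Fs\<in>L2_space N.
       (AE p in N. \<Phi> Fs p = Fs p) \<and>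
       (\<forall>F\<in>L2_space N. (AE p in N. \<Phi> F p = F p) \<longrightarrow> (AE p in N. F p = Fs p)) \<and>
       L2_norm N Fs \<le> (1 + L0 * \<beta> powr (- 1 / 2) + L1 + L2) / (1 - contraction_const L0 L1 L2 \<beta>) * K \<and>
       (AE p in N. nonlin T x0 \<beta> f (U Fs) p = Fs p) \<and>
       nonlinear_mild_solution M W T x0 \<beta> f g (U Fs) \<and>
       (\<forall>v. nonlinear_mild_solution M W T x0 \<beta> f g v \<longrightarrow> (AE p in N. v p = U Fs p))"
proof -
  obtain Fs where Fs: "Fs \<in> L2_space N" "AE p in N. \<Phi> Fs p = Fs p"
    and uniq: "\<And>F. F \<in> L2_space N \<Longrightarrow> AE p in N. \<Phi> F p = F p \<Longrightarrow> AE p in N. F p = Fs p"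
    and bnd: "L2_norm N Fs \<le> L2_norm N (\<Phi> (\<lambda>p. 0)) / (1 - contraction_const L0 L1 L2 \<beta>)"
    using L2_contraction_fixed_point[of N \<Phi> "contraction_const L0 L1 L2 \<beta>", OF Phi_L2 Phi_contraction contraction_const_nonneg lt]
    by blast
  note bnd
  also have "L2_norm N (\<Phi> (\<lambda>p. 0)) / (1 - contraction_const L0 L1 L2 \<beta>)
      \<le> ((1 + L0 * \<beta> powr (- 1 / 2) + L1 + L2) * K) / (1 - contraction_const L0 L1 L2 \<beta>)"
    using lt by (intro divide_right_mono Phi_zero) simp
  finally have bnd': "L2_norm N Fs \<le> (1 + L0 * \<beta> powr (- 1 / 2) + L1 + L2) / (1 - contraction_const L0 L1 L2 \<beta>) * K"
    by simp
  have nl: "AE p in N. nonlin T x0 \<beta> f (U Fs) p = Fs p" using Fs(2) by (simp add: Phi_def)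
  have nlL: "nonlin T x0 \<beta> f (U Fs) \<in> L2_space N" using Phi_L2[OF Fs(1)] by (simp add: Phi_def)
  have "AE p in N. U Fs p = U (nonlin T x0 \<beta> f (U Fs)) p"
    using nl by (intro U_cong_AE[OF Fs(1) nlL]) auto
  then have sol: "nonlinear_mild_solution M W T x0 \<beta> f g (U Fs)"
    using U_has_jet[OF Fs(1)] nlL by (simp add: nonlinear_mild_solution_def)
  have "AE p in N. v p = U Fs p" if v: "nonlinear_mild_solution M W T x0 \<beta> f g v" for v
  proof -
    let ?F = "nonlin T x0 \<beta> f v"
    have F: "has_occupation_mild_jet T x0 \<beta> v" "?F \<in> L2_space N" "AE p in N. v p = U ?F p"
      using v by (auto simp: nonlinear_mild_solution_def)
    have "AE p in N. \<Phi> ?F p = ?F p" using nonlin_cong_AE[OF F] by eventually_elim simp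
    from U_cong_AE[OF F(2) Fs(1) uniq[OF F(2) this]] F(3) show ?thesis by eventually_elim simp
  qed
  with Fs uniq bnd' nl sol show ?thesis by blast
qed

end

text \<open>Since functions stand for classes, well-definedness of the map has several parts:
  convergence of the Duhamel integrals, existence of a jet, its independence of choice up to null
  sets, square integrability of the image, and compatibility with equality almost
  everywhere.\<close>

theorem theorem3p7:
  fixes M :: "'w measure" and W :: "real \<Rightarrow> 'w \<Rightarrow> real ^ 'n" and x0 :: "real ^ 'n"
    and T K L0 L1 L2 \<beta> :: real
    and f :: "real \<Rightarrow> real ^ 'n \<Rightarrow> real \<Rightarrow> real ^ 'n \<Rightarrow> real ^ 'n ^ 'n \<Rightarrow> real"
    and g :: "real ^ 'n \<Rightarrow> real"
  assumes "T > 0"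
    and "brownian_motion M W"
    and "(\<lambda>(t, x, y, z, \<gamma>). f t x y z \<gamma>)
      \<in> borel_measurable (restrict_space borel ({0..T} \<times> UNIV \<times> UNIV \<times> UNIV \<times> sym_mats))"
    and "(\<lambda>(t, x). f t x 0 0 0) \<in> L2_space (nu T x0 0)"
    and "g \<in> H1_space (law M W x0 T)"
    and "K \<ge> 0" and "L0 \<ge> 0" and "L1 \<ge> 0" and "L2 \<ge> 0"
    and "L2_norm (nu T x0 0) (\<lambda>(t, x). f t x 0 0 0) \<le> K"
    and "H1_norm (law M W x0 T) g \<le> K"
    and "\<And>t x y z \<gamma> y' z' \<gamma>'.
      \<lbrakk>t \<in> {0..T}; \<gamma> \<in> sym_mats; \<gamma>' \<in> sym_mats\<rbrakk> \<Longrightarrow>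
      \<bar>f t x y z \<gamma> - f t x y' z' \<gamma>'\<bar>
        \<le> L0 * \<bar>y - y'\<bar> + L1 * norm (z - z') + L2 * norm (\<gamma> - \<gamma>')"
    and "2 * sqrt 2 * L2 < 1"
    and "\<beta> > 0"
  shows
    "(\<forall>F\<in>L2_space (nu T x0 \<beta>).
        (AE p in nu T x0 \<beta>. duhamel_converges M W T F g p) \<and>
        has_occupation_mild_jet T x0 \<beta> (duhamel M W T F g) \<and>
        (\<forall>z \<gamma> z' \<gamma>'.
           occupation_mild_jet T x0 \<beta> (duhamel M W T F g) z \<gamma> \<and>
           occupation_mild_jet T x0 \<beta> (duhamel M W T F g) z' \<gamma>' \<longrightarrow>
           (AE p in nu T x0 \<beta>. z p = z' p \<and> \<gamma> p = \<gamma>' p)) \<and>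
        Phi M W T x0 \<beta> f g F \<in> L2_space (nu T x0 \<beta>)) \<and>
     (\<forall>F\<in>L2_space (nu T x0 \<beta>). \<forall>F'\<in>L2_space (nu T x0 \<beta>).
        (AE p in nu T x0 \<beta>. F p = F' p) \<longrightarrow>
        (AE p in nu T x0 \<beta>. Phi M W T x0 \<beta> f g F p = Phi M W T x0 \<beta> f g F' p)) \<and>
     (\<forall>F\<in>L2_space (nu T x0 \<beta>). \<forall>F'\<in>L2_space (nu T x0 \<beta>).
        L2_norm (nu T x0 \<beta>) (\<lambda>p. Phi M W T x0 \<beta> f g F p - Phi M W T x0 \<beta> f g F' p)
          \<le> contraction_const L0 L1 L2 \<beta> * L2_norm (nu T x0 \<beta>) (\<lambda>p. F p - F' p)) \<and>
     (\<forall>\<^sub>F b in at_top. contraction_const L0 L1 L2 b < 1) \<and>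
     (contraction_const L0 L1 L2 \<beta> < 1 \<longrightarrow>
        (\<exists>Fs\<in>L2_space (nu T x0 \<beta>).
           (AE p in nu T x0 \<beta>. Phi M W T x0 \<beta> f g Fs p = Fs p) \<and>
           (\<forall>F\<in>L2_space (nu T x0 \<beta>).
              (AE p in nu T x0 \<beta>. Phi M W T x0 \<beta> f g F p = F p) \<longrightarrow>
              (AE p in nu T x0 \<beta>. F p = Fs p)) \<and>
           L2_norm (nu T x0 \<beta>) Fs
             \<le> (1 + L0 * \<beta> powr (- 1 / 2) + L1 + L2) / (1 - contraction_const L0 L1 L2 \<beta>) * K \<and>
           (AE p in nu T x0 \<beta>. nonlin T x0 \<beta> f (duhamel M W T Fs g) p = Fs p) \<and>
           nonlinear_mild_solution M W T x0 \<beta> f g (duhamel M W T Fs g) \<and>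
           (\<forall>v. nonlinear_mild_solution M W T x0 \<beta> f g v \<longrightarrow>
              (AE p in nu T x0 \<beta>. v p = duhamel M W T Fs g p))))"
proof -
  note h = assms(1-12,14)
  show ?thesis
  proof (intro conjI ballI allI impI)
    fix F :: "real \<times> (real ^ 'n) \<Rightarrow> real"
    assume F: "F \<in> L2_space (nu T x0 \<beta>)"
    show "AE p in nu T x0 \<beta>. duhamel_converges M W T F g p"
      by (rule duhamel_converges_AE[OF assms(2,1) F g_L2[OF h] assms(14)])
    show "has_occupation_mild_jet T x0 \<beta> (duhamel M W T F g)" by (rule U_has_jet[OF h F])
    show "Phi M W T x0 \<beta> f g F \<in> L2_space (nu T x0 \<beta>)" by (rule Phi_L2[OF h F])
    fix F' :: "real \<times> (real ^ 'n) \<Rightarrow> real" assume F': "F' \<in> L2_space (nu T x0 \<beta>)"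
    show "L2_norm (nu T x0 \<beta>) (\<lambda>p. Phi M W T x0 \<beta> f g F p - Phi M W T x0 \<beta> f g F' p)
        \<le> contraction_const L0 L1 L2 \<beta> * L2_norm (nu T x0 \<beta>) (\<lambda>p. F p - F' p)"
      by (rule Phi_contraction[OF h F F'])
    assume ae: "AE p in nu T x0 \<beta>. F p = F' p"
    show "AE p in nu T x0 \<beta>. Phi M W T x0 \<beta> f g F p = Phi M W T x0 \<beta> f g F' p"
      by (rule Phi_cong_AE[OF h F F' ae])
  next
    fix F :: "real \<times> (real ^ 'n) \<Rightarrow> real" and z \<gamma> z' \<gamma>'
    assume "occupation_mild_jet T x0 \<beta> (duhamel M W T F g) z \<gamma> \<and> occupation_mild_jet T x0 \<beta> (duhamel M W T F g) z' \<gamma>'"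
    then have "pre_jet T x0 \<beta> (duhamel M W T F g) z \<gamma>" "pre_jet T x0 \<beta> (duhamel M W T F g) z' \<gamma>'"
      by (simp_all add: occupation_mild_jet_iff)
    then show "AE p in nu T x0 \<beta>. z p = z' p \<and> \<gamma> p = \<gamma>' p" by (rule pre_jet_unique) simp
  next
    show "\<forall>\<^sub>F b in at_top. contraction_const L0 L1 L2 b < 1"
      by (rule eventually_contraction_const_less_1[OF assms(13)])
  qed (rule fixed_point_solution[OF h])
qed

end
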